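(* Let $\varphi(s)=c_1+\sum_{n\geq 2}c_nn^{-s}$ be a Dirichlet polynomial in $\mathcal G$ with unrestricted range. Suppose that its complex dimension $d$ is greater than or equal to $2$, and let $\Phi$ be an optimal Bohr lift of $\varphi$. Assume that \begin{itemize} \item either the degree of $\varphi$ is equal to $1$ or $2$, \item or the degree of $\varphi$ is at least $3$ and for any $w\in\mathbb T^d$, either $\mathrm{Re}\,\Phi(w)>0$, or $\mathrm{Re}\,\Phi(w)=0$ and $J(\Phi,w)\geq2$. \end{itemize} Then $\mathcal C_\varphi$ is compact on $\mathcal H^2$. Moreover, the result is optimal in the following sense: \begin{itemize} \item If a Dirichlet polynomial $\varphi(s)=c_1+\sum_{n\ge2}c_nn^{-s}$ in $\mathcal G$ with unrestricted range has complex dimension equal to $1$, then $\mathcal C_\varphi$ is never compact. \item There exist Dirichlet polynomials $\varphi(s)=c_1+\sum_{n\ge2}c_nn^{-s}\in\mathcal G$ with unrestricted range, of arbitrary complex dimension and of arbitrary degree greater than or equal to $3$, such that $\mathcal C_\varphi$ is not compact. \end{itemize}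
   Context: For $\theta\in\mathbb R$, $\mathbb C_\theta=\{s\in\mathbb C: \mathrm{Re}\,s>\theta\}$. $\mathbb D$ is the unit disc, $\mathbb T$ the unit circle. $\mathcal H^2$ is the Hilbert space of Dirichlet series $f(s)=\sum_{n\ge1}a_nn^{-s}$ with norm $\|f\|_{\mathcal H^2}^2=\sum_{n\ge1}|a_n|^2<\infty$; its elements are analytic in $\mathbb C_{1/2}$. A Dirichlet polynomial $\varphi(s)=c_1+\sum_{n=2}^Nc_nn^{-s}$ belongs to the Gordon--Hedenmalm class $\mathcal G$ (with characteristic $c_0=0$) if and only if $\varphi(\mathbb C_0)\subset\mathbb C_{1/2}$; then $\mathcal C_\varphi f=f\circ\varphi$ is well defined and bounded on $\mathcal H^2$. It has unrestricted range if $\inf_{s\in\mathbb C_0}\mathrm{Re}\,\varphi(s)=1/2$. Complex dimension, degree and Bohr lift. A set $\Lambda_0\subset\mathbb N\setminus\{1\}$ is $\mathbb Q$-independent if $\{\log n:n\in\Lambda_0\}$ is linearly independent over $\mathbb Q$. Write $\varphi(s)=c_1+\sum_{n\in\Lambda}c_nn^{-s}$ with $\Lambda\subset\mathbb N\setminus\{1\}$ finite and $c_n\ne0$ for all $n\in\Lambda$. The complex dimension of $\varphi$ is $d=\mathcal D(\Lambda)$, the infimum of $\mathrm{card}(\Lambda_0)$ over the $\mathbb Q$-independent sets $\Lambda_0\subset\mathbb N\setminus\{1\}$ which multiplicatively generate $\Lambda$ (every $n\in\Lambda$ is a product of non-negative integer powers of elements of $\Lambda_0$). For such $\Lambda_0=\{q_1,\dots,q_d\}$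 with $d=\mathcal D(\Lambda)$, each $n\in\Lambda$ is written uniquely $n=\prod_{j=1}^dq_j^{\alpha_j}$, which defines the multi-index $\alpha(n)=(\alpha_1,\dots,\alpha_d)$; put $\deg(\varphi,\Lambda_0)=\sup\{|\alpha(n)|=\alpha_1+\cdots+\alpha_d:n\in\Lambda\}$. $\Lambda_0$ is optimal if it minimizes $\deg(\varphi,\Lambda_0)$ among the generating $\mathbb Q$-independent sets of cardinality $\mathcal D(\Lambda)$, and the degree of $\varphi$ is this minimal value. For an optimal $\Lambda_0$, the polynomial $\Phi(z)=(c_1-\tfrac12)+\sum_{n\in\Lambda}c_nz^{\alpha(n)}$ in $z=(z_1,\dots,z_d)$ is called an optimal (or minimal) Bohr lift of $\varphi$; it maps $\mathbb D^d$ into $\mathbb C_0$. Boundary index. Put $\phi(\theta_1,\dots,\theta_d)=\Phi(e^{i\theta_1},\dots,e^{i\theta_d})$ on $\mathbb R^d$. If $w=(e^{i\vartheta_1},\dots,e^{i\vartheta_d})\in\mathbb T^d$ satisfies $\mathrm{Re}\,\Phi(w)=0$, then $\vartheta$ is a minimum of $\mathrm{Re}\,\phi$, so the Hessian matrix of $\mathrm{Re}\,\phi$ at $\vartheta$ is positive semi-definite; the boundary index $J(\Phi,w)$ is the non-negative integer such that the signature of this Hessian is $(J(\Phi,w),0)$, i.e. its number of positive eigenvalues. *)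

theory Defs
  imports "HOL-Analysis.Analysis" "Jordan_Normal_Form.Char_Poly"
begin

section \<open>The Hilbert space of Dirichlet series\<close>

text \<open>A Dirichlet series is represented by its coefficient sequence; index \<open>0\<close> is unused.\<close>

typedef h2 = "{a :: nat \<Rightarrow> complex. a 0 = 0 \<and> summable (\<lambda>n. (norm (a n))\<^sup>2)}"
  morphisms h2_coeff Abs_h2
  by (rule exI[of _ "\<lambda>_. 0"]) simp

setup_lifting type_definition_h2

lemma summable_inner_square_summable:
  fixes a b :: "nat \<Rightarrow> complex"
  assumes "summable (\<lambda>n. (norm (a n))\<^sup>2)" "summable (\<lambda>n. (norm (b n))\<^sup>2)"
  shows "summable (\<lambda>n. inner (a n) (b n))"
proof (rule summable_comparison_test)
  have "norm (inner (a n) (b n)) \<le> (norm (a n))\<^sup>2 + (norm (b n))\<^sup>2" for n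
  proof -
    have "norm (inner (a n) (b n)) \<le> norm (a n) * norm (b n)"
      by (simp add: Cauchy_Schwarz_ineq2)
    also have "\<dots> \<le> (norm (a n))\<^sup>2 + (norm (b n))\<^sup>2"
      using sum_squares_bound[of "norm (a n)" "norm (b n)"]
            mult_nonneg_nonneg[OF norm_ge_zero[of "a n"] norm_ge_zero[of "b n"]] by linarith
    finally show ?thesis .
  qed
  then show "\<exists>N. \<forall>n\<ge>N. norm (inner (a n) (b n)) \<le> (norm (a n))\<^sup>2 + (norm (b n))\<^sup>2"
    by blast
  show "summable (\<lambda>n. (norm (a n))\<^sup>2 + (norm (b n))\<^sup>2)"
    using assms by (rule summable_add)
qed

lemma square_summable_add:
  fixes a b :: "nat \<Rightarrow> complex"
  assumes "summable (\<lambda>n. (norm (a n))\<^sup>2)" "summable (\<lambda>n. (norm (b n))\<^sup>2)"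
  shows "summable (\<lambda>n. (norm (a n + b n))\<^sup>2)"
proof -
  have "(\<lambda>n. (norm (a n + b n))\<^sup>2) =
      (\<lambda>n. (norm (a n))\<^sup>2 + (norm (b n))\<^sup>2 + 2 * inner (a n) (b n))"
    by (simp add: power2_norm_eq_inner inner_add_left inner_add_right inner_commute fun_eq_iff)
  then show ?thesis
    using assms summable_inner_square_summable[OF assms]
    by (simp add: summable_add summable_mult)
qed

instantiation h2 :: real_inner
begin

lift_definition zero_h2 :: h2 is "\<lambda>_. 0" by simp

lift_definition plus_h2 :: "h2 \<Rightarrow> h2 \<Rightarrow> h2" is "\<lambda>a b n. a n + b n"
  by (auto intro: square_summable_add)

lift_definition uminus_h2 :: "h2 \<Rightarrow> h2" is "\<lambda>a n. - a n" by simp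

lift_definition minus_h2 :: "h2 \<Rightarrow> h2 \<Rightarrow> h2" is "\<lambda>a b n. a n - b n"
  subgoal for a b using square_summable_add[of a "\<lambda>n. - b n"] by simp
  done

lift_definition scaleR_h2 :: "real \<Rightarrow> h2 \<Rightarrow> h2" is "\<lambda>r a n. r *\<^sub>R a n"
  by (simp add: power_mult_distrib summable_mult)

lift_definition inner_h2 :: "h2 \<Rightarrow> h2 \<Rightarrow> real" is "\<lambda>a b. \<Sum>n. inner (a n) (b n)" .

lift_definition norm_h2 :: "h2 \<Rightarrow> real" is "\<lambda>a. sqrt (\<Sum>n. (norm (a n))\<^sup>2)" .

definition dist_h2 :: "h2 \<Rightarrow> h2 \<Rightarrow> real" where "dist_h2 f g = norm (f - g)"

definition sgn_h2 :: "h2 \<Rightarrow> h2" where "sgn_h2 f = inverse (norm f) *\<^sub>R f"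

definition uniformity_h2 :: "(h2 \<times> h2) filter" where
  "uniformity_h2 = (INF e\<in>{0<..}. principal {(f, g). dist f g < e})"

definition open_h2 :: "h2 set \<Rightarrow> bool" where
  "open_h2 U \<longleftrightarrow> (\<forall>f\<in>U. \<forall>\<^sub>F (f', g) in uniformity. f' = f \<longrightarrow> g \<in> U)"

instance
proof
  fix f g h :: h2 and r s :: real and U :: "h2 set"
  show "f + g + h = f + (g + h)" by transfer (simp add: add.assoc)
  show "f + g = g + f" by transfer (simp add: add.commute)
  show "0 + f = f" by transfer simp
  show "- f + f = 0" by transfer simp
  show "f - g = f + - g" by transfer simp
  show "r *\<^sub>R (f + g) = r *\<^sub>R f + r *\<^sub>R g" by transfer (simp add: scaleR_add_right)
  show "(r + s) *\<^sub>R f = r *\<^sub>R f + s *\<^sub>R f" by transfer (simp add: scaleR_add_left)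
  show "r *\<^sub>R s *\<^sub>R f = (r * s) *\<^sub>R f" by transfer simp
  show "1 *\<^sub>R f = f" by transfer simp
  show "dist f g = norm (f - g)" by (rule dist_h2_def)
  show "sgn f = inverse (norm f) *\<^sub>R f" by (rule sgn_h2_def)
  show "(uniformity :: (h2 \<times> h2) filter) = (INF e\<in>{0<..}. principal {(x, y). dist x y < e})"
    by (rule uniformity_h2_def)
  show "open U \<longleftrightarrow> (\<forall>x\<in>U. \<forall>\<^sub>F (x', y) in uniformity. x' = x \<longrightarrow> y \<in> U)"
    by (rule open_h2_def)
  show "inner f g = inner g f" by transfer (simp add: inner_commute)
  show "inner (f + g) h = inner f h + inner g h"
    by transfer (simp add: inner_add_left suminf_add summable_inner_square_summable)
  show "inner (r *\<^sub>R f) g = r * inner f g"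
    by transfer (simp only: inner_scaleR_left suminf_mult summable_inner_square_summable)
  show "0 \<le> inner f f"
    by transfer (simp add: suminf_nonneg summable_inner_square_summable)
  show "inner f f = 0 \<longleftrightarrow> f = 0"
    by transfer (subst suminf_eq_zero_iff,
        auto simp: summable_inner_square_summable fun_eq_iff)
  show "norm f = sqrt (inner f f)" by transfer (simp add: power2_norm_eq_inner)
qed

end

definition h2_eval :: "h2 \<Rightarrow> complex \<Rightarrow> complex" where
  "h2_eval f s = (\<Sum>n. h2_coeff f n * of_nat n powr (- s))"

section \<open>Composition operators with Dirichlet polynomial symbols\<close>

text \<open>A Dirichlet polynomial \<open>c\<^sub>1 + \<Sum>n\<ge>2. c\<^sub>n n\<^sup>-\<^sup>s\<close> is represented by
  its coefficients; \<open>spectrum_set c\<close> is the set \<open>\<Lambda>\<close>.\<close>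

definition spectrum_set :: "(nat \<Rightarrow> complex) \<Rightarrow> nat set" where
  "spectrum_set c = {n. 2 \<le> n \<and> c n \<noteq> 0}"

definition dirichlet_polynomial :: "(nat \<Rightarrow> complex) \<Rightarrow> bool" where
  "dirichlet_polynomial c \<longleftrightarrow> c 0 = 0 \<and> finite (spectrum_set c)"

definition dpoly :: "(nat \<Rightarrow> complex) \<Rightarrow> complex \<Rightarrow> complex" where
  "dpoly c s = c 1 + (\<Sum>n\<in>spectrum_set c. c n * of_nat n powr (- s))"

definition half_plane :: "real \<Rightarrow> complex set" where
  "half_plane \<theta> = {s. Re s > \<theta>}"

definition gordon_hedenmalm :: "(nat \<Rightarrow> complex) \<Rightarrow> bool" where
  "gordon_hedenmalm c \<longleftrightarrow> dirichlet_polynomial c \<and> dpoly c ` half_plane 0 \<subseteq> half_plane (1/2)"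

definition unrestricted_range :: "(nat \<Rightarrow> complex) \<Rightarrow> bool" where
  "unrestricted_range c \<longleftrightarrow> (INF s\<in>half_plane 0. Re (dpoly c s)) = 1/2"

text \<open>\<open>comp_op \<phi> f\<close> is the element of \<open>h2\<close> equal to \<open>f \<circ> \<phi>\<close>. Its
  series is only guaranteed to converge on the half-plane \<open>Re s > 1/2\<close>, which suffices
  to determine its coefficients.\<close>

definition comp_op :: "(complex \<Rightarrow> complex) \<Rightarrow> h2 \<Rightarrow> h2" where
  "comp_op \<phi> f = (THE g. \<forall>s\<in>half_plane (1/2). h2_eval g s = h2_eval f (\<phi> s))"

definition compact_operator :: "('a::real_normed_vector \<Rightarrow> 'b::real_normed_vector) \<Rightarrow> bool" where
  "compact_operator T \<longleftrightarrow> (\<forall>B. bounded B \<longrightarrow> compact (closure (T ` B)))"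

section \<open>Complex dimension, degree and Bohr lifts\<close>

lemma vector_space_rat_real: "vector_space (\<lambda>(q::rat) (x::real). of_rat q * x)"
  by unfold_locales (simp_all add: algebra_simps of_rat_add of_rat_mult)

definition rat_independent :: "nat set \<Rightarrow> bool" where
  "rat_independent L \<longleftrightarrow>
     module.independent (\<lambda>(q::rat) (x::real). of_rat q * x) ((\<lambda>n. ln (real n)) ` L)"

definition generates :: "nat set \<Rightarrow> nat set \<Rightarrow> bool" where
  "generates L M \<longleftrightarrow> (\<forall>n\<in>M. \<exists>\<alpha>::nat \<Rightarrow> nat. n = (\<Prod>q\<in>L. q ^ \<alpha> q))"

text \<open>Finiteness loses nothing, since a finite set is generated by its prime divisors.\<close>

definition generating_sets :: "nat set \<Rightarrow> nat set set" where
  "generating_sets M = {L. finite L \<and> L \<subseteq> {2..} \<and> rat_independent L \<and> generates L M}"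

definition complex_dimension :: "(nat \<Rightarrow> complex) \<Rightarrow> nat" where
  "complex_dimension c = Inf (card ` generating_sets (spectrum_set c))"

definition minimal_generating_sets :: "(nat \<Rightarrow> complex) \<Rightarrow> nat set set" where
  "minimal_generating_sets c =
     {L \<in> generating_sets (spectrum_set c). card L = complex_dimension c}"

definition multi_index :: "nat set \<Rightarrow> nat \<Rightarrow> nat \<Rightarrow> nat" where
  "multi_index L n = (THE \<alpha>. (\<forall>q. q \<notin> L \<longrightarrow> \<alpha> q = 0) \<and> n = (\<Prod>q\<in>L. q ^ \<alpha> q))"

definition degree_wrt :: "(nat \<Rightarrow> complex) \<Rightarrow> nat set \<Rightarrow> nat" where
  "degree_wrt c L = (SUP n\<in>spectrum_set c. \<Sum>q\<in>L. multi_index L n q)"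

definition dpoly_degree :: "(nat \<Rightarrow> complex) \<Rightarrow> nat" where
  "dpoly_degree c = Inf (degree_wrt c ` minimal_generating_sets c)"

definition optimal :: "(nat \<Rightarrow> complex) \<Rightarrow> nat set \<Rightarrow> bool" where
  "optimal c L \<longleftrightarrow> L \<in> minimal_generating_sets c \<and> degree_wrt c L = dpoly_degree c"

text \<open>The variables are \<open>z 0, \<dots>, z (d - 1)\<close>, numbered by a list enumerating the
  generating set; the remaining values of \<open>z\<close> are ignored.\<close>

definition bohr_lift :: "(nat \<Rightarrow> complex) \<Rightarrow> nat list \<Rightarrow> (nat \<Rightarrow> complex) \<Rightarrow> complex" where
  "bohr_lift c qs z = (c 1 - 1/2) +
     (\<Sum>n\<in>spectrum_set c. c n * (\<Prod>j<length qs. z j ^ multi_index (set qs) n (qs ! j)))"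

definition optimal_bohr_lift :: "(nat \<Rightarrow> complex) \<Rightarrow> ((nat \<Rightarrow> complex) \<Rightarrow> complex) \<Rightarrow> bool" where
  "optimal_bohr_lift c \<Phi> \<longleftrightarrow>
     (\<exists>qs. distinct qs \<and> optimal c (set qs) \<and> \<Phi> = bohr_lift c qs)"

section \<open>The boundary index\<close>

definition torus :: "nat \<Rightarrow> (nat \<Rightarrow> complex) set" where
  "torus d = {..<d} \<rightarrow>\<^sub>E sphere 0 1"

definition partial_deriv :: "nat \<Rightarrow> ((nat \<Rightarrow> real) \<Rightarrow> real) \<Rightarrow> (nat \<Rightarrow> real) \<Rightarrow> real" where
  "partial_deriv j F \<theta> = deriv (\<lambda>t. F (\<theta>(j := t))) (\<theta> j)"

definition hessian :: "nat \<Rightarrow> ((nat \<Rightarrow> real) \<Rightarrow> real) \<Rightarrow> (nat \<Rightarrow> real) \<Rightarrow> real Matrix.mat" where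
  "hessian d F \<theta> = Matrix.mat d d (\<lambda>(i, j). partial_deriv i (partial_deriv j F) \<theta>)"

definition num_pos_eigenvalues :: "real Matrix.mat \<Rightarrow> nat" where
  "num_pos_eigenvalues A = size (filter_mset (\<lambda>x. 0 < x) (proots (char_poly A)))"

text \<open>The Hessian does not depend on the choice of arguments \<open>\<theta>\<^sub>j\<close> of \<open>w\<^sub>j\<close>,
  by periodicity.\<close>

definition boundary_index :: "nat \<Rightarrow> ((nat \<Rightarrow> complex) \<Rightarrow> complex) \<Rightarrow> (nat \<Rightarrow> complex) \<Rightarrow> nat" where
  "boundary_index d \<Phi> w =
     num_pos_eigenvalues (hessian d (\<lambda>\<theta>. Re (\<Phi> (\<lambda>j. cis (\<theta> j)))) (\<lambda>j. Arg (w j)))"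

end

theory Submission
  imports Defs "HOL-Probability.Probability" "HOL-Complex_Analysis.Complex_Analysis"
begin

text \<open>Write \<open>\<phi> = 1/2 + \<Phi>(w)\<close> along the Kronecker flow on the torus, let \<open>f = \<Sum> a\<^sub>n n\<^sup>-\<^sup>s\<close> and
  \<open>F u = \<Sum> a\<^sub>n n\<^sup>-\<^sup>1\<^sup>/\<^sup>2\<^sup>-\<^sup>u\<close>. By Parseval, the squared norm of \<open>f \<circ> \<phi>\<close> is the mean of \<open>\<bar>F \<circ> \<Phi>\<bar>\<^sup>2\<close> over the
  torus. Now \<open>\<bar>F\<bar>\<^sup>2\<close> is dominated by the Poisson integral \<open>U\<close> of its boundary values, and the mean of
  \<open>U \<circ> \<Phi>\<close> is \<open>U (\<Phi> 0)\<close>, which a Schur test bounds by the squared norm of \<open>f\<close>. The operator is compact as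
  soon as the part of the Poisson mass carried by \<open>Re \<Phi> < \<delta>\<close> tends to zero uniformly relative to that of
  \<open>\<Phi> 0\<close>; by Dini's argument this follows when, for every \<open>t\<close>, almost every slice \<open>z \<mapsto> \<Phi>(z w)\<close> avoids the
  value \<open>i t\<close> on the circle. At such a value \<open>Re \<Phi>\<close> has a minimum. In degree at most two this leaves
  finitely many exceptional points in some coordinate; for boundary index at least two, a \<open>2 \<times> 2\<close> minor of
  the Hessian is nonzero, and the exceptional points lie on Lipschitz curves in a plane of coordinates.

  Conversely, if \<open>\<bar>\<Phi>(w) - i \<tau>\<bar>\<close> is bounded by a multiple of the distance of one coordinate to a point, then
  the normalised partial sums of \<open>\<Sum> n\<^sup>-\<^sup>1\<^sup>/\<^sup>2\<^sup>+\<^sup>i\<^sup>\<tau> n\<^sup>-\<^sup>s\<close> converge weakly to zero while their images do not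
  converge to zero. In dimension one this always happens; in general it happens for
  \<open>\<Phi> = (1 - z\<^sub>0) + (1 - z\<^sub>0)\<^sup>2 h\<close> with a small polynomial \<open>h\<close>.\<close>

section \<open>The Poisson kernel of the right half-plane\<close>

text \<open>Two obstacles shape the argument. Finite sums \<open>F\<close> have no bound on the
  imaginary axis that is uniform in their length; so \<open>|F|^2\<close> is replaced by a harmonic
  majorant, whose mean is read off at the interior point \<open>\<Phi> 0\<close>. And
  \<open>\<Phi>\<close> has several variables, while the potential theory used has one: an extra
  rotation \<open>s\<close> is adjoined to the torus, and every mean is first taken along a slice, a
  polynomial in one variable with the value \<open>\<Phi> 0\<close> at the centre.

  On a slice, \<open>Re (1 / (\<Phi> - i t))\<close> is a positive harmonic function, and its
  boundary measure has an atom wherever the slice takes the value \<open>i t\<close> on the circle.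
  Such atoms are invisible in the boundary values, and they are what keeps Poisson mass in
  arbitrarily thin strips. With one variable they are unavoidable. With two or more, it suffices
  that for each \<open>t\<close> they occur on a null set of slices only. This is needed for every
  \<open>t\<close>, not for almost every one, because Dini's argument asks for convergence at each
  point; large \<open>t\<close> are handled by the common decay \<open>t^-2\<close> of all
  kernels.\<close>

lemma upper_half_plane_exp_bound:
  assumes "0 \<le> l" "0 \<le> Im z"
  shows "cmod (exp (\<i> * of_real l * z)) \<le> 1"
  using assms by (simp add: norm_exp_eq_Re)

text \<open>Subtracting the value \<open>exp (- l)\<close> that \<open>exp (i l z)\<close> takes at
  \<open>i\<close> makes this pole of \<open>1 / (1 + z^2)\<close> removable. The integrand is then
  holomorphic on the whole half-disc, and the segment contributes minus the arc, where the numerator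
  is at most 2 and the denominator at least \<open>R^2 - 1\<close>.\<close>

lemma cauchy_fourier_truncated:
  fixes l R :: real
  assumes "0 \<le> l" "1 < R"
  shows "cmod (integral {-R..R} (\<lambda>t. (exp (\<i> * of_real l * of_real t) - exp (- of_real l)) / (1 + of_real t ^ 2)))
          \<le> 2 * pi * R / (R\<^sup>2 - 1)"
    and "(\<lambda>t. (exp (\<i> * of_real l * of_real t) - exp (- of_real l)) / (1 + of_real t ^ 2)) integrable_on {-R..R}"
proof -
  define f where "f = (\<lambda>z::complex. exp (\<i> * of_real l * z))"
  define h where "h = (\<lambda>z. if z = \<i> then deriv f \<i> else (f z - f \<i>) / (z - \<i>))"
  define g where "g = (\<lambda>z. h z / (z + \<i>))"
  have "f holomorphic_on UNIV" unfolding f_def by (intro holomorphic_intros)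
  then have h: "h holomorphic_on UNIV"
    unfolding h_def by (rule pole_lemma) simp
  have g: "g holomorphic_on {z. Im z > -1}"
    unfolding g_def
  proof (intro holomorphic_intros)
    show "h holomorphic_on {z. Im z > -1}" using h holomorphic_on_subset by blast
    fix z :: complex assume "z \<in> {z. Im z > -1}"
    then show "z + \<i> \<noteq> 0" by (auto simp: complex_eq_iff)
  qed
  have fi: "f \<i> = exp (- of_real l)" by (simp add: f_def mult.commute mult.left_commute)
  have g_eq: "g z = (f z - exp (- of_real l)) / (1 + z^2)" if "z \<noteq> \<i>" for z
  proof -
    have "(z - \<i>) * (z + \<i>) = 1 + z\<^sup>2" by (simp add: algebra_simps power2_eq_square)
    then show ?thesis using that by (simp add: g_def h_def fi)
  qed
  let ?C = "linepath (- of_real R) (of_real R) +++ part_circlepath 0 R 0 pi"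
  have ends: "part_circlepath 0 R 0 pi 0 = of_real R" "part_circlepath 0 R 0 pi 1 = - of_real R"
    by (simp_all add: part_circlepath_def linepath_def)
  have img: "path_image (part_circlepath 0 R 0 pi) \<subseteq> {z. cmod z = R \<and> Im z \<ge> 0}"
  proof
    fix z assume "z \<in> path_image (part_circlepath 0 R 0 pi)"
    then obtain x where x: "x \<in> {0..pi}" "z = of_real R * cis x"
      by (auto simp: path_image_part_circlepath' closed_segment_eq_real_ivl)
    have "Im z = R * sin x" "cmod z = R" using assms(2) unfolding x(2) norm_mult by simp_all
    then show "z \<in> {z. cmod z = R \<and> Im z \<ge> 0}"
      using assms(2) sin_ge_zero[of x] x(1) by simp
  qed
  have li: "path_image (linepath (- of_real R) (of_real R)) \<subseteq> {z::complex. Im z = 0}"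
    by (auto simp: closed_segment_def)
  have int0: "(g has_contour_integral 0) ?C"
  proof (rule Cauchy_theorem_convex_simple[OF g])
    show "convex {z. Im z > -1}" by (rule convex_halfspace_Im_gt)
    show "valid_path ?C" by (intro valid_path_join) (auto simp: pathstart_def ends)
    show "pathfinish ?C = pathstart ?C" by (simp add: pathfinish_def pathstart_def ends joinpaths_def linepath_def)
    show "path_image ?C \<subseteq> {z. Im z > -1}"
      using img li path_image_join_subset[of "linepath (- of_real R) (of_real R)" "part_circlepath 0 R 0 pi"]
      by force
  qed
  then have ci: "g contour_integrable_on ?C" by (auto simp: contour_integrable_on_def)
  have c1: "g contour_integrable_on (linepath (- of_real R) (of_real R))" 
    and c2: "g contour_integrable_on (part_circlepath 0 R 0 pi)"
    using contour_integrable_join[of "linepath (- of_real R) (of_real R)" "part_circlepath 0 R 0 pi" g] ci 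
    by (auto simp: pathstart_def ends)
  have "contour_integral ?C g = contour_integral (linepath (- of_real R) (of_real R)) g + contour_integral (part_circlepath 0 R 0 pi) g"
    by (rule contour_integral_join[OF c1 c2]) auto
  then have sum0: "contour_integral (linepath (- of_real R) (of_real R)) g = - contour_integral (part_circlepath 0 R 0 pi) g"
    using int0 by (simp add: contour_integral_unique eq_neg_iff_add_eq_0)
  have bd: "cmod (contour_integral (part_circlepath 0 R 0 pi) g) \<le> 2 / (R\<^sup>2 - 1) * R * \<bar>pi - 0\<bar>"
  proof (rule contour_integral_bound_part_circlepath[OF c2])
    show "0 \<le> 2 / (R\<^sup>2 - 1)" "0 \<le> R" using assms by (auto simp: power2_eq_square less_imp_le mult_ge1_I)
    fix z assume "z \<in> path_image (part_circlepath 0 R 0 pi)"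
    then have z: "cmod z = R" "Im z \<ge> 0" using img by auto
    have "z \<noteq> \<i>" using z assms by auto
    have "cmod (f z - exp (- of_real l)) \<le> cmod (f z) + cmod (exp (- of_real l))" by (rule norm_triangle_ineq4)
    also have "\<dots> \<le> 1 + 1"
    proof (rule add_mono)
      show "cmod (f z) \<le> 1" unfolding f_def by (rule upper_half_plane_exp_bound[OF assms(1) z(2)])
      show "cmod (exp (- of_real l)) \<le> 1" using assms(1) by simp
    qed
    finally have a: "cmod (f z - exp (- of_real l)) \<le> 2" by simp
    have b: "R\<^sup>2 - 1 \<le> cmod (1 + z^2)"
      using norm_triangle_ineq2[of "z^2" "-1"] z by (simp add: norm_power add.commute)
    have c: "R\<^sup>2 - 1 > 0" using assms by (simp add: power2_eq_square less_1_mult)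
    show "cmod (g z) \<le> 2 / (R\<^sup>2 - 1)"
      unfolding g_eq[OF \<open>z \<noteq> \<i>\<close>] norm_divide by (rule frac_le) (use a b c in auto)
  qed
  have geq2: "g (of_real t) = (exp (\<i> * of_real l * of_real t) - exp (- of_real l)) / (1 + of_real t ^ 2)" for t :: real
    using g_eq[of "of_real t"] by (simp add: f_def complex_eq_iff)
  have e: "contour_integral (linepath (- of_real R) (of_real R)) g = integral {-R..R} (\<lambda>t. g (of_real t))"
    using contour_integral_linepath_Reals_eq[of "- of_real R" "of_real R" g] assms by simp
  have "(\<lambda>t. g (of_real t)) integrable_on {-R..R}"
    using contour_integrable_linepath_Reals_iff[of "- of_real R" "of_real R" g] assms c1 by simp
  then show "(\<lambda>t. (exp (\<i> * of_real l * of_real t) - exp (- of_real l)) / (1 + of_real t ^ 2)) integrable_on {-R..R}"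
    unfolding geq2 .
  show "cmod (integral {-R..R} (\<lambda>t. (exp (\<i> * of_real l * of_real t) - exp (- of_real l)) / (1 + of_real t ^ 2)))
          \<le> 2 * pi * R / (R\<^sup>2 - 1)"
    using bd unfolding geq2[symmetric] e[symmetric] sum0 by (simp add: mult_ac)
qed

lemma integrable_cauchy_density: "integrable lborel (\<lambda>t::real. 1 / (1 + t\<^sup>2))"
  and integral_cauchy_density: "(LINT t|lborel. 1 / (1 + t\<^sup>2)) = pi"
  using integrable_inverse_1_plus_square LBINT_inverse_1_plus_square
  by (auto simp: set_integrable_def einterval_def interval_lebesgue_integral_def set_lebesgue_integral_def field_simps)

lemma cauchy_fourier:
  fixes l :: real
  assumes "0 \<le> l"
  shows "integrable lborel (\<lambda>t. exp (\<i> * of_real l * of_real t) / (1 + of_real t ^ 2))"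
    and "(LINT t|lborel. exp (\<i> * of_real l * of_real t) / (1 + of_real t ^ 2)) = of_real (pi * exp (-l))"
proof -
  have den: "1 + complex_of_real t ^ 2 = of_real (1 + t^2)" for t by simp
  have nm: "cmod (1 + complex_of_real t ^ 2) = 1 + t^2" for t
    unfolding den norm_of_real by simp
  show I1: "integrable lborel (\<lambda>t. exp (\<i> * of_real l * of_real t) / (1 + of_real t ^ 2))"
    by (rule Bochner_Integration.integrable_bound[OF integrable_cauchy_density])
       (auto simp: norm_divide norm_exp_eq_Re nm)
  have I2: "integrable lborel (\<lambda>t::real. exp (- complex_of_real l) / (1 + of_real t ^ 2))"
    by (rule Bochner_Integration.integrable_bound[OF integrable_cauchy_density])
       (auto simp: norm_divide norm_exp_eq_Re nm assms divide_right_mono)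
  define k where "k = (\<lambda>t::real. (exp (\<i> * of_real l * of_real t) - exp (- of_real l)) / (1 + of_real t ^ 2) :: complex)"
  have I3: "integrable lborel k" unfolding k_def diff_divide_distrib using I1 I2 by auto
  have lim: "(\<lambda>n. LINT t|lborel. indicator {- real n..real n} t *\<^sub>R k t) \<longlonglongrightarrow> (LINT t|lborel. k t)"
  proof (rule integral_dominated_convergence)
    show "integrable lborel (\<lambda>t. cmod (k t))" using I3 by auto
    show "AE t in lborel. (\<lambda>n. indicator {- real n..real n} t *\<^sub>R k t) \<longlonglongrightarrow> k t"
    proof (rule AE_I2)
      fix t :: real
      have "eventually (\<lambda>n. indicator {- real n..real n} t *\<^sub>R k t = k t) sequentially"
      proof (rule eventually_sequentiallyI)
        fix n assume "nat \<lceil>\<bar>t\<bar>\<rceil> \<le> n"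
        then have "\<bar>t\<bar> \<le> real n" by linarith
        then show "indicator {- real n..real n} t *\<^sub>R k t = k t" by (auto simp: indicator_def abs_le_iff)
      qed
      then show "(\<lambda>n. indicator {- real n..real n} t *\<^sub>R k t) \<longlonglongrightarrow> k t"
        by (rule tendsto_eventually)
    qed
    show "AE x in lborel. norm (indicator {- real n..real n} x *\<^sub>R k x) \<le> cmod (k x)" for n
      by (auto simp: indicator_def)
  qed (use I3 in auto)
  have lim0: "(\<lambda>n. LINT t|lborel. indicator {- real n..real n} t *\<^sub>R k t) \<longlonglongrightarrow> 0"
  proof (rule Lim_null_comparison)
    show "(\<lambda>n. 2 * pi * real n / ((real n)\<^sup>2 - 1)) \<longlonglongrightarrow> 0" by real_asymp
    show "\<forall>\<^sub>F n in sequentially. norm (LINT t|lborel. indicator {- real n..real n} t *\<^sub>R k t) \<le> 2 * pi * real n / ((real n)\<^sup>2 - 1)"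
    proof (rule eventually_sequentiallyI[of 2])
      fix n :: nat assume n: "2 \<le> n"
      have "set_integrable lborel {- real n..real n} k"
        unfolding set_integrable_def using I3 by (intro integrable_mult_indicator) auto
      then have "(LINT t:{- real n..real n}|lborel. k t) = integral {- real n..real n} k"
        by (rule set_borel_integral_eq_integral(2))
      then show "norm (LINT t|lborel. indicator {- real n..real n} t *\<^sub>R k t) \<le> 2 * pi * real n / ((real n)\<^sup>2 - 1)"
        using cauchy_fourier_truncated(1)[OF assms, of "real n"] n by (simp add: set_lebesgue_integral_def k_def)
    qed
  qed
  have "(LINT t|lborel. k t) = 0" using LIMSEQ_unique[OF lim lim0] .
  then have "(LINT t|lborel. exp (\<i> * of_real l * of_real t) / (1 + of_real t ^ 2)) = (LINT t|lborel. exp (- complex_of_real l) / (1 + of_real t ^ 2))"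
    unfolding k_def diff_divide_distrib using I1 I2 by (simp add: Bochner_Integration.integral_diff)
  also have "\<dots> = (LINT t|lborel. complex_of_real (exp (-l) * (1 / (1 + t^2))))"
    by (intro Bochner_Integration.integral_cong) (auto simp: exp_of_real[symmetric] simp del: exp_of_real)
  also have "\<dots> = complex_of_real (exp (-l) * pi)"
    unfolding integral_complex_of_real integral_mult_right_zero integral_cauchy_density ..
  finally show "(LINT t|lborel. exp (\<i> * of_real l * of_real t) / (1 + of_real t ^ 2)) = of_real (pi * exp (-l))"
    by (simp add: mult.commute)
qed

text \<open>The Poisson kernel without its factor \<open>1 / pi\<close>, hence of total mass
  \<open>pi\<close>. As the real part of a holomorphic function of \<open>u\<close> it can be
  averaged over slices.\<close>

definition pois :: "complex \<Rightarrow> real \<Rightarrow> real" where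
  "pois u t = Re (1 / (u - \<i> * of_real t))"

lemma pois_eq: "pois u t = Re u / ((Re u)\<^sup>2 + (Im u - t)\<^sup>2)"
  by (simp add: pois_def Re_divide power2_eq_square)

lemma pois_nonneg: "0 \<le> Re u \<Longrightarrow> 0 \<le> pois u t"
  by (simp add: pois_eq)

lemma pois_rescale:
  assumes "x > 0"
  shows "pois (Complex x y) (y + - x * r) = (1 / x) * (1 / (1 + r\<^sup>2))"
proof -
  have "x\<^sup>2 + (x * r)\<^sup>2 = x\<^sup>2 * (1 + r\<^sup>2)" by (simp add: power_mult_distrib algebra_simps)
  moreover have "1 + r\<^sup>2 \<noteq> 0" using zero_le_power2[of r] by linarith
  ultimately show ?thesis using assms by (simp add: pois_eq power2_eq_square[of x])
qed

lemma integrable_pois: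
  assumes "Re u > 0"
  shows "integrable lborel (pois u)"
proof -
  obtain x y where u: "u = Complex x y" by (cases u)
  have x: "x > 0" using assms u by simp
  have "integrable lborel (\<lambda>r. (1 / x) * (1 / (1 + r\<^sup>2)))"
    using integrable_cauchy_density by (rule integrable_mult_right)
  then have "integrable lborel (\<lambda>r. pois u (y + - x * r))"
    unfolding u pois_rescale[OF x] .
  then show ?thesis using x by (subst (asm) lborel_integrable_real_affine_iff) auto
qed

lemma exp_pois:
  fixes u :: complex and l :: real
  assumes "Re u > 0" "0 \<le> l"
  shows "integrable lborel (\<lambda>t. exp (- (\<i> * of_real (l * t))) * of_real (pois u t))"
    and "(LINT t|lborel. exp (- (\<i> * of_real (l * t))) * of_real (pois u t)) = pi * exp (- u * of_real l)"
proof -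
  obtain x y where u: "u = Complex x y" by (cases u)
  have x: "x > 0" using assms u by simp
  show "integrable lborel (\<lambda>t. exp (- (\<i> * of_real (l * t))) * of_real (pois u t))"
    by (rule Bochner_Integration.integrable_bound[OF integrable_pois[OF assms(1)]])
       (auto simp: norm_mult norm_exp_eq_Re pois_def)
  have "(LINT t|lborel. exp (- (\<i> * of_real (l * t))) * of_real (pois u t))
     = \<bar>-x\<bar> *\<^sub>R (LINT r|lborel. exp (- (\<i> * of_real (l * (y + -x * r)))) * of_real (pois u (y + -x * r)))"
    using x by (intro lborel_integral_real_affine) auto
  also have "(\<lambda>r. exp (- (\<i> * of_real (l * (y + -x * r)))) * of_real (pois u (y + -x * r)))
     = (\<lambda>r. (exp (- \<i> * of_real (l * y)) / x) * (exp (\<i> * of_real (l * x) * of_real r) / (1 + of_real r ^ 2)))"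
  proof
    fix r
    have "exp (- (\<i> * complex_of_real (l * (y + -x * r)))) = exp (- \<i> * of_real (l * y)) * exp (\<i> * of_real (l * x) * of_real r)"
      by (simp add: exp_add[symmetric] algebra_simps)
    then show "exp (- (\<i> * of_real (l * (y + -x * r)))) * of_real (pois u (y + -x * r))
      = (exp (- \<i> * of_real (l * y)) / x) * (exp (\<i> * of_real (l * x) * of_real r) / (1 + of_real r ^ 2))"
      unfolding u pois_rescale[OF x] by simp
  qed
  also have "(LINT r|lborel. (exp (- \<i> * of_real (l * y)) / x) * (exp (\<i> * of_real (l * x) * of_real r) / (1 + of_real r ^ 2)))
      = (exp (- \<i> * of_real (l * y)) / x) * of_real (pi * exp (-(l * x)))"
    using cauchy_fourier(2)[of "l * x"] x assms(2) by (simp only: integral_mult_right_zero) simp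
  also have "\<bar>-x\<bar> *\<^sub>R \<dots> = pi * (exp (- \<i> * of_real (l * y)) * exp (-(of_real (l * x))))"
    using x by (simp add: scaleR_conv_of_real exp_of_real[symmetric] del: exp_of_real)
  also have "exp (- \<i> * of_real (l * y)) * exp (-(of_real (l * x))) = exp (- u * of_real l)"
    by (simp add: exp_add[symmetric] u Complex_eq algebra_simps)
  finally show "(LINT t|lborel. exp (- (\<i> * of_real (l * t))) * of_real (pois u t)) = pi * exp (- u * of_real l)" .
qed

text \<open>The bounded harmonic extension of \<open>exp (- i l t)\<close> from the points
  \<open>i t\<close>; it is holomorphic for nonnegative \<open>l\<close> and antiholomorphic for
  negative \<open>l\<close>.\<close>

definition kap :: "real \<Rightarrow> complex \<Rightarrow> complex" where
  "kap l u = (if 0 \<le> l then exp (- u * of_real l) else cnj (exp (u * of_real l)))"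

lemma Re_mult_of_real: "Re (z * of_real r) = Re z * r" by simp

lemma exp_pois_kap:
  fixes u :: complex and l :: real
  assumes "Re u > 0"
  shows "integrable lborel (\<lambda>t. exp (- (\<i> * of_real (l * t))) * of_real (pois u t))"
    and "(LINT t|lborel. exp (- (\<i> * of_real (l * t))) * of_real (pois u t)) = pi * kap l u"
proof -
  have c: "exp (- (\<i> * of_real (l * t))) * of_real (pois u t)
     = cnj (exp (- (\<i> * of_real (-l * t))) * of_real (pois u t))" for t
    by (simp add: exp_cnj)
  show "integrable lborel (\<lambda>t. exp (- (\<i> * of_real (l * t))) * of_real (pois u t))"
    by (rule Bochner_Integration.integrable_bound[OF integrable_pois[OF assms(1)]])
       (auto simp: norm_mult norm_exp_eq_Re pois_def)
  show "(LINT t|lborel. exp (- (\<i> * of_real (l * t))) * of_real (pois u t)) = pi * kap l u"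
  proof (cases "0 \<le> l")
    case True
    then show ?thesis using exp_pois(2)[OF assms True] by (simp add: kap_def)
  next
    case False
    then have "0 \<le> -l" by simp
    have "(LINT t|lborel. exp (- (\<i> * of_real (l * t))) * of_real (pois u t))
        = (LINT t|lborel. cnj (exp (- (\<i> * of_real (-l * t))) * of_real (pois u t)))"
      by (rule arg_cong[where f = "integral\<^sup>L lborel"]) (rule ext, rule c)
    also have "\<dots> = cnj (pi * exp (- u * of_real (- l)))"
      by (subst Bochner_Integration.integral_cnj) (simp only: exp_pois(2)[OF assms \<open>0 \<le> -l\<close>])
    finally show ?thesis using False by (simp add: kap_def)
  qed
qed

lemma integral_pois: "Re u > 0 \<Longrightarrow> (LINT t|lborel. pois u t) = pi"
proof -
  assume "Re u > 0"
  from exp_pois(2)[OF this, of 0] have "(LINT t|lborel. complex_of_real (pois u t)) = of_real pi" by simp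
  then show ?thesis unfolding integral_complex_of_real of_real_eq_iff .
qed

section \<open>Exponential sums and their harmonic majorants\<close>

definition expsum :: "'a set \<Rightarrow> ('a \<Rightarrow> complex) \<Rightarrow> ('a \<Rightarrow> real) \<Rightarrow> complex \<Rightarrow> complex" where
  "expsum S b L u = (\<Sum>n\<in>S. b n * exp (- u * of_real (L n)))"

text \<open>The harmonic extension to the right half-plane of the boundary values of \<open>\<bar>expsum S b L\<bar>\<^sup>2\<close>.\<close>

definition majorant :: "'a set \<Rightarrow> ('a \<Rightarrow> complex) \<Rightarrow> ('a \<Rightarrow> real) \<Rightarrow> complex \<Rightarrow> complex" where
  "majorant S b L u = (\<Sum>n\<in>S. \<Sum>m\<in>S. b n * cnj (b m) * kap (L n - L m) u)"

lemma expsum_square: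
  "complex_of_real ((cmod (expsum S b L u))\<^sup>2)
     = (\<Sum>n\<in>S. \<Sum>m\<in>S. b n * cnj (b m) * (exp (- u * of_real (L n)) * cnj (exp (- u * of_real (L m)))))"
  unfolding complex_norm_square expsum_def cnj_sum sum_product
  by (intro sum.cong refl) (simp add: mult_ac)

lemma expsum_square_imag:
  "complex_of_real ((cmod (expsum S b L (\<i> * of_real t)))\<^sup>2)
     = (\<Sum>n\<in>S. \<Sum>m\<in>S. b n * cnj (b m) * exp (- (\<i> * of_real ((L n - L m) * t))))"
  unfolding expsum_square
  by (intro sum.cong refl) (simp add: exp_cnj exp_add[symmetric] algebra_simps)

lemma majorant_poisson:
  assumes "Re u > 0" "finite S"
  shows "integrable lborel (\<lambda>t. (cmod (expsum S b L (\<i> * of_real t)))\<^sup>2 * pois u t)"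
    and "complex_of_real (LINT t|lborel. (cmod (expsum S b L (\<i> * of_real t)))\<^sup>2 * pois u t) = pi * majorant S b L u"
proof -
  have e: "complex_of_real ((cmod (expsum S b L (\<i> * of_real t)))\<^sup>2 * pois u t)
     = (\<Sum>n\<in>S. \<Sum>m\<in>S. b n * cnj (b m) * (exp (- (\<i> * of_real ((L n - L m) * t))) * of_real (pois u t)))" for t
    unfolding of_real_mult expsum_square_imag sum_distrib_right by (simp add: mult_ac)
  have "integrable lborel (\<lambda>t. complex_of_real ((cmod (expsum S b L (\<i> * of_real t)))\<^sup>2 * pois u t))"
    unfolding e by (intro Bochner_Integration.integrable_sum integrable_mult_right exp_pois_kap(1) assms)
  then show "integrable lborel (\<lambda>t. (cmod (expsum S b L (\<i> * of_real t)))\<^sup>2 * pois u t)"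
    unfolding complex_of_real_integrable_eq .
  have "complex_of_real (LINT t|lborel. (cmod (expsum S b L (\<i> * of_real t)))\<^sup>2 * pois u t)
     = (LINT t|lborel. (\<Sum>n\<in>S. \<Sum>m\<in>S. b n * cnj (b m) * (exp (- (\<i> * of_real ((L n - L m) * t))) * of_real (pois u t))))"
    unfolding integral_complex_of_real[symmetric] e ..
  also have "\<dots> = (\<Sum>n\<in>S. \<Sum>m\<in>S. b n * cnj (b m) * (pi * kap (L n - L m) u))"
    by (simp only: Bochner_Integration.integral_sum Bochner_Integration.integrable_sum integrable_mult_right
        exp_pois_kap[OF assms(1)] integral_mult_right_zero)
  also have "\<dots> = pi * majorant S b L u"
    unfolding majorant_def sum_distrib_left by (simp add: mult_ac)
  finally show "complex_of_real (LINT t|lborel. (cmod (expsum S b L (\<i> * of_real t)))\<^sup>2 * pois u t) = pi * majorant S b L u" .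
qed

text \<open>Since only nonnegative frequencies occur, the value of the sum at \<open>u\<close> is
  its own Poisson mean; the variance of the boundary values about this mean is nonnegative. On the
  imaginary axis both sides agree.\<close>

lemma expsum_le_majorant:
  assumes "Re u \<ge> 0" "finite S" "\<And>n. n \<in> S \<Longrightarrow> 0 \<le> L n"
  shows "(cmod (expsum S b L u))\<^sup>2 \<le> Re (majorant S b L u)"
proof (cases "Re u = 0")
  case True
  have "exp (- u * of_real (L n)) * cnj (exp (- u * of_real (L m))) = kap (L n - L m) u" for n m
    using True by (auto simp: kap_def exp_cnj exp_add[symmetric] complex_eq_iff Re_exp Im_exp algebra_simps)
  then have "complex_of_real ((cmod (expsum S b L u))\<^sup>2) = majorant S b L u"
    unfolding expsum_square majorant_def by simp
  then show ?thesis by (metis Re_complex_of_real order_refl)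
next
  case False
  then have u: "Re u > 0" using assms(1) by simp
  let ?F = "\<lambda>t. expsum S b L (\<i> * of_real t)"
  let ?w = "expsum S b L u"
  note M = majorant_poisson[OF u assms(2), of b L]
  have Fe: "?F t * of_real (pois u t) = (\<Sum>n\<in>S. b n * (exp (- (\<i> * of_real (L n * t))) * of_real (pois u t)))" for t
    unfolding expsum_def sum_distrib_right by (intro sum.cong) (simp_all add: mult_ac)
  have Fi: "integrable lborel (\<lambda>t. ?F t * of_real (pois u t))"
    unfolding Fe by (intro Bochner_Integration.integrable_sum integrable_mult_right exp_pois_kap(1) u)
  have "(LINT t|lborel. ?F t * of_real (pois u t)) = (\<Sum>n\<in>S. b n * (pi * exp (- u * of_real (L n))))"
    unfolding Fe using exp_pois_kap(1)[OF u] exp_pois(2)[OF u] assms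
    by (subst Bochner_Integration.integral_sum) auto
  then have FI: "(LINT t|lborel. ?F t * of_real (pois u t)) = pi * ?w"
    by (simp add: expsum_def sum_distrib_left mult_ac)
  have sq: "(cmod (?F t - ?w))\<^sup>2 * pois u t
     = (cmod (?F t))\<^sup>2 * pois u t - 2 * Re (cnj ?w * (?F t * of_real (pois u t))) + (cmod ?w)\<^sup>2 * pois u t" for t
  proof -
    have "(cmod (a - b))\<^sup>2 = (cmod a)\<^sup>2 - 2 * Re (cnj b * a) + (cmod b)\<^sup>2" for a b :: complex
      unfolding cmod_power2 by (simp add: power2_eq_square algebra_simps)
    from this[of "?F t" ?w] show ?thesis by (simp only: distrib_right left_diff_distrib mult.assoc[symmetric] Re_mult_of_real)
  qed
  have i2: "integrable lborel (\<lambda>t. 2 * Re (cnj ?w * (?F t * of_real (pois u t))))"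
    by (intro integrable_mult_right integrable_Re Fi)
  have i3: "integrable lborel (\<lambda>t. (cmod ?w)\<^sup>2 * pois u t)" using integrable_pois[OF u] by auto
  have "0 \<le> (LINT t|lborel. (cmod (?F t - ?w))\<^sup>2 * pois u t)"
    using pois_nonneg[OF assms(1)] by (intro Bochner_Integration.integral_nonneg) auto
  also have "\<dots> = (LINT t|lborel. (cmod (?F t))\<^sup>2 * pois u t) - (LINT t|lborel. 2 * Re (cnj ?w * (?F t * of_real (pois u t))))
       + (LINT t|lborel. (cmod ?w)\<^sup>2 * pois u t)"
    unfolding sq using M(1) i2 i3 by simp
  also have "(LINT t|lborel. 2 * Re (cnj ?w * (?F t * of_real (pois u t)))) = 2 * Re (cnj ?w * (pi * ?w))"
    unfolding FI[symmetric]
    by (subst integral_mult_right_zero, subst integral_Re) (intro integrable_mult_right Fi, simp)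
  also have "2 * Re (cnj ?w * (pi * ?w)) = 2 * pi * (cmod ?w)\<^sup>2"
    unfolding cmod_power2 by (simp add: power2_eq_square algebra_simps)
  also have "(LINT t|lborel. (cmod ?w)\<^sup>2 * pois u t) = pi * (cmod ?w)\<^sup>2"
    using integral_pois[OF u] by simp
  also have "(LINT t|lborel. (cmod (?F t))\<^sup>2 * pois u t) = pi * Re (majorant S b L u)"
    using arg_cong[OF M(2), of Re] by simp
  finally have "0 \<le> pi * (Re (majorant S b L u) - (cmod ?w)\<^sup>2)" by (simp add: algebra_simps)
  then show ?thesis using pi_gt_zero by (simp only: zero_le_mult_iff) linarith
qed

section \<open>Random variables in the right half-plane\<close>

lemma powr_difference_lower:
  fixes x :: real and m :: nat
  assumes "0 < x" "x \<le> 1" "1 \<le> m"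
  shows "x * real m powr (x - 1) \<le> real m powr x - real (m - 1) powr x"
proof (cases "m = 1")
  case True
  then show ?thesis using assms by simp
next
  case False
  then have m: "2 \<le> m" using assms by simp
  have d: "((\<lambda>z. z powr x) has_real_derivative (x * z powr (x - 1))) (at z)" if "real (m - 1) \<le> z" for z
    by (rule has_real_derivative_powr) (use that m in linarith)
  have "real (m - 1) < real m" using m by simp
  from MVT2[OF this d] obtain z where z: "real (m - 1) < z" "z < real m"
    "real m powr x - real (m - 1) powr x = (real m - real (m - 1)) * (x * z powr (x - 1))" by blast
  have "z > 0" using z(1) m by linarith
  then have "real m powr (x - 1) \<le> z powr (x - 1)"
    using z(2) assms by (intro powr_mono2') auto
  then have "x * real m powr (x - 1) \<le> x * z powr (x - 1)"
    using assms(1) by (intro mult_left_mono) auto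
  moreover have "real m - real (m - 1) = 1" using m by (simp add: of_nat_diff)
  ultimately show ?thesis unfolding z(3) by (simp only: mult_1_left)
qed

lemma powr_difference_lower':
  fixes x :: real and m :: nat
  assumes "0 < x" "2 \<le> m"
  shows "x * real m powr (-1 - x) \<le> real (m - 1) powr (-x) - real m powr (-x)"
proof -
  have d: "((\<lambda>z. z powr (-x)) has_real_derivative (-x * z powr (-x - 1))) (at z)" if "real (m - 1) \<le> z" for z
    by (rule has_real_derivative_powr) (use that assms(2) in linarith)
  have "real (m - 1) < real m" using assms(2) by simp
  from MVT2[OF this d] obtain z where z: "real (m - 1) < z" "z < real m"
    "real m powr (-x) - real (m - 1) powr (-x) = (real m - real (m - 1)) * (-x * z powr (-x - 1))" by blast
  have "z > 0" using z(1) assms by linarith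
  then have "real m powr (-x - 1) \<le> z powr (-x - 1)"
    using z(2) assms by (intro powr_mono2') auto
  then have "x * real m powr (-x - 1) \<le> x * z powr (-x - 1)"
    using assms(1) by (intro mult_left_mono) auto
  moreover have "real m - real (m - 1) = 1" using assms by (simp add: of_nat_diff)
  moreover have "- 1 - x = - x - 1" by simp
  ultimately show ?thesis using z(3) by (simp only: mult_1_left mult_minus_left)
qed

lemma schur_sum_low:
  fixes x :: real
  assumes x: "0 < x" "x \<le> 1"
  shows "(\<Sum>m=1..n. real m powr (x - 1)) \<le> real n powr x / x"
proof (induction n)
  case (Suc n)
  define g where "g = (\<lambda>n. real n powr x)"
  have "x * real (Suc n) powr (x - 1) \<le> g (Suc n) - g n"
    using powr_difference_lower[OF x, of "Suc n"] by (simp add: g_def)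
  then have "real (Suc n) powr (x - 1) \<le> (g (Suc n) - g n) / x"
    using x(1) by (simp only: pos_le_divide_eq mult.commute)
  moreover have "(\<Sum>m=1..Suc n. real m powr (x - 1)) = (\<Sum>m=1..n. real m powr (x - 1)) + real (Suc n) powr (x - 1)"
    by simp
  ultimately show ?case using Suc by (simp only: g_def diff_divide_distrib)
qed simp

lemma schur_sum_high:
  fixes x :: real
  assumes x: "0 < x" and n: "1 \<le> n"
  shows "(\<Sum>m=Suc n..n+k. real m powr (-1 - x)) \<le> (real n powr (-x) - real (n+k) powr (-x)) / x"
proof (induction k)
  case (Suc k)
  define g where "g = (\<lambda>n. real n powr (-x))"
  have "x * real (Suc (n+k)) powr (-1 - x) \<le> g (n+k) - g (Suc (n+k))"
    using powr_difference_lower'[OF x, of "Suc (n+k)"] n by (simp add: g_def)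
  then have "real (Suc (n+k)) powr (-1 - x) \<le> (g (n+k) - g (Suc (n+k))) / x"
    using x(1) by (simp only: pos_le_divide_eq mult.commute)
  moreover have "(\<Sum>m=Suc n..n+Suc k. real m powr (-1 - x)) = (\<Sum>m=Suc n..n+k. real m powr (-1 - x)) + real (Suc (n+k)) powr (-1 - x)"
    by simp
  ultimately show ?case using Suc by (simp only: g_def diff_divide_distrib add_Suc_right)
qed simp

text \<open>The summand is \<open>(m/n)^x / m\<close> for \<open>m \<le> n\<close> and
  \<open>(n/m)^x / m\<close> beyond. Each half telescopes against a power of \<open>m\<close> and
  contributes at most \<open>1 / x\<close>; \<open>x \<le> 1\<close> makes \<open>z^(x-1)\<close>
  decreasing, as the comparison below \<open>n\<close> requires.\<close>

lemma schur_row_sum: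
  fixes x :: real and n :: nat and S :: "nat set"
  assumes x: "0 < x" "x \<le> 1" and n: "1 \<le> n" and S: "finite S" "S \<subseteq> {1..}"
  shows "(\<Sum>m\<in>S. exp (- x * \<bar>ln (real n) - ln (real m)\<bar>) / real m) \<le> 2 / x"
proof -
  obtain M where M: "\<And>m. m \<in> S \<Longrightarrow> m \<le> M" using S(1) by (meson finite_nat_set_iff_bounded_le)
  \<comment> \<open>Any bound with \<open>S\<close> inside \<open>{1..n + k}\<close> serves, because
    the estimate does not depend on \<open>k\<close>.\<close>
  define k where "k = M"
  have sub: "S \<subseteq> {1..n} \<union> {Suc n..n+k}" 
  proof
    fix m assume "m \<in> S"
    then have "1 \<le> m" "m \<le> n + k" using M[of m] S(2) by (auto simp: k_def)
    then show "m \<in> {1..n} \<union> {Suc n..n+k}" by auto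
  qed
  have low: "exp (- x * \<bar>ln (real n) - ln (real m)\<bar>) / real m = real n powr (-x) * real m powr (x - 1)" if "m \<in> {1..n}" for m
  proof -
    have "ln (real m) \<le> ln (real n)" using that by simp
    then have "\<bar>ln (real n) - ln (real m)\<bar> = ln n - ln m" by simp
    then have "exp (- x * \<bar>ln (real n) - ln (real m)\<bar>) = exp (-x * ln n) * exp (x * ln m)"
      by (simp add: exp_add[symmetric] algebra_simps)
    then show ?thesis using that n by (simp add: powr_def exp_diff left_diff_distrib)
  qed
  have high: "exp (- x * \<bar>ln (real n) - ln (real m)\<bar>) / real m = real n powr x * real m powr (-1 - x)" if "m \<in> {Suc n..n+k}" for m
  proof -
    have "ln (real n) \<le> ln (real m)" using that n by simp
    then have "\<bar>ln (real n) - ln (real m)\<bar> = ln m - ln n" by simp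
    then have "exp (- x * \<bar>ln (real n) - ln (real m)\<bar>) = exp (x * ln n) * exp (- x * ln m)"
      by (simp add: exp_add[symmetric] algebra_simps)
    moreover have "real m powr (-1 - x) = exp (- x * ln m) / m"
      using that n by (simp add: powr_def exp_diff left_diff_distrib exp_minus field_simps)
    ultimately show ?thesis using that n by (simp add: powr_def)
  qed
  have np: "real n powr (-x) * real n powr x = 1" using n by (simp add: powr_minus field_simps)
  have "(\<Sum>m\<in>S. exp (- x * \<bar>ln (real n) - ln (real m)\<bar>) / real m) \<le> (\<Sum>m\<in>{1..n} \<union> {Suc n..n+k}. exp (- x * \<bar>ln (real n) - ln (real m)\<bar>) / real m)"
    by (rule sum_mono2) (use sub in auto)
  also have "\<dots> = (\<Sum>m\<in>{1..n}. exp (- x * \<bar>ln (real n) - ln (real m)\<bar>) / real m) + (\<Sum>m\<in>{Suc n..n+k}. exp (- x * \<bar>ln (real n) - ln (real m)\<bar>) / real m)"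
    by (rule sum.union_disjoint) auto
  also have "(\<Sum>m\<in>{1..n}. exp (- x * \<bar>ln (real n) - ln (real m)\<bar>) / real m) = real n powr (-x) * (\<Sum>m=1..n. real m powr (x - 1))"
    unfolding sum_distrib_left by (rule sum.cong[OF refl]) (rule low)
  also have "(\<Sum>m\<in>{Suc n..n+k}. exp (- x * \<bar>ln (real n) - ln (real m)\<bar>) / real m) = real n powr x * (\<Sum>m=Suc n..n+k. real m powr (-1 - x))"
    unfolding sum_distrib_left by (rule sum.cong[OF refl]) (rule high)
  also have "real n powr (-x) * (\<Sum>m=1..n. real m powr (x - 1)) \<le> real n powr (-x) * (real n powr x / x)"
    by (intro mult_left_mono schur_sum_low x) simp
  also have "\<dots> = 1 / x" using np by simp
  also have "real n powr x * (\<Sum>m=Suc n..n+k. real m powr (-1 - x)) \<le> real n powr x * (real n powr (-x) / x)"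
  proof (intro mult_left_mono)
    have "(\<Sum>m=Suc n..n+k. real m powr (-1 - x)) \<le> (real n powr (-x) - real (n+k) powr (-x)) / x"
      by (rule schur_sum_high[OF x(1) n])
    also have "\<dots> \<le> real n powr (-x) / x" using x by (intro divide_right_mono) auto
    finally show "(\<Sum>m=Suc n..n+k. real m powr (-1 - x)) \<le> real n powr (-x) / x" .
  qed simp
  also have "\<dots> = 1 / x" using np by (simp add: mult.commute)
  finally show ?thesis by simp
qed

lemma cmod_kap: "cmod (kap l u) = exp (- Re u * \<bar>l\<bar>)"
  by (auto simp: kap_def norm_exp_eq_Re abs_if)

text \<open>Schur's test: the factors \<open>1 / sqrt n\<close> and \<open>1 / sqrt m\<close> are
  exchanged before the inequality of arithmetic and geometric means, so that \<open>|a n|^2\<close>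
  is weighted by \<open>k n m / m\<close>, whose sum over \<open>m\<close> is bounded. Lowering
  \<open>Re w\<close> to \<open>min 1 (Re w)\<close> only enlarges the kernel and brings the
  exponent into the range of the row sum bound.\<close>

lemma majorant_schur:
  fixes a :: "nat \<Rightarrow> complex"
  assumes S: "finite S" "S \<subseteq> {1..}" and w: "Re w > 0"
  shows "cmod (majorant S (\<lambda>n. a n / of_real (sqrt n)) (\<lambda>n. ln n) w) \<le> 2 / min 1 (Re w) * (\<Sum>n\<in>S. (cmod (a n))\<^sup>2)"
proof -
  define x where "x = min 1 (Re w)"
  have x: "0 < x" "x \<le> 1" "x \<le> Re w" using w by (auto simp: x_def)
  define k where "k = (\<lambda>n m. exp (- x * \<bar>ln (real n) - ln (real m)\<bar>))"
  have ksym: "k n m = k m n" for n m by (simp add: k_def abs_minus_commute)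
  have knn: "k n m \<ge> 0" for n m by (simp add: k_def)
  have amgm: "p * q \<le> (p\<^sup>2 + q\<^sup>2) / 2" for p q :: real
    using sum_squares_bound[of p q] by simp
  have bound1: "cmod (a n / of_real (sqrt n) * cnj (a m / of_real (sqrt m)) * kap (ln n - ln m) w)
      \<le> ((cmod (a n))\<^sup>2 * (k n m / m) + (cmod (a m))\<^sup>2 * (k n m / n)) / 2" if "n \<in> S" "m \<in> S" for n m
  proof -
    have pos: "real n > 0" "real m > 0" using that S(2) by force+
    have "cmod (kap (ln n - ln m) w) \<le> k n m"
      unfolding cmod_kap k_def using x(3) by (simp add: mult_right_mono)
    then have st1: "cmod (a n / of_real (sqrt n) * cnj (a m / of_real (sqrt m)) * kap (ln n - ln m) w)
       \<le> (cmod (a n) / sqrt n) * (cmod (a m) / sqrt m) * k n m"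
      using pos by (simp add: norm_mult norm_divide mult_left_mono divide_right_mono)
    have st2: "(cmod (a n) / sqrt n) * (cmod (a m) / sqrt m) * k n m = (cmod (a n) / sqrt m) * (cmod (a m) / sqrt n) * k n m" by simp
    have "(cmod (a n) / sqrt m) * (cmod (a m) / sqrt n) \<le> ((cmod (a n) / sqrt m)\<^sup>2 + (cmod (a m) / sqrt n)\<^sup>2) / 2"
      by (rule amgm)
    also have "\<dots> = ((cmod (a n))\<^sup>2 / m + (cmod (a m))\<^sup>2 / n) / 2"
      using pos by (simp add: power_divide)
    finally have "(cmod (a n) / sqrt m) * (cmod (a m) / sqrt n) * k n m \<le> ((cmod (a n))\<^sup>2 / m + (cmod (a m))\<^sup>2 / n) / 2 * k n m"
      by (rule mult_right_mono) (rule knn)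
    with st1 st2 show ?thesis by (simp add: algebra_simps)
  qed
  have "cmod (majorant S (\<lambda>n. a n / of_real (sqrt n)) (\<lambda>n. ln n) w)
     \<le> (\<Sum>n\<in>S. \<Sum>m\<in>S. ((cmod (a n))\<^sup>2 * (k n m / m) + (cmod (a m))\<^sup>2 * (k n m / n)) / 2)"
    unfolding majorant_def by (intro order.trans[OF norm_sum] sum_mono bound1)
  also have "\<dots> = ((\<Sum>n\<in>S. \<Sum>m\<in>S. (cmod (a n))\<^sup>2 * (k n m / m)) + (\<Sum>n\<in>S. \<Sum>m\<in>S. (cmod (a m))\<^sup>2 * (k n m / n))) / 2"
    by (simp add: sum.distrib sum_divide_distrib[symmetric])
  also have "(\<Sum>n\<in>S. \<Sum>m\<in>S. (cmod (a m))\<^sup>2 * (k n m / n)) = (\<Sum>n\<in>S. \<Sum>m\<in>S. (cmod (a n))\<^sup>2 * (k n m / m))"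
    by (subst sum.swap) (simp add: ksym)
  also have "((\<Sum>n\<in>S. \<Sum>m\<in>S. (cmod (a n))\<^sup>2 * (k n m / m)) + (\<Sum>n\<in>S. \<Sum>m\<in>S. (cmod (a n))\<^sup>2 * (k n m / m))) / 2
     = (\<Sum>n\<in>S. (cmod (a n))\<^sup>2 * (\<Sum>m\<in>S. k n m / m))" by (simp add: sum_distrib_left sum_distrib_right mult_ac)
  also have "\<dots> \<le> (\<Sum>n\<in>S. (cmod (a n))\<^sup>2 * (2 / x))"
    unfolding k_def using S by (intro sum_mono mult_left_mono schur_row_sum[OF x(1,2)]) auto
  finally show ?thesis by (simp add: x_def sum_distrib_left mult.commute)
qed

text \<open>What remains of the lift once the torus is forgotten: \<open>W\<close> stands for
  \<open>\<Phi>\<close> on a random slice and \<open>w0\<close> for \<open>\<Phi> 0\<close>. From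
  \<open>mean_exp\<close>, a mean value property, the mean of each \<open>kap l\<close>, hence of
  each majorant, is its value at \<open>w0\<close>.\<close>

locale half_plane_variable = prob_space Q for Q :: "'q measure" +
  fixes W :: "'q \<Rightarrow> complex" and w0 :: complex and K :: real
  assumes W_measurable[measurable]: "W \<in> borel_measurable Q"
    and Re_W: "\<And>x. x \<in> space Q \<Longrightarrow> 0 \<le> Re (W x)"
    and cmod_W: "\<And>x. x \<in> space Q \<Longrightarrow> cmod (W x) \<le> K"
    and Re_w0: "0 < Re w0" and cmod_w0: "cmod w0 \<le> K"
    and mean_exp: "\<And>l. 0 \<le> l \<Longrightarrow> (LINT x|Q. exp (- W x * of_real l)) = exp (- w0 * of_real l)"
begin

lemma kap_measurable[measurable]: "kap l \<in> borel_measurable borel"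
  unfolding kap_def by (cases "0 \<le> l") (auto intro!: borel_measurable_continuous_onI continuous_intros)

lemma pois_measurable[measurable]: "case_prod pois \<in> borel_measurable (borel \<Otimes>\<^sub>M borel)"
proof -
  have "case_prod pois = (\<lambda>(u, t). Re u / ((Re u)\<^sup>2 + (Im u - t)\<^sup>2))" by (auto simp: pois_eq)
  also have "\<dots> \<in> borel_measurable (borel \<Otimes>\<^sub>M borel)" by measurable
  finally show ?thesis .
qed

lemma integrable_kap: "integrable Q (\<lambda>x. kap l (W x))"
proof (rule integrable_const_bound[where B = 1])
  show "AE x in Q. norm (kap l (W x)) \<le> 1" using Re_W by (auto simp: cmod_kap)
qed simp

lemma mean_kap: "(LINT x|Q. kap l (W x)) = kap l w0"
proof (cases "0 \<le> l")
  case True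
  then show ?thesis using mean_exp by (simp add: kap_def)
next
  case False
  then have "0 \<le> -l" by simp
  have "(LINT x|Q. kap l (W x)) = (LINT x|Q. cnj (exp (- W x * of_real (- l))))"
    using False by (simp add: kap_def)
  also have "\<dots> = cnj (exp (- w0 * of_real (- l)))"
    by (subst Bochner_Integration.integral_cnj) (simp only: mean_exp[OF \<open>0 \<le> -l\<close>])
  finally show ?thesis using False by (simp add: kap_def)
qed

lemma mean_majorant:
  assumes "finite S"
  shows "integrable Q (\<lambda>x. majorant S b L (W x))" "(LINT x|Q. majorant S b L (W x)) = majorant S b L w0"
proof -
  show "integrable Q (\<lambda>x. majorant S b L (W x))" unfolding majorant_def
    by (intro Bochner_Integration.integrable_sum integrable_mult_right integrable_kap)
  show "(LINT x|Q. majorant S b L (W x)) = majorant S b L w0" unfolding majorant_def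
    by (simp only: Bochner_Integration.integral_sum Bochner_Integration.integrable_sum integrable_mult_right
        integrable_kap integral_mult_right_zero mean_kap)
qed

lemma expsum_measurable[measurable]: "expsum S b L \<in> borel_measurable borel"
  unfolding expsum_def by (intro borel_measurable_continuous_onI continuous_intros)

lemma integrable_expsum_square:
  assumes "finite S" "\<And>n. n \<in> S \<Longrightarrow> 0 \<le> L n"
  shows "integrable Q (\<lambda>x. (cmod (expsum S b L (W x)))\<^sup>2)"
proof (rule Bochner_Integration.integrable_bound)
  show "integrable Q (\<lambda>x. Re (majorant S b L (W x)))" using mean_majorant(1)[OF assms(1)] by (rule integrable_Re)
  show "AE x in Q. norm ((cmod (expsum S b L (W x)))\<^sup>2) \<le> norm (Re (majorant S b L (W x)))"
  proof (rule AE_I2)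
    fix x assume "x \<in> space Q"
    from expsum_le_majorant[OF Re_W[OF this] assms(1), of L b] assms(2)
    show "norm ((cmod (expsum S b L (W x)))\<^sup>2) \<le> norm (Re (majorant S b L (W x)))" by simp
  qed
qed simp

text \<open>This becomes boundedness of the composition operator: whatever \<open>W\<close> does
  near the imaginary axis, the mean of the majorant is its value at the interior point
  \<open>w0\<close>, where the Schur test applies.\<close>

lemma expsum_mean_bound:
  assumes "finite S" "S \<subseteq> {1..}"
  shows "(LINT x|Q. (cmod (expsum S (\<lambda>n. a n / of_real (sqrt (real n))) (\<lambda>n. ln (real n)) (W x)))\<^sup>2)
          \<le> 2 / min 1 (Re w0) * (\<Sum>n\<in>S. (cmod (a n))\<^sup>2)"
proof -
  let ?b = "\<lambda>n. a n / of_real (sqrt (real n))" and ?L = "\<lambda>n::nat. ln (real n)"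
  have L: "0 \<le> ?L n" if "n \<in> S" for n using that assms(2) by auto
  note M = mean_majorant[OF assms(1), of ?b ?L]
  have "(LINT x|Q. (cmod (expsum S ?b ?L (W x)))\<^sup>2) \<le> (LINT x|Q. Re (majorant S ?b ?L (W x)))"
    by (rule Bochner_Integration.integral_mono[OF integrable_expsum_square[OF assms(1) L] integrable_Re[OF M(1)]],
        assumption, rule expsum_le_majorant[OF Re_W assms(1) L])
  also have "\<dots> = Re (majorant S ?b ?L w0)" using integral_Re[OF M(1)] M(2) by simp
  also have "\<dots> \<le> cmod (majorant S ?b ?L w0)" by (rule complex_Re_le_cmod)
  also have "\<dots> \<le> 2 / min 1 (Re w0) * (\<Sum>n\<in>S. (cmod (a n))\<^sup>2)" by (rule majorant_schur[OF assms Re_w0])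
  finally show ?thesis .
qed

end

section \<open>The Poisson mass carried by a thin strip\<close>

lemma pois_eq_cmod: "pois u t = Re u / (cmod (u - \<i> * of_real t))\<^sup>2"
  by (simp add: pois_eq cmod_power2)

lemma pois_lipschitz:
  assumes "0 < d" "d \<le> Re u"
  shows "\<bar>pois u t - pois u t'\<bar> \<le> 1 / d\<^sup>2 * \<bar>t - t'\<bar>"
proof -
  let ?p = "u - \<i> * of_real t" and ?q = "u - \<i> * of_real t'"
  have n: "d \<le> cmod ?p" "d \<le> cmod ?q"
    using assms(2) complex_Re_le_cmod[of ?p] complex_Re_le_cmod[of ?q] by simp_all
  then have nz: "?p \<noteq> 0" "?q \<noteq> 0" using assms(1) by auto
  have "1 / ?p - 1 / ?q = (?q - ?p) / (?p * ?q)" by (simp only: diff_frac_eq[OF nz] mult_1_left)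
  also have "?q - ?p = \<i> * of_real (t - t')" by (simp add: algebra_simps)
  finally have "cmod (1 / ?p - 1 / ?q) = \<bar>t - t'\<bar> / (cmod ?p * cmod ?q)"
    by (simp only: norm_divide norm_mult norm_ii norm_of_real mult_1_left)
  also have "\<dots> \<le> \<bar>t - t'\<bar> / (d * d)"
    using n assms(1) by (intro divide_left_mono mult_mono mult_pos_pos) auto
  finally have "cmod (1 / ?p - 1 / ?q) \<le> 1 / d\<^sup>2 * \<bar>t - t'\<bar>" by (simp add: power2_eq_square)
  moreover have "\<bar>pois u t - pois u t'\<bar> \<le> cmod (1 / ?p - 1 / ?q)"
    unfolding pois_def minus_complex.sel(1)[symmetric] by (rule abs_Re_le_cmod)
  ultimately show ?thesis by linarith
qed

lemma pois_continuous: "0 < Re u \<Longrightarrow> continuous_on UNIV (pois u)"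
proof (rule lipschitz_on_continuous_on)
  assume "0 < Re u"
  then show "(1 / (Re u)\<^sup>2)-lipschitz_on UNIV (pois u)"
    using pois_lipschitz[of "Re u" u] by (intro lipschitz_onI) (auto simp: dist_real_def)
qed

text \<open>In general Fatou's lemma gives only that the mean of \<open>pois (W x) t\<close> is at
  most \<open>pois w0 t\<close>. Equality says that no mass has escaped into an atom at
  \<open>i t\<close>.\<close>

locale compact_half_plane_variable = half_plane_variable +
  assumes integrable_pois_W: "\<And>t. integrable Q (\<lambda>x. pois (W x) t)"
    and mean_pois: "\<And>t. (LINT x|Q. pois (W x) t) = pois w0 t"
begin

definition off_mass :: "real \<Rightarrow> real \<Rightarrow> real" where
  "off_mass d t = (LINT x|Q. indicator {x. d \<le> Re (W x)} x * pois (W x) t)"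

definition strip_mass :: "real \<Rightarrow> real \<Rightarrow> real" where
  "strip_mass d t = (LINT x|Q. indicator {x. Re (W x) < d} x * pois (W x) t)"

lemma integrable_parts:
  fixes f :: "'a \<Rightarrow> real"
  assumes "integrable Q f"
  shows "integrable Q (\<lambda>x. indicator {x. d \<le> Re (W x)} x * f x)"
    and "integrable Q (\<lambda>x. indicator {x. Re (W x) < d} x * f x)"
  by (rule Bochner_Integration.integrable_bound[OF assms]; use assms in \<open>auto simp: indicator_def\<close>)+

lemma integral_parts:
  fixes f :: "'a \<Rightarrow> real"
  assumes "integrable Q f"
  shows "(LINT x|Q. f x) = (LINT x|Q. indicator {x. d \<le> Re (W x)} x * f x) + (LINT x|Q. indicator {x. Re (W x) < d} x * f x)"
  unfolding Bochner_Integration.integral_add[OF integrable_parts[OF assms], symmetric]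
  by (rule Bochner_Integration.integral_cong) (auto simp: indicator_def)

text \<open>Here \<open>mean_pois\<close> enters. The part off the strip is Lipschitz in
  \<open>t\<close>, because the kernel is so at distance \<open>d\<close> from the axis; the strip
  mass, as its complement, becomes continuous, which its definition does not show.\<close>

lemma strip_mass_eq: "strip_mass d t = pois w0 t - off_mass d t"
  using integral_parts[OF integrable_pois_W, of t d] mean_pois[of t] by (simp add: strip_mass_def off_mass_def)

lemma off_mass_continuous:
  assumes "0 < d"
  shows "continuous_on UNIV (off_mass d)"
proof (rule lipschitz_on_continuous_on)
  show "(1 / d\<^sup>2)-lipschitz_on UNIV (off_mass d)"
  proof (rule lipschitz_onI)
    fix t t' :: real
    let ?I = "\<lambda>x. indicator {x. d \<le> Re (W x)} x :: real"
    have "off_mass d t - off_mass d t' = (LINT x|Q. ?I x * pois (W x) t - ?I x * pois (W x) t')"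
      unfolding off_mass_def by (rule Bochner_Integration.integral_diff[symmetric]) (rule integrable_parts(1)[OF integrable_pois_W])+
    also have "\<bar>\<dots>\<bar> \<le> (LINT x|Q. \<bar>?I x * pois (W x) t - ?I x * pois (W x) t'\<bar>)"
      by (rule integral_abs_bound)
    also have "\<dots> \<le> (LINT x|Q. 1 / d\<^sup>2 * \<bar>t - t'\<bar>)"
    proof (rule Bochner_Integration.integral_mono)
      show "integrable Q (\<lambda>x. \<bar>?I x * pois (W x) t - ?I x * pois (W x) t'\<bar>)"
        by (intro integrable_abs Bochner_Integration.integrable_diff integrable_parts integrable_pois_W)
      show "\<bar>?I x * pois (W x) t - ?I x * pois (W x) t'\<bar> \<le> 1 / d\<^sup>2 * \<bar>t - t'\<bar>" for x
        using pois_lipschitz[OF assms, of "W x" t t'] by (auto simp: indicator_def)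
    qed simp
    finally show "dist (off_mass d t) (off_mass d t') \<le> 1 / d\<^sup>2 * dist t t'"
      by (simp add: dist_real_def prob_space)
  qed simp
qed

lemma strip_mass_continuous: "0 < d \<Longrightarrow> continuous_on UNIV (strip_mass d)"
  unfolding strip_mass_eq[abs_def] by (intro continuous_intros pois_continuous off_mass_continuous Re_w0)

lemma strip_mass_mono: "d \<le> d' \<Longrightarrow> strip_mass d t \<le> strip_mass d' t"
  unfolding strip_mass_def
  by (rule Bochner_Integration.integral_mono[OF integrable_parts(2)[OF integrable_pois_W] integrable_parts(2)[OF integrable_pois_W]])
     (auto simp: indicator_def pois_nonneg Re_W)

lemma strip_mass_tendsto: "(\<lambda>k. strip_mass (1 / real (Suc k)) t) \<longlonglongrightarrow> 0"
proof -
  have "(\<lambda>k. LINT x|Q. indicator {x. Re (W x) < 1 / real (Suc k)} x * pois (W x) t) \<longlonglongrightarrow> (LINT x|Q. 0)"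
  proof (rule integral_dominated_convergence)
    show "integrable Q (\<lambda>x. pois (W x) t)" by (rule integrable_pois_W)
    show "AE x in Q. norm (indicator {x. Re (W x) < 1 / real (Suc k)} x * pois (W x) t) \<le> pois (W x) t" for k
      by (rule AE_I2) (auto simp: indicator_def pois_nonneg Re_W)
    show "AE x in Q. (\<lambda>k. indicator {x. Re (W x) < 1 / real (Suc k)} x * pois (W x) t) \<longlonglongrightarrow> 0"
    proof (rule AE_I2)
      fix x assume "x \<in> space Q"
      show "(\<lambda>k. indicator {x. Re (W x) < 1 / real (Suc k)} x * pois (W x) t) \<longlonglongrightarrow> 0"
      proof (cases "Re (W x) = 0")
        case True
        \<comment> \<open>On the axis the kernel is 0, at \<open>W x = i t\<close> by the convention
          \<open>0 / 0 = 0\<close>. Nothing is hidden by this, since \<open>mean_pois\<close>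
          accounts for the full value \<open>pois w0 t\<close>.\<close>
        then show ?thesis by (simp add: pois_eq)
      next
        case False
        then have "Re (W x) > 0" using Re_W[OF \<open>x \<in> space Q\<close>] by simp
        then obtain N where N: "1 / real (Suc N) < Re (W x)"
          using nat_approx_posE by metis
        show ?thesis
        proof (rule tendsto_eventually, rule eventually_sequentiallyI)
          fix k assume "N \<le> k"
          then have "1 / real (Suc k) \<le> 1 / real (Suc N)" by (simp add: frac_le)
          then show "indicator {x. Re (W x) < 1 / real (Suc k)} x * pois (W x) t = 0" using N by auto
        qed
      qed
    qed
  qed (auto simp: borel_measurable_integrable integrable_parts integrable_pois_W)
  then show ?thesis by (simp add: strip_mass_def)
qed

text \<open>Dini's argument: the decreasing continuous functions \<open>strip_mass (1 / (k + 1))\<close> tend to \<open>0\<close> pointwise.\<close>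

lemma strip_mass_uniform_compact:
  assumes "0 < c"
  shows "\<exists>k. \<forall>t\<in>{-T..T}. strip_mass (1 / real (Suc k)) t < c"
proof (rule ccontr)
  assume "\<not> ?thesis"
  then have "\<forall>k. \<exists>t. t \<in> {-T..T} \<and> c \<le> strip_mass (1 / real (Suc k)) t"
    by (simp add: not_less Bex_def)
  then obtain \<tau> where \<tau>: "\<And>k. \<tau> k \<in> {-T..T}" "\<And>k. c \<le> strip_mass (1 / real (Suc k)) (\<tau> k)" by metis
  have "seq_compact {-T..T}" using compact_Icc compact_imp_seq_compact by blast
  then obtain l r where lr: "strict_mono r" "(\<tau> \<circ> r) \<longlonglongrightarrow> l"
    unfolding seq_compact_def using \<tau>(1) by metis
  have "c \<le> strip_mass (1 / real (Suc j)) l" for j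
  proof (rule LIMSEQ_le_const)
    have "isCont (strip_mass (1 / real (Suc j))) l"
      using strip_mass_continuous[of "1 / real (Suc j)"] continuous_on_eq_continuous_at open_UNIV by auto
    then show "(\<lambda>k. strip_mass (1 / real (Suc j)) (\<tau> (r k))) \<longlonglongrightarrow> strip_mass (1 / real (Suc j)) l"
      using lr(2) by (auto simp: o_def intro: isCont_tendsto_compose)
    show "\<exists>N. \<forall>k\<ge>N. c \<le> strip_mass (1 / real (Suc j)) (\<tau> (r k))"
    proof (intro exI allI impI)
      fix k assume "j \<le> k"
      then have "j \<le> r k" using seq_suble[OF lr(1), of k] by linarith
      then have "1 / real (Suc (r k)) \<le> 1 / real (Suc j)" by (simp add: frac_le)
      from strip_mass_mono[OF this] \<tau>(2)[of "r k"] show "c \<le> strip_mass (1 / real (Suc j)) (\<tau> (r k))"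
        using order.trans by blast
    qed
  qed
  then have "c \<le> 0" using LIMSEQ_le_const[OF strip_mass_tendsto[of l]] by blast
  then show False using assms by simp
qed

lemma pois_w0_lower: "Re w0 / (K + \<bar>t\<bar>)\<^sup>2 \<le> pois w0 t"
proof -
  have "cmod (w0 - \<i> * of_real t) \<le> K + \<bar>t\<bar>"
    using norm_triangle_ineq4[of w0 "\<i> * of_real t"] cmod_w0 by (simp add: norm_mult)
  moreover have "0 < cmod (w0 - \<i> * of_real t)" using Re_w0 by (auto simp: complex_eq_iff)
  moreover from calculation have "0 < K + \<bar>t\<bar>" by linarith
  ultimately show ?thesis unfolding pois_eq_cmod using Re_w0
    by (intro divide_left_mono power_mono mult_pos_pos zero_less_power) auto
qed

text \<open>The comparison is with \<open>pois w0 t\<close>, which decays like \<open>t^-2\<close>.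
  For bounded \<open>t\<close> it follows from compactness; for large \<open>t\<close> the point
  \<open>i t\<close> is far from the range of \<open>W\<close>, and the numerator
  \<open>Re (W x) < d\<close> alone gives the small factor.\<close>

lemma strip_mass_uniform:
  assumes "0 < \<eta>"
  shows "\<exists>d>0. \<forall>t. strip_mass d t \<le> \<eta> * pois w0 t"
proof -
  \<comment> \<open>For \<open>|t|\<close> beyond \<open>2 K\<close> the distance from
    \<open>i t\<close> to the range of \<open>W\<close> is at least \<open>(K + |t|) / 3\<close>;
    squaring the 3 gives the 9 in the choice of \<open>d\<close>.\<close>
  define T where "T = 2 * K + 1"
  have K: "0 < K" using cmod_w0 complex_Re_le_cmod[of w0] Re_w0 by linarith
  define c where "c = \<eta> * (Re w0 / (K + T)\<^sup>2)"
  have "c > 0" using assms Re_w0 K by (simp add: c_def T_def)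
  from strip_mass_uniform_compact[OF this, of T] obtain k where k: "\<And>t. t \<in> {-T..T} \<Longrightarrow> strip_mass (1 / real (Suc k)) t < c"
    by blast
  define d where "d = min (1 / real (Suc k)) (\<eta> * Re w0 / 9)"
  have d: "0 < d" "d \<le> 1 / real (Suc k)" "9 * d \<le> \<eta> * Re w0" using assms Re_w0 by (auto simp: d_def)
  have "strip_mass d t \<le> \<eta> * pois w0 t" for t
  proof (cases "t \<in> {-T..T}")
    case True
    have "strip_mass d t \<le> c" using strip_mass_mono[OF d(2), of t] k[OF True] by linarith
    also have "\<dots> \<le> \<eta> * (Re w0 / (K + \<bar>t\<bar>)\<^sup>2)"
      unfolding c_def using True K assms Re_w0
      by (auto intro!: mult_left_mono divide_left_mono power_mono mult_pos_pos zero_less_power simp: T_def)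
    also have "\<dots> \<le> \<eta> * pois w0 t" using assms by (intro mult_left_mono pois_w0_lower) auto
    finally show ?thesis .
  next
    case False
    then have t: "2 * K + 1 < \<bar>t\<bar>" by (auto simp: T_def abs_if)
    have b: "indicator {x. Re (W x) < d} x * pois (W x) t \<le> \<eta> * pois w0 t" if "x \<in> space Q" for x
    proof (cases "Re (W x) < d")
      case True
      have "\<bar>t\<bar> - K \<le> cmod (W x - \<i> * of_real t)"
        using norm_triangle_ineq2[of "\<i> * of_real t" "W x"] cmod_W[OF that] by (simp add: norm_mult norm_minus_commute)
      moreover have "(K + \<bar>t\<bar>) / 3 \<le> \<bar>t\<bar> - K" using t by (simp add: field_simps)
      ultimately have "(K + \<bar>t\<bar>) / 3 \<le> cmod (W x - \<i> * of_real t)" by (rule order.trans[rotated])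
      then have "((K + \<bar>t\<bar>) / 3)\<^sup>2 \<le> (cmod (W x - \<i> * of_real t))\<^sup>2" using t K by (intro power_mono) auto
      then have "pois (W x) t \<le> d / ((K + \<bar>t\<bar>) / 3)\<^sup>2"
        unfolding pois_eq_cmod using True Re_W[OF that] t K by (intro frac_le) auto
      also have "\<dots> = 9 * d / (K + \<bar>t\<bar>)\<^sup>2" by (simp add: power_divide)
      also have "\<dots> \<le> \<eta> * Re w0 / (K + \<bar>t\<bar>)\<^sup>2" using d(3) by (intro divide_right_mono) auto
      also have "\<dots> \<le> \<eta> * pois w0 t" using pois_w0_lower[of t] assms by (simp add: mult_left_mono times_divide_eq_right[symmetric] del: times_divide_eq_right)
      finally show ?thesis using True by simp
    next
      case False
      then show ?thesis using assms pois_nonneg[of w0 t] Re_w0 by simp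
    qed
    have "strip_mass d t \<le> (LINT x|Q. \<eta> * pois w0 t)"
      unfolding strip_mass_def by (rule Bochner_Integration.integral_mono[OF integrable_parts(2)[OF integrable_pois_W] _ b]) auto
    then show ?thesis by (simp add: prob_space)
  qed
  then show ?thesis using d(1) by blast
qed

text \<open>Integrating \<open>t\<close> against the boundary values turns the bound on strip masses
  into one on the majorant, with the same factor. Fubini is applied only where
  \<open>d \<le> Re (W x)\<close>, so that the Poisson formula holds at each point; the strip is
  what the exact total mean leaves over.\<close>

lemma strip_expsum:
  assumes d: "0 < d" "\<And>t. strip_mass d t \<le> \<eta> * pois w0 t" and S: "finite S" "\<And>n. n \<in> S \<Longrightarrow> 0 \<le> L n"
  shows "(LINT x|Q. indicator {x. Re (W x) < d} x * (cmod (expsum S b L (W x)))\<^sup>2) \<le> \<eta> * Re (majorant S b L w0)"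
proof -
  let ?A = "\<lambda>x. indicator {x. d \<le> Re (W x)} x :: real" and ?B = "\<lambda>x. indicator {x. Re (W x) < d} x :: real"
  define h where "h = (\<lambda>t. (cmod (expsum S b L (\<i> * of_real t)))\<^sup>2)"
  have h0: "0 \<le> h t" for t by (simp add: h_def)
  have hm[measurable]: "h \<in> borel_measurable borel" unfolding h_def by measurable
  define M where "M = (\<lambda>u. Re (majorant S b L u))"
  have Mi: "integrable Q (\<lambda>x. M (W x))" unfolding M_def using mean_majorant(1)[OF S(1)] by (rule integrable_Re)
  have MM: "(LINT x|Q. M (W x)) = M w0"
    unfolding M_def integral_Re[OF mean_majorant(1)[OF S(1)]] mean_majorant(2)[OF S(1)] ..
  have hP: "integrable lborel (\<lambda>t. h t * pois u t)" "(LINT t|lborel. h t * pois u t) = pi * M u" if "0 < Re u" for u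
    using majorant_poisson[OF that S(1), of b L] unfolding h_def M_def
    by (auto dest!: arg_cong[where f = Re])
  interpret P: pair_sigma_finite Q lborel ..
  have jm[measurable]: "(\<lambda>(x, t). ?A x * (h t * pois (W x) t)) \<in> borel_measurable (Q \<Otimes>\<^sub>M lborel)"
    by (simp add: pois_eq split_beta')
  have inner: "(LINT t|lborel. ?A x * (h t * pois (W x) t)) = ?A x * (pi * M (W x))" for x
    using hP(2)[of "W x"] d(1) by (auto simp: indicator_def)
  have ji: "integrable (Q \<Otimes>\<^sub>M lborel) (\<lambda>(x, t). ?A x * (h t * pois (W x) t))"
  proof (rule P.Fubini_integrable[OF jm])
    show "AE x in Q. integrable lborel (\<lambda>t. case (x, t) of (x, t) \<Rightarrow> ?A x * (h t * pois (W x) t))"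
      using hP(1) d(1) by (intro AE_I2) (auto simp: indicator_def)
    have "(\<lambda>x. LINT t|lborel. norm (case (x, t) of (x, t) \<Rightarrow> ?A x * (h t * pois (W x) t))) = (\<lambda>x. LINT t|lborel. ?A x * (h t * pois (W x) t))"
    proof (intro ext Bochner_Integration.integral_cong refl)
      fix x t
      show "norm (case (x, t) of (x, t) \<Rightarrow> ?A x * (h t * pois (W x) t)) = ?A x * (h t * pois (W x) t)"
        using h0 d(1) pois_nonneg[of "W x" t] by (auto simp: indicator_def)
    qed
    then show "integrable Q (\<lambda>x. LINT t|lborel. norm (case (x, t) of (x, t) \<Rightarrow> ?A x * (h t * pois (W x) t)))"
      using Mi by (simp only: inner) (intro integrable_parts integrable_mult_right)
  qed
  have sw: "(LINT x|Q. ?A x * (h t * pois (W x) t)) = h t * off_mass d t" for t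
    unfolding off_mass_def integral_mult_right_zero[symmetric] by (simp add: mult_ac)
  have "pi * (LINT x|Q. ?A x * M (W x)) = (LINT x|Q. LINT t|lborel. ?A x * (h t * pois (W x) t))"
    unfolding inner integral_mult_right_zero[symmetric] by (simp add: mult_ac)
  also have "\<dots> = (LINT t|lborel. h t * off_mass d t)"
    unfolding sw[symmetric] using P.Fubini_integral[OF ji] by simp
  finally have A: "pi * (LINT x|Q. ?A x * M (W x)) = (LINT t|lborel. h t * off_mass d t)" .
  have Gi: "integrable lborel (\<lambda>t. h t * off_mass d t)"
    unfolding sw[symmetric] using P.integrable_snd[OF ji] by simp
  have "pi * (LINT x|Q. ?B x * M (W x)) = pi * M w0 - pi * (LINT x|Q. ?A x * M (W x))"
    using integral_parts[OF Mi, of d] MM by (simp add: algebra_simps)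
  also have "\<dots> = (LINT t|lborel. h t * pois w0 t) - (LINT t|lborel. h t * off_mass d t)"
    unfolding A hP(2)[OF Re_w0] ..
  also have "\<dots> = (LINT t|lborel. h t * strip_mass d t)"
    unfolding strip_mass_eq right_diff_distrib using hP(1)[OF Re_w0] Gi by simp
  also have "\<dots> \<le> (LINT t|lborel. \<eta> * (h t * pois w0 t))"
  proof (rule Bochner_Integration.integral_mono)
    show "integrable lborel (\<lambda>t. h t * strip_mass d t)"
      unfolding strip_mass_eq right_diff_distrib using hP(1)[OF Re_w0] Gi by simp
    show "integrable lborel (\<lambda>t. \<eta> * (h t * pois w0 t))" using hP(1)[OF Re_w0] by simp
    show "h t * strip_mass d t \<le> \<eta> * (h t * pois w0 t)" for t
      using mult_left_mono[OF d(2)[of t] h0[of t]] by (simp add: mult_ac)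
  qed
  also have "\<dots> = pi * (\<eta> * M w0)" using hP(2)[OF Re_w0] by simp
  finally have fin: "(LINT x|Q. ?B x * M (W x)) \<le> \<eta> * M w0" by simp
  have "(LINT x|Q. ?B x * (cmod (expsum S b L (W x)))\<^sup>2) \<le> (LINT x|Q. ?B x * M (W x))"
    by (rule Bochner_Integration.integral_mono[OF integrable_parts(2)[OF integrable_expsum_square[OF S]] integrable_parts(2)[OF Mi]])
       (auto intro!: expsum_le_majorant[OF Re_W S] simp: M_def indicator_def)
  then show ?thesis using fin by (simp add: M_def)
qed

text \<open>Inside the strip the factor \<open>\<eta>\<close> is as small as desired. Outside it,
  Cauchy-Schwarz bounds the sum by a tail of the convergent series of \<open>n^(-1-2d)\<close>, so
  it is enough that all frequencies are large. The Schur constant \<open>C\<close> is divided out in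
  \<open>\<eta>\<close>, and each region receives half of \<open>\<epsilon>\<close>.\<close>

theorem compact_estimate:
  assumes "0 < \<epsilon>"
  shows "\<exists>N. \<forall>S a. finite S \<longrightarrow> S \<subseteq> {max 1 N..} \<longrightarrow>
    (LINT x|Q. (cmod (expsum S (\<lambda>n. a n / of_real (sqrt (real n))) (\<lambda>n. ln (real n)) (W x)))\<^sup>2)
       \<le> \<epsilon> * (\<Sum>n\<in>S. (cmod (a n))\<^sup>2)"
proof -
  define C where "C = 2 / min 1 (Re w0)"
  have C: "C > 0" using Re_w0 by (simp add: C_def)
  define \<eta> where "\<eta> = \<epsilon> / (2 * C)"
  have \<eta>: "\<eta> > 0" "\<eta> * C = \<epsilon> / 2" using assms C by (auto simp: \<eta>_def)
  obtain d where d: "0 < d" "\<And>t. strip_mass d t \<le> \<eta> * pois w0 t" using strip_mass_uniform[OF \<eta>(1)] by blast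
  have "summable (\<lambda>n. real n powr (- (1 + 2 * d)))" using d(1) by (subst summable_real_powr_iff) auto
  then have "\<exists>N. \<forall>m\<ge>N. \<forall>n. norm (\<Sum>k\<in>{m..<n}. real k powr (- (1 + 2 * d))) < \<epsilon> / 2"
    unfolding summable_Cauchy using assms by (meson half_gt_zero)
  then obtain N where N: "\<And>m n. m \<ge> N \<Longrightarrow> norm (\<Sum>k\<in>{m..<n}. real k powr (- (1 + 2 * d))) < \<epsilon> / 2"
    by blast
  have "(LINT x|Q. (cmod (expsum S (\<lambda>n. a n / of_real (sqrt (real n))) (\<lambda>n. ln (real n)) (W x)))\<^sup>2)
       \<le> \<epsilon> * (\<Sum>n\<in>S. (cmod (a n))\<^sup>2)" if S: "finite S" "S \<subseteq> {max 1 N..}" for S a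
  proof -
    let ?b = "\<lambda>n. a n / of_real (sqrt (real n))" and ?L = "\<lambda>n::nat. ln (real n)"
    let ?A = "\<lambda>x. indicator {x. d \<le> Re (W x)} x :: real" and ?B = "\<lambda>x. indicator {x. Re (W x) < d} x :: real"
    define F where "F = (\<lambda>u. (cmod (expsum S ?b ?L u))\<^sup>2)"
    define E where "E = (\<Sum>n\<in>S. (cmod (a n))\<^sup>2)"
    have E0: "E \<ge> 0" by (simp add: E_def sum_nonneg)
    have S1: "S \<subseteq> {1..}" using S(2) by auto
    have L: "0 \<le> ?L n" if "n \<in> S" for n using that S1 by auto
    have Fi: "integrable Q (\<lambda>x. F (W x))" unfolding F_def by (rule integrable_expsum_square[OF S(1) L])
    obtain M where M: "S \<subseteq> {N..<M}"
    proof -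
      obtain M where M: "\<forall>n\<in>S. n < M" using S(1) finite_nat_set_iff_bounded by blast
      have "S \<subseteq> {N..<M}"
      proof
        fix n assume "n \<in> S"
        then have "n < M" "n \<in> {max 1 N..}" using M S(2) by auto
        then show "n \<in> {N..<M}" by simp
      qed
      then show ?thesis by (rule that)
    qed
    have tail: "(\<Sum>n\<in>S. real n powr (- (1 + 2 * d))) \<le> \<epsilon> / 2"
    proof -
      have "(\<Sum>n\<in>S. real n powr (- (1 + 2 * d))) \<le> (\<Sum>n\<in>{N..<M}. real n powr (- (1 + 2 * d)))"
        by (rule sum_mono2) (use M in auto)
      also have "\<dots> \<le> \<epsilon> / 2" using N[of N M] by simp
      finally show ?thesis .
    qed
    have off: "F u \<le> E * (\<epsilon> / 2)" if "d \<le> Re u" for u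
    proof -
      have t: "cmod (?b n * exp (- u * of_real (?L n))) \<le> cmod (a n) * (real n powr (- (1/2) - d))" if "n \<in> S" for n
      proof -
        have n: "1 \<le> n" using that S1 by auto
        have "cmod (exp (- u * of_real (?L n))) = exp (- Re u * ln (real n))" by (simp add: norm_exp_eq_Re)
        also have "\<dots> \<le> exp (- d * ln (real n))" 
          unfolding exp_le_cancel_iff using n \<open>d \<le> Re u\<close> by (intro mult_right_mono) auto
        also have "\<dots> = real n powr (- d)" using n by (simp add: powr_def)
        finally have e: "cmod (exp (- u * of_real (?L n))) \<le> real n powr (- d)" .
        have "real n powr (- (1/2)) = inverse (sqrt (real n))"
          by (simp only: powr_minus powr_half_sqrt[OF of_nat_0_le_iff])
        moreover have "cmod (?b n) = cmod (a n) * inverse (sqrt (real n))" 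
          by (simp only: norm_mult norm_inverse divide_inverse norm_of_real) simp
        ultimately have "cmod (?b n) = cmod (a n) * real n powr (- (1/2))" by (simp only:)
        then have "cmod (?b n * exp (- u * of_real (?L n))) \<le> cmod (a n) * real n powr (- (1/2)) * real n powr (- d)"
          unfolding norm_mult using e by (simp add: mult_left_mono)
        also have "\<dots> = cmod (a n) * (real n powr (- (1/2) - d))"
          unfolding mult.assoc powr_add[symmetric] by simp
        finally show ?thesis .
      qed
      have "cmod (expsum S ?b ?L u) \<le> (\<Sum>n\<in>S. cmod (a n) * (real n powr (- (1/2) - d)))"
        unfolding expsum_def by (rule order.trans[OF norm_sum sum_mono[OF t]])
      then have "F u \<le> (\<Sum>n\<in>S. cmod (a n) * (real n powr (- (1/2) - d)))\<^sup>2"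
        unfolding F_def by (rule power_mono) simp
      also have "\<dots> \<le> E * (\<Sum>n\<in>S. (real n powr (- (1/2) - d))\<^sup>2)"
        unfolding E_def by (rule Cauchy_Schwarz_ineq_sum)
      also have "(\<Sum>n\<in>S. (real n powr (- (1/2) - d))\<^sup>2) = (\<Sum>n\<in>S. real n powr (- (1 + 2 * d)))"
      proof (intro sum.cong refl)
        fix n
        show "(real n powr (- (1/2) - d))\<^sup>2 = real n powr (- (1 + 2 * d))"
          unfolding power2_eq_square powr_add[symmetric] by (rule arg_cong[where f = "(powr) (real n)"]) simp
      qed
      also have "E * \<dots> \<le> E * (\<epsilon> / 2)" using tail E0 by (rule mult_left_mono)
      finally show ?thesis .
    qed
    have "(LINT x|Q. ?A x * F (W x)) \<le> (LINT x|Q. E * (\<epsilon> / 2))"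
      by (rule Bochner_Integration.integral_mono[OF integrable_parts(1)[OF Fi]])
         (use E0 assms off in \<open>auto simp: indicator_def\<close>)
    then have a1: "(LINT x|Q. ?A x * F (W x)) \<le> E * (\<epsilon> / 2)" by (simp add: prob_space)
    have "(LINT x|Q. ?B x * F (W x)) \<le> \<eta> * Re (majorant S ?b ?L w0)"
      unfolding F_def by (rule strip_expsum[OF d S(1) L])
    also have "\<dots> \<le> \<eta> * (C * E)"
      using majorant_schur[OF S(1) S1 Re_w0, of a] complex_Re_le_cmod[of "majorant S ?b ?L w0"] \<eta>(1)
      by (intro mult_left_mono) (auto simp: C_def E_def)
    also have "\<dots> = E * (\<epsilon> / 2)" by (metis \<eta>(2) mult.assoc mult.commute)
    finally have a2: "(LINT x|Q. ?B x * F (W x)) \<le> E * (\<epsilon> / 2)" .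
    show ?thesis using integral_parts[OF Fi, of d] a1 a2 unfolding F_def E_def by (simp add: algebra_simps)
  qed
  then show ?thesis by blast
qed

end

section \<open>Composition operators given by a coefficient matrix\<close>

lemma h2_summable: "summable (\<lambda>n. (cmod (h2_coeff f n))\<^sup>2)"
  and h2_coeff_0 [simp]: "h2_coeff f 0 = 0"
  using h2_coeff[of f] by auto

lemma h2_norm_power2: "(norm f)\<^sup>2 = (\<Sum>n. (cmod (h2_coeff f n))\<^sup>2)"
  unfolding norm_h2.rep_eq by (simp add: suminf_nonneg h2_summable)

lemma h2_coeff_diff [simp]: "h2_coeff (f - g) n = h2_coeff f n - h2_coeff g n"
  by (simp add: minus_h2.rep_eq)

lemma h2_eqI: "(\<And>n. h2_coeff f n = h2_coeff g n) \<Longrightarrow> f = g"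
  by (metis ext h2_coeff_inject)

lemma sum_le_h2_norm: "finite S \<Longrightarrow> (\<Sum>n\<in>S. (cmod (h2_coeff f n))\<^sup>2) \<le> (norm f)\<^sup>2"
  unfolding h2_norm_power2 by (rule sum_le_suminf) (auto simp: h2_summable)

lemma cmod_h2_coeff_le: "cmod (h2_coeff f n) \<le> norm f"
  using sum_le_h2_norm[of "{n}" f] by (simp add: power2_le_iff_abs_le)

lemma h2_exists:
  assumes "a 0 = 0" "\<And>M. (\<Sum>n<M. (cmod (a n))\<^sup>2) \<le> B"
  shows "\<exists>f. h2_coeff f = a \<and> (norm f)\<^sup>2 \<le> B"
proof -
  have s: "summable (\<lambda>n. (cmod (a n))\<^sup>2)"
  proof (rule bounded_imp_summable[of _ B])
    show "(\<Sum>n\<le>M. (cmod (a n))\<^sup>2) \<le> B" for M unfolding lessThan_Suc_atMost[symmetric] by (rule assms(2))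
  qed simp
  then have c: "h2_coeff (Abs_h2 a) = a" using assms(1) by (simp add: Abs_h2_inverse)
  have "(norm (Abs_h2 a))\<^sup>2 \<le> B"
    unfolding h2_norm_power2 c by (rule suminf_le_const[OF s]) (rule assms(2))
  with c show ?thesis by blast
qed

lift_definition h2_trunc :: "nat \<Rightarrow> h2 \<Rightarrow> h2" is "\<lambda>K a n. if n < K then a n else 0"
proof -
  fix K :: nat and a :: "nat \<Rightarrow> complex"
  assume "a 0 = 0 \<and> summable (\<lambda>n. (norm (a n))\<^sup>2)"
  then show "(if 0 < K then a 0 else 0) = 0 \<and> summable (\<lambda>n. (norm (if n < K then a n else 0))\<^sup>2)"
    by (auto intro!: summable_comparison_test[of _ "\<lambda>n. (norm (a n))\<^sup>2"])
qed

lemma h2_coeff_trunc: "h2_coeff (h2_trunc K f) n = (if n < K then h2_coeff f n else 0)"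
  by (simp add: h2_trunc.rep_eq)

lemma h2_norm_trunc: "(norm (h2_trunc K f))\<^sup>2 = (\<Sum>n<K. (cmod (h2_coeff f n))\<^sup>2)"
proof -
  have "(norm (h2_trunc K f))\<^sup>2 = (\<Sum>n<K. (cmod (h2_coeff (h2_trunc K f) n))\<^sup>2)"
    unfolding h2_norm_power2 by (rule suminf_finite) (auto simp: h2_coeff_trunc)
  then show ?thesis by (simp add: h2_coeff_trunc)
qed

lemma h2_trunc_tendsto: "(\<lambda>K. norm (f - h2_trunc K f)) \<longlonglongrightarrow> 0"
proof -
  have "(norm (f - h2_trunc K f))\<^sup>2 = (norm f)\<^sup>2 - (\<Sum>n<K. (cmod (h2_coeff f n))\<^sup>2)" for K
  proof -
    have "(norm (f - h2_trunc K f))\<^sup>2 + (norm (h2_trunc K f))\<^sup>2 = (\<Sum>n. (cmod (h2_coeff (f - h2_trunc K f) n))\<^sup>2 + (cmod (h2_coeff (h2_trunc K f) n))\<^sup>2)"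
      unfolding h2_norm_power2 by (rule suminf_add) (rule h2_summable)+
    also have "\<dots> = (norm f)\<^sup>2"
      unfolding h2_norm_power2 by (rule suminf_cong) (simp add: h2_coeff_trunc)
    finally show ?thesis by (simp add: h2_norm_trunc)
  qed
  moreover have "(\<lambda>K. (norm f)\<^sup>2 - (\<Sum>n<K. (cmod (h2_coeff f n))\<^sup>2)) \<longlonglongrightarrow> (norm f)\<^sup>2 - (norm f)\<^sup>2"
    by (intro tendsto_intros) (use summable_LIMSEQ[OF h2_summable] in \<open>simp add: h2_norm_power2\<close>)
  ultimately have "(\<lambda>K. (norm (f - h2_trunc K f))\<^sup>2) \<longlonglongrightarrow> 0" by simp
  then have "(\<lambda>K. sqrt ((norm (f - h2_trunc K f))\<^sup>2)) \<longlonglongrightarrow> sqrt 0" by (rule tendsto_real_sqrt)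
  then show ?thesis by simp
qed

lemma cmod_of_nat_powr: "cmod (of_nat n powr s) = real n powr Re s"
  by (cases "n = 0") (auto simp: norm_powr_real_powr)

text \<open>The square root of \<open>zeta (2 Re s)\<close>, the norm of evaluation at
  \<open>s\<close>; the term for 0 vanishes because \<open>0 powr x = 0\<close>.\<close>

definition zeta_bound :: "complex \<Rightarrow> real" where
  "zeta_bound s = sqrt (\<Sum>n. (real n powr - Re s)\<^sup>2)"

lemma zeta_bound_summable: "Re s > 1/2 \<Longrightarrow> summable (\<lambda>n. (real n powr - Re s)\<^sup>2)"
proof -
  assume "Re s > 1/2"
  then have "summable (\<lambda>n. real n powr (- 2 * Re s))" by (subst summable_real_powr_iff) auto
  moreover have "(real n powr - Re s)\<^sup>2 = real n powr (- 2 * Re s)" for n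
    unfolding power2_eq_square powr_add[symmetric] by (rule arg_cong[where f = "(powr) (real n)"]) simp
  ultimately show ?thesis by simp
qed

lemma zeta_bound_nonneg: "Re s > 1/2 \<Longrightarrow> 0 \<le> zeta_bound s"
  unfolding zeta_bound_def by (intro real_sqrt_ge_zero suminf_nonneg zeta_bound_summable) auto

lemma h2_eval_bounds:
  assumes "Re s > 1/2"
  shows "summable (\<lambda>n. cmod (h2_coeff f n * of_nat n powr (- s)))"
    and "cmod (h2_eval f s) \<le> norm f * zeta_bound s"
proof -
  have part: "(\<Sum>n<M. cmod (h2_coeff f n * of_nat n powr (- s))) \<le> norm f * zeta_bound s" for M
  proof -
    have "(\<Sum>n<M. cmod (h2_coeff f n * of_nat n powr (- s))) = (\<Sum>n<M. \<bar>cmod (h2_coeff f n)\<bar> * \<bar>real n powr - Re s\<bar>)"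
      by (simp add: norm_mult cmod_of_nat_powr)
    also have "\<dots> \<le> L2_set (\<lambda>n. cmod (h2_coeff f n)) {..<M} * L2_set (\<lambda>n. real n powr - Re s) {..<M}"
      by (rule L2_set_mult_ineq)
    also have "\<dots> \<le> norm f * zeta_bound s"
    proof (rule mult_mono)
      show "L2_set (\<lambda>n. cmod (h2_coeff f n)) {..<M} \<le> norm f"
        unfolding L2_set_def using sum_le_h2_norm[of "{..<M}" f] by (intro real_le_lsqrt) (auto simp: sum_nonneg)
      show "L2_set (\<lambda>n. real n powr - Re s) {..<M} \<le> zeta_bound s"
        unfolding L2_set_def zeta_bound_def by (intro real_sqrt_le_mono sum_le_suminf zeta_bound_summable assms) auto
    qed (auto simp: L2_set_nonneg)
    finally show ?thesis .
  qed
  show s: "summable (\<lambda>n. cmod (h2_coeff f n * of_nat n powr (- s)))"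
  proof (rule bounded_imp_summable[of _ "norm f * zeta_bound s"])
    show "(\<Sum>n\<le>M. cmod (h2_coeff f n * of_nat n powr (- s))) \<le> norm f * zeta_bound s" for M
      unfolding lessThan_Suc_atMost[symmetric] by (rule part)
  qed simp
  have "cmod (h2_eval f s) \<le> (\<Sum>n. cmod (h2_coeff f n * of_nat n powr (- s)))"
    unfolding h2_eval_def by (rule summable_norm[OF s])
  also have "\<dots> \<le> norm f * zeta_bound s" by (rule suminf_le_const[OF s part])
  finally show "cmod (h2_eval f s) \<le> norm f * zeta_bound s" .
qed

lemma h2_eval_summable: "Re s > 1/2 \<Longrightarrow> summable (\<lambda>n. h2_coeff f n * of_nat n powr (- s))"
  by (rule summable_norm_cancel[OF h2_eval_bounds(1)])

lemma h2_eval_diff: "Re s > 1/2 \<Longrightarrow> h2_eval (f - g) s = h2_eval f s - h2_eval g s"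
  unfolding h2_eval_def by (simp add: suminf_diff[symmetric] h2_eval_summable left_diff_distrib)

text \<open>At \<open>s = k + 2\<close> the first nonzero term must be cancelled by the later ones,
  which are smaller by a factor \<open>(N / (N + 1))^k\<close>. The 2 keeps a weight
  \<open>n^-2\<close> in reserve, so that the remaining sum is bounded in \<open>k\<close>.\<close>

lemma h2_eval_zero_imp_zero:
  assumes "\<And>s. Re s > 1/2 \<Longrightarrow> h2_eval h s = 0"
  shows "h = 0"
proof (rule ccontr)
  assume "h \<noteq> 0"
  then have "\<exists>n. h2_coeff h n \<noteq> 0" using h2_eqI[of h 0] by (auto simp: zero_h2.rep_eq)
  define N where "N = (LEAST n. h2_coeff h n \<noteq> 0)"
  have N: "h2_coeff h N \<noteq> 0" unfolding N_def by (rule LeastI_ex) fact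
  have below: "h2_coeff h n = 0" if "n < N" for n using not_less_Least[of n] that unfolding N_def by blast
  have N0: "N > 0" using N by (metis h2_coeff_0 gr0I)
  define b where "b = (\<lambda>n. cmod (h2_coeff h n) / real n ^ 2)"
  have pw: "of_nat n powr (- of_nat m :: complex) = inverse (of_nat n ^ m)" if "n > 0" for n m
    using that by (simp add: powr_minus powr_nat')
  have bs: "summable b"
  proof -
    have "summable (\<lambda>n. cmod (h2_coeff h n * of_nat n powr (- 2)))" by (rule h2_eval_bounds(1)) simp
    moreover have "cmod (h2_coeff h n * of_nat n powr (- 2)) = b n" for n
      using pw[of n 2] by (cases "n = 0") (auto simp: b_def norm_mult norm_inverse norm_power divide_inverse)
    ultimately show ?thesis by simp
  qed
  have "b N \<le> suminf b * (real N / real (Suc N)) ^ k" for k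
  proof -
    define g where "g = (\<lambda>n. h2_coeff h n * of_nat n powr (- of_nat (k + 2)))"
    have gs: "summable (\<lambda>n. cmod (g n))" unfolding g_def by (rule h2_eval_bounds(1)) simp
    have g0: "suminf g = 0" using assms[of "of_nat (k + 2)"] by (simp add: g_def h2_eval_def)
    have gn: "cmod (g n) = b n / real n ^ k" for n
      using pw[of n "k+2"] by (cases "n = 0") (auto simp: g_def b_def norm_mult norm_inverse norm_power divide_inverse power_add mult_ac power2_eq_square)
    have "suminf g = (\<Sum>n. g (n + Suc N)) + (\<Sum>n<Suc N. g n)"
      by (rule suminf_split_initial_segment[OF summable_norm_cancel[OF gs]])
    moreover have "(\<Sum>n<Suc N. g n) = g N" using below by (simp add: g_def)
    ultimately have "g N = - (\<Sum>n. g (n + Suc N))" using g0 by (simp add: eq_neg_iff_add_eq_0 add.commute)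
    then have "cmod (g N) = cmod (\<Sum>n. g (n + Suc N))" by simp
    also have "\<dots> \<le> (\<Sum>n. cmod (g (n + Suc N)))"
      by (intro summable_norm summable_ignore_initial_segment gs)
    also have "\<dots> \<le> (\<Sum>n. b (n + Suc N) / real (Suc N) ^ k)"
    proof (rule suminf_le)
      show "summable (\<lambda>n. cmod (g (n + Suc N)))" by (rule summable_ignore_initial_segment[OF gs])
      show "summable (\<lambda>n. b (n + Suc N) / real (Suc N) ^ k)"
        by (intro summable_divide summable_ignore_initial_segment bs)
      show "cmod (g (n + Suc N)) \<le> b (n + Suc N) / real (Suc N) ^ k" for n
        unfolding gn by (intro divide_left_mono power_mono) (auto simp: b_def)
    qed
    also have "\<dots> = (\<Sum>n. b (n + Suc N)) / real (Suc N) ^ k"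
      by (intro suminf_divide summable_ignore_initial_segment bs)
    also have "\<dots> \<le> suminf b / real (Suc N) ^ k"
    proof (rule divide_right_mono)
      show "(\<Sum>n. b (n + Suc N)) \<le> suminf b"
        using suminf_split_initial_segment[OF bs, of "Suc N"] sum_nonneg[of "{..<Suc N}" b] by (simp add: b_def)
    qed simp
    finally have "b N / real N ^ k \<le> suminf b / real (Suc N) ^ k" unfolding gn .
    then show ?thesis using N0 by (simp add: power_divide field_simps)
  qed
  moreover have "(\<lambda>k. suminf b * (real N / real (Suc N)) ^ k) \<longlonglongrightarrow> suminf b * 0"
    by (intro tendsto_intros LIMSEQ_realpow_zero) auto
  ultimately have "b N \<le> suminf b * 0" by (intro LIMSEQ_le_const[of _ "suminf b * 0" "b N"]) auto
  then show False using N N0 by (simp add: b_def zero_le_divide_iff divide_le_0_iff)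
qed

lemma h2_eval_inject:
  assumes "\<And>s. Re s > 1/2 \<Longrightarrow> h2_eval f s = h2_eval g s"
  shows "f = g"
  using h2_eval_zero_imp_zero[of "f - g"] assms by (simp add: h2_eval_diff)

text \<open>\<open>E n\<close> is the coefficient sequence of \<open>n^(-\<phi>)\<close>, and
  \<open>E_bound\<close> is boundedness of the operator on Dirichlet polynomials; the extension to
  all of \<open>h2\<close> is by density.\<close>

locale h2_composition =
  fixes \<phi> :: "complex \<Rightarrow> complex" and E :: "nat \<Rightarrow> nat \<Rightarrow> complex" and C :: real
  assumes maps: "\<And>s. Re s > 1/2 \<Longrightarrow> Re (\<phi> s) > 1/2"
    and E_0: "\<And>n. E n 0 = 0"
    and E_summable: "\<And>n. 1 \<le> n \<Longrightarrow> summable (\<lambda>N. cmod (E n N))"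
    and E_eval: "\<And>n s. 1 \<le> n \<Longrightarrow> Re s > 1/2 \<Longrightarrow> (\<lambda>N. E n N * of_nat N powr (- s)) sums (of_nat n powr (- \<phi> s))"
    and C_nonneg: "0 \<le> C"
    and E_bound: "\<And>S a M. finite S \<Longrightarrow> S \<subseteq> {1..} \<Longrightarrow>
        (\<Sum>N<M. (cmod (\<Sum>n\<in>S. a n * E n N))\<^sup>2) \<le> C * (\<Sum>n\<in>S. (cmod (a n))\<^sup>2)"
begin

lemma E_sum_restrict:
  "(\<Sum>n<k. h2_coeff f n * E n N) = (\<Sum>n\<in>{1..<k}. h2_coeff f n * E n N)"
  by (rule sum.mono_neutral_right) (auto simp: not_le)

text \<open>The \<open>N\<close>-th coefficient of the image of a block is at most the norm of that
  image, which \<open>E_bound\<close> controls by the norm of the block.\<close>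

lemma coeff_summable: "summable (\<lambda>n. h2_coeff f n * E n N)"
  unfolding summable_Cauchy
proof (intro allI impI)
  fix e :: real assume e: "0 < e"
  define e' where "e' = e\<^sup>2 / (C + 1)"
  have "0 < e'" using e C_nonneg by (simp add: e'_def)
  then obtain m0 where m0: "\<And>m n. m0 \<le> m \<Longrightarrow> norm (\<Sum>k\<in>{m..<n}. (cmod (h2_coeff f k))\<^sup>2) < e'"
    using h2_summable[of f] unfolding summable_Cauchy by blast
  show "\<exists>m0. \<forall>m\<ge>m0. \<forall>n. norm (\<Sum>k = m..<n. h2_coeff f k * E k N) < e"
  proof (intro exI allI impI)
    fix m n assume m: "max 1 m0 \<le> m"
    have "(cmod (\<Sum>k = m..<n. h2_coeff f k * E k N))\<^sup>2 \<le> (\<Sum>N<Suc N. (cmod (\<Sum>k = m..<n. h2_coeff f k * E k N))\<^sup>2)"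
      by (rule member_le_sum[of N "{..<Suc N}" "\<lambda>N. (cmod (\<Sum>k = m..<n. h2_coeff f k * E k N))\<^sup>2"]) auto
    also have "\<dots> \<le> C * (\<Sum>k = m..<n. (cmod (h2_coeff f k))\<^sup>2)"
      by (rule E_bound) (use m in auto)
    also have "\<dots> \<le> C * e'" using m0[of m n] m C_nonneg by (intro mult_left_mono) auto
    also have "\<dots> < (C + 1) * e'" using \<open>0 < e'\<close> by (intro mult_strict_right_mono) auto
    also have "\<dots> = e\<^sup>2" using C_nonneg by (simp add: e'_def)
    finally show "norm (\<Sum>k = m..<n. h2_coeff f k * E k N) < e"
      by (rule power_less_imp_less_base) (use e in simp)
  qed
qed

lemma comp_sum_bound:
  assumes f: "\<And>n. n < N0 \<Longrightarrow> h2_coeff f n = 0"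
    and B: "0 \<le> B" "\<And>S a M. finite S \<Longrightarrow> S \<subseteq> {max 1 N0..} \<Longrightarrow>
        (\<Sum>N<M. (cmod (\<Sum>n\<in>S. a n * E n N))\<^sup>2) \<le> B * (\<Sum>n\<in>S. (cmod (a n))\<^sup>2)"
  shows "(\<Sum>N<M. (cmod (\<Sum>n. h2_coeff f n * E n N))\<^sup>2) \<le> B * (norm f)\<^sup>2"
proof (rule LIMSEQ_le_const2)
  show "(\<lambda>k. \<Sum>N<M. (cmod (\<Sum>n<k. h2_coeff f n * E n N))\<^sup>2) \<longlonglongrightarrow> (\<Sum>N<M. (cmod (\<Sum>n. h2_coeff f n * E n N))\<^sup>2)"
    by (intro tendsto_intros summable_LIMSEQ coeff_summable)
  show "\<exists>K. \<forall>k\<ge>K. (\<Sum>N<M. (cmod (\<Sum>n<k. h2_coeff f n * E n N))\<^sup>2) \<le> B * (norm f)\<^sup>2"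
  proof (intro exI allI impI)
    fix k :: nat
    have r: "(\<Sum>n<k. h2_coeff f n * E n N) = (\<Sum>n\<in>{max 1 N0..<k}. h2_coeff f n * E n N)" for N
      by (rule sum.mono_neutral_right) (use f in \<open>auto simp: not_le max_def split: if_splits\<close>)
    have "(\<Sum>N<M. (cmod (\<Sum>n<k. h2_coeff f n * E n N))\<^sup>2) \<le> B * (\<Sum>n\<in>{max 1 N0..<k}. (cmod (h2_coeff f n))\<^sup>2)"
      unfolding r by (rule B(2)) auto
    also have "\<dots> \<le> B * (norm f)\<^sup>2" using B(1) by (intro mult_left_mono sum_le_h2_norm) auto
    finally show "(\<Sum>N<M. (cmod (\<Sum>n<k. h2_coeff f n * E n N))\<^sup>2) \<le> B * (norm f)\<^sup>2" .
  qed
qed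

definition comp :: "h2 \<Rightarrow> h2" where
  "comp f = Abs_h2 (\<lambda>N. \<Sum>n. h2_coeff f n * E n N)"

lemma comp_coeff: "h2_coeff (comp f) = (\<lambda>N. \<Sum>n. h2_coeff f n * E n N)"
  and norm_comp: "(norm (comp f))\<^sup>2 \<le> C * (norm f)\<^sup>2"
proof -
  have "\<exists>g. h2_coeff g = (\<lambda>N. \<Sum>n. h2_coeff f n * E n N) \<and> (norm g)\<^sup>2 \<le> C * (norm f)\<^sup>2"
    by (rule h2_exists, simp add: E_0, rule comp_sum_bound[of 0]) (use C_nonneg E_bound in auto)
  then obtain g where g: "h2_coeff g = (\<lambda>N. \<Sum>n. h2_coeff f n * E n N)" "(norm g)\<^sup>2 \<le> C * (norm f)\<^sup>2" by blast
  then have "comp f = g" using h2_coeff_inverse[of g] by (simp add: comp_def)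
  with g show "h2_coeff (comp f) = (\<lambda>N. \<Sum>n. h2_coeff f n * E n N)" "(norm (comp f))\<^sup>2 \<le> C * (norm f)\<^sup>2" by auto
qed

lemma norm_comp_tail:
  assumes f: "\<And>n. n < N0 \<Longrightarrow> h2_coeff f n = 0"
    and B: "0 \<le> B" "\<And>S a M. finite S \<Longrightarrow> S \<subseteq> {max 1 N0..} \<Longrightarrow>
        (\<Sum>N<M. (cmod (\<Sum>n\<in>S. a n * E n N))\<^sup>2) \<le> B * (\<Sum>n\<in>S. (cmod (a n))\<^sup>2)"
  shows "(norm (comp f))\<^sup>2 \<le> B * (norm f)\<^sup>2"
  unfolding h2_norm_power2[of "comp f"] 
  by (rule suminf_le_const[OF h2_summable]) (unfold comp_coeff, rule comp_sum_bound[OF f B])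

lemma norm_comp': "norm (comp f) \<le> sqrt C * norm f"
  using norm_comp[of f] C_nonneg by (metis norm_ge_zero power_mult_distrib real_sqrt_ge_zero real_sqrt_pow2 mult_nonneg_nonneg power2_le_imp_le)

lemma comp_diff: "comp (f - g) = comp f - comp g"
  by (rule h2_eqI) (simp add: comp_coeff left_diff_distrib suminf_diff coeff_summable)

lemma eval_comp_trunc:
  assumes "Re s > 1/2"
  shows "h2_eval (comp (h2_trunc K f)) s = (\<Sum>n<K. h2_coeff f n * of_nat n powr (- \<phi> s))"
proof -
  have c: "h2_coeff (comp (h2_trunc K f)) N = (\<Sum>n\<in>{1..<K}. h2_coeff f n * E n N)" for N
  proof -
    have "h2_coeff (comp (h2_trunc K f)) N = (\<Sum>n<K. h2_coeff (h2_trunc K f) n * E n N)"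
      unfolding comp_coeff by (rule suminf_finite) (auto simp: h2_coeff_trunc)
    also have "\<dots> = (\<Sum>n<K. h2_coeff f n * E n N)" by (simp add: h2_coeff_trunc)
    finally show ?thesis by (simp add: E_sum_restrict)
  qed
  have "(\<lambda>N. \<Sum>n\<in>{1..<K}. h2_coeff f n * (E n N * of_nat N powr (- s))) sums (\<Sum>n\<in>{1..<K}. h2_coeff f n * of_nat n powr (- \<phi> s))"
    by (intro sums_sum sums_mult E_eval) (use assms in auto)
  then have "h2_eval (comp (h2_trunc K f)) s = (\<Sum>n\<in>{1..<K}. h2_coeff f n * of_nat n powr (- \<phi> s))"
    unfolding h2_eval_def c by (simp add: sum_distrib_right mult.assoc sums_iff)
  also have "\<dots> = (\<Sum>n<K. h2_coeff f n * of_nat n powr (- \<phi> s))"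
    by (rule sum.mono_neutral_left) (auto simp: not_le)
  finally show ?thesis .
qed

text \<open>Truncations satisfy the identity by linearity. In the limit, the left side is controlled
  by boundedness of \<open>comp\<close> and of evaluation, the right side by convergence of the
  series at \<open>\<phi> s\<close>.\<close>

lemma eval_comp:
  assumes "Re s > 1/2"
  shows "h2_eval (comp f) s = h2_eval f (\<phi> s)"
proof (rule LIMSEQ_unique)
  show "(\<lambda>K. \<Sum>n<K. h2_coeff f n * of_nat n powr (- \<phi> s)) \<longlonglongrightarrow> h2_eval f (\<phi> s)"
    unfolding h2_eval_def by (intro summable_LIMSEQ h2_eval_summable maps assms)
  have "(\<lambda>K. h2_eval (comp f) s - h2_eval (comp (h2_trunc K f)) s) \<longlonglongrightarrow> 0"
  proof (rule Lim_null_comparison)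
    show "\<forall>\<^sub>F K in sequentially. norm (h2_eval (comp f) s - h2_eval (comp (h2_trunc K f)) s)
       \<le> sqrt C * norm (f - h2_trunc K f) * zeta_bound s"
    proof (rule always_eventually, rule allI)
      fix K
      have "norm (h2_eval (comp f) s - h2_eval (comp (h2_trunc K f)) s) \<le> norm (comp (f - h2_trunc K f)) * zeta_bound s"
        using h2_eval_bounds(2)[OF assms, of "comp (f - h2_trunc K f)"] by (simp only: comp_diff h2_eval_diff[OF assms])
      also have "\<dots> \<le> sqrt C * norm (f - h2_trunc K f) * zeta_bound s"
        by (intro mult_right_mono norm_comp' zeta_bound_nonneg assms)
      finally show "norm (h2_eval (comp f) s - h2_eval (comp (h2_trunc K f)) s)
         \<le> sqrt C * norm (f - h2_trunc K f) * zeta_bound s" .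
    qed
    have "(\<lambda>K. sqrt C * norm (f - h2_trunc K f) * zeta_bound s) \<longlonglongrightarrow> sqrt C * 0 * zeta_bound s"
      by (intro tendsto_intros h2_trunc_tendsto)
    then show "(\<lambda>K. sqrt C * norm (f - h2_trunc K f) * zeta_bound s) \<longlonglongrightarrow> 0" by simp
  qed
  from tendsto_diff[OF tendsto_const[of "h2_eval (comp f) s"] this]
  show "(\<lambda>K. \<Sum>n<K. h2_coeff f n * of_nat n powr (- \<phi> s)) \<longlonglongrightarrow> h2_eval (comp f) s"
    by (simp add: eval_comp_trunc[OF assms])
qed

lemma comp_op_eq: "comp_op \<phi> f = comp f"
  unfolding comp_op_def half_plane_def
  by (rule the_equality) (auto simp: eval_comp intro: h2_eval_inject)

text \<open>A bounded sequence has a subsequence converging in each coefficient. After subtracting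
  the limit, the hypothesis makes the indices from \<open>N0\<close> on uniformly small, and the
  finitely many others tend to zero.\<close>

lemma compact_comp_op:
  assumes tail: "\<And>\<epsilon>. 0 < \<epsilon> \<Longrightarrow> \<exists>N0. \<forall>S a M. finite S \<longrightarrow> S \<subseteq> {max 1 N0..} \<longrightarrow>
        (\<Sum>N<M. (cmod (\<Sum>n\<in>S. a n * E n N))\<^sup>2) \<le> \<epsilon> * (\<Sum>n\<in>S. (cmod (a n))\<^sup>2)"
  shows "compact_operator (comp_op \<phi>)"
  unfolding compact_operator_def
proof (intro allI impI)
  fix B :: "h2 set" assume "bounded B"
  then obtain R where R: "\<And>f. f \<in> B \<Longrightarrow> norm f \<le> R" "R > 0" unfolding bounded_pos by blast
  have "seq_compact (comp ` {f. norm f \<le> R})"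
    unfolding seq_compact_def
  proof (intro allI impI)
    fix y :: "nat \<Rightarrow> h2" assume "\<forall>k. y k \<in> comp ` {f. norm f \<le> R}"
    then have "\<forall>k::nat. \<exists>f. y k = comp f \<and> norm f \<le> R" by blast
    then obtain f where f: "\<And>k. y k = comp (f k)" "\<And>k. norm (f k) \<le> R" by metis
    obtain r where r: "strict_mono r" "\<And>n. n \<in> UNIV \<Longrightarrow> \<exists>l. (\<lambda>k. h2_coeff (f (r k)) n) \<longlonglongrightarrow> l"
    proof (rule function_convergent_subsequence[of UNIV "\<lambda>k. h2_coeff (f k)" R])
      show "norm (h2_coeff (f k) n) \<le> R" for k n using cmod_h2_coeff_le[of "f k" n] f(2)[of k] by linarith
    qed auto
    then obtain l where l: "\<And>n. (\<lambda>k. h2_coeff (f (r k)) n) \<longlonglongrightarrow> l n" by (metis UNIV_I)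
    have "\<exists>g. h2_coeff g = l \<and> (norm g)\<^sup>2 \<le> R\<^sup>2"
    proof (rule h2_exists)
      show "l 0 = 0" using l[of 0] by (simp add: LIMSEQ_const_iff)
      fix M
      show "(\<Sum>n<M. (cmod (l n))\<^sup>2) \<le> R\<^sup>2"
      proof (rule LIMSEQ_le_const2)
        show "(\<lambda>k. \<Sum>n<M. (cmod (h2_coeff (f (r k)) n))\<^sup>2) \<longlonglongrightarrow> (\<Sum>n<M. (cmod (l n))\<^sup>2)"
          by (intro tendsto_intros l)
        have "(\<Sum>n<M. (cmod (h2_coeff (f (r k)) n))\<^sup>2) \<le> R\<^sup>2" for k
          using sum_le_h2_norm[of "{..<M}" "f (r k)"] power_mono[OF f(2)[of "r k"] norm_ge_zero, of 2] by simp
        then show "\<exists>K. \<forall>k\<ge>K. (\<Sum>n<M. (cmod (h2_coeff (f (r k)) n))\<^sup>2) \<le> R\<^sup>2" by blast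
      qed
    qed
    then obtain g where g: "h2_coeff g = l" "norm g \<le> R"
      using R(2) by (auto simp: power2_le_iff_abs_le)
    define h where "h = (\<lambda>k. f (r k) - g)"
    have hn: "norm (h k) \<le> 2 * R" for k
      unfolding h_def using norm_triangle_ineq4[of "f (r k)" g] f(2)[of "r k"] g(2) by linarith
    have hc: "(\<lambda>k. h2_coeff (h k) n) \<longlonglongrightarrow> 0" for n
      unfolding h_def using tendsto_diff[OF l[of n] tendsto_const[of "l n"]] by (simp add: g(1))
    have "(\<lambda>k. norm (comp (h k))) \<longlonglongrightarrow> 0"
    proof (rule LIMSEQ_I)
      fix e :: real assume e: "0 < e"
      define \<epsilon> where "\<epsilon> = (e / 2)\<^sup>2 / (2 * R)\<^sup>2"
      have "0 < \<epsilon>" using e R(2) by (simp add: \<epsilon>_def)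
      from tail[OF this] obtain N0 where N0: "\<And>S a M. finite S \<Longrightarrow> S \<subseteq> {max 1 N0..} \<Longrightarrow>
        (\<Sum>N<M. (cmod (\<Sum>n\<in>S. a n * E n N))\<^sup>2) \<le> \<epsilon> * (\<Sum>n\<in>S. (cmod (a n))\<^sup>2)" by blast
      have t: "norm (comp (h k - h2_trunc N0 (h k))) \<le> e / 2" for k
      proof -
        have "(norm (comp (h k - h2_trunc N0 (h k))))\<^sup>2 \<le> \<epsilon> * (norm (h k - h2_trunc N0 (h k)))\<^sup>2"
          by (rule norm_comp_tail[OF _ _ N0]) (use \<open>0 < \<epsilon>\<close> in \<open>auto simp: h2_coeff_trunc\<close>)
        also have "(norm (h k - h2_trunc N0 (h k)))\<^sup>2 \<le> (norm (h k))\<^sup>2"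
          unfolding h2_norm_power2
          by (rule suminf_le[OF _ h2_summable h2_summable]) (simp add: h2_coeff_trunc)
        also have "\<dots> \<le> (2 * R)\<^sup>2" using hn by (intro power_mono) auto
        also have "\<epsilon> * (2 * R)\<^sup>2 = (e / 2)\<^sup>2" using R(2) by (simp add: \<epsilon>_def)
        finally have "(norm (comp (h k - h2_trunc N0 (h k))))\<^sup>2 \<le> (e / 2)\<^sup>2" using \<open>0 < \<epsilon>\<close> by (simp add: mult_left_mono)
        then show ?thesis by (rule power2_le_imp_le) (use e in simp)
      qed
      have "(\<lambda>k. sqrt C * sqrt (\<Sum>n<N0. (cmod (h2_coeff (h k) n))\<^sup>2)) \<longlonglongrightarrow> sqrt C * sqrt (\<Sum>n<N0. (cmod (0::complex))\<^sup>2)"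
        by (intro tendsto_intros hc)
      then have "(\<lambda>k. sqrt C * sqrt (\<Sum>n<N0. (cmod (h2_coeff (h k) n))\<^sup>2)) \<longlonglongrightarrow> 0" by simp
      then obtain k0 where k0: "\<And>k. k \<ge> k0 \<Longrightarrow> norm (sqrt C * sqrt (\<Sum>n<N0. (cmod (h2_coeff (h k) n))\<^sup>2) - 0) < e / 2"
        using e LIMSEQ_D half_gt_zero by metis
      show "\<exists>k0. \<forall>k\<ge>k0. norm (norm (comp (h k)) - 0) < e"
      proof (intro exI allI impI)
        fix k assume "k0 \<le> k"
        have "norm (comp (h2_trunc N0 (h k))) \<le> sqrt C * sqrt (\<Sum>n<N0. (cmod (h2_coeff (h k) n))\<^sup>2)"
          using norm_comp'[of "h2_trunc N0 (h k)"] unfolding h2_norm_trunc[symmetric] by simp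
        also have "\<dots> < e / 2" using k0[OF \<open>k0 \<le> k\<close>] by simp
        finally have "norm (comp (h2_trunc N0 (h k))) < e / 2" .
        moreover have "comp (h k) = comp (h k - h2_trunc N0 (h k)) + comp (h2_trunc N0 (h k))"
          by (simp add: comp_diff)
        ultimately show "norm (norm (comp (h k)) - 0) < e"
          using norm_triangle_ineq[of "comp (h k - h2_trunc N0 (h k))" "comp (h2_trunc N0 (h k))"] t[of k] by simp
      qed
    qed
    then have "(\<lambda>k. comp (f (r k)) - comp g) \<longlonglongrightarrow> 0"
      unfolding h_def comp_diff by (rule tendsto_norm_zero_cancel)
    then have "(y \<circ> r) \<longlonglongrightarrow> comp g" by (simp add: f(1) o_def LIM_zero_iff)
    then show "\<exists>l\<in>comp ` {f. norm f \<le> R}. \<exists>r. strict_mono r \<and> (y \<circ> r) \<longlonglongrightarrow> l"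
      using r(1) g(2) by blast
  qed
  then have K: "compact (comp ` {f. norm f \<le> R})" by (simp add: compact_eq_seq_compact_metric)
  have "comp_op \<phi> ` B \<subseteq> comp ` {f. norm f \<le> R}" using R(1) by (auto simp: comp_op_eq)
  then have "closure (comp_op \<phi> ` B) \<subseteq> comp ` {f. norm f \<le> R}"
    using K compact_imp_closed closure_minimal by blast
  then show "compact (closure (comp_op \<phi> ` B))"
    using K compact_Int_closed[OF K closed_closure] by (metis inf.absorb2)
qed

text \<open>Evaluation is continuous, so any limit of the images vanishes at each point of the
  half-plane, hence is 0, against the lower bound of their norms.\<close>

lemma not_compact_comp_op:
  assumes f: "\<And>k. norm (f k) \<le> 1"
    and ev: "\<And>s. Re s > 1/2 \<Longrightarrow> (\<lambda>k. h2_eval (f k) s) \<longlonglongrightarrow> 0"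
    and c: "0 < c" "\<And>k. c \<le> norm (comp (f k))"
  shows "\<not> compact_operator (comp_op \<phi>)"
proof
  assume "compact_operator (comp_op \<phi>)"
  moreover have "bounded (range f)" using f by (auto simp: bounded_iff)
  ultimately have "seq_compact (closure (comp_op \<phi> ` range f))"
    unfolding compact_operator_def compact_eq_seq_compact_metric by blast
  moreover have "comp (f k) \<in> closure (comp_op \<phi> ` range f)" for k
    using closure_subset[of "comp_op \<phi> ` range f"] by (auto simp: comp_op_eq)
  ultimately obtain g r where r: "strict_mono r" "((\<lambda>k. comp (f k)) \<circ> r) \<longlonglongrightarrow> g"
    unfolding seq_compact_def by (metis (lifting))
  have "g = 0"
  proof (rule h2_eval_zero_imp_zero)
    fix s :: complex assume s: "Re s > 1/2"
    have "(\<lambda>k. h2_eval (comp (f (r k))) s - h2_eval g s) \<longlonglongrightarrow> 0"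
    proof (rule Lim_null_comparison)
      show "\<forall>\<^sub>F k in sequentially. norm (h2_eval (comp (f (r k))) s - h2_eval g s) \<le> norm (comp (f (r k)) - g) * zeta_bound s"
        using h2_eval_bounds(2)[OF s] by (intro always_eventually allI) (simp add: h2_eval_diff[OF s, symmetric])
      have "(\<lambda>k. norm (comp (f (r k)) - g) * zeta_bound s) \<longlonglongrightarrow> 0 * zeta_bound s"
        using r(2) by (intro tendsto_intros) (simp add: o_def LIM_zero tendsto_norm_zero)
      then show "(\<lambda>k. norm (comp (f (r k)) - g) * zeta_bound s) \<longlonglongrightarrow> 0" by simp
    qed
    then have "(\<lambda>k. h2_eval (comp (f (r k))) s) \<longlonglongrightarrow> h2_eval g s" by (simp add: LIM_zero_iff)
    moreover have "(\<lambda>k. h2_eval (comp (f (r k))) s) \<longlonglongrightarrow> 0"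
      using LIMSEQ_subseq_LIMSEQ[OF ev[OF maps[OF s]] r(1)] by (simp add: o_def eval_comp[OF s])
    ultimately show "h2_eval g s = 0" using LIMSEQ_unique by blast
  qed
  then have "(\<lambda>k. norm (comp (f (r k)))) \<longlonglongrightarrow> 0" using r(2) by (simp add: o_def tendsto_norm_zero)
  then have "c \<le> 0" by (rule LIMSEQ_le_const) (use c(2) in auto)
  then show False using c(1) by simp
qed

end

section \<open>Matrices with two positive eigenvalues\<close>

text \<open>Sylvester's identity: one block matrix is made block triangular from the right and from
  the left. The factor \<open>x\<close> on the left replaces a division, so that
  \<open>x = 0\<close> is covered.\<close>

lemma det_rank_one_update:
  fixes x :: real
  assumes U: "U \<in> carrier_mat n 1" and V: "V \<in> carrier_mat 1 n"
  shows "x * Determinant.det (x \<cdot>\<^sub>m 1\<^sub>m n - U * V) = x ^ n * (x - (V * U) $$ (0, 0))"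
proof -
  let ?I = "1\<^sub>m n :: real mat" and ?J = "1\<^sub>m 1 :: real mat"
  define M where "M = four_block_mat (x \<cdot>\<^sub>m ?I) U V ?J"
  define R where "R = four_block_mat ?I (0\<^sub>m n 1) (- V) ?J"
  define L where "L = four_block_mat ?I (0\<^sub>m n 1) (- V) (x \<cdot>\<^sub>m ?J)"
  have c: "M \<in> carrier_mat (n+1) (n+1)" "R \<in> carrier_mat (n+1) (n+1)" "L \<in> carrier_mat (n+1) (n+1)"
    using U V by (auto simp: M_def R_def L_def)
  have UV: "U * V \<in> carrier_mat n n" and VU: "V * U \<in> carrier_mat 1 1" using U V by auto
  have "M * R = four_block_mat ((x \<cdot>\<^sub>m ?I) * ?I + U * (- V)) ((x \<cdot>\<^sub>m ?I) * 0\<^sub>m n 1 + U * ?J) (V * ?I + ?J * (- V)) (V * 0\<^sub>m n 1 + ?J * ?J)"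
    unfolding M_def R_def by (rule mult_four_block_mat) (use U V in auto)
  also have "\<dots> = four_block_mat (x \<cdot>\<^sub>m ?I - U * V) U (0\<^sub>m 1 n) ?J"
    using U V UV by (intro arg_cong4[where f = four_block_mat]) auto
  finally have MR: "M * R = four_block_mat (x \<cdot>\<^sub>m ?I - U * V) U (0\<^sub>m 1 n) ?J" .
  have "L * M = four_block_mat (?I * (x \<cdot>\<^sub>m ?I) + 0\<^sub>m n 1 * V) (?I * U + 0\<^sub>m n 1 * ?J) (- V * (x \<cdot>\<^sub>m ?I) + (x \<cdot>\<^sub>m ?J) * V) (- V * U + (x \<cdot>\<^sub>m ?J) * ?J)"
    unfolding M_def L_def by (rule mult_four_block_mat) (use U V in auto)
  also have "\<dots> = four_block_mat (x \<cdot>\<^sub>m ?I) U (0\<^sub>m 1 n) (x \<cdot>\<^sub>m ?J - V * U)"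
    using U V VU by (intro arg_cong4[where f = four_block_mat]) (auto simp: mult_smult_distrib)
  finally have LM: "L * M = four_block_mat (x \<cdot>\<^sub>m ?I) U (0\<^sub>m 1 n) (x \<cdot>\<^sub>m ?J - V * U)" .
  have dR: "Determinant.det R = 1"
    unfolding R_def using V by (subst det_four_block_mat_upper_right_zero[of _ n _ 1]) auto
  have dL: "Determinant.det L = x"
    unfolding L_def using V by (subst det_four_block_mat_upper_right_zero[of _ n _ 1]) (auto simp: det_single det_smult)
  have "Determinant.det (M * R) = Determinant.det (x \<cdot>\<^sub>m ?I - U * V)"
    unfolding MR by (simp only: det_four_block_mat_lower_left_zero[OF minus_carrier_mat[OF UV] U refl one_carrier_mat] det_one mult_1_right)
  then have e1: "Determinant.det M = Determinant.det (x \<cdot>\<^sub>m ?I - U * V)"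
    using det_mult[OF c(1,2)] dR by simp
  have c1: "x \<cdot>\<^sub>m ?J - V * U \<in> carrier_mat 1 1" by (rule minus_carrier_mat[OF VU])
  have "(x \<cdot>\<^sub>m ?J - V * U) $$ (0, 0) = x - (V * U) $$ (0, 0)"
    using VU by (subst index_minus_mat) (auto simp del: One_nat_def)
  then have "Determinant.det (x \<cdot>\<^sub>m ?J - V * U) = x - (V * U) $$ (0, 0)"
    using det_single[OF c1] by simp
  then have "Determinant.det (L * M) = x ^ n * (x - (V * U) $$ (0, 0))"
    unfolding LM using U c1 by (subst det_four_block_mat_lower_left_zero[of _ n _ 1]) (auto simp: det_smult simp del: One_nat_def)
  then show ?thesis using det_mult[OF c(3,1)] dL e1 by simp
qed

text \<open>Times the variable, the characteristic polynomial is a power of it times one linear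
  factor, whose root is the scalar \<open>V * U\<close>; no other root can be positive.\<close>

lemma num_pos_eigenvalues_rank_one:
  assumes A: "A \<in> carrier_mat n n" and r: "A = U * V" and U: "U \<in> carrier_mat n 1" and V: "V \<in> carrier_mat 1 n"
  shows "num_pos_eigenvalues A \<le> 1"
proof -
  define \<tau> where "\<tau> = (V * U) $$ (0, 0)"
  define p where "p = char_poly A"
  have p0: "p \<noteq> 0" using degree_monic_char_poly[OF A] by (auto simp: p_def)
  have "poly (monom 1 1 * p) x = poly (monom 1 n * [:- \<tau>, 1:]) x" for x
  proof -
    have "poly p x = Determinant.det (- (char_matrix A x))" unfolding p_def by (rule char_poly_matrix[OF A])
    also have "- (char_matrix A x) = x \<cdot>\<^sub>m 1\<^sub>m n - U * V"
      unfolding r[symmetric] using A by (auto simp: char_matrix_def)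
    finally show ?thesis using det_rank_one_update[OF U V, of x] by (simp add: poly_monom \<tau>_def algebra_simps)
  qed
  then have eq: "monom 1 1 * p = monom 1 n * [:- \<tau>, 1:]" by (intro poly_ext)
  have pm: "proots (monom (1::real) k) = replicate_mset k 0" for k
  proof -
    have "monom (1::real) k = [:0, 1:] ^ k" by (simp add: monom_altdef)
    then show ?thesis by (simp add: proots_power)
  qed
  have "proots (monom 1 1 * p) = proots (monom 1 1) + proots p" using p0 by (intro proots_mult) auto
  moreover have "proots (monom 1 n * [:- \<tau>, 1:]) = proots (monom 1 n) + proots [:- \<tau>, 1:]" by (intro proots_mult) auto
  ultimately have "replicate_mset 1 0 + proots p = replicate_mset n 0 + {#\<tau>#}"
    unfolding eq pm by simp
  then have "filter_mset (\<lambda>x. 0 < x) (replicate_mset 1 0 + proots p) = filter_mset (\<lambda>x. 0 < x) (replicate_mset n 0 + {#\<tau>#})"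
    by simp
  moreover have fr: "filter_mset (\<lambda>x. 0 < x) (replicate_mset k (0::real)) = {#}" for k by (induction k) auto
  ultimately have "filter_mset (\<lambda>x. 0 < x) (proots p) = filter_mset (\<lambda>x. 0 < x) {#\<tau>#}"
    using fr[of 1] fr[of n] by simp
  then show ?thesis by (simp add: num_pos_eigenvalues_def p_def)
qed

text \<open>A matrix all of whose 2 by 2 minors vanish is the product of a column and a row, read
  off from any nonzero entry.\<close>

lemma two_pos_eigenvalues_minor:
  assumes A: "A \<in> carrier_mat n n" and J: "2 \<le> num_pos_eigenvalues A"
  shows "\<exists>i<n. \<exists>j<n. \<exists>k<n. \<exists>l<n. A $$ (i, k) * A $$ (j, l) \<noteq> A $$ (i, l) * A $$ (j, k)"
proof (rule ccontr)
  assume "\<not> ?thesis"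
  then have m: "A $$ (i, k) * A $$ (j, l) = A $$ (i, l) * A $$ (j, k)" if "i < n" "j < n" "k < n" "l < n" for i j k l
    using that by blast
  have "\<exists>u v. \<forall>i<n. \<forall>j<n. A $$ (i, j) = u i * v j"
  proof (cases "\<exists>k<n. \<exists>l<n. A $$ (k, l) \<noteq> 0")
    case True
    then obtain k l where kl: "k < n" "l < n" "A $$ (k, l) \<noteq> 0" by blast
    have "A $$ (i, j) = (A $$ (i, l) / A $$ (k, l)) * A $$ (k, j)" if "i < n" "j < n" for i j
      using m[of i k j l] that kl by (simp add: nonzero_eq_divide_eq)
    then show ?thesis by (intro exI[of _ "\<lambda>i. A $$ (i, l) / A $$ (k, l)"] exI[of _ "\<lambda>j. A $$ (k, j)"]) auto
  next
    case False
    then show ?thesis by (intro exI[of _ "\<lambda>_. 0"]) auto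
  qed
  then obtain u v where uv: "\<And>i j. i < n \<Longrightarrow> j < n \<Longrightarrow> A $$ (i, j) = u i * v j" by blast
  define U where "U = Matrix.mat n 1 (\<lambda>(i, j). u i)"
  define V where "V = Matrix.mat 1 n (\<lambda>(i, j). v j)"
  have c: "U \<in> carrier_mat n 1" "V \<in> carrier_mat 1 n" by (auto simp: U_def V_def)
  have "A = U * V"
    by (rule eq_matI) (use A uv in \<open>auto simp: U_def V_def scalar_prod_def\<close>)
  from num_pos_eigenvalues_rank_one[OF A this c] J show False by simp
qed

section \<open>The circle and the torus as probability spaces\<close>

text \<open>The measure is carried by the whole real line, so that points of the torus are plain
  real angles and no quotient modulo \<open>2 pi\<close> is formed.\<close>

definition circ :: "real measure" where
  "circ = density lborel (\<lambda>s. ennreal (indicator {0..2*pi} s / (2*pi)))"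

lemma sets_circ [simp, measurable_cong]: "sets circ = sets borel"
  and space_circ [simp]: "space circ = UNIV"
  by (simp_all add: circ_def)

lemma prob_space_circ: "prob_space circ"
proof
  have "emeasure circ (space circ) = (\<integral>\<^sup>+s. ennreal (1 / (2*pi)) * indicator {0..2*pi} s \<partial>lborel)"
    unfolding circ_def by (subst emeasure_density) (auto intro!: nn_integral_cong simp: indicator_def)
  also have "\<dots> = ennreal (1 / (2*pi)) * ennreal (2*pi)"
    by (subst nn_integral_cmult_indicator) auto
  also have "\<dots> = 1" by (simp add: ennreal_mult[symmetric])
  finally show "emeasure circ (space circ) = 1" .
qed

interpretation circ: prob_space circ by (rule prob_space_circ)

interpretation circs: product_sigma_finite "\<lambda>_::nat. circ"
  by (intro product_sigma_finite.intro) (rule circ.sigma_finite_measure_axioms)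

lemma prob_space_torus: "prob_space (PiM I (\<lambda>_::nat. circ))"
  by (rule prob_space_PiM) (rule prob_space_circ)

lemma integral_circ:
  fixes f :: "real \<Rightarrow> 'a::{banach, second_countable_topology}"
  assumes "f \<in> borel_measurable borel"
  shows "(LINT s|circ. f s) = (1 / (2*pi)) *\<^sub>R (LINT s:{0..2*pi}|lborel. f s)"
proof -
  have "(LINT s|circ. f s) = (LINT s|lborel. (indicator {0..2*pi} s / (2*pi)) *\<^sub>R f s)"
    unfolding circ_def using assms by (intro integral_density) auto
  also have "\<dots> = (LINT s|lborel. (1 / (2*pi)) *\<^sub>R (indicator {0..2*pi} s *\<^sub>R f s))"
    by (intro Bochner_Integration.integral_cong) (auto simp: indicator_def)
  also have "\<dots> = (1 / (2*pi)) *\<^sub>R (LINT s:{0..2*pi}|lborel. f s)"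
    unfolding set_lebesgue_integral_def by (rule integral_scaleR_right)
  finally show ?thesis .
qed

lemma AE_circI: "(AE s in lborel. P s) \<Longrightarrow> AE s in circ. P s"
  unfolding circ_def by (subst AE_density) auto

lemma circ_mean_holomorphic:
  assumes "continuous_on (cball 0 1) f" "f holomorphic_on ball 0 1"
  shows "(LINT s|circ. f (cis s)) = f 0"
proof -
  have "((\<lambda>u. f u / (u - 0)) has_contour_integral (2 * of_real pi * \<i> * f 0)) (circlepath 0 1)"
    by (rule Cauchy_integral_circlepath[OF assms]) simp
  then have "((\<lambda>t. (f (0 + 1 * cis t) / (0 + 1 * cis t - 0)) * 1 * \<i> * cis t) has_integral (2 * of_real pi * \<i> * f 0)) {0..2*pi}"
    unfolding circlepath_def by (subst (asm) has_contour_integral_part_circlepath_iff) auto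
  then have "((\<lambda>t. \<i> * f (cis t)) has_integral (\<i> * (2 * of_real pi * f 0))) {0..2*pi}"
    by (rule has_integral_eq_rhs[OF has_integral_eq[rotated]]) (auto simp: mult_ac)
  from has_integral_mult_right[OF this, of "-\<i>"]
  have hi: "((\<lambda>t. f (cis t)) has_integral (2 * of_real pi * f 0)) {0..2*pi}" by (simp add: mult.assoc[symmetric])
  have c: "continuous_on UNIV (\<lambda>t. f (cis t))"
    by (rule continuous_on_compose2[OF assms(1)]) (auto intro!: continuous_intros)
  have m: "(\<lambda>t. f (cis t)) \<in> borel_measurable borel" by (rule borel_measurable_continuous_onI[OF c])
  have "set_integrable lborel {0..2*pi} (\<lambda>t. f (cis t))"
    by (rule borel_integrable_atLeastAtMost') (rule continuous_on_subset[OF c], simp)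
  then have "(LINT t:{0..2*pi}|lborel. f (cis t)) = 2 * of_real pi * f 0"
    using set_borel_integral_eq_integral(2) hi integral_unique by metis
  then show ?thesis unfolding integral_circ[OF m] by (simp add: scaleR_conv_of_real)
qed

lemma circ_character: "(LINT s|circ. cis (of_int k * s)) = (if k = 0 then 1 else 0)"
proof -
  have pos: "(LINT s|circ. cis (real n * s)) = 0" if "n > 0" for n :: nat
  proof -
    have "(LINT s|circ. cis s ^ n) = 0 ^ n"
      by (rule circ_mean_holomorphic) (auto intro!: continuous_intros holomorphic_intros)
    then show ?thesis using that by (simp add: Complex.DeMoivre)
  qed
  consider "k = 0" | "k > 0" | "k < 0" by linarith
  then show ?thesis
  proof cases
    case 1
    then show ?thesis using circ.prob_space by simp
  next
    case 2
    then show ?thesis using pos[of "nat k"] by simp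
  next
    case 3
    have "(LINT s|circ. cis (of_int k * s)) = (LINT s|circ. cnj (cis (real (nat (- k)) * s)))"
      using 3 by (simp add: cis_cnj)
    also have "\<dots> = cnj 0" using pos[of "nat (- k)"] 3 by (subst Bochner_Integration.integral_cnj) simp
    finally show ?thesis using 3 by simp
  qed
qed

lemma cis_measurable [measurable]: "cis \<in> borel_measurable borel"
  by (intro borel_measurable_continuous_onI continuous_intros)

lemma cis_sum: "finite I \<Longrightarrow> cis (\<Sum>j\<in>I. f j) = (\<Prod>j\<in>I. cis (f j))"
  by (induction I rule: finite_induct) (auto simp: cis_mult[symmetric])

lemma torus_character:
  assumes "finite I"
  shows "(LINT \<theta>|PiM I (\<lambda>_::nat. circ). cis (\<Sum>j\<in>I. of_int (k j) * \<theta> j)) = (if \<forall>j\<in>I. k j = 0 then 1 else 0)"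
proof -
  have i: "integrable circ (\<lambda>s. cis (of_int (k j) * s))" for j
    by (rule circ.integrable_const_bound[where B = 1]) auto
  have "(LINT \<theta>|PiM I (\<lambda>_::nat. circ). cis (\<Sum>j\<in>I. of_int (k j) * \<theta> j))
     = (LINT \<theta>|PiM I (\<lambda>_::nat. circ). (\<Prod>j\<in>I. cis (of_int (k j) * \<theta> j)))"
    by (simp add: cis_sum assms)
  also have "\<dots> = (\<Prod>j\<in>I. (LINT s|circ. cis (of_int (k j) * s)))"
    by (rule circs.product_integral_prod[OF assms]) (rule i)
  also have "\<dots> = (if \<forall>j\<in>I. k j = 0 then 1 else 0)"
    unfolding circ_character using assms by (auto simp: prod_zero_iff)
  finally show ?thesis .
qed

lemma countable_cis_fibre: "countable {s. cis s = z}"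
proof (cases "\<exists>s0. cis s0 = z")
  case True
  then obtain s0 where s0: "cis s0 = z" by blast
  have "{s. cis s = z} \<subseteq> range (\<lambda>k::int. s0 + 2 * pi * of_int k)"
  proof
    fix s assume "s \<in> {s. cis s = z}"
    then have "cis s / cis s0 = 1" using s0 by auto
    then have "cis (s - s0) = 1" unfolding cis_divide .
    then have "cos (s - s0) = 1" by (simp add: complex_eq_iff)
    then obtain k :: int where "s - s0 = of_int k * 2 * pi" using cos_one_2pi_int by blast
    then have "s = s0 + 2 * pi * of_int k" by (simp add: algebra_simps)
    then show "s \<in> range (\<lambda>k::int. s0 + 2 * pi * of_int k)" by blast
  qed
  then show ?thesis by (rule countable_subset) simp
next
  case False
  then have "{s. cis s = z} = {}" by blast
  then show ?thesis by (simp only: countable_empty)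
qed

lemma AE_circ_countable:
  assumes "countable A"
  shows "AE s in circ. s \<notin> A"
  by (rule AE_circI, rule AE_not_in, rule countable_imp_null_set_lborel[OF assms])

lemma AE_circ_cis_notin:
  assumes "finite R"
  shows "AE s in circ. cis s \<notin> R"
proof -
  have "countable (\<Union>z\<in>R. {s. cis s = z})"
    using assms countable_cis_fibre by (intro countable_UN) (auto intro: countable_finite)
  from AE_circ_countable[OF this] show ?thesis by (rule AE_mp) auto
qed

text \<open>Fubini in one coordinate. Measurability is assumed because the properties in question
  quantify over all rotations \<open>s\<close>, and their exceptional sets are projections.\<close>

lemma AE_torus_insert:
  assumes I: "finite I" "i \<notin> I"
    and P: "{\<theta> \<in> space (PiM (insert i I) (\<lambda>_::nat. circ)). P \<theta>} \<in> sets (PiM (insert i I) (\<lambda>_. circ))"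
    and ae: "AE \<theta> in PiM I (\<lambda>_. circ). AE y in circ. P (\<theta>(i := y))"
  shows "AE \<theta> in PiM (insert i I) (\<lambda>_. circ). P \<theta>"
proof -
  let ?M = "PiM (insert i I) (\<lambda>_::nat. circ)"
  define N where "N = {\<theta> \<in> space ?M. \<not> P \<theta>}"
  have N[measurable]: "N \<in> sets ?M"
  proof -
    have "N = space ?M - {\<theta> \<in> space ?M. P \<theta>}" by (auto simp: N_def)
    then show ?thesis using P by auto
  qed
  have "emeasure ?M N = (\<integral>\<^sup>+\<theta>. indicator N \<theta> \<partial>?M)" by simp
  also have "\<dots> = (\<integral>\<^sup>+\<theta>. (\<integral>\<^sup>+y. indicator N (\<theta>(i := y)) \<partial>circ) \<partial>PiM I (\<lambda>_. circ))"
    by (rule circs.product_nn_integral_insert[OF I]) auto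
  also have "\<dots> = (\<integral>\<^sup>+\<theta>. 0 \<partial>PiM I (\<lambda>_::nat. circ))"
  proof (rule nn_integral_cong_AE)
    show "AE \<theta> in PiM I (\<lambda>_. circ). (\<integral>\<^sup>+y. indicator N (\<theta>(i := y)) \<partial>circ) = 0"
      using ae
    proof (rule AE_mp, intro AE_I2 impI)
      fix \<theta> assume "AE y in circ. P (\<theta>(i := y))"
      then have "(\<integral>\<^sup>+y. indicator N (\<theta>(i := y)) \<partial>circ) = (\<integral>\<^sup>+y. 0 \<partial>circ)"
        by (intro nn_integral_cong_AE) (auto simp: N_def indicator_def)
      then show "(\<integral>\<^sup>+y. indicator N (\<theta>(i := y)) \<partial>circ) = 0" by simp
    qed
  qed
  finally have "emeasure ?M N = 0" by simp
  then show ?thesis using N by (intro AE_I[of _ _ N]) (auto simp: N_def)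
qed

lemma trig_sum_measurable:
  assumes "finite I"
  shows "(\<lambda>\<theta>. \<Sum>x\<in>S. c x * cis (\<Sum>j\<in>I. real (e x j) * \<theta> j)) \<in> borel_measurable (PiM I (\<lambda>_::nat. circ))"
  by measurable

text \<open>In the new coordinate the sum is a polynomial in \<open>cis y\<close>. One of its
  coefficients is a sum of the same kind in the other coordinates, almost surely nonzero by
  induction, and finitely many roots are met for countably many \<open>y\<close> only.\<close>

lemma AE_trig_sum_nonzero:
  fixes e :: "'x \<Rightarrow> nat \<Rightarrow> nat" and c :: "'x \<Rightarrow> complex"
  assumes "finite I" "finite S" "S \<noteq> {}" "\<And>x. x \<in> S \<Longrightarrow> c x \<noteq> 0"
    and "\<And>x y. x \<in> S \<Longrightarrow> y \<in> S \<Longrightarrow> x \<noteq> y \<Longrightarrow> \<exists>j\<in>I. e x j \<noteq> e y j"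
  shows "AE \<theta> in PiM I (\<lambda>_::nat. circ). (\<Sum>x\<in>S. c x * cis (\<Sum>j\<in>I. real (e x j) * \<theta> j)) \<noteq> 0"
  using assms
proof (induction I arbitrary: S rule: finite_induct)
  case empty
  then obtain x where x: "x \<in> S" by blast
  with empty.prems(4) have "S = {x}" by blast
  then show ?case using empty.prems(3)[OF x] by simp
next
  case (insert i I)
  let ?Q = "\<lambda>T \<theta>. \<Sum>x\<in>T. c x * cis (\<Sum>j\<in>I. real (e x j) * \<theta> j)"
  obtain x0 where x0: "x0 \<in> S" using insert.prems(2) by blast
  \<comment> \<open>Exponents that agree in coordinate \<open>i\<close> must differ in another one,
    so each of these groups satisfies the induction hypothesis.\<close>
  define T where "T k = {x\<in>S. e x i = k}" for k
  have ae0: "AE \<theta> in PiM I (\<lambda>_::nat. circ). ?Q (T (e x0 i)) \<theta> \<noteq> 0"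
  proof (rule insert.IH)
    fix x y assume "x \<in> T (e x0 i)" "y \<in> T (e x0 i)" "x \<noteq> y"
    then show "\<exists>j\<in>I. e x j \<noteq> e y j" using insert.prems(4)[of x y] by (auto simp: T_def)
  qed (use insert.prems x0 in \<open>auto simp: T_def\<close>)
  have ae: "AE \<theta> in PiM I (\<lambda>_::nat. circ). AE y in circ. (\<Sum>x\<in>S. c x * cis (\<Sum>j\<in>insert i I. real (e x j) * (\<theta>(i := y)) j)) \<noteq> 0"
  proof (rule AE_mp[OF ae0], rule AE_I2, rule impI)
    fix \<theta> assume nz: "?Q (T (e x0 i)) \<theta> \<noteq> 0"
    define p where "p = (\<Sum>k\<in>(\<lambda>x. e x i) ` S. monom (?Q (T k) \<theta>) k)"
    have "coeff p (e x0 i) = ?Q (T (e x0 i)) \<theta>"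
      unfolding p_def coeff_sum using insert.prems(1) x0 by (simp add: sum.delta)
    then have "p \<noteq> 0" using nz by auto
    have "(\<Sum>x\<in>S. c x * cis (\<Sum>j\<in>insert i I. real (e x j) * (\<theta>(i := y)) j)) = poly p (cis y)" for y
    proof -
      have "(\<Sum>x\<in>S. c x * cis (\<Sum>j\<in>insert i I. real (e x j) * (\<theta>(i := y)) j))
         = (\<Sum>x\<in>S. c x * cis (\<Sum>j\<in>I. real (e x j) * \<theta> j) * cis y ^ e x i)"
      proof (rule sum.cong[OF refl])
        fix x
        have "(\<Sum>j\<in>I. real (e x j) * (\<theta>(i := y)) j) = (\<Sum>j\<in>I. real (e x j) * \<theta> j)"
          using insert.hyps(2) by (intro sum.cong) auto
        then show "c x * cis (\<Sum>j\<in>insert i I. real (e x j) * (\<theta>(i := y)) j) = c x * cis (\<Sum>j\<in>I. real (e x j) * \<theta> j) * cis y ^ e x i"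
          using insert.hyps by (simp add: cis_mult[symmetric] Complex.DeMoivre mult_ac)
      qed
      also have "\<dots> = (\<Sum>k\<in>(\<lambda>x. e x i) ` S. \<Sum>x\<in>T k. c x * cis (\<Sum>j\<in>I. real (e x j) * \<theta> j) * cis y ^ e x i)"
        unfolding T_def by (rule sum.image_gen[OF insert.prems(1)])
      also have "\<dots> = (\<Sum>k\<in>(\<lambda>x. e x i) ` S. ?Q (T k) \<theta> * cis y ^ k)"
        unfolding sum_distrib_right by (intro sum.cong refl) (auto simp: T_def)
      also have "\<dots> = poly p (cis y)" by (simp add: p_def poly_sum poly_monom)
      finally show ?thesis .
    qed
    then show "AE y in circ. (\<Sum>x\<in>S. c x * cis (\<Sum>j\<in>insert i I. real (e x j) * (\<theta>(i := y)) j)) \<noteq> 0"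
      using AE_circ_cis_notin[OF poly_roots_finite[OF \<open>p \<noteq> 0\<close>]] by simp
  qed
  have m[measurable]: "(\<lambda>\<theta>. \<Sum>x\<in>S. c x * cis (\<Sum>j\<in>insert i I. real (e x j) * \<theta> j)) \<in> borel_measurable (PiM (insert i I) (\<lambda>_::nat. circ))"
    using insert.hyps by (intro trig_sum_measurable) auto
  show ?case
    by (rule AE_torus_insert[OF insert.hyps _ ae]) measurable
qed

text \<open>The quantifier over \<open>s\<close> is an uncountable union. By continuity and
  compactness, a nonnegative function has a zero in the interval exactly when it takes arbitrarily
  small values at rational points.\<close>

lemma measurable_ex_zero:
  fixes h :: "'a \<Rightarrow> real \<Rightarrow> real"
  assumes ab: "a < b" and meas[measurable]: "\<And>s. (\<lambda>x. h x s) \<in> borel_measurable M"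
    and cont: "\<And>x. continuous_on {a..b} (h x)" and nonneg: "\<And>x s. 0 \<le> h x s"
  shows "{x \<in> space M. \<exists>s\<in>{a..b}. h x s = 0} \<in> sets M"
proof -
  let ?D = "\<rat> \<inter> {a..b}"
  have D: "countable ?D" by (simp add: countable_rat countable_Int1)
  have "(\<exists>s\<in>{a..b}. h x s = 0) \<longleftrightarrow> (\<forall>k. \<exists>s\<in>?D. h x s < 1 / real (Suc k))" for x
  proof
    assume "\<exists>s\<in>{a..b}. h x s = 0"
    then obtain s where s: "s \<in> {a..b}" "h x s = 0" by blast
    show "\<forall>k. \<exists>s\<in>?D. h x s < 1 / real (Suc k)"
    proof
      fix k
      have "(0::real) < 1 / real (Suc k)" by simp
      then obtain \<delta> where \<delta>: "\<delta> > 0" "\<And>q. q \<in> {a..b} \<Longrightarrow> dist q s < \<delta> \<Longrightarrow> dist (h x q) (h x s) < 1 / real (Suc k)"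
        using cont[of x] s(1) unfolding continuous_on_iff by blast
      have "max a (s - \<delta>) < min b (s + \<delta>)" using ab s(1) \<delta>(1) by auto
      then obtain q where q: "q \<in> \<rat>" "max a (s - \<delta>) < q" "q < min b (s + \<delta>)" using Rats_dense_in_real by blast
      then have "q \<in> {a..b}" "dist q s < \<delta>" by (auto simp: dist_real_def)
      from \<delta>(2)[OF this] have "h x q < 1 / real (Suc k)" using nonneg[of x q] s(2) by (simp add: dist_real_def)
      then show "\<exists>s\<in>?D. h x s < 1 / real (Suc k)" using q(1) \<open>q \<in> {a..b}\<close> by blast
    qed
  next
    assume "\<forall>k. \<exists>s\<in>?D. h x s < 1 / real (Suc k)"
    then obtain q where q: "\<And>k. q k \<in> {a..b}" "\<And>k. h x (q k) < 1 / real (Suc k)" by (metis IntD2)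
    obtain l r where lr: "l \<in> {a..b}" "strict_mono r" "(q \<circ> r) \<longlonglongrightarrow> l"
      using q(1) compact_imp_seq_compact[OF compact_Icc[of a b]] unfolding seq_compact_def by blast
    have l1: "(\<lambda>k. h x ((q \<circ> r) k)) \<longlonglongrightarrow> h x l"
      using cont[of x] lr(1,3) q(1) by (auto simp: continuous_on_sequentially o_def)
    have l2: "(\<lambda>k. h x ((q \<circ> r) k)) \<longlonglongrightarrow> 0"
    proof (rule Lim_null_comparison)
      show "\<forall>\<^sub>F k in sequentially. norm (h x ((q \<circ> r) k)) \<le> 1 / real (Suc k)"
      proof (intro always_eventually allI)
        fix k
        have "1 / real (Suc (r k)) \<le> 1 / real (Suc k)"
          using seq_suble[OF lr(2), of k] by (intro divide_left_mono) auto
        then show "norm (h x ((q \<circ> r) k)) \<le> 1 / real (Suc k)" using q(2)[of "r k"] nonneg[of x "q (r k)"] by simp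
      qed
      show "(\<lambda>k. 1 / real (Suc k)) \<longlonglongrightarrow> 0" by (rule LIMSEQ_Suc) (rule lim_1_over_n)
    qed
    have "h x l = 0" using LIMSEQ_unique[OF l1 l2] .
    then show "\<exists>s\<in>{a..b}. h x s = 0" using lr(1) by blast
  qed
  then have "{x \<in> space M. \<exists>s\<in>{a..b}. h x s = 0} = {x \<in> space M. \<forall>k. \<exists>s\<in>?D. h x s < 1 / real (Suc k)}" by simp
  also have "\<dots> \<in> sets M" using D by measurable
  finally show ?thesis .
qed

section \<open>Negligible projections of zero sets\<close>

lemma negligible_lipschitz_graph:
  fixes T :: "((real \<times> real) \<times> real) set"
  assumes "\<And>p q. p \<in> T \<Longrightarrow> q \<in> T \<Longrightarrow> norm (fst q - fst p) \<le> B * \<bar>snd q - snd p\<bar>"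
  shows "negligible (fst ` T)"
proof -
  define f where "f = (\<lambda>s. fst (SOME p. p \<in> T \<and> snd p = s))"
  have f: "f (snd p) = fst p" if "p \<in> T" for p
  proof -
    define q where "q = (SOME q. q \<in> T \<and> snd q = snd p)"
    have "q \<in> T \<and> snd q = snd p" unfolding q_def by (rule someI[of _ p]) (use that in auto)
    then have "norm (fst q - fst p) \<le> B * 0" using assms[of p q] that by simp
    then show ?thesis by (simp add: f_def q_def)
  qed
  define F where "F = (\<lambda>z :: real \<times> real. f (fst z))"
  let ?M = "(\<lambda>p. (snd p, 0 :: real)) ` T"
  have "negligible ?M"
  proof (rule negligible_subset)
    show "negligible {z :: real \<times> real. (0, 1) \<bullet> z = 0}" by (rule negligible_hyperplane) (simp add: zero_prod_def)
  qed (auto simp: inner_prod_def)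
  then have "negligible (F ` ?M)"
  proof (rule negligible_locally_Lipschitz_image[rotated])
    fix x assume "x \<in> ?M"
    then obtain p where p: "p \<in> T" "x = (snd p, 0)" by auto
    have "\<forall>y\<in>?M \<inter> UNIV. norm (F y - F x) \<le> B * norm (y - x)"
    proof
      fix y assume "y \<in> ?M \<inter> UNIV"
      then obtain q where q: "q \<in> T" "y = (snd q, 0)" by auto
      have "norm (y - x) = \<bar>snd q - snd p\<bar>" by (simp add: p q norm_prod_def)
      then show "norm (F y - F x) \<le> B * norm (y - x)"
        using assms[OF p(1) q(1)] by (simp add: F_def p(2) q(2) f p(1) q(1))
    qed
    then show "\<exists>U B. open U \<and> x \<in> U \<and> (\<forall>y\<in>?M \<inter> U. norm (F y - F x) \<le> B * norm (y - x))"
      by (intro exI[of _ UNIV] exI[of _ B] conjI open_UNIV UNIV_I)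
  qed simp
  moreover have "F ` ?M = (\<lambda>p. f (snd p)) ` T" by (simp only: image_image F_def fst_conv)
  moreover have "(\<lambda>p. f (snd p)) ` T = fst ` T" by (rule image_cong[OF refl f])
  ultimately show ?thesis by (simp only:)
qed

text \<open>Near a point where the partial derivative in the first two variables is invertible, the zero set
  is a Lipschitz curve parametrised by the third variable.\<close>

lemma negligible_projection_zero_set:
  fixes G :: "(real \<times> real) \<times> real \<Rightarrow> real \<times> real" and S :: "((real \<times> real) \<times> real) set"
  assumes zero: "\<And>p. p \<in> S \<Longrightarrow> G p = 0"
    and deriv: "\<And>p. p \<in> S \<Longrightarrow> (G has_derivative D p) (at p)"
    and inj: "\<And>p z. p \<in> S \<Longrightarrow> D p (z, 0) = 0 \<Longrightarrow> z = 0"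
  shows "negligible (fst ` S)"
proof -
  \<comment> \<open>Pieces on which the Lipschitz constant and the radius of its validity are both
    uniform; cut into small balls, each of them is a Lipschitz curve.\<close>
  define S' where "S' n = {p\<in>S. \<forall>q\<in>S. norm (q - p) < 1 / real (Suc n) \<longrightarrow> norm (fst q - fst p) \<le> real (Suc n) * \<bar>snd q - snd p\<bar>}" for n
  have cover: "\<exists>n. p \<in> S' n" if p: "p \<in> S" for p
  proof -
    have lin: "linear (D p)" using deriv[OF p] has_derivative_linear by blast
    have bl: "bounded_linear (D p)" using deriv[OF p] has_derivative_bounded_linear by blast
    have "linear (\<lambda>z :: real \<times> real. (z, 0 :: real))" by (rule linearI) simp_all
    from linear_compose[OF this lin] have lin2: "linear (\<lambda>z. D p (z, 0))" unfolding o_def .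
    have inj1: "inj (\<lambda>z. D p (z, 0))" using linear_injective_0[OF lin2] inj[OF p] by blast
    then obtain c where c: "c > 0" "\<And>z. c * norm z \<le> norm (D p (z, 0))"
      using linear_inj_bounded_below_pos[OF lin2 inj1] by blast
    obtain B where B: "B > 0" "\<And>v. norm (D p v) \<le> norm v * B" using bounded_linear.pos_bounded[OF bl] by blast
    obtain \<delta> where \<delta>: "\<delta> > 0" "\<And>q. norm (q - p) < \<delta> \<Longrightarrow> norm (G q - G p - D p (q - p)) \<le> c / 2 * norm (q - p)"
      using deriv[OF p] half_gt_zero[OF c(1)] unfolding has_derivative_at_alt by blast
    \<comment> \<open>With \<open>z\<close> and \<open>s\<close> the planar and the last component
      of \<open>q - p\<close>, the derivative gives
      \<open>c |z| \<le> c/2 (|z| + |s|) + B |s|\<close>; half of \<open>c |z|\<close> is absorbed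
      on the left.\<close>
    define L where "L = 1 + 2 * B / c"
    obtain n where n: "1 / real (Suc n) < \<delta>" "L \<le> real (Suc n)"
    proof -
      obtain n1 where n1: "1 / real (Suc n1) < \<delta>" using nat_approx_posE[OF \<delta>(1)] by blast
      obtain n2 where n2: "L \<le> real n2" using real_arch_simple by blast
      have "1 / real (Suc (max n1 n2)) \<le> 1 / real (Suc n1)" by (rule divide_left_mono) auto
      then have "1 / real (Suc (max n1 n2)) < \<delta>" using n1 by linarith
      moreover have "L \<le> real (Suc (max n1 n2))" using n2 by linarith
      ultimately show ?thesis by (rule that)
    qed
    have est: "norm (fst q - fst p) \<le> real (Suc n) * \<bar>snd q - snd p\<bar>" if q: "q \<in> S" "norm (q - p) < 1 / real (Suc n)" for q
    proof -
      define z where "z = fst q - fst p"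
      define s where "s = snd q - snd p"
      have qp: "q - p = (z, 0) + (0, s)" by (simp add: z_def s_def prod_eq_iff)
      have e: "norm (D p (q - p)) \<le> c / 2 * norm (q - p)"
        using \<delta>(2)[of q] q(2) n(1) zero[OF q(1)] zero[OF p] by simp
      have "norm (q - p) \<le> norm z + \<bar>s\<bar>"
        unfolding qp using norm_triangle_ineq[of "(z, 0)" "(0, s)"] by (simp add: norm_prod_def)
      then have e2: "c / 2 * norm (q - p) \<le> c / 2 * (norm z + \<bar>s\<bar>)" using c(1) by (intro mult_left_mono) auto
      have "D p (q - p) = D p (z, 0) + D p (0, s)" unfolding qp by (rule linear_add[OF lin])
      then have "norm (D p (z, 0)) \<le> norm (D p (q - p)) + norm (D p (0, s))"
        by (metis add_diff_cancel_right' norm_triangle_ineq4)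
      also have "norm (D p (0, s)) \<le> \<bar>s\<bar> * B" using B(2)[of "(0, s)"] by (simp add: norm_prod_def)
      finally have "c * norm z \<le> c / 2 * (norm z + \<bar>s\<bar>) + \<bar>s\<bar> * B" using c(2)[of z] e e2 by linarith
      moreover have "c / 2 * (norm z + \<bar>s\<bar>) = c / 2 * norm z + c / 2 * \<bar>s\<bar>" by (rule distrib_left)
      moreover have "c * norm z = c / 2 * norm z + c / 2 * norm z" by simp
      moreover have "(c / 2 + B) * \<bar>s\<bar> = c / 2 * \<bar>s\<bar> + \<bar>s\<bar> * B" by (simp add: distrib_right)
      ultimately have "c / 2 * norm z \<le> (c / 2 + B) * \<bar>s\<bar>" by linarith
      also have "\<dots> = c / 2 * (L * \<bar>s\<bar>)" using c(1) by (simp add: L_def field_simps)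
      finally have "norm z \<le> L * \<bar>s\<bar>" using c(1) by simp
      also have "\<dots> \<le> real (Suc n) * \<bar>s\<bar>" using n(2) by (intro mult_right_mono) auto
      finally show ?thesis by (simp add: z_def s_def)
    qed
    have "p \<in> S' n" unfolding S'_def by (intro CollectI conjI ballI impI p est)
    then show ?thesis ..
  qed
  have "\<exists>A :: ((real \<times> real) \<times> real) set. countable A \<and> (\<forall>X. open X \<longrightarrow> X \<noteq> {} \<longrightarrow> (\<exists>a\<in>A. a \<in> X))"
    by (rule countable_dense_exists)
  then obtain A :: "((real \<times> real) \<times> real) set" where A: "countable A" "\<And>X. open X \<Longrightarrow> X \<noteq> {} \<Longrightarrow> \<exists>a\<in>A. a \<in> X"
    by (elim exE conjE) (simp only: simp_thms)
  \<comment> \<open>Two points of a ball of this radius are closer than \<open>1 / Suc n\<close>,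
    the radius in \<open>S' n\<close>.\<close>
  let ?r = "\<lambda>n. 1 / (2 * real (Suc n))"
  have sub: "fst ` S \<subseteq> (\<Union>(n, a)\<in>UNIV \<times> A. fst ` (S' n \<inter> ball a (?r n)))"
  proof
    fix z assume "z \<in> fst ` S"
    then obtain p where p: "p \<in> S" "z = fst p" by auto
    obtain n where n: "p \<in> S' n" using cover[OF p(1)] by blast
    have "ball p (?r n) \<noteq> {}" by simp
    then obtain a where "a \<in> A" "a \<in> ball p (?r n)" using A(2)[of "ball p (?r n)"] by blast
    then have "(n, a) \<in> UNIV \<times> A" "z \<in> fst ` (S' n \<inter> ball a (?r n))"
      using n p(2) by (simp_all add: dist_commute)
    then show "z \<in> (\<Union>(n, a)\<in>UNIV \<times> A. fst ` (S' n \<inter> ball a (?r n)))" by blast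
  qed
  have "negligible (fst ` (S' n \<inter> ball a (?r n)))" for n a
  proof (rule negligible_lipschitz_graph)
    fix p q assume pq: "p \<in> S' n \<inter> ball a (?r n)" "q \<in> S' n \<inter> ball a (?r n)"
    have "norm (q - p) \<le> dist a p + dist a q" by (metis dist_commute dist_norm dist_triangle)
    also have "\<dots> < ?r n + ?r n" using pq by (intro add_strict_mono) auto
    also have "\<dots> = 1 / real (Suc n)" by (simp del: of_nat_Suc)
    finally show "norm (fst q - fst p) \<le> real (Suc n) * \<bar>snd q - snd p\<bar>"
      using pq by (auto simp: S'_def)
  qed
  then have "negligible (\<Union>(n, a)\<in>UNIV \<times> A. fst ` (S' n \<inter> ball a (?r n)))"
    using A(1) by (intro negligible_countable_Union countable_image countable_SIGMA) auto
  then show ?thesis by (rule negligible_subset[OF _ sub])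
qed

section \<open>The Bohr lift\<close>

lemma exp_has_sum: "((\<lambda>k. x ^ k / fact k) has_sum exp x) (UNIV :: nat set)" for x :: complex
proof (rule norm_summable_imp_has_sum)
  show "summable (\<lambda>k. norm (x ^ k / fact k))"
    using summable_norm_exp[of x] by (simp add: divide_inverse scaleR_conv_of_real mult.commute)
  show "(\<lambda>k. x ^ k / fact k) sums exp x"
    using exp_converges[of x] by (simp add: divide_inverse scaleR_conv_of_real mult.commute)
qed

lemma exp_sum_expansion:
  fixes x :: "nat \<Rightarrow> complex"
  assumes "finite S"
  shows "(\<lambda>k. norm (\<Prod>m\<in>S. x m ^ k m / fact (k m))) summable_on (PiE S (\<lambda>_. UNIV))"
    and "infsum (\<lambda>k. \<Prod>m\<in>S. x m ^ k m / fact (k m)) (PiE S (\<lambda>_. UNIV)) = exp (\<Sum>m\<in>S. x m)"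
proof -
  have e: "(\<lambda>k. norm (x m ^ k / fact k)) summable_on (UNIV :: nat set)" for m
  proof -
    have "summable (\<lambda>k. norm (x m ^ k / fact k))"
      using summable_norm_exp[of "x m"] by (simp add: divide_inverse scaleR_conv_of_real mult.commute)
    then show ?thesis by (subst summable_on_UNIV_nonneg_real_iff) auto
  qed
  have "Infinite_Set_Sum.abs_summable_on (\<lambda>k. \<Prod>m\<in>S. x m ^ k m / fact (k m)) (PiE S (\<lambda>_. UNIV))"
    by (rule abs_summable_on_prod_PiE[OF assms]) (use e abs_summable_equivalent in auto)
  then show "(\<lambda>k. norm (\<Prod>m\<in>S. x m ^ k m / fact (k m))) summable_on (PiE S (\<lambda>_. UNIV))"
    unfolding abs_summable_equivalent[symmetric] .
  have "infsum (\<lambda>k. \<Prod>m\<in>S. x m ^ k m / fact (k m)) (PiE S (\<lambda>_. UNIV)) = (\<Prod>m\<in>S. infsum (\<lambda>k. x m ^ k / fact k) UNIV)"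
    by (rule infsum_prod_PiE_abs[OF assms]) (rule e)
  also have "\<dots> = (\<Prod>m\<in>S. exp (x m))" using infsumI[OF exp_has_sum] by simp
  finally show "infsum (\<lambda>k. \<Prod>m\<in>S. x m ^ k m / fact (k m)) (PiE S (\<lambda>_. UNIV)) = exp (\<Sum>m\<in>S. x m)"
    by (simp add: exp_sum[OF assms])
qed

text \<open>Summation over the fibres of \<open>\<nu>\<close> for an absolutely summable family; the
  bounded multiplier \<open>h\<close> is constant on each fibre. It collects the terms of an
  exponential series that belong to the same integer.\<close>

lemma infsum_regroup:
  fixes G :: "'k \<Rightarrow> complex" and \<nu> :: "'k \<Rightarrow> nat" and h :: "nat \<Rightarrow> complex"
  assumes G: "(\<lambda>k. norm (G k)) summable_on K"
  defines "e \<equiv> \<lambda>N. infsum G {k\<in>K. \<nu> k = N}"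
  shows "summable (\<lambda>N. norm (e N))"
    and "(\<And>N. norm (h N) \<le> 1) \<Longrightarrow> (\<lambda>N. e N * h N) sums infsum (\<lambda>k. G k * h (\<nu> k)) K"
proof -
  define A where "A N = {k\<in>K. \<nu> k = N}" for N
  have bij: "bij_betw snd (Sigma UNIV A) K"
    by (rule bij_betwI[of _ _ _ "\<lambda>k. (\<nu> k, k)"]) (auto simp: A_def)
  have main: "(\<lambda>N. norm (infsum (\<lambda>k. H k) (A N))) summable_on UNIV \<and> ((\<lambda>N. infsum H (A N)) has_sum infsum H K) UNIV"
    if H: "(\<lambda>k. norm (H k)) summable_on K" for H :: "'k \<Rightarrow> complex"
  proof -
    have s1: "(\<lambda>p. norm (H (snd p))) summable_on (Sigma UNIV A)"
      using H by (subst summable_on_reindex_bij_betw[OF bij])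
    have s2: "(\<lambda>p. H (snd p)) summable_on (Sigma UNIV A)" by (rule abs_summable_summable[OF s1])
    from s1 have out: "(\<lambda>N. norm (infsum (\<lambda>k. norm (H k)) (A N))) summable_on UNIV" and inner: "\<And>N. (\<lambda>k. norm (H k)) summable_on A N"
      unfolding Infinite_Sum.abs_summable_on_Sigma_iff[of "\<lambda>p. H (snd p)"] by auto
    have a: "(\<lambda>N. norm (infsum H (A N))) summable_on UNIV"
    proof (rule Infinite_Sum.abs_summable_on_comparison_test[OF out])
      fix N
      show "norm (infsum H (A N)) \<le> norm (infsum (\<lambda>k. norm (H k)) (A N))"
        using norm_infsum_bound[OF inner[of N]] by (simp add: infsum_nonneg)
    qed
    have "infsum (\<lambda>N. infsum (\<lambda>k. H (snd (N, k))) (A N)) UNIV = infsum (\<lambda>p. H (snd p)) (Sigma UNIV A)"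
      by (rule infsum_Sigma_banach[OF s2])
    also have "\<dots> = infsum H K" by (rule infsum_reindex_bij_betw[OF bij])
    finally have "infsum (\<lambda>N. infsum H (A N)) UNIV = infsum H K" by simp
    moreover have "(\<lambda>N. infsum H (A N)) summable_on UNIV" by (rule abs_summable_summable[OF a])
    ultimately show ?thesis using a has_sum_infsum by metis
  qed
  have eA: "e N = infsum G (A N)" for N by (simp add: e_def A_def)
  show "summable (\<lambda>N. norm (e N))"
    unfolding eA using main[OF G] by (subst summable_on_UNIV_nonneg_real_iff[symmetric]) auto
  assume h: "\<And>N. norm (h N) \<le> 1"
  have "(\<lambda>k. norm (G k * h (\<nu> k))) summable_on K"
    by (rule Infinite_Sum.abs_summable_on_comparison_test[OF G]) (use h in \<open>auto simp: norm_mult mult_left_le\<close>)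
  from main[OF this] have "(\<lambda>N. infsum (\<lambda>k. G k * h (\<nu> k)) (A N)) sums infsum (\<lambda>k. G k * h (\<nu> k)) K"
    using has_sum_imp_sums by blast
  moreover have "infsum (\<lambda>k. G k * h (\<nu> k)) (A N) = e N * h N" for N
  proof -
    have "infsum (\<lambda>k. G k * h (\<nu> k)) (A N) = infsum (\<lambda>k. G k * h N) (A N)"
      by (rule infsum_cong) (simp add: A_def)
    then show ?thesis by (simp add: eA infsum_cmult_left')
  qed
  ultimately show "(\<lambda>N. e N * h N) sums infsum (\<lambda>k. G k * h (\<nu> k)) K" by simp
qed

definition monomial_of :: "nat set \<Rightarrow> (nat \<Rightarrow> nat) \<Rightarrow> nat" where
  "monomial_of S k = (\<Prod>m\<in>S. m ^ k m)"

text \<open>The Dirichlet coefficients of \<open>n\<^sup>-\<^sup>\<phi>\<close>, from expanding \<open>exp (- log n \<cdot> \<phi>)\<close>.\<close>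

definition dcoeff :: "(nat \<Rightarrow> complex) \<Rightarrow> nat \<Rightarrow> nat \<Rightarrow> complex" where
  "dcoeff c n N = infsum (\<lambda>k. exp (- of_real (ln n) * c 1) * (\<Prod>m\<in>spectrum_set c. (- of_real (ln n) * c m) ^ k m / fact (k m)))
      {k \<in> PiE (spectrum_set c) (\<lambda>_. UNIV). monomial_of (spectrum_set c) k = N}"

lemma dcoeff_summable:
  assumes "finite (spectrum_set c)"
  shows "summable (\<lambda>N. norm (dcoeff c n N))"
  unfolding dcoeff_def
  by (rule infsum_regroup(1)) (unfold norm_mult, rule summable_on_cmult_right[OF exp_sum_expansion(1)[OF assms]])

lemma dcoeff_zero:
  assumes "\<And>k. monomial_of (spectrum_set c) k \<noteq> N"
  shows "dcoeff c n N = 0"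
  unfolding dcoeff_def using assms by simp

text \<open>One expansion serves two purposes: \<open>h N = N^(-s)\<close> yields the Dirichlet
  series of \<open>n^(-\<phi>)\<close>, and the characters of the torus yield its lift. For their
  sake multiplicativity is asked only on products of frequencies.\<close>

lemma dcoeff_sums:
  assumes S: "finite (spectrum_set c)" and h: "\<And>N. norm (h N) \<le> 1"
    and mult: "\<And>k. h (monomial_of (spectrum_set c) k) = (\<Prod>m\<in>spectrum_set c. h m ^ k m)"
  shows "(\<lambda>N. dcoeff c n N * h N) sums exp (- of_real (ln n) * (c 1 + (\<Sum>m\<in>spectrum_set c. c m * h m)))"
proof -
  let ?S = "spectrum_set c" and ?L = "complex_of_real (ln n)"
  let ?K = "PiE ?S (\<lambda>_. UNIV :: nat set)"
  let ?G = "\<lambda>k. exp (- ?L * c 1) * (\<Prod>m\<in>?S. (- ?L * c m) ^ k m / fact (k m))"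
  have "(\<lambda>N. dcoeff c n N * h N) sums infsum (\<lambda>k. ?G k * h (monomial_of ?S k)) ?K"
    unfolding dcoeff_def
    by (rule infsum_regroup(2)) (unfold norm_mult, rule summable_on_cmult_right[OF exp_sum_expansion(1)[OF S]], rule h)
  also have "(\<lambda>k. ?G k * h (monomial_of ?S k)) = (\<lambda>k. exp (- ?L * c 1) * (\<Prod>m\<in>?S. (- ?L * c m * h m) ^ k m / fact (k m)))"
  proof
    fix k
    have "(\<Prod>m\<in>?S. (- ?L * c m) ^ k m / fact (k m)) * (\<Prod>m\<in>?S. h m ^ k m) = (\<Prod>m\<in>?S. (- ?L * c m * h m) ^ k m / fact (k m))"
      unfolding prod.distrib[symmetric]
      by (rule prod.cong[OF refl]) (simp only: power_mult_distrib[of "- ?L * c _" "h _"] times_divide_eq_left)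
    then show "?G k * h (monomial_of ?S k) = exp (- ?L * c 1) * (\<Prod>m\<in>?S. (- ?L * c m * h m) ^ k m / fact (k m))"
      unfolding mult by (simp only: mult.assoc)
  qed
  also have "infsum \<dots> ?K = exp (- ?L * c 1) * exp (\<Sum>m\<in>?S. - ?L * c m * h m)"
    by (simp only: infsum_cmult_right' exp_sum_expansion(2)[OF S])
  also have "\<dots> = exp (- ?L * (c 1 + (\<Sum>m\<in>?S. c m * h m)))"
    by (simp add: exp_add[symmetric] sum_distrib_left distrib_left sum_negf mult.assoc)
  finally show ?thesis .
qed

lemma of_nat_powr_exp: "0 < N \<Longrightarrow> of_nat N powr (- s) = exp (- s * of_real (ln (real N)))" for s :: complex
  by (simp add: powr_def Ln_of_nat)

lemma ln_prod_pow:
  assumes "finite L" "\<And>q. q \<in> L \<Longrightarrow> (q::nat) > 0"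
  shows "ln (real (\<Prod>q\<in>L. q ^ \<beta> q)) = (\<Sum>q\<in>L. real (\<beta> q) * ln (real q))"
  using assms by (induction L rule: finite_induct) (auto simp: ln_mult ln_realpow prod_pos)

section \<open>Uniqueness of multi-indices over a rationally independent set\<close>

lemma rat_independentD:
  assumes ind: "rat_independent L" and L: "finite L" "L \<subseteq> {2..}"
    and z: "(\<Sum>q\<in>L. of_int (k q) * ln (real q)) = 0" and q: "q \<in> L"
  shows "k q = 0"
proof -
  interpret V: vector_space "\<lambda>(q::rat) (x::real). of_rat q * x" by (rule vector_space_rat_real)
  define l where "l n = ln (real n)" for n :: nat
  have inj: "inj_on l L"
  proof (rule inj_onI)
    fix x y assume "x \<in> L" "y \<in> L" "l x = l y"
    moreover from this have "0 < real x" "0 < real y" using L(2) by force+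
    ultimately show "x = y" by (simp add: l_def)
  qed
  have "(\<Sum>v\<in>l ` L. of_rat (of_int (k (the_inv_into L l v))) * v) = (\<Sum>q\<in>L. of_rat (of_int (k (the_inv_into L l (l q)))) * l q)"
    by (subst sum.reindex[OF inj]) simp
  also have "\<dots> = (\<Sum>q\<in>L. of_int (k q) * ln (real q))"
  proof (rule sum.cong[OF refl])
    fix q assume "q \<in> L"
    then have "the_inv_into L l (l q) = q" by (rule the_inv_into_f_f[OF inj])
    then show "of_rat (of_int (k (the_inv_into L l (l q)))) * l q = of_int (k q) * ln (real q)"
      by (simp add: l_def[of q])
  qed
  finally have "(\<Sum>v\<in>l ` L. of_rat (of_int (k (the_inv_into L l v))) * v) = 0" using z by simp
  from V.independentD[OF _ _ _ this, of "l ` L" "l q"] ind L(1) q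
  have "of_int (k (the_inv_into L l (l q))) = (0::rat)" by (auto simp: rat_independent_def l_def)
  then show ?thesis using the_inv_into_f_f[OF inj q] by simp
qed

lemma prod_pow_unique:
  assumes "rat_independent L" "finite L" "L \<subseteq> {2..}"
    and "(\<Prod>q\<in>L. q ^ \<beta> q) = (\<Prod>q\<in>L. q ^ \<gamma> q)" "q \<in> L"
  shows "\<beta> q = \<gamma> q"
proof -
  have pos: "q > 0" if "q \<in> L" for q using assms(3) that by force
  have "(\<Sum>q\<in>L. real (\<beta> q) * ln (real q)) = (\<Sum>q\<in>L. real (\<gamma> q) * ln (real q))"
    using ln_prod_pow[OF assms(2) pos, of \<beta>] ln_prod_pow[OF assms(2) pos, of \<gamma>] assms(4) by simp
  then have "(\<Sum>q\<in>L. of_int (int (\<beta> q) - int (\<gamma> q)) * ln (real q)) = 0"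
    by (simp add: left_diff_distrib sum_subtractf)
  from rat_independentD[OF assms(1-3) this assms(5)] show ?thesis by simp
qed

lemma multi_index_prod:
  assumes "rat_independent L" "finite L" "L \<subseteq> {2..}"
  shows "multi_index L (\<Prod>q\<in>L. q ^ \<beta> q) = (\<lambda>q. if q \<in> L then \<beta> q else 0)"
  unfolding multi_index_def
proof (rule the_equality)
  show "(\<forall>q. q \<notin> L \<longrightarrow> (if q \<in> L then \<beta> q else 0) = 0) \<and> (\<Prod>q\<in>L. q ^ \<beta> q) = (\<Prod>q\<in>L. q ^ (if q \<in> L then \<beta> q else 0))"
    by (auto intro!: prod.cong)
  fix \<alpha> assume \<alpha>: "(\<forall>q. q \<notin> L \<longrightarrow> \<alpha> q = 0) \<and> (\<Prod>q\<in>L. q ^ \<beta> q) = (\<Prod>q\<in>L. q ^ \<alpha> q)"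
  show "\<alpha> = (\<lambda>q. if q \<in> L then \<beta> q else 0)"
  proof
    fix q
    show "\<alpha> q = (if q \<in> L then \<beta> q else 0)"
      using \<alpha> prod_pow_unique[OF assms, of \<beta> \<alpha> q] by auto
  qed
qed

section \<open>Coefficients and characters for a fixed generating list\<close>

locale bohr_data =
  fixes c :: "nat \<Rightarrow> complex" and qs :: "nat list"
  assumes fin: "finite (spectrum_set c)" and dist_qs: "distinct qs"
    and gen: "set qs \<in> generating_sets (spectrum_set c)"
begin

abbreviation "S \<equiv> spectrum_set c"
definition "d = length qs"
definition "al n j = multi_index (set qs) n (qs ! j)"
text \<open>The multiplicative monoid generated by the list; it carries all coefficients
  \<open>dcoeff c n\<close>, and on it \<open>al\<close> is injective.\<close>

definition "M = range (\<lambda>\<beta>. \<Prod>j<d. (qs ! j) ^ \<beta> j)"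

lemma qs_ge: "j < d \<Longrightarrow> 2 \<le> qs ! j"
proof -
  assume "j < d"
  then have "qs ! j \<in> set qs" by (simp add: d_def)
  moreover have "set qs \<subseteq> {2..}" using gen by (simp add: generating_sets_def)
  ultimately show "2 \<le> qs ! j" by auto
qed

lemma S_ge: "n \<in> S \<Longrightarrow> 2 \<le> n" by (simp add: spectrum_set_def)

lemma indep: "rat_independent (set qs)" "finite (set qs)" "set qs \<subseteq> {2..}"
  using gen by (auto simp: generating_sets_def)

lemma bij_qs: "bij_betw (\<lambda>j. qs ! j) {..<d} (set qs)"
  unfolding d_def using dist_qs by (rule bij_betw_nth) auto

lemma prod_qs: "(\<Prod>q\<in>set qs. f q) = (\<Prod>j<d. f (qs ! j))"
  by (rule prod.reindex_bij_betw[OF bij_qs, symmetric])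

lemma sum_qs: "(\<Sum>q\<in>set qs. f q) = (\<Sum>j<d. f (qs ! j))"
  by (rule sum.reindex_bij_betw[OF bij_qs, symmetric])

lemma inj_qs: "i < d \<Longrightarrow> j < d \<Longrightarrow> qs ! i = qs ! j \<Longrightarrow> i = j"
  using dist_qs nth_eq_iff_index_eq[OF dist_qs] by (simp add: d_def)

lemma al_prod:
  assumes "j < d"
  shows "al (\<Prod>i<d. (qs ! i) ^ \<beta> i) j = \<beta> j"
proof -
  define \<gamma> where "\<gamma> q = \<beta> (the_inv_into {..<d} ((!) qs) q)" for q
  have g: "\<gamma> (qs ! i) = \<beta> i" if "i < d" for i
    using that bij_qs by (simp add: \<gamma>_def the_inv_into_f_f bij_betw_def)
  have "(\<Prod>i<d. (qs ! i) ^ \<beta> i) = (\<Prod>q\<in>set qs. q ^ \<gamma> q)"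
    unfolding prod_qs by (rule prod.cong) (auto simp: g)
  then have "al (\<Prod>i<d. (qs ! i) ^ \<beta> i) j = (if qs ! j \<in> set qs then \<gamma> (qs ! j) else 0)"
    by (simp add: al_def multi_index_prod[OF indep])
  then show ?thesis using assms g[OF assms] nth_mem[of j qs] by (simp add: d_def)
qed

lemma M_eq: "N \<in> M \<Longrightarrow> N = (\<Prod>j<d. (qs ! j) ^ al N j)"
  unfolding M_def using al_prod by fastforce

lemma M_pos: "N \<in> M \<Longrightarrow> 0 < N"
  unfolding M_def by (auto intro!: prod_pos zero_less_power dest: qs_ge)

lemma M_inj: "N \<in> M \<Longrightarrow> N' \<in> M \<Longrightarrow> (\<And>j. j < d \<Longrightarrow> al N j = al N' j) \<Longrightarrow> N = N'"
  using M_eq[of N] M_eq[of N'] by simp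

lemma S_M: "n \<in> S \<Longrightarrow> n \<in> M"
proof -
  assume "n \<in> S"
  then obtain \<alpha> where "n = (\<Prod>q\<in>set qs. q ^ \<alpha> q)"
    using gen by (auto simp: generating_sets_def generates_def)
  then show "n \<in> M" unfolding M_def prod_qs by (intro image_eqI[of _ _ "\<lambda>j. \<alpha> (qs ! j)"]) auto
qed

lemma monomial_of_M: "monomial_of S k = (\<Prod>j<d. (qs ! j) ^ (\<Sum>m\<in>S. k m * al m j))"
proof -
  have "monomial_of S k = (\<Prod>m\<in>S. \<Prod>j<d. (qs ! j) ^ (k m * al m j))"
    unfolding monomial_of_def
  proof (rule prod.cong[OF refl])
    fix m assume "m \<in> S"
    have "m ^ k m = (\<Prod>j<d. (qs ! j) ^ al m j) ^ k m" using M_eq[OF S_M[OF \<open>m \<in> S\<close>]] by simp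
    then show "m ^ k m = (\<Prod>j<d. (qs ! j) ^ (k m * al m j))"
      by (simp add: prod_power_distrib power_mult[symmetric] mult.commute)
  qed
  also have "\<dots> = (\<Prod>j<d. \<Prod>m\<in>S. (qs ! j) ^ (k m * al m j))" by (rule prod.swap)
  finally show ?thesis by (simp add: power_sum)
qed

lemma al_monomial_of: "j < d \<Longrightarrow> al (monomial_of S k) j = (\<Sum>m\<in>S. k m * al m j)"
  unfolding monomial_of_M by (rule al_prod)

lemma dcoeff_M: "N \<notin> M \<Longrightarrow> dcoeff c n N = 0"
  by (rule dcoeff_zero) (auto simp: monomial_of_M M_def)

text \<open>The character of the torus attached to \<open>N\<close>. Off \<open>M\<close> the
  exponents \<open>al N j\<close> carry no meaning, but the modulus is 1 there too and the
  coefficients vanish.\<close>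

definition "psi \<theta> N = cis (\<Sum>j<d. real (al N j) * \<theta> j)"

lemma norm_psi [simp]: "cmod (psi \<theta> N) = 1" by (simp add: psi_def)

lemma psi_mult: "psi \<theta> (monomial_of S k) = (\<Prod>m\<in>S. psi \<theta> m ^ k m)"
proof -
  have "(\<Sum>j<d. real (al (monomial_of S k) j) * \<theta> j) = (\<Sum>j<d. \<Sum>m\<in>S. real (k m) * (real (al m j) * \<theta> j))"
    by (rule sum.cong) (auto simp: al_monomial_of sum_distrib_left sum_distrib_right mult_ac)
  also have "\<dots> = (\<Sum>m\<in>S. real (k m) * (\<Sum>j<d. real (al m j) * \<theta> j))"
    by (subst sum.swap) (simp add: sum_distrib_left)
  finally show ?thesis by (simp add: psi_def cis_sum[OF fin] Complex.DeMoivre)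
qed

definition "w0 = c 1 - 1/2"
definition "Phi \<theta> = w0 + (\<Sum>n\<in>S. c n * psi \<theta> n)"

lemma bohr_lift_eq: "bohr_lift c qs (\<lambda>j. cis (\<theta> j)) = Phi \<theta>"
proof -
  have "(\<Prod>j<length qs. cis (\<theta> j) ^ multi_index (set qs) n (qs ! j)) = psi \<theta> n" for n
    by (simp add: psi_def cis_sum Complex.DeMoivre al_def d_def)
  then show ?thesis by (simp add: bohr_lift_def Phi_def w0_def)
qed

text \<open>The factor \<open>1 / sqrt n\<close> comes from the shift by \<open>1/2\<close> between
  the symbol and its lift.\<close>

lemma dcoeff_psi_sums:
  assumes "1 \<le> n"
  shows "(\<lambda>N. dcoeff c n N * psi \<theta> N) sums (exp (- Phi \<theta> * of_real (ln n)) / of_real (sqrt n))"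
proof -
  have "(\<lambda>N. dcoeff c n N * psi \<theta> N) sums exp (- of_real (ln n) * (c 1 + (\<Sum>m\<in>S. c m * psi \<theta> m)))"
    by (rule dcoeff_sums[OF fin]) (simp_all add: psi_mult)
  also have "- of_real (ln n) * (c 1 + (\<Sum>m\<in>S. c m * psi \<theta> m)) = - Phi \<theta> * of_real (ln n) - of_real (ln n / 2)"
    by (simp add: Phi_def w0_def algebra_simps)
  also have "exp \<dots> = exp (- Phi \<theta> * of_real (ln n)) / of_real (exp (ln n / 2))"
    by (simp only: exp_diff exp_of_real)
  also have "exp (ln n / 2) = sqrt n"
    using assms by (simp add: ln_sqrt[symmetric])
  finally show ?thesis .
qed

lemma dcoeff_eval:
  assumes "1 \<le> n" "0 < Re s"
  shows "(\<lambda>N. dcoeff c n N * of_nat N powr (- s)) sums (of_nat n powr (- dpoly c s))"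
proof -
  have mult: "of_nat (monomial_of S k) powr (- s) = (\<Prod>m\<in>S. (of_nat m powr (- s)) ^ k m)" for k
  proof -
    have p: "0 < m" if "m \<in> S" for m using S_ge[OF that] by simp
    then have "0 < monomial_of S k" unfolding monomial_of_def by (intro prod_pos) auto
    then have "of_nat (monomial_of S k) powr (- s) = exp (- s * of_real (\<Sum>m\<in>S. real (k m) * ln (real m)))"
      by (simp only: of_nat_powr_exp, simp only: monomial_of_def ln_prod_pow[OF fin p])
    also have "\<dots> = exp (\<Sum>m\<in>S. of_nat (k m) * (- s * of_real (ln (real m))))"
      by (simp add: sum_distrib_left mult_ac)
    also have "\<dots> = (\<Prod>m\<in>S. (of_nat m powr (- s)) ^ k m)"
      unfolding exp_sum[OF fin] exp_of_nat_mult by (rule prod.cong) (simp_all add: of_nat_powr_exp p)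
    finally show ?thesis .
  qed
  have "(\<lambda>N. dcoeff c n N * of_nat N powr (- s)) sums exp (- of_real (ln n) * (c 1 + (\<Sum>m\<in>S. c m * of_nat m powr (- s))))"
  proof (rule dcoeff_sums[OF fin _ mult])
    fix N :: nat
    show "norm (of_nat N powr (- s)) \<le> 1"
    proof (cases "N = 0")
      case False
      then have "real N powr - Re s \<le> real N powr 0" using assms(2) by (intro powr_mono) auto
      then show ?thesis using False by (simp add: cmod_of_nat_powr)
    qed simp
  qed
  also have "exp (- of_real (ln n) * (c 1 + (\<Sum>m\<in>S. c m * of_nat m powr (- s)))) = of_nat n powr (- dpoly c s)"
  proof -
    have "0 < n" using assms(1) by simp
    then have "of_nat n powr (- dpoly c s) = exp (- dpoly c s * of_real (ln n))" by (rule of_nat_powr_exp)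
    then show ?thesis by (simp only: dpoly_def mult_minus_left mult_minus_right mult.commute)
  qed
  finally show ?thesis .
qed

end

lemma cnj_measurable [measurable]: "cnj \<in> borel_measurable borel"
  by (intro borel_measurable_continuous_onI continuous_intros)

context bohr_data
begin

section \<open>Parseval on the torus and restriction to slices\<close>

abbreviation "tor \<equiv> PiM {..<d} (\<lambda>_::nat. circ)"

definition "deg N = (\<Sum>j<d. al N j)"

lemma psi_measurable [measurable]: "(\<lambda>\<theta>. psi \<theta> N) \<in> borel_measurable tor"
  unfolding psi_def by measurable

lemma psi_orthogonal:
  assumes "N \<in> M" "N' \<in> M"
  shows "(LINT \<theta>|tor. psi \<theta> N * cnj (psi \<theta> N')) = (if N = N' then 1 else 0)"
proof -
  have "psi \<theta> N * cnj (psi \<theta> N') = cis (\<Sum>j<d. of_int (int (al N j) - int (al N' j)) * \<theta> j)" for \<theta>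
    by (simp add: psi_def cis_cnj cis_mult left_diff_distrib sum_subtractf)
  then have "(LINT \<theta>|tor. psi \<theta> N * cnj (psi \<theta> N')) = (if \<forall>j\<in>{..<d}. int (al N j) - int (al N' j) = 0 then 1 else 0)"
    using torus_character[of "{..<d}" "\<lambda>j. int (al N j) - int (al N' j)"] by simp
  then show ?thesis using M_inj[OF assms] by auto
qed

lemma parseval:
  assumes b: "summable (\<lambda>N. cmod (b N))" "\<And>N. N \<notin> M \<Longrightarrow> b N = 0"
  shows "(\<lambda>N. (cmod (b N))\<^sup>2) sums (LINT \<theta>|tor. (cmod (\<Sum>N. b N * psi \<theta> N))\<^sup>2)"
proof -
  interpret T: prob_space tor by (rule prob_space_torus)
  define F where "F K \<theta> = (\<Sum>N<K. b N * psi \<theta> N)" for K \<theta>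
  define B where "B = (\<Sum>N. cmod (b N))"
  have sm: "summable (\<lambda>N. b N * psi \<theta> N)" for \<theta>
    by (rule summable_norm_cancel) (use b(1) in \<open>simp add: norm_mult\<close>)
  have lim: "(\<lambda>K. F K \<theta>) \<longlonglongrightarrow> (\<Sum>N. b N * psi \<theta> N)" for \<theta>
    unfolding F_def by (rule summable_LIMSEQ[OF sm])
  have FB: "cmod (F K \<theta>) \<le> B" for K \<theta>
  proof -
    have "cmod (F K \<theta>) \<le> (\<Sum>N<K. cmod (b N))"
      unfolding F_def by (rule order.trans[OF norm_sum]) (simp add: norm_mult)
    also have "\<dots> \<le> B" unfolding B_def by (rule sum_le_suminf[OF b(1)]) auto
    finally show ?thesis .
  qed
  have Fm[measurable]: "F K \<in> borel_measurable tor" for K unfolding F_def by measurable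
  have fin: "(LINT \<theta>|tor. (cmod (F K \<theta>))\<^sup>2) = (\<Sum>N<K. (cmod (b N))\<^sup>2)" for K
  proof -
    have i: "integrable tor (\<lambda>\<theta>. psi \<theta> N * cnj (psi \<theta> N'))" for N N'
      by (rule T.integrable_const_bound[where B = 1]) (auto simp: norm_mult)
    have e: "complex_of_real ((cmod (F K \<theta>))\<^sup>2) = (\<Sum>N<K. \<Sum>N'<K. (b N * cnj (b N')) * (psi \<theta> N * cnj (psi \<theta> N')))" for \<theta>
      unfolding complex_norm_square F_def cnj_sum sum_product by (intro sum.cong refl) (simp add: mult_ac)
    have "complex_of_real (LINT \<theta>|tor. (cmod (F K \<theta>))\<^sup>2) = (LINT \<theta>|tor. (\<Sum>N<K. \<Sum>N'<K. (b N * cnj (b N')) * (psi \<theta> N * cnj (psi \<theta> N'))))"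
      unfolding integral_complex_of_real[symmetric] e ..
    also have "\<dots> = (\<Sum>N<K. \<Sum>N'<K. (b N * cnj (b N')) * (LINT \<theta>|tor. psi \<theta> N * cnj (psi \<theta> N')))"
      by (simp only: Bochner_Integration.integral_sum Bochner_Integration.integrable_sum integrable_mult_right i integral_mult_right_zero)
    also have "\<dots> = (\<Sum>N<K. \<Sum>N'<K. if N = N' then b N * cnj (b N) else 0)"
    proof (intro sum.cong refl)
      fix N N'
      show "(b N * cnj (b N')) * (LINT \<theta>|tor. psi \<theta> N * cnj (psi \<theta> N')) = (if N = N' then b N * cnj (b N) else 0)"
        using psi_orthogonal[of N N'] b(2)[of N] b(2)[of N'] by (cases "N \<in> M \<and> N' \<in> M") auto
    qed
    also have "\<dots> = complex_of_real (\<Sum>N<K. (cmod (b N))\<^sup>2)"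
      by (simp add: sum.delta complex_norm_square del: of_real_power)
    finally show ?thesis unfolding of_real_eq_iff .
  qed
  have "(\<lambda>K. LINT \<theta>|tor. (cmod (F K \<theta>))\<^sup>2) \<longlonglongrightarrow> (LINT \<theta>|tor. (cmod (\<Sum>N. b N * psi \<theta> N))\<^sup>2)"
  proof (rule integral_dominated_convergence[where w = "\<lambda>_. B\<^sup>2"])
    show "(\<lambda>\<theta>. (cmod (\<Sum>N. b N * psi \<theta> N))\<^sup>2) \<in> borel_measurable tor"
      using borel_measurable_LIMSEQ_metric[OF Fm lim] by measurable
    show "AE \<theta> in tor. (\<lambda>K. (cmod (F K \<theta>))\<^sup>2) \<longlonglongrightarrow> (cmod (\<Sum>N. b N * psi \<theta> N))\<^sup>2"
      by (intro AE_I2 tendsto_intros lim)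
    show "AE \<theta> in tor. norm ((cmod (F K \<theta>))\<^sup>2) \<le> B\<^sup>2" for K
      using FB[of K] by (intro AE_I2) (simp add: power_mono)
  qed auto
  then show ?thesis unfolding fin sums_def .
qed

lemma psi_shift: "psi (\<lambda>j. \<theta> j + s) N = cis (s * deg N) * psi \<theta> N"
proof -
  have "(\<Sum>j<d. real (al N j) * (\<theta> j + s)) = s * deg N + (\<Sum>j<d. real (al N j) * \<theta> j)"
  proof -
    have "(\<Sum>j<d. real (al N j) * (\<theta> j + s)) = (\<Sum>j<d. s * real (al N j) + real (al N j) * \<theta> j)"
      by (rule sum.cong) (auto simp: algebra_simps)
    then show ?thesis by (simp add: deg_def sum.distrib sum_distrib_left)
  qed
  then show ?thesis by (simp add: psi_def cis_mult)
qed

text \<open>The angle \<open>s\<close> rotates all coordinates at once. It does not change square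
  means over the torus, but for fixed \<open>\<theta>\<close> it makes \<open>W\<close> run through
  the boundary values of the one-variable polynomial \<open>slice \<theta>\<close>.\<close>

definition "W = (\<lambda>(\<theta>, s). Phi (\<lambda>j. \<theta> j + s))"
definition "Q = tor \<Otimes>\<^sub>M circ"
definition "Kb = cmod w0 + (\<Sum>n\<in>S. cmod (c n))"
definition "slice \<theta> z = w0 + (\<Sum>n\<in>S. c n * psi \<theta> n * z ^ deg n)"

lemma W_slice: "W (\<theta>, s) = slice \<theta> (cis s)"
  by (simp add: W_def Phi_def slice_def psi_shift Complex.DeMoivre mult_ac)

lemma deg_pos: "n \<in> S \<Longrightarrow> 0 < deg n"
proof (rule ccontr)
  assume n: "n \<in> S" "\<not> 0 < deg n"
  then have "n = 1" using M_eq[OF S_M[OF n(1)]] by (simp add: deg_def)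
  then show False using S_ge[OF n(1)] by simp
qed

lemma slice_0: "slice \<theta> 0 = w0"
proof -
  have "(\<Sum>n\<in>S. c n * psi \<theta> n * 0 ^ deg n) = 0"
    by (rule sum.neutral) (auto dest!: deg_pos)
  then show ?thesis by (simp add: slice_def)
qed

lemma slice_holomorphic: "slice \<theta> holomorphic_on A"
  unfolding slice_def by (intro holomorphic_intros)

lemma slice_continuous: "continuous_on A (slice \<theta>)"
  unfolding slice_def by (intro continuous_intros)

lemma W_measurable [measurable]: "W \<in> borel_measurable Q"
proof -
  have "W = (\<lambda>p. w0 + (\<Sum>n\<in>S. c n * (cis (snd p * real (deg n)) * psi (fst p) n)))"
    by (auto simp: W_def Phi_def psi_shift fun_eq_iff)
  also have "\<dots> \<in> borel_measurable Q" unfolding Q_def by measurable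
  finally show ?thesis .
qed

lemma cmod_Phi: "cmod (Phi \<theta>) \<le> Kb"
  unfolding Phi_def Kb_def
  by (rule order.trans[OF norm_triangle_ineq add_mono[OF order.refl order.trans[OF norm_sum]]]) (simp add: norm_mult)

lemma cmod_W: "cmod (W x) \<le> Kb" by (cases x) (simp add: W_def cmod_Phi)

lemma prob_space_Q: "prob_space Q"
proof -
  interpret T: prob_space tor by (rule prob_space_torus)
  interpret P: pair_prob_space tor circ ..
  show ?thesis unfolding Q_def by (rule P.prob_space_axioms)
qed

text \<open>Cauchy's mean value formula on each slice; the value at the centre is the same for all
  slices, since every frequency has positive degree.\<close>

lemma mean_exp_W: "(LINT x|Q. exp (- W x * of_real l)) = exp (- w0 * of_real l)"
proof -
  interpret T: prob_space tor by (rule prob_space_torus)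
  interpret P: pair_prob_space tor circ ..
  interpret Q: prob_space Q by (rule prob_space_Q)
  have i: "integrable Q (\<lambda>x. exp (- W x * of_real l))"
  proof (rule Q.integrable_const_bound[where B = "exp (Kb * \<bar>l\<bar>)"])
    show "AE x in Q. norm (exp (- W x * of_real l)) \<le> exp (Kb * \<bar>l\<bar>)"
    proof (rule AE_I2)
      fix x
      have "- (Re (W x) * l) \<le> \<bar>Re (W x)\<bar> * \<bar>l\<bar>" by (metis abs_ge_minus_self abs_mult)
      also have "\<dots> \<le> Kb * \<bar>l\<bar>" using abs_Re_le_cmod[of "W x"] cmod_W[of x] by (intro mult_right_mono) auto
      finally show "norm (exp (- W x * of_real l)) \<le> exp (Kb * \<bar>l\<bar>)" by (simp add: norm_exp_eq_Re)
    qed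
  qed measurable
  have "(LINT x|Q. exp (- W x * of_real l)) = (LINT \<theta>|tor. (LINT s|circ. exp (- W (\<theta>, s) * of_real l)))"
    using P.integral_fst'[of "\<lambda>x. exp (- W x * of_real l)"] i by (simp add: Q_def)
  also have "\<dots> = (LINT \<theta>|tor. exp (- w0 * of_real l))"
  proof (rule Bochner_Integration.integral_cong[OF refl])
    fix \<theta>
    have "(LINT s|circ. exp (- slice \<theta> (cis s) * of_real l)) = exp (- slice \<theta> 0 * of_real l)"
      by (rule circ_mean_holomorphic) (intro continuous_intros slice_continuous holomorphic_intros slice_holomorphic)+
    then show "(LINT s|circ. exp (- W (\<theta>, s) * of_real l)) = exp (- w0 * of_real l)"
      by (simp add: W_slice slice_0)
  qed
  also have "\<dots> = exp (- w0 * of_real l)" using T.prob_space by simp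
  finally show ?thesis .
qed

lemma expsum_Phi:
  fixes a :: "nat \<Rightarrow> complex"
  assumes "finite A" "A \<subseteq> {1..}"
  shows "expsum A (\<lambda>n. a n / of_real (sqrt n)) (\<lambda>n. ln n) (Phi \<theta>) = (\<Sum>N. (\<Sum>n\<in>A. a n * dcoeff c n N) * psi \<theta> N)"
proof -
  have "(\<lambda>N. \<Sum>n\<in>A. a n * (dcoeff c n N * psi \<theta> N)) sums (\<Sum>n\<in>A. a n * (exp (- Phi \<theta> * of_real (ln n)) / of_real (sqrt n)))"
    by (intro sums_sum sums_mult dcoeff_psi_sums) (use assms(2) in auto)
  then show ?thesis by (simp add: expsum_def sums_iff sum_distrib_right mult.assoc)
qed

text \<open>The rotation by \<open>s\<close> multiplies each coefficient by a number of modulus 1,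
  so the left side does not depend on \<open>s\<close>. Invariance under rotation is thus obtained
  from Parseval.\<close>

lemma expsum_parseval:
  fixes a :: "nat \<Rightarrow> complex"
  assumes "finite A" "A \<subseteq> {1..}"
  shows "(\<lambda>N. (cmod (\<Sum>n\<in>A. a n * dcoeff c n N))\<^sup>2) sums
     (LINT \<theta>|tor. (cmod (expsum A (\<lambda>n. a n / of_real (sqrt n)) (\<lambda>n. ln n) (Phi (\<lambda>j. \<theta> j + s))))\<^sup>2)"
proof -
  define b where "b N = cis (s * deg N) * (\<Sum>n\<in>A. a n * dcoeff c n N)" for N
  have "summable (\<lambda>N. cmod (b N))"
  proof (rule summable_comparison_test)
    show "\<exists>N0. \<forall>N\<ge>N0. norm (cmod (b N)) \<le> (\<Sum>n\<in>A. cmod (a n) * cmod (dcoeff c n N))"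
    proof (intro exI allI impI)
      fix N
      have "cmod (\<Sum>n\<in>A. a n * dcoeff c n N) \<le> (\<Sum>n\<in>A. cmod (a n * dcoeff c n N))" by (rule norm_sum)
      then show "norm (cmod (b N)) \<le> (\<Sum>n\<in>A. cmod (a n) * cmod (dcoeff c n N))" by (simp add: b_def norm_mult)
    qed
    show "summable (\<lambda>N. \<Sum>n\<in>A. cmod (a n) * cmod (dcoeff c n N))"
      by (intro summable_sum summable_mult dcoeff_summable fin)
  qed
  from parseval[OF this] have "(\<lambda>N. (cmod (b N))\<^sup>2) sums (LINT \<theta>|tor. (cmod (\<Sum>N. b N * psi \<theta> N))\<^sup>2)"
    by (simp add: b_def dcoeff_M)
  moreover have "(\<Sum>N. b N * psi \<theta> N) = expsum A (\<lambda>n. a n / of_real (sqrt n)) (\<lambda>n. ln n) (Phi (\<lambda>j. \<theta> j + s))" for \<theta>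
    unfolding expsum_Phi[OF assms] by (simp add: psi_shift b_def mult_ac)
  ultimately show ?thesis by (simp add: b_def norm_mult)
qed

end

lemma cis_lipschitz: "cmod (cis a - cis b) \<le> \<bar>a - b\<bar>"
proof -
  have "cis a - cis b = cis b * (cis (a - b) - 1)" by (simp add: cis_mult algebra_simps)
  then have "cmod (cis a - cis b) = cmod (exp (\<i> * of_real (a - b)) - 1)" by (simp add: norm_mult cis_conv_exp)
  also have "\<dots> \<le> \<bar>a - b\<bar>" using dist_exp_i_1[of "a - b"] abs_sin_x_le_abs_x[of "(a - b) / 2"] by simp
  finally show ?thesis .
qed

locale gh_data = bohr_data +
  assumes gh: "dpoly c ` half_plane 0 \<subseteq> half_plane (1/2)"
begin

section \<open>Positivity of the lift and boundedness of the operator\<close>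

lemma Re_dpoly: "0 < Re s \<Longrightarrow> 1/2 < Re (dpoly c s)"
  using gh unfolding half_plane_def by blast

lemma dpoly_flow:
  "dpoly c (of_real \<sigma> + \<i> * of_real \<tau>) - 1/2 = w0 + (\<Sum>n\<in>S. c n * (of_real (real n powr (- \<sigma>)) * psi (\<lambda>j. - \<tau> * ln (qs ! j)) n))"
proof -
  have "of_nat n powr (- (of_real \<sigma> + \<i> * of_real \<tau>)) = of_real (real n powr (- \<sigma>)) * psi (\<lambda>j. - \<tau> * ln (qs ! j)) n" if n: "n \<in> S" for n
  proof -
    have pos: "0 < n" using S_ge[OF n] by simp
    have "n = (\<Prod>q\<in>set qs. q ^ multi_index (set qs) n q)"
      using M_eq[OF S_M[OF n]] by (simp add: prod_qs al_def)
    moreover have "0 < q" if "q \<in> set qs" for q using indep(3) that by force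
    ultimately have "ln (real n) = (\<Sum>q\<in>set qs. real (multi_index (set qs) n q) * ln (real q))"
      using ln_prod_pow[OF indep(2), of "multi_index (set qs) n"] by metis
    then have l: "ln (real n) = (\<Sum>j<d. real (al n j) * ln (real (qs ! j)))"
      by (simp add: sum_qs al_def)
    have "of_nat n powr (- (of_real \<sigma> + \<i> * of_real \<tau>)) = exp (of_real (- \<sigma> * ln n)) * exp (\<i> * of_real (- \<tau> * ln n))"
      unfolding of_nat_powr_exp[OF pos] by (simp add: exp_add[symmetric] algebra_simps)
    also have "exp (of_real (- \<sigma> * ln n)) = of_real (real n powr (- \<sigma>))" using pos by (simp add: powr_def exp_of_real[symmetric] del: exp_of_real)
    also have "exp (\<i> * of_real (- \<tau> * ln n)) = psi (\<lambda>j. - \<tau> * ln (qs ! j)) n"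
      unfolding psi_def cis_conv_exp l by (simp add: sum_distrib_left mult_ac sum_negf)
    finally show ?thesis .
  qed
  then show ?thesis by (simp add: dpoly_def w0_def cong: sum.cong)
qed

text \<open>On the line of abscissa \<open>\<sigma> > 0\<close> the hypothesis applies; letting
  \<open>\<sigma>\<close> tend to 0 in the finite sum reaches the torus itself.\<close>

lemma Re_Phi_flow: "0 \<le> Re (Phi (\<lambda>j. - \<tau> * ln (qs ! j)))"
proof -
  let ?f = "\<lambda>k. Re (w0 + (\<Sum>n\<in>S. c n * (of_real (real n powr (- (1 / real (Suc k)))) * psi (\<lambda>j. - \<tau> * ln (qs ! j)) n)))"
  have "0 \<le> ?f k" for k
  proof -
    have "Re (dpoly c (of_real (1 / real (Suc k)) + \<i> * of_real \<tau>)) > 1/2" by (rule Re_dpoly) simp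
    then have "0 < Re (dpoly c (of_real (1 / real (Suc k)) + \<i> * of_real \<tau>) - 1/2)" by simp
    then show ?thesis unfolding dpoly_flow by simp
  qed
  moreover have "?f \<longlonglongrightarrow> Re (w0 + (\<Sum>n\<in>S. c n * (of_real (real n powr (- 0)) * psi (\<lambda>j. - \<tau> * ln (qs ! j)) n)))"
  proof (intro tendsto_intros)
    show "(\<lambda>k. 1 / real (Suc k)) \<longlonglongrightarrow> 0" by (rule LIMSEQ_Suc) (rule lim_1_over_n)
  qed (use S_ge in force)
  ultimately have "0 \<le> Re (w0 + (\<Sum>n\<in>S. c n * (of_real (real n powr (- 0)) * psi (\<lambda>j. - \<tau> * ln (qs ! j)) n)))"
    by (intro LIMSEQ_le_const) auto
  moreover have "real n powr (- 0) = 1" if "n \<in> S" for n using S_ge[OF that] by simp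
  ultimately show ?thesis by (simp add: Phi_def cong: sum.cong)
qed

lemma Phi_lipschitz: "cmod (Phi \<theta> - Phi \<theta>') \<le> (\<Sum>n\<in>S. cmod (c n) * (\<Sum>j<d. real (al n j) * \<bar>\<theta> j - \<theta>' j\<bar>))"
proof -
  have "Phi \<theta> - Phi \<theta>' = (\<Sum>n\<in>S. c n * (psi \<theta> n - psi \<theta>' n))"
    by (simp add: Phi_def right_diff_distrib sum_subtractf)
  also have "cmod \<dots> \<le> (\<Sum>n\<in>S. cmod (c n) * (\<Sum>j<d. real (al n j) * \<bar>\<theta> j - \<theta>' j\<bar>))"
  proof (rule order.trans[OF norm_sum sum_mono])
    fix n
    have "cmod (psi \<theta> n - psi \<theta>' n) \<le> \<bar>(\<Sum>j<d. real (al n j) * \<theta> j) - (\<Sum>j<d. real (al n j) * \<theta>' j)\<bar>"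
      unfolding psi_def by (rule cis_lipschitz)
    also have "\<dots> = \<bar>\<Sum>j<d. real (al n j) * (\<theta> j - \<theta>' j)\<bar>" by (simp add: right_diff_distrib sum_subtractf)
    also have "\<dots> \<le> (\<Sum>j<d. \<bar>real (al n j) * (\<theta> j - \<theta>' j)\<bar>)" by (rule sum_abs)
    finally show "cmod (c n * (psi \<theta> n - psi \<theta>' n)) \<le> cmod (c n) * (\<Sum>j<d. real (al n j) * \<bar>\<theta> j - \<theta>' j\<bar>)"
      unfolding norm_mult by (intro mult_left_mono) (simp_all add: abs_mult)
  qed
  finally show ?thesis .
qed

lemma psi_periodic: "psi (\<lambda>j. \<theta> j + 2 * pi * of_int (h j)) n = psi \<theta> n"
proof -
  have "(\<Sum>j<d. real (al n j) * (\<theta> j + 2 * pi * of_int (h j))) = (\<Sum>j<d. real (al n j) * \<theta> j) + 2 * pi * of_int (\<Sum>j<d. int (al n j) * h j)"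
    by (simp add: distrib_left sum.distrib sum_distrib_left mult_ac)
  then show ?thesis unfolding psi_def by (simp only: cis_mult[symmetric] cis_multiple_2pi[OF Ints_of_int] mult_1_right)
qed

text \<open>Kronecker's theorem approximates modulo 1, whereas angles are taken modulo
  \<open>2 pi\<close>; hence the division.\<close>

lemma log_independent_int:
  "module.independent (\<lambda>r. (*) (real_of_int r)) ((\<lambda>j. ln (qs ! j) / (2 * pi)) ` {..<d})"
  and log_inj: "inj_on (\<lambda>j. ln (qs ! j) / (2 * pi)) {..<d}"
proof -
  interpret V: Modules.module "\<lambda>r. (*) (real_of_int r)"
    by (simp add: Modules.module.intro distrib_left mult.commute)
  let ?l = "\<lambda>j. ln (real (qs ! j)) / (2 * pi)"
  show inj: "inj_on ?l {..<d}"
  proof (rule inj_onI)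
    fix i j assume ij: "i \<in> {..<d}" "j \<in> {..<d}" "?l i = ?l j"
    then have "0 < real (qs ! i)" "0 < real (qs ! j)" using qs_ge[of i] qs_ge[of j] by auto
    then have "qs ! i = qs ! j" using ij(3) by simp
    then show "i = j" using inj_qs ij by simp
  qed
  show "V.independent (?l ` {..<d})"
    unfolding V.independent_explicit_module
  proof (intro allI impI)
    fix t u v assume t: "finite t" "t \<subseteq> ?l ` {..<d}" "(\<Sum>v\<in>t. real_of_int (u v) * v) = 0" "v \<in> t"
    define k where "k q = (let l = ln (real q) / (2 * pi) in if l \<in> t then u l else 0)" for q :: nat
    have "(\<Sum>v\<in>t. real_of_int (u v) * v) = (\<Sum>v\<in>?l ` {..<d}. if v \<in> t then real_of_int (u v) * v else 0)"
      using t(2) by (subst sum.inter_restrict[symmetric]) (auto intro!: sum.cong)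
    also have "\<dots> = (\<Sum>j<d. if ?l j \<in> t then real_of_int (u (?l j)) * ?l j else 0)"
      by (subst sum.reindex[OF inj]) simp
    also have "\<dots> = (\<Sum>j<d. of_int (k (qs ! j)) * ln (real (qs ! j))) / (2 * pi)"
      unfolding sum_divide_distrib by (rule sum.cong) (auto simp: k_def Let_def)
    finally have "(\<Sum>j<d. of_int (k (qs ! j)) * ln (real (qs ! j))) = 0" using t(3) by simp
    then have "(\<Sum>q\<in>set qs. of_int (k q) * ln (real q)) = 0" unfolding sum_qs .
    from rat_independentD[OF indep this] have k0: "k q = 0" if "q \<in> set qs" for q using that by blast
    obtain j where j: "j < d" "v = ?l j" using t(2,4) by auto
    then have "k (qs ! j) = 0" by (intro k0) (simp add: d_def)
    then show "u v = 0" using t(4) j(2) by (simp add: k_def)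
  qed
qed

text \<open>By Kronecker's theorem the flow of \<open>Re_Phi_flow\<close> is dense in the torus, and
  the Lipschitz bound carries the inequality to all angles.\<close>

lemma Re_Phi_nonneg: "0 \<le> Re (Phi \<theta>)"
proof (rule ccontr)
  assume "\<not> 0 \<le> Re (Phi \<theta>)"
  then have neg: "Re (Phi \<theta>) < 0" by simp
  define C where "C = (\<Sum>n\<in>S. cmod (c n) * (\<Sum>j<d. real (al n j) * (2 * pi)))"
  have C: "0 \<le> C" by (auto simp: C_def intro!: sum_nonneg mult_nonneg_nonneg)
  \<comment> \<open>\<open>C \<epsilon>\<close> bounds the change of \<open>Phi\<close> between
    \<open>\<theta>\<close> and the approximating point; the \<open>+ 1\<close> makes it strictly
    smaller than the supposed negative excess.\<close>
  define \<epsilon> where "\<epsilon> = - Re (Phi \<theta>) / (C + 1)"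
  have \<epsilon>: "0 < \<epsilon>" using neg C unfolding \<epsilon>_def by (intro divide_pos_pos) auto
  obtain t h where th: "\<And>i. i < d \<Longrightarrow> \<bar>t * (ln (qs ! i) / (2 * pi)) - of_int (h i) - (- \<theta> i / (2 * pi))\<bar> < \<epsilon>"
  proof (rule Kronecker_thm_1[OF log_independent_int log_inj \<epsilon>, of "\<lambda>i. - \<theta> i / (2 * pi)"])
    fix t h assume "\<And>i. i < d \<Longrightarrow> \<bar>t * (ln (real (qs ! i)) / (2 * pi)) - real_of_int (h i) - - \<theta> i / (2 * pi)\<bar> < \<epsilon>"
    from that[OF this] show thesis .
  qed
  define \<theta>' where "\<theta>' j = - t * ln (qs ! j) + 2 * pi * of_int (h j)" for j
  have "Phi \<theta>' = Phi (\<lambda>j. - t * ln (qs ! j))"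
    unfolding Phi_def \<theta>'_def by (simp only: psi_periodic)
  then have "0 \<le> Re (Phi \<theta>')" using Re_Phi_flow by simp
  have close: "\<bar>\<theta> j - \<theta>' j\<bar> \<le> 2 * pi * \<epsilon>" if "j < d" for j
  proof -
    have "\<theta> j - \<theta>' j = 2 * pi * (t * (ln (qs ! j) / (2 * pi)) - of_int (h j) - (- \<theta> j / (2 * pi)))"
      by (simp add: \<theta>'_def right_diff_distrib distrib_left)
    then have "\<bar>\<theta> j - \<theta>' j\<bar> = 2 * pi * \<bar>t * (ln (qs ! j) / (2 * pi)) - of_int (h j) - (- \<theta> j / (2 * pi))\<bar>"
      by (simp only: abs_mult) simp
    then show ?thesis using th[OF that] by (simp add: less_imp_le)
  qed
  have "cmod (Phi \<theta> - Phi \<theta>') \<le> (\<Sum>n\<in>S. cmod (c n) * (\<Sum>j<d. real (al n j) * \<bar>\<theta> j - \<theta>' j\<bar>))" by (rule Phi_lipschitz)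
  also have "\<dots> \<le> (\<Sum>n\<in>S. cmod (c n) * (\<Sum>j<d. real (al n j) * (2 * pi * \<epsilon>)))"
    by (intro sum_mono mult_left_mono close) auto
  also have "\<dots> = C * \<epsilon>" by (simp add: C_def sum_distrib_right sum_distrib_left mult_ac)
  also have "\<dots> < - Re (Phi \<theta>)"
  proof -
    have "C * \<epsilon> < (C + 1) * \<epsilon>" using \<epsilon> by simp
    also have "\<dots> = - Re (Phi \<theta>)" using C by (simp add: \<epsilon>_def)
    finally show ?thesis .
  qed
  finally have "cmod (Phi \<theta> - Phi \<theta>') < - Re (Phi \<theta>)" .
  moreover have "Re (Phi \<theta>') - Re (Phi \<theta>) \<le> cmod (Phi \<theta> - Phi \<theta>')"
    using abs_Re_le_cmod[of "Phi \<theta> - Phi \<theta>'"] by simp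
  ultimately show False using \<open>0 \<le> Re (Phi \<theta>')\<close> by linarith
qed

text \<open>The Fourier coefficient of \<open>Re \<Phi>\<close> at a frequency \<open>n0\<close> is
  \<open>c n0 / 2\<close>. For a nonnegative function its modulus is at most the mean, here
  \<open>Re w0\<close>, so one nonzero coefficient forces strict positivity.\<close>

lemma Re_w0_pos: "0 < Re w0"
proof (cases "S = {}")
  case True
  then show ?thesis using Re_dpoly[of 1] by (simp add: dpoly_def w0_def)
next
  case False
  then obtain n0 where n0: "n0 \<in> S" by blast
  interpret T: prob_space tor by (rule prob_space_torus)
  have ip: "integrable tor (\<lambda>\<theta>. psi \<theta> n)" for n by (rule T.integrable_const_bound[where B = 1]) auto
  have Pm[measurable]: "Phi \<in> borel_measurable tor" unfolding Phi_def by measurable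
  have iP: "integrable tor (\<lambda>\<theta>. Phi \<theta>)" by (rule T.integrable_const_bound[where B = Kb]) (auto simp: cmod_Phi)
  have iPp: "integrable tor (\<lambda>\<theta>. Phi \<theta> * psi \<theta> n0)" "integrable tor (\<lambda>\<theta>. Phi \<theta> * cnj (psi \<theta> n0))"
    by (rule T.integrable_const_bound[where B = Kb]; simp add: norm_mult cmod_Phi)+
  have one: "1 \<in> M" "al 1 j = 0" if "j < d" for j
    using al_prod[OF that, of "\<lambda>_. 0"] by (auto simp: M_def intro!: image_eqI[of _ _ "\<lambda>_. 0"])
  have ch: "(LINT \<theta>|tor. cis (\<Sum>j<d. of_int (k j) * \<theta> j)) = (if \<forall>j<d. k j = 0 then 1 else 0)" for k
    using torus_character[of "{..<d}" k] by simp
  have ex: "\<exists>j<d. al n j \<noteq> 0" if "n \<in> S" for n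
    by (rule ccontr) (use deg_pos[OF that] in \<open>auto simp: deg_def\<close>)
  have p0: "(LINT \<theta>|tor. psi \<theta> n) = 0" if "n \<in> S" for n
    using ch[of "\<lambda>j. int (al n j)"] ex[OF that] by (auto simp: psi_def)
  have pp: "(LINT \<theta>|tor. psi \<theta> n * psi \<theta> n0) = 0" if "n \<in> S" for n
  proof -
    have "psi \<theta> n * psi \<theta> n0 = cis (\<Sum>j<d. of_int (int (al n j + al n0 j)) * \<theta> j)" for \<theta>
      by (simp add: psi_def cis_mult distrib_right sum.distrib)
    then show ?thesis using ch[of "\<lambda>j. int (al n j + al n0 j)"] ex[OF that] by auto
  qed
  have i2: "integrable tor (\<lambda>\<theta>. psi \<theta> n * psi \<theta> n0)" "integrable tor (\<lambda>\<theta>. psi \<theta> n * cnj (psi \<theta> n0))" for n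
    by (rule T.integrable_const_bound[where B = 1]; simp add: norm_mult)+
  have P1: "(LINT \<theta>|tor. Phi \<theta>) = w0"
    unfolding Phi_def using ip p0 T.prob_space by (subst Bochner_Integration.integral_add) (auto simp: Bochner_Integration.integral_sum)
  have P2: "(LINT \<theta>|tor. Phi \<theta> * psi \<theta> n0) = 0"
  proof -
    have "Phi \<theta> * psi \<theta> n0 = w0 * psi \<theta> n0 + (\<Sum>n\<in>S. c n * (psi \<theta> n * psi \<theta> n0))" for \<theta>
      by (simp add: Phi_def distrib_right sum_distrib_right mult.assoc)
    then show ?thesis using ip i2 pp p0[OF n0] by (simp add: Bochner_Integration.integral_sum)
  qed
  have P3: "(LINT \<theta>|tor. Phi \<theta> * cnj (psi \<theta> n0)) = c n0"
  proof -
    have "Phi \<theta> * cnj (psi \<theta> n0) = w0 * cnj (psi \<theta> n0) + (\<Sum>n\<in>S. c n * (psi \<theta> n * cnj (psi \<theta> n0)))" for \<theta>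
      by (simp add: Phi_def distrib_right sum_distrib_right mult.assoc)
    then have "(LINT \<theta>|tor. Phi \<theta> * cnj (psi \<theta> n0)) = w0 * cnj 0 + (\<Sum>n\<in>S. c n * (if n = n0 then 1 else 0))"
      using ip i2 p0[OF n0] psi_orthogonal[OF S_M S_M[OF n0]] by (simp add: Bochner_Integration.integral_sum)
    then show ?thesis using n0 fin by (simp add: sum.delta if_distrib cong: if_cong)
  qed
  have ReP: "of_real (Re (Phi \<theta>)) * cnj (psi \<theta> n0) = (Phi \<theta> * cnj (psi \<theta> n0) + cnj (Phi \<theta> * psi \<theta> n0)) / 2" for \<theta>
    by (simp add: complex_eq_iff)
  have "(LINT \<theta>|tor. cnj (Phi \<theta> * psi \<theta> n0)) = cnj 0"
    unfolding P2[symmetric] by (rule Bochner_Integration.integral_cnj)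
  then have "(LINT \<theta>|tor. of_real (Re (Phi \<theta>)) * cnj (psi \<theta> n0)) = (c n0 + cnj 0) / 2"
    unfolding ReP integral_divide_zero
    by (subst Bochner_Integration.integral_add[OF iPp(2) integrable_bounded_linear[OF bounded_linear_cnj iPp(1)]]) (simp only: P3)
  then have "(LINT \<theta>|tor. of_real (Re (Phi \<theta>)) * cnj (psi \<theta> n0)) = c n0 / 2" by (simp only: complex_cnj_zero add_0_right)
  then have "cmod (c n0) / 2 = cmod (LINT \<theta>|tor. of_real (Re (Phi \<theta>)) * cnj (psi \<theta> n0))"
    by (simp only: norm_divide norm_numeral)
  also have "\<dots> \<le> (LINT \<theta>|tor. cmod (of_real (Re (Phi \<theta>)) * cnj (psi \<theta> n0)))" by (rule integral_norm_bound)
  also have "\<dots> = (LINT \<theta>|tor. Re (Phi \<theta>))" using Re_Phi_nonneg by (simp add: norm_mult)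
  also have "\<dots> = Re w0" using integral_Re[OF iP] P1 by simp
  finally have "cmod (c n0) / 2 \<le> Re w0" .
  moreover have "0 < cmod (c n0)" using n0 by (simp add: spectrum_set_def)
  ultimately show ?thesis by linarith
qed

sublocale half_plane_variable Q W w0 Kb
proof -
  interpret Q: prob_space Q by (rule prob_space_Q)
  show "half_plane_variable Q W w0 Kb"
  proof
    show "0 \<le> Re (W x)" for x by (cases x) (simp add: W_def Re_Phi_nonneg)
    show "cmod w0 \<le> Kb" by (simp add: Kb_def sum_nonneg)
  qed (use W_measurable cmod_W Re_w0_pos mean_exp_W in auto)
qed

lemma expsum_Q:
  fixes a :: "nat \<Rightarrow> complex"
  assumes "finite A" "A \<subseteq> {1..}"
  shows "(\<Sum>N<k. (cmod (\<Sum>n\<in>A. a n * dcoeff c n N))\<^sup>2)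
      \<le> (LINT x|Q. (cmod (expsum A (\<lambda>n. a n / of_real (sqrt n)) (\<lambda>n. ln n) (W x)))\<^sup>2)"
proof -
  interpret T: prob_space tor by (rule prob_space_torus)
  interpret P: pair_prob_space tor circ ..
  define f where "f x = (cmod (expsum A (\<lambda>n. a n / of_real (sqrt (real n))) (\<lambda>n. ln (real n)) (W x)))\<^sup>2" for x
  have i: "integrable Q f" unfolding f_def by (rule integrable_expsum_square) (use assms in auto)
  have cp: "(\<lambda>(\<theta>, s). f (\<theta>, s)) = f" by (rule ext) (simp add: case_prod_beta)
  have "(LINT x|Q. f x) = (LINT s|circ. (LINT \<theta>|tor. f (\<theta>, s)))"
    using P.integral_snd[of "\<lambda>\<theta> s. f (\<theta>, s)"] i unfolding cp Q_def by simp
  also have "\<dots> = (LINT s|circ. (\<Sum>N. (cmod (\<Sum>n\<in>A. a n * dcoeff c n N))\<^sup>2))"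
    using expsum_parseval[OF assms, of a] by (simp add: f_def W_def sums_iff)
  also have "\<dots> = (\<Sum>N. (cmod (\<Sum>n\<in>A. a n * dcoeff c n N))\<^sup>2)" using circ.prob_space by simp
  finally show ?thesis
    using expsum_parseval[OF assms, of a] unfolding f_def by (simp add: sums_iff sum_le_suminf)
qed

sublocale comp: h2_composition "dpoly c" "dcoeff c" "2 / min 1 (Re w0)"
proof
  show "Re (dpoly c s) > 1/2" if "Re s > 1/2" for s
  proof -
    show ?thesis by (rule Re_dpoly) (use that in simp)
  qed
  show "dcoeff c n 0 = 0" for n by (rule dcoeff_M) (use M_pos in blast)
  show "summable (\<lambda>N. cmod (dcoeff c n N))" for n by (rule dcoeff_summable[OF fin])
  show "(\<lambda>N. dcoeff c n N * of_nat N powr (- s)) sums (of_nat n powr (- dpoly c s))" if "1 \<le> n" "Re s > 1/2" for n s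
    by (rule dcoeff_eval) (use that in auto)
  show "0 \<le> 2 / min 1 (Re w0)" using Re_w0_pos by simp
  show "(\<Sum>N<M. (cmod (\<Sum>n\<in>A. a n * dcoeff c n N))\<^sup>2) \<le> 2 / min 1 (Re w0) * (\<Sum>n\<in>A. (cmod (a n))\<^sup>2)"
    if "finite A" "A \<subseteq> {1..}" for A a M
    by (rule order.trans[OF expsum_Q[OF that] expsum_mean_bound[OF that]])
qed

text \<open>Maximum principle for \<open>exp (- slice)\<close>, of modulus at most 1 on the circle
  and less than 1 at the centre.\<close>

lemma Re_slice_pos:
  assumes "cmod z < 1"
  shows "0 < Re (slice \<theta> z)"
proof -
  define f where "f z = exp (- slice \<theta> z)" for z
  have hol: "f holomorphic_on A" for A unfolding f_def by (intro holomorphic_intros slice_holomorphic)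
  have cont: "continuous_on A f" for A unfolding f_def by (intro continuous_intros slice_continuous)
  have bd: "cmod (f z) \<le> 1" if "cmod z = 1" for z
  proof -
    have "z \<noteq> 0" using that by auto
    then have "z = cis (Arg z)" using cis_Arg[of z] that by (simp add: sgn_eq)
    then have "slice \<theta> z = Phi (\<lambda>j. \<theta> j + Arg z)" using W_slice[of \<theta> "Arg z"] by (simp add: W_def)
    then show ?thesis using Re_Phi_nonneg by (simp add: f_def norm_exp_eq_Re)
  qed
  have le: "cmod (f z) \<le> 1" if "z \<in> ball 0 1" for z
  proof (rule maximum_modulus_frontier[of f "ball 0 1"])
    show "cmod (f w) \<le> 1" if "w \<in> frontier (ball 0 1)" for w
      using that by (intro bd) (simp add: frontier_ball)
  qed (use hol cont that in auto)
  have "cmod (f z) \<noteq> 1"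
  proof
    assume eq: "cmod (f z) = 1"
    have "f constant_on ball 0 1"
    proof (rule maximum_modulus_principle[of f "ball 0 1" "ball 0 1" z])
      show "cmod (f w) \<le> cmod (f z)" if "w \<in> ball 0 1" for w using le[OF that] eq by simp
    qed (use hol assms in auto)
    then obtain k where "\<And>w. w \<in> ball 0 1 \<Longrightarrow> f w = k" unfolding constant_on_def by blast
    then have "f 0 = f z" using assms by simp
    then have "cmod (f 0) = 1" using eq by (simp only:)
    then show False using Re_w0_pos by (simp add: f_def slice_0 norm_exp_eq_Re)
  qed
  then have "cmod (f z) < 1" using le[of z] assms by simp
  then show ?thesis by (simp add: f_def norm_exp_eq_Re)
qed

text \<open>If almost no slice \<open>z \<mapsto> \<Phi>(z w)\<close> attains the value \<open>i t\<close> on the circle, then the positive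
  pluriharmonic function \<open>Re (1 / (\<Phi> - i t))\<close> is the Poisson integral of its boundary values.\<close>

lemma compact_if_slices_avoid:
  assumes avoid: "\<And>t. AE \<theta> in tor. \<forall>s. Phi (\<lambda>j. \<theta> j + s) \<noteq> \<i> * of_real t"
  shows "compact_operator (comp_op (dpoly c))"
proof -
  interpret T: prob_space tor by (rule prob_space_torus)
  interpret P: pair_prob_space tor circ ..
  \<comment> \<open>Tonelli's theorem for nonnegative functions: integrability of the kernel is not
    known beforehand and is itself deduced from this value.\<close>
  have nn: "(\<integral>\<^sup>+x. ennreal (pois (W x) t) \<partial>Q) = ennreal (pois w0 t)" for t
  proof -
    have m: "(\<lambda>x. pois (W x) t) \<in> borel_measurable Q" unfolding pois_eq by measurable
    have "(\<integral>\<^sup>+x. ennreal (pois (W x) t) \<partial>Q) = (\<integral>\<^sup>+\<theta>. \<integral>\<^sup>+s. ennreal (pois (W (\<theta>, s)) t) \<partial>circ \<partial>tor)"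
      using circ.nn_integral_fst[of "\<lambda>x. ennreal (pois (W x) t)" tor] m unfolding Q_def by simp
    also have "\<dots> = (\<integral>\<^sup>+\<theta>. ennreal (pois w0 t) \<partial>tor)"
    proof (rule nn_integral_cong_AE, rule AE_mp[OF avoid[of t]], rule AE_I2, rule impI)
      fix \<theta> assume av: "\<forall>s. Phi (\<lambda>j. \<theta> j + s) \<noteq> \<i> * of_real t"
      let ?g = "\<lambda>z. 1 / (slice \<theta> z - \<i> * of_real t)"
      have nz: "slice \<theta> z - \<i> * of_real t \<noteq> 0" if "z \<in> cball 0 1" for z
      proof (cases "cmod z < 1")
        case True
        then show ?thesis using Re_slice_pos[OF True, of \<theta>] by (auto simp: complex_eq_iff)
      next
        case False
        then have "cmod z = 1" using that by simp
        moreover from this have "z \<noteq> 0" by auto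
        ultimately have "z = cis (Arg z)" using cis_Arg[of z] by (simp add: sgn_eq)
        then have "slice \<theta> z = Phi (\<lambda>j. \<theta> j + Arg z)" using W_slice[of \<theta> "Arg z"] by (simp add: W_def)
        then show ?thesis using av by simp
      qed
      have gc: "continuous_on (cball 0 1) ?g" by (intro continuous_intros slice_continuous) (use nz in auto)
      have mean: "(LINT s|circ. ?g (cis s)) = ?g 0"
        by (rule circ_mean_holomorphic[OF gc]) (intro holomorphic_intros slice_holomorphic, use nz in auto)
      have cont: "continuous_on UNIV (\<lambda>s. ?g (cis s))"
        by (rule continuous_on_compose2[OF gc]) (auto intro!: continuous_intros)
      have "bounded (?g ` cball 0 1)"
        by (rule compact_imp_bounded[OF compact_continuous_image[OF gc compact_cball]])
      then obtain B where "\<forall>x\<in>?g ` cball 0 1. norm x \<le> B" unfolding bounded_iff by blast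
      then have B: "\<And>z. z \<in> cball 0 1 \<Longrightarrow> cmod (?g z) \<le> B" by blast
      have ig: "integrable circ (\<lambda>s. ?g (cis s))"
        by (rule circ.integrable_const_bound[where B = B]) (use B borel_measurable_continuous_onI[OF cont] in auto)
      have pe: "pois (W (\<theta>, s)) t = Re (?g (cis s))" for s by (simp add: W_slice pois_def)
      have "(LINT s|circ. pois (W (\<theta>, s)) t) = pois w0 t"
        unfolding pe integral_Re[OF ig] mean by (simp add: slice_0 pois_def)
      moreover have "integrable circ (\<lambda>s. pois (W (\<theta>, s)) t)" unfolding pe using ig by (rule integrable_Re)
      ultimately show "(\<integral>\<^sup>+s. ennreal (pois (W (\<theta>, s)) t) \<partial>circ) = ennreal (pois w0 t)"
        by (subst nn_integral_eq_integral) (auto simp: pois_nonneg W_def Re_Phi_nonneg)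
    qed
    also have "\<dots> = ennreal (pois w0 t)" using T.emeasure_space_1 by simp
    finally show ?thesis .
  qed
  have pm: "(\<lambda>x. pois (W x) t) \<in> borel_measurable Q" for t unfolding pois_eq by measurable
  have pn: "0 \<le> pois (W x) t" for x t by (cases x) (simp add: pois_nonneg W_def Re_Phi_nonneg)
  interpret C: compact_half_plane_variable Q W w0 Kb
  proof
    fix t
    show i: "integrable Q (\<lambda>x. pois (W x) t)"
      by (rule integrableI_nonneg[OF pm]) (auto simp: pn nn)
    have "ennreal (LINT x|Q. pois (W x) t) = ennreal (pois w0 t)"
      using nn_integral_eq_integral[OF i] nn[of t] pn by auto
    moreover have "0 \<le> (LINT x|Q. pois (W x) t)" by (rule Bochner_Integration.integral_nonneg) (rule pn)
    ultimately show "(LINT x|Q. pois (W x) t) = pois w0 t"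
      using pois_nonneg[of w0 t] Re_w0_pos by (simp add: ennreal_inj)
  qed
  show ?thesis
  proof (rule comp.compact_comp_op)
    fix \<epsilon> :: real assume "0 < \<epsilon>"
    from C.compact_estimate[OF this] obtain N0 where N0: "\<And>A a. finite A \<Longrightarrow> A \<subseteq> {max 1 N0..} \<Longrightarrow>
      (LINT x|Q. (cmod (expsum A (\<lambda>n. a n / of_real (sqrt (real n))) (\<lambda>n. ln (real n)) (W x)))\<^sup>2)
         \<le> \<epsilon> * (\<Sum>n\<in>A. (cmod (a n))\<^sup>2)" by blast
    show "\<exists>N0. \<forall>A a M. finite A \<longrightarrow> A \<subseteq> {max 1 N0..} \<longrightarrow>
        (\<Sum>N<M. (cmod (\<Sum>n\<in>A. a n * dcoeff c n N))\<^sup>2) \<le> \<epsilon> * (\<Sum>n\<in>A. (cmod (a n))\<^sup>2)"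
    proof (intro exI allI impI)
      fix A a M assume A: "finite A" "A \<subseteq> {max 1 N0..}"
      then have A1: "A \<subseteq> {1..}" by auto
      show "(\<Sum>N<M. (cmod (\<Sum>n\<in>A. a n * dcoeff c n N))\<^sup>2) \<le> \<epsilon> * (\<Sum>n\<in>A. (cmod (a n))\<^sup>2)"
        by (rule order.trans[OF expsum_Q[OF A(1) A1] N0[OF A]])
    qed
  qed
qed

end

section \<open>Boundary zeros of quadratic slices\<close>

lemma infinite_roots_zero_poly:
  fixes p :: "complex poly"
  assumes "infinite Z" "\<And>z. z \<in> Z \<Longrightarrow> poly p z = 0"
  shows "p = 0"
proof (rule ccontr)
  assume "p \<noteq> 0"
  then have "finite {z. poly p z = 0}" by (rule poly_roots_finite)
  moreover have "Z \<subseteq> {z. poly p z = 0}" using assms(2) by blast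
  ultimately show False using assms(1) finite_subset by blast
qed

text \<open>On the unit circle \<open>cnj z = 1 / z\<close>; the factor \<open>z\<close> clears the
  denominator, so that relations between moduli become polynomial equations.\<close>

lemma square_modulus_linear:
  assumes "cmod z = 1"
  shows "z * of_real ((cmod (b1 * z + b0))\<^sup>2) = poly [:cnj (b1 * cnj b0), of_real ((cmod b1)\<^sup>2 + (cmod b0)\<^sup>2), b1 * cnj b0:] z"
proof -
  have zz: "z * cnj z = 1" using complex_norm_square[of z] assms by simp
  have "z * of_real ((cmod (b1 * z + b0))\<^sup>2) = z * ((b1 * z + b0) * (cnj b1 * cnj z + cnj b0))"
    unfolding complex_norm_square by (simp only: complex_cnj_add complex_cnj_mult)
  also have "\<dots> = (b1 * cnj b1 * (z * cnj z) + b0 * cnj b0) * z + b0 * cnj b1 * (z * cnj z) + b1 * cnj b0 * z * z"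
    by Groebner_Basis.algebra
  finally show ?thesis unfolding zz of_real_add complex_norm_square by (simp add: algebra_simps)
qed

lemma square_modulus_quadratic:
  assumes "cmod z = 1"
  shows "z\<^sup>2 * of_real ((cmod (a2 * z\<^sup>2 + a1 * z + a0))\<^sup>2)
    = poly [:cnj (a2 * cnj a0), cnj (a2 * cnj a1 + a1 * cnj a0), of_real ((cmod a2)\<^sup>2 + (cmod a1)\<^sup>2 + (cmod a0)\<^sup>2),
            a2 * cnj a1 + a1 * cnj a0, a2 * cnj a0:] z"
proof -
  define w where "w = cnj z"
  have zz: "z * w = 1" using complex_norm_square[of z] assms by (simp add: w_def)
  have "z\<^sup>2 * of_real ((cmod (a2 * z\<^sup>2 + a1 * z + a0))\<^sup>2) = z\<^sup>2 * ((a2 * z\<^sup>2 + a1 * z + a0) * (cnj a2 * w\<^sup>2 + cnj a1 * w + cnj a0))"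
    unfolding complex_norm_square w_def by (simp only: complex_cnj_add complex_cnj_mult complex_cnj_power)
  also have "\<dots> = a0 * cnj a2 + (a1 * cnj a2 + a0 * cnj a1) * z + (a2 * cnj a2 + a1 * cnj a1 + a0 * cnj a0) * z\<^sup>2
      + (a2 * cnj a1 + a1 * cnj a0) * z ^ 3 + a2 * cnj a0 * z ^ 4"
    using zz by Groebner_Basis.algebra
  finally show ?thesis unfolding of_real_add complex_norm_square
    by (simp add: algebra_simps power2_eq_square power3_eq_cube power4_eq_xxxx)
qed

text \<open>A zero on the unit circle at which the real part is stationary along the circle, as it
  is at a boundary minimum; the second condition is the vanishing angular derivative.\<close>

definition quad_root :: "complex \<Rightarrow> complex \<Rightarrow> complex \<Rightarrow> bool" where
  "quad_root \<gamma> b a \<longleftrightarrow> (\<exists>l. cmod l = 1 \<and> \<gamma> + b * l + a * l\<^sup>2 = 0 \<and> Im (b * l + 2 * a * l\<^sup>2) = 0)"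

text \<open>Stationarity makes \<open>k = - (b l + 2 a l^2)\<close> real, and then
  \<open>b l = k - 2 \<gamma>\<close> and \<open>a l^2 = \<gamma> - k\<close>. Moduli eliminate
  \<open>l\<close>, and the difference of the two squared moduli is linear in
  \<open>k\<close>.\<close>

lemma quad_rootD:
  assumes "quad_root \<gamma> b a"
  shows "\<exists>k::real. (cmod b)\<^sup>2 = k\<^sup>2 - 4 * k * Re \<gamma> + 4 * (cmod \<gamma>)\<^sup>2 \<and>
    2 * k * Re \<gamma> = 3 * (cmod \<gamma>)\<^sup>2 - (cmod b)\<^sup>2 + (cmod a)\<^sup>2 \<and>
    a * (of_real k - 2 * \<gamma>)\<^sup>2 = (\<gamma> - of_real k) * b\<^sup>2"
proof -
  obtain l where l: "cmod l = 1" "\<gamma> + b * l + a * l\<^sup>2 = 0" "Im (b * l + 2 * a * l\<^sup>2) = 0"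
    using assms unfolding quad_root_def by blast
  define k where "k = - Re (b * l + 2 * a * l\<^sup>2)"
  have k: "b * l + 2 * a * l\<^sup>2 = - of_real k" using l(3) by (simp add: k_def complex_eq_iff)
  have bl: "b * l = of_real k - 2 * \<gamma>" and al: "a * l\<^sup>2 = \<gamma> - of_real k"
    using k l(2) by Groebner_Basis.algebra+
  have "cmod b = cmod (of_real k - 2 * \<gamma>)" unfolding bl[symmetric] by (simp add: norm_mult l(1))
  then have nb: "(cmod b)\<^sup>2 = k\<^sup>2 - 4 * k * Re \<gamma> + 4 * (cmod \<gamma>)\<^sup>2"
    by (simp only: cmod_power2) (simp add: power2_eq_square algebra_simps)
  have "cmod a = cmod (\<gamma> - of_real k)" unfolding al[symmetric] by (simp add: norm_mult norm_power l(1))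
  then have na: "(cmod a)\<^sup>2 = k\<^sup>2 - 2 * k * Re \<gamma> + (cmod \<gamma>)\<^sup>2"
    by (simp only: cmod_power2) (simp add: power2_eq_square algebra_simps)
  have "a * (of_real k - 2 * \<gamma>)\<^sup>2 = (\<gamma> - of_real k) * b\<^sup>2"
    unfolding bl[symmetric] al[symmetric] by (simp add: power_mult_distrib)
  with nb na show ?thesis by (intro exI[of _ k]) auto
qed

text \<open>For \<open>\<bar>z\<bar> = 1\<close> all moduli are trigonometric polynomials in \<open>z\<close>; eliminating the root, \<open>\<bar>b1 z + b0\<bar>\<^sup>2\<close>
  is a quadratic expression in a trigonometric polynomial, hence of even degree.\<close>

lemma quad_root_slice_linear:
  assumes inf: "infinite Z" and Z: "\<And>z. z \<in> Z \<Longrightarrow> cmod z = 1 \<and> quad_root \<gamma> (b1 * z + b0) (a2 * z\<^sup>2 + a1 * z + a0)"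
    and \<gamma>: "0 < Re \<gamma>"
  shows "b1 * b0 = 0"
proof -
  define x where "x = complex_of_real (Re \<gamma>)"
  have x: "x \<noteq> 0" using \<gamma> by (simp add: x_def)
  define g where "g = complex_of_real ((cmod \<gamma>)\<^sup>2)"
  define B0 where "B0 = complex_of_real ((cmod b1)\<^sup>2 + (cmod b0)\<^sup>2)"
  define B1 where "B1 = b1 * cnj b0"
  define A0 where "A0 = complex_of_real ((cmod a2)\<^sup>2 + (cmod a1)\<^sup>2 + (cmod a0)\<^sup>2)"
  define A1 where "A1 = a2 * cnj a1 + a1 * cnj a0"
  define A2 where "A2 = a2 * cnj a0"
  define K0 where "K0 = 3 * g - B0 + A0"
  define K1 where "K1 = A1 - B1"
  define K1' where "K1' = cnj A1 - cnj B1"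
  define kp where "kp = [:cnj A2, K1', K0, K1, A2:]"
  define bp where "bp = [:cnj B1, B0, B1:]"
  \<comment> \<open>On \<open>Z\<close> the factors are \<open>kp = z^2 (2 k x)\<close> and
    \<open>bp = z |b1 z + b0|^2\<close>, so \<open>p\<close> is \<open>4 x^2 z^4\<close> times the
    first relation of \<open>quad_rootD\<close>, with all terms on one side.\<close>
  define p where "p = kp * kp - [:0, 0, 8 * x\<^sup>2:] * kp + [:0, 0, 0, 0, 16 * x\<^sup>2 * g:] - [:0, 0, 0, 4 * x\<^sup>2:] * bp"
  have "poly p z = 0" if "z \<in> Z" for z
  proof -
    have z: "cmod z = 1" "quad_root \<gamma> (b1 * z + b0) (a2 * z\<^sup>2 + a1 * z + a0)" using Z[OF that] by auto
    define \<beta> where "\<beta> = (cmod (b1 * z + b0))\<^sup>2"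
    define \<alpha> where "\<alpha> = (cmod (a2 * z\<^sup>2 + a1 * z + a0))\<^sup>2"
    obtain k :: real where k: "\<beta> = k\<^sup>2 - 4 * k * Re \<gamma> + 4 * (cmod \<gamma>)\<^sup>2" "2 * k * Re \<gamma> = 3 * (cmod \<gamma>)\<^sup>2 - \<beta> + \<alpha>"
      using quad_rootD[OF z(2)] unfolding \<alpha>_def \<beta>_def by blast
    define K B A where "K = complex_of_real k" "B = complex_of_real \<beta>" "A = complex_of_real \<alpha>"
    note KBA = this
    have k1: "B = K\<^sup>2 - 4 * K * x + 4 * g" using arg_cong[OF k(1), of complex_of_real] by (simp add: KBA x_def g_def)
    have k2: "2 * K * x = 3 * g - B + A" using arg_cong[OF k(2), of complex_of_real] by (simp add: KBA x_def g_def)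
    have pb: "z * B = poly bp z"
      unfolding KBA \<beta>_def bp_def B0_def B1_def by (rule square_modulus_linear[OF z(1)])
    have pa: "z\<^sup>2 * A = poly [:cnj A2, cnj A1, A0, A1, A2:] z"
      unfolding KBA \<alpha>_def A0_def A1_def A2_def by (rule square_modulus_quadratic[OF z(1)])
    have "poly kp z = z\<^sup>2 * (3 * g) - z * poly bp z + poly [:cnj A2, cnj A1, A0, A1, A2:] z"
      by (simp add: kp_def bp_def K0_def K1_def K1'_def algebra_simps power2_eq_square)
    also have "\<dots> = z\<^sup>2 * (2 * K * x)" unfolding pb[symmetric] pa[symmetric] k2 by (simp add: algebra_simps power2_eq_square)
    finally have pk: "poly kp z = z\<^sup>2 * (2 * K * x)" .
    have "poly p z = (poly kp z)\<^sup>2 - 8 * x\<^sup>2 * z\<^sup>2 * poly kp z + 16 * x\<^sup>2 * g * z ^ 4 - 4 * x\<^sup>2 * z ^ 3 * poly bp z"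
      by (simp add: p_def power2_eq_square power3_eq_cube power4_eq_xxxx algebra_simps)
    also have "\<dots> = 4 * x\<^sup>2 * z ^ 4 * (K\<^sup>2 - 4 * K * x + 4 * g - B)"
      unfolding pk pb[symmetric] by Groebner_Basis.algebra
    also have "\<dots> = 0" unfolding k1 by simp
    finally show ?thesis .
  qed
  then have p0: "p = 0" using infinite_roots_zero_poly[OF inf] by blast
  \<comment> \<open>The degrees 8, 6 and 5 annihilate \<open>A2\<close>, \<open>K1\<close> and
    \<open>B1\<close> in turn: once the first two are gone, only \<open>- 4 x^2 B1\<close> is left
    in degree 5.\<close>
  have c: "coeff p 8 = A2 * A2" "coeff p 6 = K1 * K1 + 2 * K0 * A2 - 8 * x\<^sup>2 * A2"
    "coeff p 5 = 2 * K0 * K1 + 2 * A2 * K1' - 8 * x\<^sup>2 * K1 - 4 * x\<^sup>2 * B1"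
    by (simp_all add: p_def kp_def bp_def eval_nat_numeral algebra_simps)
  have "A2 = 0" using c(1) p0 by simp
  then have "K1 = 0" using c(2) p0 by simp
  then have "B1 = 0" using c(3) p0 \<open>A2 = 0\<close> x by simp
  then show ?thesis by (simp add: B1_def)
qed

text \<open>Here \<open>|b|\<close> is constant, so \<open>k\<close> is a root of a fixed quadratic
  and takes finitely many values. For each of them \<open>z\<close> is a root of a polynomial that
  is nonzero as soon as \<open>a1\<close> or \<open>a0\<close> is; the value
  \<open>k = 2 \<gamma>\<close> would force \<open>b1 = 0\<close>.\<close>

lemma quad_root_slice_monomial:
  assumes inf: "infinite Z" and Z: "\<And>z. z \<in> Z \<Longrightarrow> cmod z = 1 \<and> quad_root \<gamma> (b1 * z) (a2 * z\<^sup>2 + a1 * z + a0)"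
    and b1: "b1 \<noteq> 0"
  shows "a1 = 0 \<and> a0 = 0"
proof (rule ccontr)
  assume nz: "\<not> (a1 = 0 \<and> a0 = 0)"
  define q where "q = [:4 * (cmod \<gamma>)\<^sup>2 - (cmod b1)\<^sup>2, - 4 * Re \<gamma>, 1:]"
  have "q \<noteq> 0" by (simp add: q_def)
  then have fq: "finite {k. poly q k = 0}" by (rule poly_roots_finite)
  define r where "r k = [:a0 * (of_real k - 2 * \<gamma>)\<^sup>2, a1 * (of_real k - 2 * \<gamma>)\<^sup>2, a2 * (of_real k - 2 * \<gamma>)\<^sup>2 - (\<gamma> - of_real k) * b1\<^sup>2:]" for k :: real
  have "Z \<subseteq> (\<Union>k\<in>{k. poly q k = 0 \<and> of_real k - 2 * \<gamma> \<noteq> 0}. {z. poly (r k) z = 0})"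
  proof
    fix z assume "z \<in> Z"
    then have z: "cmod z = 1" "quad_root \<gamma> (b1 * z) (a2 * z\<^sup>2 + a1 * z + a0)" using Z by auto
    obtain k :: real where k: "(cmod (b1 * z))\<^sup>2 = k\<^sup>2 - 4 * k * Re \<gamma> + 4 * (cmod \<gamma>)\<^sup>2"
      "(a2 * z\<^sup>2 + a1 * z + a0) * (of_real k - 2 * \<gamma>)\<^sup>2 = (\<gamma> - of_real k) * (b1 * z)\<^sup>2"
      using quad_rootD[OF z(2)] by blast
    have kb: "(cmod b1)\<^sup>2 = k\<^sup>2 - 4 * k * Re \<gamma> + 4 * (cmod \<gamma>)\<^sup>2" using k(1) z(1) by (simp add: norm_mult)
    then have "poly q k = 0" by (simp add: q_def power2_eq_square algebra_simps)
    moreover have "of_real k - 2 * \<gamma> \<noteq> 0"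
    proof
      assume "of_real k - 2 * \<gamma> = 0"
      then have re: "Re \<gamma> = k / 2" and im: "Im \<gamma> = 0" by (auto simp: complex_eq_iff)
      have cg: "(cmod \<gamma>)\<^sup>2 = (k / 2)\<^sup>2" by (simp only: cmod_power2 re im) simp
      have "(cmod b1)\<^sup>2 = 0" unfolding kb re cg by (simp add: power2_eq_square)
      then show False using b1 by simp
    qed
    moreover have "poly (r k) z = 0" using k(2) by (simp add: r_def power2_eq_square algebra_simps)
    ultimately show "z \<in> (\<Union>k\<in>{k. poly q k = 0 \<and> of_real k - 2 * \<gamma> \<noteq> 0}. {z. poly (r k) z = 0})" by blast
  qed
  moreover have "finite (\<Union>k\<in>{k. poly q k = 0 \<and> of_real k - 2 * \<gamma> \<noteq> 0}. {z. poly (r k) z = 0})"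
  proof (rule finite_UN_I)
    show "finite {k. poly q k = 0 \<and> of_real k - 2 * \<gamma> \<noteq> 0}" by (rule finite_subset[OF _ fq]) auto
    fix k assume "k \<in> {k. poly q k = 0 \<and> of_real k - 2 * \<gamma> \<noteq> 0}"
    then have "r k \<noteq> 0" using nz by (auto simp: r_def)
    then show "finite {z. poly (r k) z = 0}" by (rule poly_roots_finite)
  qed
  ultimately show False using inf finite_subset by blast
qed

text \<open>Without a linear term, a root forces \<open>|a| = |\<gamma>|\<close>. If this holds
  infinitely often on the circle, it holds identically there, and a polynomial of constant modulus
  on the circle is a single monomial.\<close>

lemma quad_root_slice_homogeneous:
  assumes inf: "infinite Z" and Z: "\<And>z. z \<in> Z \<Longrightarrow> cmod z = 1 \<and> quad_root \<gamma> 0 (a2 * z\<^sup>2 + a1 * z + a0)"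
  shows "a2 * a0 = 0 \<and> a2 * a1 = 0 \<and> a1 * a0 = 0"
proof -
  define A1 where "A1 = a2 * cnj a1 + a1 * cnj a0"
  define A0 where "A0 = complex_of_real ((cmod a2)\<^sup>2 + (cmod a1)\<^sup>2 + (cmod a0)\<^sup>2)"
  define p where "p = [:cnj (a2 * cnj a0), cnj A1, A0, A1, a2 * cnj a0:] - [:0, 0, complex_of_real ((cmod \<gamma>)\<^sup>2):]"
  have "poly p z = 0" if "z \<in> Z" for z
  proof -
    have z: "cmod z = 1" using Z[OF that] by simp
    have "quad_root \<gamma> 0 (a2 * z\<^sup>2 + a1 * z + a0)" using Z[OF that] by simp
    then obtain l where l: "cmod l = 1" "\<gamma> + (a2 * z\<^sup>2 + a1 * z + a0) * l\<^sup>2 = 0"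
      unfolding quad_root_def by auto
    have "(a2 * z\<^sup>2 + a1 * z + a0) * l\<^sup>2 = - \<gamma>" using l(2) by (simp add: eq_neg_iff_add_eq_0 add.commute)
    then have "cmod (a2 * z\<^sup>2 + a1 * z + a0) * 1 = cmod \<gamma>"
      using arg_cong[of _ _ cmod] by (metis l(1) norm_minus_cancel norm_mult norm_power power_one)
    then have "z\<^sup>2 * of_real ((cmod \<gamma>)\<^sup>2) = poly [:cnj (a2 * cnj a0), cnj A1, A0, A1, a2 * cnj a0:] z"
      using square_modulus_quadratic[OF z, of a2 a1 a0] by (simp only: A1_def A0_def mult_1_right)
    moreover have "poly [:0, 0, complex_of_real ((cmod \<gamma>)\<^sup>2):] z = z\<^sup>2 * of_real ((cmod \<gamma>)\<^sup>2)"
      by (simp add: power2_eq_square)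
    ultimately show ?thesis by (simp only: p_def poly_diff) simp
  qed
  then have "p = 0" using infinite_roots_zero_poly[OF inf] by blast
  then have "a2 * cnj a0 = 0" "A1 = 0" by (simp_all add: p_def)
  then show ?thesis by (auto simp: A1_def)
qed

section \<open>Slices avoiding an imaginary value\<close>

text \<open>Two coordinates are integrated together because the exceptional set of the Hessian case
  is a union of curves: null in a plane of coordinates, but possibly not in a single coordinate
  direction.\<close>

lemma AE_torus_insert2:
  assumes I: "finite I" "l \<notin> I" "k \<notin> insert l I"
    and P: "{\<theta> \<in> space (PiM (insert k (insert l I)) (\<lambda>_::nat. circ)). P \<theta>} \<in> sets (PiM (insert k (insert l I)) (\<lambda>_. circ))"
    and ae: "\<And>\<theta>. \<theta> \<in> space (PiM I (\<lambda>_. circ)) \<Longrightarrow> AE y in circ. AE x in circ. P (\<theta>(l := y, k := x))"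
  shows "AE \<theta> in PiM (insert k (insert l I)) (\<lambda>_. circ). P \<theta>"
proof -
  let ?M = "PiM (insert k (insert l I)) (\<lambda>_::nat. circ)" and ?M' = "PiM (insert l I) (\<lambda>_::nat. circ)"
  define N where "N = {\<theta> \<in> space ?M. \<not> P \<theta>}"
  have N[measurable]: "N \<in> sets ?M"
  proof -
    have "N = space ?M - {\<theta> \<in> space ?M. P \<theta>}" by (auto simp: N_def)
    then show ?thesis using P by auto
  qed
  have fin: "finite (insert l I)" using I(1) by simp
  have m: "(\<lambda>\<theta>. \<integral>\<^sup>+x. indicator N (\<theta>(k := x)) \<partial>circ) \<in> borel_measurable ?M'"
    by measurable
  have "emeasure ?M N = (\<integral>\<^sup>+\<theta>. indicator N \<theta> \<partial>?M)" by simp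
  also have "\<dots> = (\<integral>\<^sup>+\<theta>. (\<integral>\<^sup>+x. indicator N (\<theta>(k := x)) \<partial>circ) \<partial>?M')"
    by (rule circs.product_nn_integral_insert[OF fin I(3)]) auto
  also have "\<dots> = (\<integral>\<^sup>+\<theta>. (\<integral>\<^sup>+y. (\<integral>\<^sup>+x. indicator N (\<theta>(l := y, k := x)) \<partial>circ) \<partial>circ) \<partial>PiM I (\<lambda>_. circ))"
    by (rule circs.product_nn_integral_insert[OF I(1,2) m])
  also have "\<dots> = (\<integral>\<^sup>+\<theta>. 0 \<partial>PiM I (\<lambda>_::nat. circ))"
  proof (rule nn_integral_cong)
    fix \<theta> assume \<theta>: "\<theta> \<in> space (PiM I (\<lambda>_::nat. circ))"
    have "(\<integral>\<^sup>+y. (\<integral>\<^sup>+x. indicator N (\<theta>(l := y, k := x)) \<partial>circ) \<partial>circ) = (\<integral>\<^sup>+y. 0 \<partial>circ)"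
    proof (rule nn_integral_cong_AE, rule AE_mp[OF ae[OF \<theta>]], rule AE_I2, rule impI)
      fix y assume "AE x in circ. P (\<theta>(l := y, k := x))"
      then have "(\<integral>\<^sup>+x. indicator N (\<theta>(l := y, k := x)) \<partial>circ) = (\<integral>\<^sup>+x. 0 \<partial>circ)"
        by (intro nn_integral_cong_AE) (auto simp: N_def indicator_def)
      then show "(\<integral>\<^sup>+x. indicator N (\<theta>(l := y, k := x)) \<partial>circ) = 0" by simp
    qed
    then show "(\<integral>\<^sup>+y. (\<integral>\<^sup>+x. indicator N (\<theta>(l := y, k := x)) \<partial>circ) \<partial>circ) = 0" by simp
  qed
  finally have "emeasure ?M N = 0" by simp
  then show ?thesis using N by (intro AE_I[of _ _ N]) (auto simp: N_def)
qed

lemma AE_circ_negligible: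
  fixes N :: "(real \<times> real) set"
  assumes "negligible N"
  shows "AE y in circ. AE x in circ. (y, x) \<notin> N"
proof -
  have "AE p in lebesgue. p \<notin> N" using assms by (intro AE_not_in) (simp add: negligible_iff_null_sets)
  then have "AE p in lborel \<Otimes>\<^sub>M (lborel :: real measure). p \<notin> N"
    unfolding lborel_prod AE_completion_iff .
  then have ae0: "AE y in lborel. AE x in lborel. (y, x) \<notin> N" by (rule lborel_pair.AE_pair)
  show ?thesis
  proof (rule AE_circI, rule AE_mp[OF ae0], rule AE_I2, rule impI)
    fix y :: real assume "AE x in lborel. (y, x) \<notin> N"
    then show "AE x in circ. (y, x) \<notin> N" by (rule AE_circI)
  qed
qed

lemma cis_Arg2pi_range: "\<exists>s'\<in>{0..2*pi}. cis s' = cis s"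
proof (intro bexI)
  show "cis (Arg2pi (cis s)) = cis s" using Arg2pi[of "cis s"] by (simp add: cis_conv_exp is_Arg_def)
  show "Arg2pi (cis s) \<in> {0..2*pi}" using Arg2pi[of "cis s"] by auto
qed

lemma has_derivative_Im_cis:
  assumes "(u has_derivative u') (at p)"
  shows "((\<lambda>p. Im (a * cis (u p))) has_derivative (\<lambda>v. Re (a * cis (u p)) * u' v)) (at p)"
proof -
  have "((\<lambda>p. Re a * sin (u p) + Im a * cos (u p)) has_derivative
     (\<lambda>v. Re a * (u' v * cos (u p)) + Im a * (- (u' v) * sin (u p)))) (at p)"
    using assms by (auto intro!: derivative_eq_intros)
  then show ?thesis by (simp add: algebra_simps)
qed

context gh_data
begin

lemma Phi_shift_cis: "cis s = cis s' \<Longrightarrow> Phi (\<lambda>j. \<theta> j + s) = Phi (\<lambda>j. \<theta> j + s')"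
  using W_slice[of \<theta> s] W_slice[of \<theta> s'] by (simp add: W_def)

lemma Phi_shift_measurable [measurable]: "(\<lambda>\<theta>. Phi (\<lambda>j. \<theta> j + s)) \<in> borel_measurable tor"
proof -
  have "(\<lambda>\<theta>. Phi (\<lambda>j. \<theta> j + s)) = (\<lambda>\<theta>. w0 + (\<Sum>n\<in>S. c n * (cis (s * deg n) * psi \<theta> n)))"
    by (simp add: Phi_def psi_shift)
  also have "\<dots> \<in> borel_measurable tor" by measurable
  finally show ?thesis .
qed

lemma Phi_shift_continuous: "continuous_on A (\<lambda>s. Phi (\<lambda>j. \<theta> j + s))"
  unfolding Phi_def psi_shift by (intro continuous_intros)

text \<open>By periodicity \<open>s\<close> may be confined to a compact interval, where
  \<open>measurable_ex_zero\<close> applies.\<close>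

lemma avoid_measurable: "{\<theta> \<in> space tor. \<forall>s. Phi (\<lambda>j. \<theta> j + s) \<noteq> \<i> * of_real t} \<in> sets tor"
proof -
  have "{\<theta> \<in> space tor. \<exists>s\<in>{0..2*pi}. cmod (Phi (\<lambda>j. \<theta> j + s) - \<i> * of_real t) = 0} \<in> sets tor"
    by (rule measurable_ex_zero) (auto intro!: continuous_intros Phi_shift_continuous)
  moreover have "{\<theta> \<in> space tor. \<forall>s. Phi (\<lambda>j. \<theta> j + s) \<noteq> \<i> * of_real t}
     = space tor - {\<theta> \<in> space tor. \<exists>s\<in>{0..2*pi}. cmod (Phi (\<lambda>j. \<theta> j + s) - \<i> * of_real t) = 0}"
  proof -
    have "(\<exists>s. Phi (\<lambda>j. \<theta> j + s) = \<i> * of_real t) \<longleftrightarrow> (\<exists>s\<in>{0..2*pi}. Phi (\<lambda>j. \<theta> j + s) = \<i> * of_real t)" for \<theta>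
      using cis_Arg2pi_range Phi_shift_cis by metis
    then show ?thesis by auto
  qed
  ultimately show ?thesis by auto
qed

text \<open>The coefficient of the \<open>k\<close>-th power of coordinate \<open>i\<close> in the
  homogeneous component of degree \<open>\<delta>\<close>, at the remaining angles; in a slice this
  component carries the power \<open>z^\<delta>\<close>.\<close>

definition part :: "nat \<Rightarrow> nat \<Rightarrow> nat \<Rightarrow> (nat \<Rightarrow> real) \<Rightarrow> complex" where
  "part i \<delta> k \<theta> = (\<Sum>n\<in>{n\<in>S. deg n = \<delta> \<and> al n i = k}. c n * cis (\<Sum>j\<in>{..<d}-{i}. real (al n j) * \<theta> j))"

lemma AE_part_nonzero:
  assumes "n \<in> S" "deg n = \<delta>" "al n i = k"
  shows "AE \<theta> in PiM ({..<d}-{i}) (\<lambda>_::nat. circ). part i \<delta> k \<theta> \<noteq> 0"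
  unfolding part_def
proof (rule AE_trig_sum_nonzero)
  fix x y assume x: "x \<in> {n\<in>S. deg n = \<delta> \<and> al n i = k}" and y: "y \<in> {n\<in>S. deg n = \<delta> \<and> al n i = k}" and "x \<noteq> y"
  then have "x \<in> M" "y \<in> M" using S_M by auto
  then obtain j where "j < d" "al x j \<noteq> al y j" using M_inj \<open>x \<noteq> y\<close> by blast
  then show "\<exists>j\<in>{..<d}-{i}. al x j \<noteq> al y j" using x y by (cases "j = i") auto
next
  show "finite {n\<in>S. deg n = \<delta> \<and> al n i = k}" using fin by simp
  show "{n\<in>S. deg n = \<delta> \<and> al n i = k} \<noteq> {}" using assms by blast
next
  fix x assume "x \<in> {n\<in>S. deg n = \<delta> \<and> al n i = k}"
  then show "c x \<noteq> 0" by (simp add: spectrum_set_def)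
qed auto

lemma al_le_deg: "j < d \<Longrightarrow> al n j \<le> deg n"
  unfolding deg_def by (rule member_le_sum) auto

lemma slice_quadratic:
  assumes deg2: "\<And>n. n \<in> S \<Longrightarrow> deg n \<le> 2" and i: "i < d"
  shows "slice (\<theta>(i := y)) z = w0 + (part i 1 1 \<theta> * cis y + part i 1 0 \<theta>) * z
      + (part i 2 2 \<theta> * (cis y)\<^sup>2 + part i 2 1 \<theta> * cis y + part i 2 0 \<theta>) * z\<^sup>2"
proof -
  let ?q = "\<lambda>n. cis (\<Sum>j\<in>{..<d}-{i}. real (al n j) * \<theta> j)"
  let ?T = "\<lambda>\<delta> k. {n\<in>S. deg n = \<delta> \<and> al n i = k}"
  have ps: "psi (\<theta>(i := y)) n = ?q n * cis y ^ al n i" for n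
  proof -
    have "(\<Sum>j<d. real (al n j) * (\<theta>(i := y)) j) = real (al n i) * y + (\<Sum>j\<in>{..<d}-{i}. real (al n j) * (\<theta>(i := y)) j)"
      using i by (subst sum.remove[of _ i]) auto
    also have "(\<Sum>j\<in>{..<d}-{i}. real (al n j) * (\<theta>(i := y)) j) = (\<Sum>j\<in>{..<d}-{i}. real (al n j) * \<theta> j)"
      by (rule sum.cong) auto
    finally show ?thesis by (simp add: psi_def cis_mult[symmetric] Complex.DeMoivre)
  qed
  have S_eq: "S = ?T 1 1 \<union> ?T 1 0 \<union> ?T 2 2 \<union> ?T 2 1 \<union> ?T 2 0"
  proof -
    have "(deg n = 1 \<and> (al n i = 1 \<or> al n i = 0)) \<or> (deg n = 2 \<and> (al n i = 2 \<or> al n i = 1 \<or> al n i = 0))" if "n \<in> S" for n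
      using deg2[OF that] deg_pos[OF that] al_le_deg[OF i, of n] by linarith
    then show ?thesis by (intro equalityI subsetI) (elim UnE CollectE conjE; simp; fail | blast)+
  qed
  let ?f = "\<lambda>n. c n * psi (\<theta>(i := y)) n * z ^ deg n"
  have ts: "(\<Sum>n\<in>?T \<delta> k. ?f n) = part i \<delta> k \<theta> * cis y ^ k * z ^ \<delta>" for \<delta> k
    unfolding part_def sum_distrib_right by (rule sum.cong) (auto simp: ps)
  have fT: "finite (?T \<delta> k)" for \<delta> k using fin by auto
  have "(\<Sum>n\<in>S. ?f n) = (\<Sum>n\<in>?T 1 1 \<union> ?T 1 0 \<union> ?T 2 2 \<union> ?T 2 1 \<union> ?T 2 0. ?f n)"
    using S_eq by simp
  also have "\<dots> = (\<Sum>n\<in>?T 1 1. ?f n) + (\<Sum>n\<in>?T 1 0. ?f n) + (\<Sum>n\<in>?T 2 2. ?f n) + (\<Sum>n\<in>?T 2 1. ?f n) + (\<Sum>n\<in>?T 2 0. ?f n)"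
    by (subst sum.union_disjoint; (auto intro: fT)?)+
  finally show ?thesis unfolding ts slice_def by (simp add: algebra_simps power2_eq_square)
qed

text \<open>For degree at most two, a point \<open>l\<close> of a slice where \<open>\<Phi> = i t\<close> is a boundary minimum of \<open>Re \<Phi>\<close>, so it
  solves two equations; these admit finitely many values of one further coordinate.\<close>

lemma avoid_quadratic:
  assumes deg2: "\<And>n. n \<in> S \<Longrightarrow> deg n \<le> 2" and d2: "2 \<le> d"
    and used: "\<And>j. j < d \<Longrightarrow> \<exists>n\<in>S. 0 < al n j"
    and two: "(\<And>n. n \<in> S \<Longrightarrow> deg n = 2) \<Longrightarrow> \<exists>n\<in>S. \<exists>n'\<in>S. n \<noteq> n'"
  shows "AE \<theta> in tor. \<forall>s. Phi (\<lambda>j. \<theta> j + s) \<noteq> \<i> * of_real t"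
proof -
  define \<gamma> where "\<gamma> = w0 - \<i> * of_real t"
  have \<gamma>: "0 < Re \<gamma>" using Re_w0_pos by (simp add: \<gamma>_def)
  \<comment> \<open>With the other angles fixed, the values of coordinate \<open>i\<close> for which
    the slice can attain \<open>i t\<close>; an \<open>i\<close> is sought for which they are almost
    surely finite in number.\<close>
  define Z where "Z i \<theta> = {z. cmod z = 1 \<and> quad_root \<gamma> (part i 1 1 \<theta> * z + part i 1 0 \<theta>) (part i 2 2 \<theta> * z\<^sup>2 + part i 2 1 \<theta> * z + part i 2 0 \<theta>)}" for i \<theta>
  have "\<exists>i<d. AE \<theta> in PiM ({..<d}-{i}) (\<lambda>_::nat. circ). finite (Z i \<theta>)"
  proof (cases "\<exists>n\<in>S. deg n = 1")
    case True
    then obtain n0 where n0: "n0 \<in> S" "deg n0 = 1" by blast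
    obtain i where i: "i < d" "al n0 i \<noteq> 0"
    proof -
      have "\<exists>i<d. al n0 i \<noteq> 0" by (rule ccontr) (use n0(2) in \<open>auto simp: deg_def\<close>)
      then show ?thesis using that by blast
    qed
    then have ai: "al n0 i = 1" using al_le_deg[OF i(1), of n0] n0(2) by simp
    have b1: "AE \<theta> in PiM ({..<d}-{i}) (\<lambda>_::nat. circ). part i 1 1 \<theta> \<noteq> 0" by (rule AE_part_nonzero[OF n0 ai])
    show ?thesis
    proof (cases "\<exists>n\<in>S. deg n = 1 \<and> al n i = 0")
      case True
      \<comment> \<open>A second linear term, free of coordinate \<open>i\<close>, makes both
        coefficients of the linear part almost surely nonzero.\<close>
      then obtain n1 where n1: "n1 \<in> S" "deg n1 = 1" "al n1 i = 0" by blast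
      have b0: "AE \<theta> in PiM ({..<d}-{i}) (\<lambda>_::nat. circ). part i 1 0 \<theta> \<noteq> 0" by (rule AE_part_nonzero[OF n1])
      have "AE \<theta> in PiM ({..<d}-{i}) (\<lambda>_::nat. circ). finite (Z i \<theta>)"
        using b1 b0
      proof eventually_elim
        case (elim \<theta>)
        show ?case
        proof (rule ccontr)
          assume inf: "infinite (Z i \<theta>)"
          have "part i 1 1 \<theta> * part i 1 0 \<theta> = 0"
            by (rule quad_root_slice_linear[OF inf, of \<gamma>, OF _ \<gamma>]) (unfold Z_def, blast)
          then show False using elim mult_eq_0_iff by blast
        qed
      qed
      then show ?thesis using i(1) by blast
    next
      case False
      \<comment> \<open>Coordinate \<open>i\<close> carries the only linear term. Another coordinate
        \<open>j\<close> must then occur in a quadratic monomial, which contains coordinate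
        \<open>i\<close> at most once and so contributes to \<open>part i 2 1\<close> or
        \<open>part i 2 0\<close>.\<close>
      then have b0: "part i 1 0 \<theta> = 0" for \<theta> unfolding part_def by (intro sum.neutral) auto
      obtain j where j: "j < d" "j \<noteq> i"
      proof -
        have "\<exists>j<d. j \<noteq> i" using d2 by (intro exI[of _ "if i = 0 then 1 else 0"]) auto
        then show ?thesis using that by blast
      qed
      obtain n1 where n1: "n1 \<in> S" "0 < al n1 j" using used[OF j(1)] by blast
      have sm: "al n1 i + al n1 j \<le> deg n1"
      proof -
        have "(\<Sum>k\<in>{i, j}. al n1 k) \<le> deg n1" unfolding deg_def by (rule sum_mono2) (use i j in auto)
        then show ?thesis using j(2) by simp
      qed
      have "deg n1 = 2"
      proof -
        have "deg n1 \<noteq> 1"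
        proof
          assume "deg n1 = 1"
          then have "al n1 i = 0" using sm n1(2) by linarith
          then show False using False n1(1) \<open>deg n1 = 1\<close> by blast
        qed
        then show ?thesis using deg2[OF n1(1)] deg_pos[OF n1(1)] by linarith
      qed
      then have "al n1 i = 0 \<or> al n1 i = 1" using sm n1(2) by linarith
      then have a: "AE \<theta> in PiM ({..<d}-{i}) (\<lambda>_::nat. circ). \<not> (part i 2 1 \<theta> = 0 \<and> part i 2 0 \<theta> = 0)"
      proof
        assume "al n1 i = 0"
        from AE_part_nonzero[OF n1(1) \<open>deg n1 = 2\<close> this] show ?thesis by (rule AE_mp) (rule AE_I2, blast)
      next
        assume "al n1 i = 1"
        from AE_part_nonzero[OF n1(1) \<open>deg n1 = 2\<close> this] show ?thesis by (rule AE_mp) (rule AE_I2, blast)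
      qed
      have "AE \<theta> in PiM ({..<d}-{i}) (\<lambda>_::nat. circ). finite (Z i \<theta>)"
        using b1 a
      proof eventually_elim
        case (elim \<theta>)
        show ?case
        proof (rule ccontr)
          assume inf: "infinite (Z i \<theta>)"
          have "part i 2 1 \<theta> = 0 \<and> part i 2 0 \<theta> = 0"
            by (rule quad_root_slice_monomial[OF inf, of \<gamma> "part i 1 1 \<theta>", OF _ elim(1)])
              (unfold Z_def b0 add_0_right, blast)
          then show False using elim by blast
        qed
      qed
      then show ?thesis using i(1) by blast
    qed
  next
    case False
    \<comment> \<open>In the homogeneous case, two different monomials differ in some coordinate,
      and two of the three quadratic coefficients are almost surely nonzero.\<close>
    then have dg: "deg n = 2" if "n \<in> S" for n proof -
      have "deg n \<noteq> 1" using False that by blast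
      then show ?thesis using deg2[OF that] deg_pos[OF that] by linarith
    qed
    obtain n n' where n: "n \<in> S" "n' \<in> S" "n \<noteq> n'" using two[OF dg] by blast
    obtain i where i: "i < d" "al n i \<noteq> al n' i" using M_inj[OF S_M[OF n(1)] S_M[OF n(2)]] n(3) by blast
    have b: "part i 1 k \<theta> = 0" for k \<theta> unfolding part_def by (rule sum.neutral) (use dg in auto)
    have ar: "al n i \<le> 2" "al n' i \<le> 2" using al_le_deg[OF i(1), of n] al_le_deg[OF i(1), of n'] dg n by auto
    have "AE \<theta> in PiM ({..<d}-{i}) (\<lambda>_::nat. circ). finite (Z i \<theta>)"
      using AE_part_nonzero[OF n(1) dg[OF n(1)] refl, of i] AE_part_nonzero[OF n(2) dg[OF n(2)] refl, of i]
    proof eventually_elim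
      case (elim \<theta>)
      have "al n i \<in> {0, 1, 2}" "al n' i \<in> {0, 1, 2}" using ar by auto
      then have "\<not> (part i 2 2 \<theta> * part i 2 0 \<theta> = 0 \<and> part i 2 2 \<theta> * part i 2 1 \<theta> = 0 \<and> part i 2 1 \<theta> * part i 2 0 \<theta> = 0)"
        using elim i(2) by auto
      note nz = this
      show ?case
      proof (rule ccontr)
        assume inf: "infinite (Z i \<theta>)"
        have "part i 2 2 \<theta> * part i 2 0 \<theta> = 0 \<and> part i 2 2 \<theta> * part i 2 1 \<theta> = 0 \<and> part i 2 1 \<theta> * part i 2 0 \<theta> = 0"
          by (rule quad_root_slice_homogeneous[OF inf, of \<gamma>]) (unfold Z_def b mult_zero_left add_0_right, blast)
        then show False using nz by blast
      qed
    qed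
    then show ?thesis using i(1) by blast
  qed
  then obtain i where i: "i < d" and fz: "AE \<theta> in PiM ({..<d}-{i}) (\<lambda>_::nat. circ). finite (Z i \<theta>)" by blast
  have ins: "insert i ({..<d}-{i}) = {..<d}" using i by auto
  have root: "cis y \<in> Z i \<theta>" if eq: "Phi (\<lambda>j. (\<theta>(i := y)) j + s) = \<i> * of_real t" for \<theta> y s
  proof -
    define b where "b = part i 1 1 \<theta> * cis y + part i 1 0 \<theta>"
    define a where "a = part i 2 2 \<theta> * (cis y)\<^sup>2 + part i 2 1 \<theta> * cis y + part i 2 0 \<theta>"
    have sl: "Phi (\<lambda>j. (\<theta>(i := y)) j + s) = w0 + b * cis s + a * (cis s)\<^sup>2" for s
      using W_slice[of "\<theta>(i := y)" s] slice_quadratic[OF deg2 i, of \<theta> y "cis s"] by (simp add: W_def b_def a_def)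
    define g where "g s = Re w0 + (Re b * cos s - Im b * sin s) + (Re a * cos (2 * s) - Im a * sin (2 * s))" for s
    have gs: "g s = Re (Phi (\<lambda>j. (\<theta>(i := y)) j + s))" for s
      unfolding sl g_def by (simp add: Complex.DeMoivre)
    have d: "(g has_real_derivative (- Re b * sin s - Im b * cos s - 2 * Re a * sin (2 * s) - 2 * Im a * cos (2 * s))) (at s)"
      unfolding g_def by (auto intro!: derivative_eq_intros)
    have "g s = 0" unfolding gs eq by simp
    then have "\<And>s'. g s \<le> g s'" unfolding gs using Re_Phi_nonneg by simp
    then have "- Re b * sin s - Im b * cos s - 2 * Re a * sin (2 * s) - 2 * Im a * cos (2 * s) = 0"
      by (intro DERIV_local_min[OF d, of 1]) auto
    then have "Im (b * cis s + 2 * a * (cis s)\<^sup>2) = 0" by (simp add: Complex.DeMoivre algebra_simps)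
    moreover have "\<gamma> + b * cis s + a * (cis s)\<^sup>2 = 0" using eq unfolding sl \<gamma>_def by (simp add: algebra_simps)
    ultimately have "quad_root \<gamma> b a" unfolding quad_root_def by (intro exI[of _ "cis s"]) simp
    then show ?thesis by (simp add: Z_def b_def a_def)
  qed
  have "AE \<theta> in PiM (insert i ({..<d}-{i})) (\<lambda>_::nat. circ). \<forall>s. Phi (\<lambda>j. \<theta> j + s) \<noteq> \<i> * of_real t"
  proof (rule AE_torus_insert)
    show "AE \<theta> in PiM ({..<d}-{i}) (\<lambda>_::nat. circ). AE y in circ. \<forall>s. Phi (\<lambda>j. (\<theta>(i := y)) j + s) \<noteq> \<i> * of_real t"
      using fz
    proof eventually_elim
      case (elim \<theta>)
      from AE_circ_cis_notin[OF elim] show ?case by (rule AE_mp) (rule AE_I2, use root in blast)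
    qed
    show "{\<theta> \<in> space (PiM (insert i ({..<d}-{i})) (\<lambda>_::nat. circ)). \<forall>s. Phi (\<lambda>j. \<theta> j + s) \<noteq> \<i> * of_real t} \<in> sets (PiM (insert i ({..<d}-{i})) (\<lambda>_::nat. circ))"
      unfolding ins by (rule avoid_measurable)
  qed auto
  then show ?thesis unfolding ins .
qed

section \<open>Zeros of the real part through its gradient and Hessian\<close>

definition hess :: "(nat \<Rightarrow> real) \<Rightarrow> nat \<Rightarrow> nat \<Rightarrow> real" where
  "hess \<theta> a b = - (\<Sum>n\<in>S. real (al n a) * real (al n b) * Re (c n * psi \<theta> n))"

definition grad :: "(nat \<Rightarrow> real) \<Rightarrow> nat \<Rightarrow> real" where
  "grad \<theta> a = - (\<Sum>n\<in>S. real (al n a) * Im (c n * psi \<theta> n))"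

lemma psi_update:
  assumes "a < d"
  shows "(\<Sum>j<d. real (al n j) * (\<theta>(a := x)) j) = real (al n a) * x + (\<Sum>j\<in>{..<d}-{a}. real (al n j) * \<theta> j)"
proof -
  have "(\<Sum>j<d. real (al n j) * (\<theta>(a := x)) j) = real (al n a) * x + (\<Sum>j\<in>{..<d}-{a}. real (al n j) * (\<theta>(a := x)) j)"
    using assms by (subst sum.remove[of _ a]) auto
  also have "(\<Sum>j\<in>{..<d}-{a}. real (al n j) * (\<theta>(a := x)) j) = (\<Sum>j\<in>{..<d}-{a}. real (al n j) * \<theta> j)"
    by (rule sum.cong) auto
  finally show ?thesis .
qed

lemma Re_Im_psi_deriv:
  assumes a: "a < d"
  shows "((\<lambda>x. Re (k * psi (\<theta>(a := x)) n)) has_real_derivative - (real (al n a) * Im (k * psi (\<theta>(a := x)) n))) (at x)"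
    and "((\<lambda>x. Im (k * psi (\<theta>(a := x)) n)) has_real_derivative (real (al n a) * Re (k * psi (\<theta>(a := x)) n))) (at x)"
  unfolding psi_def psi_update[OF a] by (auto intro!: derivative_eq_intros simp: algebra_simps)

lemma Re_Phi_deriv:
  assumes a: "a < d"
  shows "((\<lambda>x. Re (Phi (\<theta>(a := x)))) has_real_derivative grad (\<theta>(a := x)) a) (at x)"
proof -
  have "((\<lambda>x. Re w0 + (\<Sum>n\<in>S. Re (c n * psi (\<theta>(a := x)) n))) has_real_derivative (0 + (\<Sum>n\<in>S. - (real (al n a) * Im (c n * psi (\<theta>(a := x)) n))))) (at x)"
    by (intro DERIV_add DERIV_const DERIV_sum Re_Im_psi_deriv(1)[OF a])
  then show ?thesis by (simp add: Phi_def grad_def sum_negf)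
qed

lemma grad_deriv:
  assumes b: "b < d"
  shows "((\<lambda>x. grad (\<theta>(b := x)) a) has_real_derivative hess (\<theta>(b := x)) a b) (at x)"
proof -
  have "((\<lambda>x. - (\<Sum>n\<in>S. real (al n a) * Im (c n * psi (\<theta>(b := x)) n))) has_real_derivative
     - (\<Sum>n\<in>S. real (al n a) * (real (al n b) * Re (c n * psi (\<theta>(b := x)) n)))) (at x)"
    by (intro DERIV_minus DERIV_sum DERIV_cmult Re_Im_psi_deriv(2)[OF b])
  then show ?thesis by (simp add: hess_def grad_def mult.assoc)
qed

lemma grad_zero:
  assumes "Re (Phi \<theta>) = 0" "a < d"
  shows "grad \<theta> a = 0"
proof -
  have "((\<lambda>x. Re (Phi (\<theta>(a := x)))) has_real_derivative grad (\<theta>(a := \<theta> a)) a) (at (\<theta> a))"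
    by (rule Re_Phi_deriv[OF assms(2)])
  then have "grad (\<theta>(a := \<theta> a)) a = 0"
    by (rule DERIV_local_min[of _ _ _ 1]) (use assms(1) Re_Phi_nonneg in auto)
  then show ?thesis by simp
qed

text \<open>Fixing all but two coordinates, the gradient vanishes at a zero of \<open>Re \<Phi>\<close>, and a nonzero minor of the
  Hessian makes these critical points a Lipschitz curve in the slice parameter \<open>s\<close>.\<close>

lemma negligible_critical:
  assumes kl: "k < d" "l < d" "k \<noteq> l"
  shows "negligible {(y, x). \<exists>s. let \<Theta> = (\<lambda>j. (\<theta>(l := y, k := x)) j + s) in
     grad \<Theta> i = 0 \<and> grad \<Theta> j = 0 \<and> hess \<Theta> i k * hess \<Theta> j l \<noteq> hess \<Theta> i l * hess \<Theta> j k}"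
proof -
  define \<Theta> where "\<Theta> p = (\<lambda>j. (\<theta>(l := fst (fst p), k := snd (fst p))) j + snd p)" for p :: "(real \<times> real) \<times> real"
  define A where "A = {p. grad (\<Theta> p) i = 0 \<and> grad (\<Theta> p) j = 0 \<and> hess (\<Theta> p) i k * hess (\<Theta> p) j l \<noteq> hess (\<Theta> p) i l * hess (\<Theta> p) j k}"
  \<comment> \<open>The differential of the angle of \<open>psi\<close> in \<open>(y, x, s)\<close>:
    the two free coordinates enter with their exponents, the common rotation with the total
    degree.\<close>
  define u' where "u' n v = real (al n l) * fst (fst v) + real (al n k) * snd (fst v) + real (deg n) * snd v" for n and v :: "(real \<times> real) \<times> real"
  define g' where "g' p a v = - (\<Sum>n\<in>S. real (al n a) * (Re (c n * psi (\<Theta> p) n) * u' n v))" for p a v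
  have arg: "(\<Sum>m<d. real (al n m) * \<Theta> p m) = u' n p + (\<Sum>m\<in>{..<d}-{k}-{l}. real (al n m) * \<theta> m)" for n p
  proof -
    have "(\<Sum>m<d. real (al n m) * \<Theta> p m) = (\<Sum>m<d. real (al n m) * (\<theta>(l := fst (fst p), k := snd (fst p))) m) + real (deg n) * snd p"
      by (simp add: \<Theta>_def distrib_left sum.distrib deg_def sum_distrib_right)
    also have "(\<Sum>m<d. real (al n m) * (\<theta>(l := fst (fst p), k := snd (fst p))) m)
      = real (al n k) * snd (fst p) + (\<Sum>m\<in>{..<d}-{k}. real (al n m) * (\<theta>(l := fst (fst p))) m)"
      by (rule psi_update[OF kl(1)])
    also have "(\<Sum>m\<in>{..<d}-{k}. real (al n m) * (\<theta>(l := fst (fst p))) m)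
      = real (al n l) * fst (fst p) + (\<Sum>m\<in>{..<d}-{k}-{l}. real (al n m) * (\<theta>(l := fst (fst p))) m)"
      using kl by (subst sum.remove[of _ l]) auto
    also have "(\<Sum>m\<in>{..<d}-{k}-{l}. real (al n m) * (\<theta>(l := fst (fst p))) m) = (\<Sum>m\<in>{..<d}-{k}-{l}. real (al n m) * \<theta> m)"
      by (rule sum.cong) auto
    finally show ?thesis by (simp add: u'_def)
  qed
  have ud: "((\<lambda>p. \<Sum>m<d. real (al n m) * \<Theta> p m) has_derivative u' n) (at p)" for n p
    unfolding arg u'_def by (auto intro!: derivative_eq_intros)
  have gd: "((\<lambda>p. grad (\<Theta> p) a) has_derivative g' p a) (at p)" for a p
    unfolding grad_def g'_def psi_def
    by (intro has_derivative_minus has_derivative_sum has_derivative_mult_right has_derivative_Im_cis ud)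
  have "negligible (fst ` A)"
  proof (rule negligible_projection_zero_set[where G = "\<lambda>p. (grad (\<Theta> p) i, grad (\<Theta> p) j)" and D = "\<lambda>p v. (g' p i v, g' p j v)"])
    show "(grad (\<Theta> p) i, grad (\<Theta> p) j) = 0" if "p \<in> A" for p using that by (simp add: A_def zero_prod_def)
    show "((\<lambda>p. (grad (\<Theta> p) i, grad (\<Theta> p) j)) has_derivative (\<lambda>v. (g' p i v, g' p j v))) (at p)" for p
      by (rule has_derivative_Pair[OF gd gd])
    fix p and z :: "real \<times> real" assume p: "p \<in> A" and z: "(g' p i (z, 0), g' p j (z, 0)) = 0"
    have ge: "g' p a (z, 0) = hess (\<Theta> p) a l * fst z + hess (\<Theta> p) a k * snd z" for a
    proof -
      have "g' p a (z, 0) = (\<Sum>n\<in>S. - (real (al n a) * real (al n l) * Re (c n * psi (\<Theta> p) n)) * fst z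
          + - (real (al n a) * real (al n k) * Re (c n * psi (\<Theta> p) n)) * snd z)"
        unfolding g'_def u'_def sum_negf[symmetric] by (rule sum.cong) (simp_all add: algebra_simps)
      then show ?thesis unfolding hess_def sum_negf[symmetric] sum_distrib_right sum.distrib .
    qed
    have e: "hess (\<Theta> p) i l * fst z + hess (\<Theta> p) i k * snd z = 0" "hess (\<Theta> p) j l * fst z + hess (\<Theta> p) j k * snd z = 0"
      using z by (simp_all add: ge zero_prod_def)
    have nz: "hess (\<Theta> p) i k * hess (\<Theta> p) j l - hess (\<Theta> p) i l * hess (\<Theta> p) j k \<noteq> 0" using p by (simp add: A_def)
    have "(hess (\<Theta> p) i k * hess (\<Theta> p) j l - hess (\<Theta> p) i l * hess (\<Theta> p) j k) * fst z = 0"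
      "(hess (\<Theta> p) i k * hess (\<Theta> p) j l - hess (\<Theta> p) i l * hess (\<Theta> p) j k) * snd z = 0"
    proof -
      \<comment> \<open>Cramer's rule for the two linear equations \<open>e\<close>.\<close>
      have r: "(A * D - B * C) * x = A * (D * x + C * y) - C * (B * x + A * y)"
        "(A * D - B * C) * y = D * (B * x + A * y) - B * (D * x + C * y)" for A B C D x y :: real
        by (simp_all add: algebra_simps)
      show "(hess (\<Theta> p) i k * hess (\<Theta> p) j l - hess (\<Theta> p) i l * hess (\<Theta> p) j k) * fst z = 0"
        using r(1)[of "hess (\<Theta> p) i k" "hess (\<Theta> p) j l" "hess (\<Theta> p) i l" "hess (\<Theta> p) j k" "fst z" "snd z"] unfolding e mult_zero_right diff_self .
      show "(hess (\<Theta> p) i k * hess (\<Theta> p) j l - hess (\<Theta> p) i l * hess (\<Theta> p) j k) * snd z = 0"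
        using r(2)[of "hess (\<Theta> p) i k" "hess (\<Theta> p) j l" "hess (\<Theta> p) i l" "hess (\<Theta> p) j k" "snd z" "fst z"] unfolding e mult_zero_right diff_self .
    qed
    then have "fst z = 0" "snd z = 0" using nz by simp_all
    then show "z = 0" by (simp add: prod_eq_iff)
  qed
  moreover have "{(y, x). \<exists>s. let \<Theta> = (\<lambda>j. (\<theta>(l := y, k := x)) j + s) in
     grad \<Theta> i = 0 \<and> grad \<Theta> j = 0 \<and> hess \<Theta> i k * hess \<Theta> j l \<noteq> hess \<Theta> i l * hess \<Theta> j k} \<subseteq> fst ` A"
  proof
    fix q assume q0: "q \<in> {(y, x). \<exists>s. let \<Theta> = (\<lambda>j. (\<theta>(l := y, k := x)) j + s) in
     grad \<Theta> i = 0 \<and> grad \<Theta> j = 0 \<and> hess \<Theta> i k * hess \<Theta> j l \<noteq> hess \<Theta> i l * hess \<Theta> j k}"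
    obtain y x where q: "q = (y, x)" by (cases q)
    obtain s where s: "let \<Theta> = (\<lambda>j. (\<theta>(l := y, k := x)) j + s) in
     grad \<Theta> i = 0 \<and> grad \<Theta> j = 0 \<and> hess \<Theta> i k * hess \<Theta> j l \<noteq> hess \<Theta> i l * hess \<Theta> j k"
      using q0 unfolding q mem_Collect_eq prod.case by (rule exE)
    have "((y, x), s) \<in> A" using s unfolding A_def \<Theta>_def mem_Collect_eq fst_conv snd_conv Let_def .
    then show "q \<in> fst ` A" unfolding q by (rule image_eqI[rotated]) (simp only: fst_conv)
  qed
  ultimately show ?thesis by (rule negligible_subset)
qed

text \<open>A minor being nonzero is an open condition. Requiring at least \<open>1 / Suc m\<close>
  instead makes the bad \<open>s\<close> the zeros of a continuous nonnegative function
  \<open>h\<close>, hence the exceptional sets measurable; countably many choices of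
  \<open>m\<close> and of the four indices exhaust all cases.\<close>

lemma avoid_hessian:
  assumes minor: "\<And>\<theta>. Re (Phi \<theta>) = 0 \<Longrightarrow>
    \<exists>i<d. \<exists>j<d. \<exists>k<d. \<exists>l<d. hess \<theta> i k * hess \<theta> j l \<noteq> hess \<theta> i l * hess \<theta> j k"
  shows "AE \<theta> in tor. \<forall>s. Phi (\<lambda>j. \<theta> j + s) \<noteq> \<i> * of_real t"
proof -
  define \<mu> where "\<mu> \<theta> i j k l = \<bar>hess \<theta> i k * hess \<theta> j l - hess \<theta> i l * hess \<theta> j k\<bar>" for \<theta> i j k l
  define h where "h i j k l m \<theta> s = cmod (Phi (\<lambda>j. \<theta> j + s) - \<i> * of_real t) + max 0 (1 / real (Suc m) - \<mu> (\<lambda>j. \<theta> j + s) i j k l)" for i j k l m \<theta> s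
  have hess_shift: "hess (\<lambda>j. \<theta> j + s) a b = - (\<Sum>n\<in>S. real (al n a) * real (al n b) * Re (c n * (cis (s * deg n) * psi \<theta> n)))" for \<theta> s a b
    by (simp add: hess_def psi_shift)
  have h0: "h i j k l m \<theta> s = 0 \<longleftrightarrow> Phi (\<lambda>j. \<theta> j + s) = \<i> * of_real t \<and> 1 / real (Suc m) \<le> \<mu> (\<lambda>j. \<theta> j + s) i j k l" for i j k l m \<theta> s
    unfolding h_def by (subst add_nonneg_eq_0_iff) auto
  have hm: "(\<lambda>\<theta>. h i j k l m \<theta> s) \<in> borel_measurable tor" for i j k l m s
    unfolding h_def \<mu>_def hess_shift by measurable
  have hc: "continuous_on A (h i j k l m \<theta>)" for A i j k l m \<theta>
    unfolding h_def[abs_def] \<mu>_def hess_shift by (intro continuous_intros Phi_shift_continuous)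
  have ae: "AE \<theta> in tor. \<not> (\<exists>s\<in>{0..2*pi}. h i j k l m \<theta> s = 0)" if ij: "i < d" "j < d" and kl: "k < d" "l < d" for i j k l m
  proof (cases "k = l")
    case True
    then have "h i j k l m \<theta> s \<noteq> 0" for \<theta> s unfolding h0 by (simp add: \<mu>_def mult.commute)
    then show ?thesis by simp
  next
    case False
    define I where "I = {..<d} - {k, l}"
    have ins: "insert k (insert l I) = {..<d}" using kl by (auto simp: I_def)
    have ms: "{\<theta> \<in> space tor. \<not> (\<exists>s\<in>{0..2*pi}. h i j k l m \<theta> s = 0)} \<in> sets tor"
    proof -
      have "{\<theta> \<in> space tor. \<exists>s\<in>{0..2*pi}. h i j k l m \<theta> s = 0} \<in> sets tor"
        by (rule measurable_ex_zero[OF _ hm hc]) (auto simp: h_def)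
      moreover have "{\<theta> \<in> space tor. \<not> (\<exists>s\<in>{0..2*pi}. h i j k l m \<theta> s = 0)} = space tor - {\<theta> \<in> space tor. \<exists>s\<in>{0..2*pi}. h i j k l m \<theta> s = 0}" by auto
      ultimately show ?thesis by auto
    qed
    have "AE \<theta> in PiM (insert k (insert l I)) (\<lambda>_::nat. circ). \<not> (\<exists>s\<in>{0..2*pi}. h i j k l m \<theta> s = 0)"
    proof (rule AE_torus_insert2)
      show "{\<theta> \<in> space (PiM (insert k (insert l I)) (\<lambda>_::nat. circ)). \<not> (\<exists>s\<in>{0..2*pi}. h i j k l m \<theta> s = 0)} \<in> sets (PiM (insert k (insert l I)) (\<lambda>_::nat. circ))"
        unfolding ins by (rule ms)
      fix \<theta>
      let ?N = "{(y, x). \<exists>s. let \<Theta> = (\<lambda>j. (\<theta>(l := y, k := x)) j + s) in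
        grad \<Theta> i = 0 \<and> grad \<Theta> j = 0 \<and> hess \<Theta> i k * hess \<Theta> j l \<noteq> hess \<Theta> i l * hess \<Theta> j k}"
      have key: "\<not> (\<exists>s\<in>{0..2*pi}. h i j k l m (\<theta>(l := y, k := x)) s = 0)" if "(y, x) \<notin> ?N" for y x
      proof
        assume "\<exists>s\<in>{0..2*pi}. h i j k l m (\<theta>(l := y, k := x)) s = 0"
        then obtain s where s: "h i j k l m (\<theta>(l := y, k := x)) s = 0" by blast
        let ?T = "\<lambda>j. (\<theta>(l := y, k := x)) j + s"
        have a: "Phi ?T = \<i> * of_real t" "1 / real (Suc m) \<le> \<mu> ?T i j k l" using s unfolding h0 by blast+
        have "Re (Phi ?T) = 0" unfolding a(1) by simp
        then have g: "grad ?T i = 0 \<and> grad ?T j = 0" using grad_zero ij by blast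
        have "0 < \<mu> ?T i j k l" by (rule less_le_trans[OF _ a(2)]) simp
        then have "hess ?T i k * hess ?T j l \<noteq> hess ?T i l * hess ?T j k" unfolding \<mu>_def by linarith
        then have "(y, x) \<in> ?N" using g unfolding Let_def mem_Collect_eq prod.case by blast
        then show False using that by blast
      qed
      have aeN: "AE y in circ. AE x in circ. (y, x) \<notin> ?N"
        by (rule AE_circ_negligible[OF negligible_critical[OF kl False]])
      show "AE y in circ. AE x in circ. \<not> (\<exists>s\<in>{0..2*pi}. h i j k l m (\<theta>(l := y, k := x)) s = 0)"
      proof (rule AE_mp[OF aeN], rule AE_I2, rule impI)
        fix y assume "AE x in circ. (y, x) \<notin> ?N"
        then show "AE x in circ. \<not> (\<exists>s\<in>{0..2*pi}. h i j k l m (\<theta>(l := y, k := x)) s = 0)"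
          by (rule AE_mp) (rule AE_I2, rule impI, rule key)
      qed
    qed (use False in \<open>auto simp: I_def\<close>)
    then show ?thesis unfolding ins .
  qed
  have "AE \<theta> in tor. \<forall>m. \<forall>i\<in>{..<d}. \<forall>j\<in>{..<d}. \<forall>k\<in>{..<d}. \<forall>l\<in>{..<d}. \<not> (\<exists>s\<in>{0..2*pi}. h i j k l m \<theta> s = 0)"
    using ae by (simp add: AE_all_countable AE_ball_countable)
  then show ?thesis
  proof (rule AE_mp, intro AE_I2 impI allI notI)
    fix \<theta> s assume av: "\<forall>m. \<forall>i\<in>{..<d}. \<forall>j\<in>{..<d}. \<forall>k\<in>{..<d}. \<forall>l\<in>{..<d}. \<not> (\<exists>s\<in>{0..2*pi}. h i j k l m \<theta> s = 0)"
      and eq0: "Phi (\<lambda>j. \<theta> j + s) = \<i> * of_real t"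
    obtain s' where s': "s' \<in> {0..2*pi}" "cis s' = cis s" using cis_Arg2pi_range by blast
    have eq: "Phi (\<lambda>j. \<theta> j + s') = \<i> * of_real t" using eq0 Phi_shift_cis[OF s'(2), of \<theta>] by simp
    then have "Re (Phi (\<lambda>j. \<theta> j + s')) = 0" by simp
    from minor[OF this] obtain i j k l where ijkl: "i < d" "j < d" "k < d" "l < d" "0 < \<mu> (\<lambda>j. \<theta> j + s') i j k l"
      unfolding \<mu>_def by auto
    obtain m where "1 / real (Suc m) < \<mu> (\<lambda>j. \<theta> j + s') i j k l" using nat_approx_posE[OF ijkl(5)] by blast
    then have "h i j k l m \<theta> s' = 0" unfolding h0 using eq by simp
    then show False using av ijkl(1-4) s'(1) by blast
  qed
qed

end

section \<open>Failure of compactness\<close>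

lemma measure_circ_interval:
  assumes "0 \<le> a" "a \<le> b" "b \<le> 2 * pi"
  shows "measure circ {a..b} = (b - a) / (2 * pi)"
proof -
  have "measure circ {a..b} = (LINT s|circ. indicator {a..b} s)" by simp
  also have "\<dots> = (1 / (2*pi)) *\<^sub>R (LINT s:{0..2*pi}|lborel. indicator {a..b} s)"
    by (rule integral_circ) simp
  also have "(LINT s:{0..2*pi}|lborel. indicator {a..b} s) = (LINT s|lborel. indicator {a..b} s)"
    unfolding set_lebesgue_integral_def
    by (rule Bochner_Integration.integral_cong) (use assms in \<open>auto simp: indicator_def\<close>)
  also have "\<dots> = b - a" using assms by simp
  finally show ?thesis by simp
qed

lemma Re_exp_ge_quarter:
  assumes "cmod u \<le> 1/2"
  shows "1/4 \<le> Re (exp (- u))"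
proof -
  have "\<bar>Re u\<bar> \<le> 1/2" "\<bar>Im u\<bar> \<le> 1/2"
    using assms abs_Re_le_cmod[of u] abs_Im_le_cmod[of u] by linarith+
  then have "1/2 \<le> exp (- Re u)" using exp_ge_add_one_self[of "- Re u"] by linarith
  moreover have "1/2 \<le> cos (Im u)"
  proof -
    have "cmod (cis (Im u) - cis 0) \<le> \<bar>Im u - 0\<bar>" by (rule cis_lipschitz)
    moreover have "\<bar>cos (Im u) - 1\<bar> \<le> cmod (cis (Im u) - cis 0)"
      using abs_Re_le_cmod[of "cis (Im u) - cis 0"] by simp
    ultimately show ?thesis using \<open>\<bar>Im u\<bar> \<le> 1/2\<close> by linarith
  qed
  ultimately have "1/2 * (1/2) \<le> exp (- Re u) * cos (Im u)" by (intro mult_mono) auto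
  then show ?thesis by (simp add: Re_exp)
qed

context gh_data
begin

section \<open>Test functions concentrating at a boundary point\<close>

lemma measure_tor_interval:
  assumes "i < d" "0 \<le> a" "a \<le> b" "b \<le> 2 * pi"
  shows "measure tor {\<theta>\<in>space tor. \<theta> i \<in> {a..b}} = (b - a) / (2 * pi)"
proof -
  have i: "i \<in> {..<d}" using assms(1) by simp
  have "measure circ {a..b} = measure (distr tor circ (\<lambda>\<theta>. \<theta> i)) {a..b}"
    by (simp only: distr_PiM_component[OF prob_space_circ i])
  also have "\<dots> = measure tor ((\<lambda>\<theta>. \<theta> i) -` {a..b} \<inter> space tor)"
    by (rule measure_distr) (use i in auto)
  also have "(\<lambda>\<theta>. \<theta> i) -` {a..b} \<inter> space tor = {\<theta>\<in>space tor. \<theta> i \<in> {a..b}}" by auto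
  finally show ?thesis using measure_circ_interval[OF assms(2-4)] by simp
qed

text \<open>The coefficients \<open>n^(-1/2 + i \<tau>)\<close> are those of the reproducing kernel
  at \<open>1/2 + i \<tau>\<close>, just outside the space; cut off at \<open>N\<close>, their
  square norm is the harmonic number. The twist by \<open>\<tau>\<close> moves the degenerate value
  to 0, where all terms of the sum have the same phase.\<close>

lemma test_function:
  fixes N :: nat and \<tau> :: real
  assumes N: "1 \<le> N"
  defines "H \<equiv> harm N"
  obtains f where "norm f \<le> 1"
    and "\<And>s. 1/2 < Re s \<Longrightarrow> cmod (h2_eval f s) \<le> (\<Sum>n. real n powr (- 1/2 - Re s)) / sqrt H"
    and "(norm (comp.comp f))\<^sup>2 = (LINT \<theta>|tor. (cmod (expsum {1..N} (\<lambda>n. of_real (1 / (n * sqrt H))) (\<lambda>n. ln n) (Phi \<theta> - \<i> * of_real \<tau>)))\<^sup>2)"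
proof -
  have H: "0 < H" using N by (simp add: H_def harm_pos)
  define a where "a n = (if n \<in> {1..N} then of_real (1 / sqrt (real n * H)) * cis (\<tau> * ln n) else 0)" for n :: nat
  have na: "cmod (a n) = (if n \<in> {1..N} then 1 / sqrt (real n * H) else 0)" for n
    using H by (auto simp: a_def norm_mult norm_divide)
  have na2: "(cmod (a n))\<^sup>2 = (if n \<in> {1..N} then 1 / real n / H else 0)" for n
    using H by (auto simp: na power_divide real_sqrt_mult power_mult_distrib)
  have HS: "(\<Sum>n\<in>{1..N}. 1 / real n) = H" by (simp add: H_def harm_def inverse_eq_divide)
  have "(\<Sum>n<M. (cmod (a n))\<^sup>2) \<le> 1" for M
  proof -
    have "(\<Sum>n<M. (cmod (a n))\<^sup>2) = (\<Sum>n\<in>{..<M}\<inter>{1..N}. 1 / real n / H)"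
      by (simp add: na2 sum.If_cases Int_def)
    also have "\<dots> \<le> (\<Sum>n\<in>{1..N}. 1 / real n / H)" by (rule sum_mono2) (use H in auto)
    also have "\<dots> = H / H" unfolding sum_divide_distrib[symmetric] HS ..
    also have "\<dots> = 1" using H by simp
    finally show ?thesis .
  qed
  then obtain f where f: "h2_coeff f = a" "(norm f)\<^sup>2 \<le> 1"
    using h2_exists[of a 1] by (auto simp: a_def)
  show thesis
  proof
    show "norm f \<le> 1" using f(2) by (simp add: power_le_one_iff abs_square_le_1)
    fix s assume s: "1/2 < Re s"
    have sm: "summable (\<lambda>n. real n powr (- 1/2 - Re s))" using s by (subst summable_real_powr_iff) auto
    have le: "cmod (h2_coeff f n * of_nat n powr (- s)) \<le> real n powr (- 1/2 - Re s) / sqrt H" for n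
    proof (cases "n \<in> {1..N}")
      case True
      then have n: "0 < n" by auto
      have "cmod (h2_coeff f n * of_nat n powr (- s)) = 1 / (sqrt (real n) * sqrt H) * real n powr (- Re s)"
        using True n by (simp add: f na norm_mult cmod_of_nat_powr real_sqrt_mult)
      also have "\<dots> = real n powr (- 1/2) * real n powr (- Re s) / sqrt H"
        using n by (simp add: powr_minus_divide powr_half_sqrt)
      also have "\<dots> = real n powr (- 1/2 - Re s) / sqrt H" by (simp add: powr_add[symmetric])
      finally show ?thesis by simp
    qed (use H in \<open>auto simp: f a_def\<close>)
    have "cmod (h2_eval f s) \<le> (\<Sum>n. cmod (h2_coeff f n * of_nat n powr (- s)))"
      unfolding h2_eval_def by (rule summable_norm[OF h2_eval_bounds(1)[OF s]])
    also have "\<dots> \<le> (\<Sum>n. real n powr (- 1/2 - Re s) / sqrt H)"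
      by (rule suminf_le[OF le h2_eval_bounds(1)[OF s] summable_divide[OF sm]])
    also have "\<dots> = (\<Sum>n. real n powr (- 1/2 - Re s)) / sqrt H" by (rule suminf_divide[OF sm])
    finally show "cmod (h2_eval f s) \<le> (\<Sum>n. real n powr (- 1/2 - Re s)) / sqrt H" .
  next
    have eq: "expsum {1..N} (\<lambda>n. a n / of_real (sqrt n)) (\<lambda>n. ln n) w
        = expsum {1..N} (\<lambda>n. of_real (1 / (n * sqrt H))) (\<lambda>n. ln n) (w - \<i> * of_real \<tau>)" for w
      unfolding expsum_def
    proof (rule sum.cong[OF refl])
      fix n assume n: "n \<in> {1..N}"
      have "exp (- (w - \<i> * of_real \<tau>) * of_real (ln n)) = cis (\<tau> * ln n) * exp (- w * of_real (ln n))"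
        by (simp add: cis_conv_exp exp_add[symmetric] algebra_simps)
      moreover have "a n / of_real (sqrt n) = of_real (1 / (n * sqrt H)) * cis (\<tau> * ln n)"
      proof -
        have "1 / sqrt (real n * H) / sqrt n = 1 / (n * sqrt H)" using n by (simp add: real_sqrt_mult)
        then have "of_real (1 / (n * sqrt H)) = complex_of_real (1 / sqrt (real n * H)) / of_real (sqrt n)"
          by (metis of_real_divide)
        then show ?thesis using n by (simp only: a_def if_True) simp
      qed
      ultimately show "a n / of_real (sqrt n) * exp (- w * of_real (ln n))
        = of_real (1 / (n * sqrt H)) * exp (- (w - \<i> * of_real \<tau>) * of_real (ln n))"
        by (simp only: mult.assoc)
    qed
    have "h2_coeff (comp.comp f) N' = (\<Sum>n\<in>{1..N}. a n * dcoeff c n N')" for N'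
      unfolding comp.comp_coeff f by (rule suminf_finite) (auto simp: a_def)
    then have "(norm (comp.comp f))\<^sup>2 = (\<Sum>N'. (cmod (\<Sum>n\<in>{1..N}. a n * dcoeff c n N'))\<^sup>2)"
      by (simp add: h2_norm_power2)
    also have "\<dots> = (LINT \<theta>|tor. (cmod (expsum {1..N} (\<lambda>n. a n / of_real (sqrt n)) (\<lambda>n. ln n) (Phi (\<lambda>j. \<theta> j + 0))))\<^sup>2)"
      by (rule sums_unique[symmetric], rule expsum_parseval) auto
    finally show "(norm (comp.comp f))\<^sup>2 = (LINT \<theta>|tor. (cmod (expsum {1..N} (\<lambda>n. of_real (1 / (n * sqrt H))) (\<lambda>n. ln n) (Phi \<theta> - \<i> * of_real \<tau>)))\<^sup>2)"
      unfolding eq by simp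
  qed
qed

text \<open>On the set \<open>\<bar>\<theta>\<^sub>i - t\<^sub>0\<bar> \<le> \<delta>\<close> with \<open>\<delta>\<close> of order \<open>1 / ln N\<close> the \<open>N\<close>-th test function has squared modulus of
  order \<open>harm N \<ge> ln N\<close>, so its image keeps a norm bounded below.\<close>

lemma not_compact_if_degenerate:
  assumes i: "i < d" and t0: "0 \<le> t0" "t0 < 2 * pi"
    and bnd: "\<And>\<theta>. cmod (Phi \<theta> - \<i> * of_real \<tau>) \<le> C * \<bar>\<theta> i - t0\<bar>"
  shows "\<not> compact_operator (comp_op (dpoly c))"
proof -
  \<comment> \<open>The last summand keeps the interval from \<open>t0\<close> to
    \<open>t0 + \<delta>\<close> inside \<open>[0, 2 pi]\<close>; the others give
    \<open>B \<ge> 1\<close> and \<open>B \<ge> C\<close>.\<close>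
  define B where "B = 1 + \<bar>C\<bar> + 1 / (2 * pi - t0)"
  have B: "1 \<le> B" "C \<le> B" "1 / (2 * pi - t0) \<le> B" 
  proof -
    have "0 < 1 / (2 * pi - t0)" using t0 by simp
    then show "1 \<le> B" "C \<le> B" "1 / (2 * pi - t0) \<le> B" unfolding B_def by linarith+
  qed
  \<comment> \<open>The product of \<open>H / 16\<close> with the normalised length
    \<open>\<delta> / (2 pi) = 1 / (4 pi B L)\<close>, where \<open>H\<close> is at least
    \<open>L\<close>.\<close>
  define m where "m = 1 / (64 * pi * B)"
  have "\<exists>f. norm f \<le> 1 \<and> (\<forall>s. 1/2 < Re s \<longrightarrow> cmod (h2_eval f s) \<le> (\<Sum>n. real n powr (- 1/2 - Re s)) / sqrt (harm (k + 3)))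
      \<and> m \<le> (norm (comp.comp f))\<^sup>2" for k
  proof -
    \<comment> \<open>From 3 on, the logarithm of \<open>N\<close> is at least 1.\<close>
    define N where "N = k + 3"
    define H :: real where "H = harm N"
    define L where "L = ln (real N)"
    have L1: "1 \<le> L"
    proof -
      have "exp 1 \<le> real N" using exp_le by (simp add: N_def)
      then show ?thesis unfolding L_def by (subst ln_ge_iff) (auto simp: N_def)
    qed
    have HL: "L \<le> H"
    proof -
      have "L \<le> ln (real N + 1)" unfolding L_def by (simp add: N_def)
      then show ?thesis using ln_le_harm[of N] unfolding H_def by linarith
    qed
    have Hp: "0 < H" using L1 HL by linarith
    have N1: "1 \<le> N" by (simp add: N_def)
    obtain f where f: "norm f \<le> 1"
      "\<And>s. 1/2 < Re s \<Longrightarrow> cmod (h2_eval f s) \<le> (\<Sum>n. real n powr (- 1/2 - Re s)) / sqrt H"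
      "(norm (comp.comp f))\<^sup>2 = (LINT \<theta>|tor. (cmod (expsum {1..N} (\<lambda>n. of_real (1 / (n * sqrt H))) (\<lambda>n. ln n) (Phi \<theta> - \<i> * of_real \<tau>)))\<^sup>2)"
      using test_function[OF N1] unfolding H_def by blast
    define F where "F w = expsum {1..N} (\<lambda>n. of_real (1 / (n * sqrt H))) (\<lambda>n. ln n) w" for w
    \<comment> \<open>So short an interval keeps \<open>|w| ln n\<close> below \<open>1/2\<close>
      for all \<open>n \<le> N\<close>, and the real part of every term at least a quarter of its
      value at \<open>w = 0\<close>.\<close>
    define \<delta> where "\<delta> = 1 / (2 * B * L)"
    have \<delta>: "0 < \<delta>" "B * \<delta> * L = 1/2" using B L1 by (auto simp: \<delta>_def)
    have BL: "1 / (2 * pi - t0) \<le> 2 * B * L"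
    proof -
      have "B * 1 \<le> B * (2 * L)" using B L1 by (intro mult_left_mono) auto
      then show ?thesis using B(3) by linarith
    qed
    then have \<delta>2: "t0 + \<delta> \<le> 2 * pi"
    proof -
      have "1 / (2 * B * L) \<le> 1 / (1 / (2 * pi - t0))" using BL t0 by (intro divide_left_mono) (use B L1 in auto)
      then show ?thesis by (simp add: \<delta>_def)
    qed
    have lower: "sqrt H / 4 \<le> cmod (F w)" if w: "cmod w \<le> B * \<delta>" for w
    proof -
      have "1 / (n * sqrt H) * (1/4) \<le> Re (of_real (1 / (n * sqrt H)) * exp (- w * of_real (ln n)))" if n: "n \<in> {1..N}" for n
      proof -
        have l: "0 \<le> ln (real n)" "ln (real n) \<le> L" using n by (auto simp: L_def)
        have "cmod (w * of_real (ln n)) \<le> B * \<delta> * L"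
          unfolding norm_mult using w l by (intro mult_mono) (use B \<delta> in auto)
        then have "1/4 \<le> Re (exp (- (w * of_real (ln n))))" unfolding \<delta>(2) by (rule Re_exp_ge_quarter)
        then have "1 / (n * sqrt H) * (1/4) \<le> 1 / (n * sqrt H) * Re (exp (- (w * of_real (ln n))))"
          by (intro mult_left_mono) (use Hp in auto)
        then show ?thesis by simp
      qed
      then have "(\<Sum>n\<in>{1..N}. 1 / (real n * sqrt H) * (1/4)) \<le> Re (F w)"
        unfolding F_def expsum_def Re_sum by (rule sum_mono)
      also have "(\<Sum>n\<in>{1..N}. 1 / (real n * sqrt H) * (1/4)) = (\<Sum>n\<in>{1..N}. 1 / real n) / sqrt H / 4"
        unfolding sum_divide_distrib by (rule sum.cong) auto
      also have "(\<Sum>n\<in>{1..N}. 1 / real n) = H" by (simp add: H_def harm_def inverse_eq_divide)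
      also have "H / sqrt H = sqrt H" using Hp by (simp add: real_div_sqrt)
      also have "Re (F w) \<le> cmod (F w)" by (rule complex_Re_le_cmod)
      finally show ?thesis .
    qed
    let ?A = "{\<theta>\<in>space tor. \<theta> i \<in> {t0..t0+\<delta>}}"
    have mA: "?A \<in> sets tor"
    proof -
      have ii: "i \<in> {..<d}" using i by simp
      have "(\<lambda>\<theta>. \<theta> i) -` {t0..t0+\<delta>} \<inter> space tor \<in> sets tor"
        by (rule measurable_sets[OF measurable_component_singleton[OF ii]]) simp
      also have "(\<lambda>\<theta>. \<theta> i) -` {t0..t0+\<delta>} \<inter> space tor = ?A" by auto
      finally show ?thesis .
    qed
    have pw: "H / 16 * indicator ?A \<theta> \<le> (cmod (F (Phi \<theta> - \<i> * of_real \<tau>)))\<^sup>2" for \<theta>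
    proof (cases "\<theta> \<in> ?A")
      case True
      then have "\<bar>\<theta> i - t0\<bar> \<le> \<delta>" by auto
      then have "C * \<bar>\<theta> i - t0\<bar> \<le> B * \<delta>" using B by (intro mult_mono) auto
      then have "cmod (Phi \<theta> - \<i> * of_real \<tau>) \<le> B * \<delta>" using bnd[of \<theta>] by linarith
      from lower[OF this] have "(sqrt H / 4)\<^sup>2 \<le> (cmod (F (Phi \<theta> - \<i> * of_real \<tau>)))\<^sup>2"
        using Hp by (intro power_mono) auto
      then show ?thesis using True Hp by (simp add: power_divide)
    qed simp
    interpret pt: prob_space tor by (rule prob_space_torus)
    have "m \<le> H / 16 * (\<delta> / (2 * pi))"
    proof -
      have "m = L / 16 * (\<delta> / (2 * pi))" using B L1 by (simp add: m_def \<delta>_def)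
      also have "\<dots> \<le> H / 16 * (\<delta> / (2 * pi))" using HL \<delta> by (intro mult_right_mono) auto
      finally show ?thesis .
    qed
    also have "\<delta> / (2 * pi) = measure tor ?A"
      using measure_tor_interval[OF i t0(1), of "t0 + \<delta>"] \<delta> \<delta>2 by simp
    also have "H / 16 * measure tor ?A = (LINT \<theta>|tor. H / 16 * indicator ?A \<theta>)"
      using mA by simp
    also have "\<dots> \<le> (LINT \<theta>|tor. (cmod (F (Phi \<theta> - \<i> * of_real \<tau>)))\<^sup>2)"
    proof (rule Bochner_Integration.integral_mono)
      show "integrable tor (\<lambda>\<theta>. H / 16 * indicator ?A \<theta>)" using mA by (auto simp: pt.emeasure_eq_measure)
      show "integrable tor (\<lambda>\<theta>. (cmod (F (Phi \<theta> - \<i> * of_real \<tau>)))\<^sup>2)"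
      proof (rule pt.integrable_const_bound)
        have Pm: "Phi \<in> borel_measurable tor" unfolding Phi_def[abs_def] by measurable
        show "(\<lambda>\<theta>. (cmod (F (Phi \<theta> - \<i> * of_real \<tau>)))\<^sup>2) \<in> borel_measurable tor"
          unfolding F_def expsum_def using Pm by measurable
        have "cmod (F (Phi \<theta> - \<i> * of_real \<tau>)) \<le> (\<Sum>n\<in>{1..N}. (1 / (n * sqrt H)) * exp (0 * ln n))" for \<theta>
          unfolding F_def expsum_def
        proof (rule order.trans[OF norm_sum sum_mono])
          fix n assume n: "n \<in> {1..N}"
          have "cmod (exp (- (Phi \<theta> - \<i> * of_real \<tau>) * of_real (ln n))) \<le> 1"
            using Re_Phi_nonneg[of \<theta>] n by (simp add: norm_exp_eq_Re)
          then show "cmod (of_real (1 / (n * sqrt H)) * exp (- (Phi \<theta> - \<i> * of_real \<tau>) * of_real (ln n))) \<le> 1 / (n * sqrt H) * exp (0 * ln n)"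
            unfolding norm_mult using Hp by (intro mult_mono) (auto simp: norm_mult norm_divide)
        qed
        then have "\<bar>(cmod (F (Phi \<theta> - \<i> * of_real \<tau>)))\<^sup>2\<bar> \<le> (\<Sum>n\<in>{1..N}. (1 / (n * sqrt H)) * exp (0 * ln n))\<^sup>2" for \<theta>
          unfolding abs_power2 by (intro power_mono) auto
        then show "AE \<theta> in tor. norm ((cmod (F (Phi \<theta> - \<i> * of_real \<tau>)))\<^sup>2) \<le> (\<Sum>n\<in>{1..N}. (1 / (n * sqrt H)) * exp (0 * ln n))\<^sup>2"
          unfolding real_norm_def by (intro AE_I2)
      qed
    qed (rule pw)
    also have "\<dots> = (norm (comp.comp f))\<^sup>2" unfolding f(3) F_def ..
    finally have "m \<le> (norm (comp.comp f))\<^sup>2" .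
    then show ?thesis using f(1,2) unfolding H_def N_def by blast
  qed
  then obtain f where f: "\<And>k. norm (f k) \<le> 1"
    "\<And>k s. 1/2 < Re s \<Longrightarrow> cmod (h2_eval (f k) s) \<le> (\<Sum>n. real n powr (- 1/2 - Re s)) / sqrt (harm (k + 3))"
    "\<And>k. m \<le> (norm (comp.comp (f k)))\<^sup>2" by metis
  show ?thesis
  proof (rule comp.not_compact_comp_op[of f "sqrt m"])
    show "0 < sqrt m" using B by (simp add: m_def)
    show "sqrt m \<le> norm (comp.comp (f k))" for k using real_sqrt_le_mono[OF f(3)[of k]] by simp
    fix s assume s: "1/2 < Re s"
    have "(\<lambda>k. (\<Sum>n. real n powr (- 1/2 - Re s)) / sqrt (harm (k + 3))) \<longlonglongrightarrow> 0"
    proof (rule tendsto_divide_0[OF tendsto_const filterlim_at_top_imp_at_infinity])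
      have "filterlim (\<lambda>k. ln (real (k + 3) + 1)) at_top sequentially" by real_asymp
      then have "filterlim (\<lambda>k. harm (k + 3) :: real) at_top sequentially"
        by (rule filterlim_at_top_mono) (intro always_eventually allI ln_le_harm)
      then show "filterlim (\<lambda>k. sqrt (harm (k + 3))) at_top sequentially"
        by (rule filterlim_compose[OF sqrt_at_top])
    qed
    then show "(\<lambda>k. h2_eval (f k) s) \<longlonglongrightarrow> 0"
      by (rule Lim_null_comparison[rotated]) (use f(2)[OF s] in auto)
  qed (rule f(1))
qed

end

section \<open>Complex dimension and degree\<close>

lemma common_denominator:
  fixes r :: "'a \<Rightarrow> rat"
  assumes "finite A"
  shows "\<exists>D>0. \<exists>k. \<forall>x\<in>A. of_nat D * r x = of_int (k x :: int)"
proof -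
  define D where "D = (\<Prod>x\<in>A. nat (snd (quotient_of (r x))))"
  have pos: "0 < snd (quotient_of (r x))" for x by (rule quotient_of_denom_pos')
  then have "0 < D" unfolding D_def by (intro prod_pos) auto
  moreover have "\<exists>k. of_nat D * r x = of_int (k :: int)" if x: "x \<in> A" for x
  proof -
    obtain p q where pq: "quotient_of (r x) = (p, q)" by fastforce
    have q: "0 < q" using pos[of x] pq by simp
    have r: "r x = of_int p / of_int q" by (rule quotient_of_div[OF pq])
    define R where "R = (\<Prod>y\<in>A - {x}. nat (snd (quotient_of (r y))))"
    have "D = nat q * R"
      unfolding D_def R_def by (subst prod.remove[OF assms x]) (simp add: pq)
    then have "of_nat D * r x = of_int (int R * p)" using q by (simp add: r)
    then show ?thesis ..
  qed
  ultimately show ?thesis by metis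
qed

text \<open>Clearing denominators and separating positive from negative exponents turns a rational
  relation into an equality of two prime factorisations.\<close>

lemma rat_independent_primes:
  assumes P: "finite P" "\<And>p. p \<in> P \<Longrightarrow> prime (p::nat)"
  shows "rat_independent P"
proof -
  interpret V: vector_space "\<lambda>(q::rat) (x::real). of_rat q * x" by (rule vector_space_rat_real)
  have inj: "inj_on (\<lambda>n. ln (real n)) P"
    by (rule inj_onI) (use P(2) prime_gt_0_nat in auto)
  show ?thesis
    unfolding rat_independent_def
  proof (rule V.independent_if_scalars_zero)
    show "finite ((\<lambda>n. ln (real n)) ` P)" using P(1) by simp
    fix f x assume z: "(\<Sum>x\<in>(\<lambda>n. ln (real n)) ` P. of_rat (f x) * x) = 0" and x: "x \<in> (\<lambda>n. ln (real n)) ` P"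
    define r where "r p = f (ln (real p))" for p :: nat
    have z': "(\<Sum>p\<in>P. of_rat (r p) * ln (real p)) = 0"
      using z by (simp add: sum.reindex[OF inj] r_def)
    obtain D k where D: "0 < D" and k: "\<And>p. p \<in> P \<Longrightarrow> of_nat D * r p = of_int (k p :: int)"
      using common_denominator[OF P(1), of r] by blast
    have kr: "real_of_int (k p) = of_nat D * of_rat (r p)" if "p \<in> P" for p
      using arg_cong[OF k[OF that], of "of_rat :: rat \<Rightarrow> real"] by (simp add: of_rat_mult)
    define a b where "a p = nat (k p)" and "b p = nat (- k p)" for p
    have "(\<Sum>p\<in>P. real_of_int (k p) * ln (real p)) = of_nat D * (\<Sum>p\<in>P. of_rat (r p) * ln (real p))"
      unfolding sum_distrib_left by (rule sum.cong) (auto simp: kr)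
    then have "(\<Sum>p\<in>P. real_of_int (k p) * ln (real p)) = 0" using z' by simp
    moreover have "real_of_int (k p) = real (a p) - real (b p)" for p by (auto simp: a_def b_def)
    ultimately have "(\<Sum>p\<in>P. real (a p) * ln (real p)) = (\<Sum>p\<in>P. real (b p) * ln (real p))"
      by (simp add: left_diff_distrib sum_subtractf)
    then have l: "ln (real (\<Prod>p\<in>P. p ^ a p)) = ln (real (\<Prod>p\<in>P. p ^ b p))"
      using ln_prod_pow[OF P(1), of a] ln_prod_pow[OF P(1), of b] P(2) prime_gt_0_nat by simp
    have pos: "0 < (\<Prod>p\<in>P. p ^ g p)" for g :: "nat \<Rightarrow> nat"
      using P(2) prime_gt_0_nat by (intro prod_pos) auto
    have "real (\<Prod>p\<in>P. p ^ a p) = real (\<Prod>p\<in>P. p ^ b p)"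
      by (rule iffD1[OF ln_inj_iff l]) (simp_all only: of_nat_0_less_iff pos)
    then have eq: "(\<Prod>p\<in>P. p ^ a p) = (\<Prod>p\<in>P. p ^ b p)" by (simp only: of_nat_eq_iff)
    obtain p where p: "p \<in> P" "x = ln (real p)" using x by blast
    have "a p = b p"
      using arg_cong[OF eq, of "multiplicity p"] multiplicity_prod_prime_powers[OF P(1), of p] P(2) p(1) by simp
    then have "k p = 0" by (auto simp: a_def b_def)
    then have "r p = 0" using kr[OF p(1)] D by simp
    then show "f x = 0" by (simp add: r_def p(2))
  qed
qed

lemma rat_independent_singleton:
  assumes "2 \<le> n"
  shows "rat_independent {n}"
proof -
  interpret V: vector_space "\<lambda>(q::rat) (x::real). of_rat q * x" by (rule vector_space_rat_real)
  show ?thesis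
    unfolding rat_independent_def
  proof (rule V.independent_if_scalars_zero)
    fix f x assume "(\<Sum>x\<in>(\<lambda>n. ln (real n)) ` {n}. of_rat (f x) * x) = 0" "x \<in> (\<lambda>n. ln (real n)) ` {n}"
    then show "f x = 0" using assms by simp
  qed simp
qed

lemma rat_independent_subset:
  assumes "rat_independent L" "L' \<subseteq> L"
  shows "rat_independent L'"
proof -
  interpret V: vector_space "\<lambda>(q::rat) (x::real). of_rat q * x" by (rule vector_space_rat_real)
  show ?thesis using assms V.independent_mono[of "(\<lambda>n. ln (real n)) ` L" "(\<lambda>n. ln (real n)) ` L'"]
    by (auto simp: rat_independent_def)
qed

text \<open>The prime divisors of the elements always generate, so the infimum defining the
  dimension is attained.\<close>

lemma generating_sets_nonempty:
  assumes "finite S" "S \<subseteq> {2..}"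
  shows "generating_sets S \<noteq> {}"
proof -
  define P where "P = (\<Union>n\<in>S. prime_factors n)"
  have P: "finite P" "\<And>p. p \<in> P \<Longrightarrow> prime p" using assms(1) by (auto simp: P_def)
  have "n = (\<Prod>q\<in>P. q ^ multiplicity q n)" if n: "n \<in> S" for n
  proof -
    have n0: "n > 0" using n assms(2) by force
    then have "n = (\<Prod>q\<in>prime_factors n. q ^ multiplicity q n)" by (rule prime_factorization_nat)
    also have "\<dots> = (\<Prod>q\<in>P. q ^ multiplicity q n)"
    proof (rule prod.mono_neutral_left)
      show "prime_factors n \<subseteq> P" using n by (auto simp: P_def)
      show "\<forall>i\<in>P - prime_factors n. i ^ multiplicity i n = 1"
        using P(2) n0 by (auto simp: prime_factors_multiplicity)
    qed (rule P(1))
    finally show ?thesis .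
  qed
  then have "generates P S" unfolding generates_def by (intro ballI exI)
  moreover have "P \<subseteq> {2..}" using P(2) prime_ge_2_nat by auto
  ultimately have "P \<in> generating_sets S" unfolding generating_sets_def using P rat_independent_primes by auto
  then show ?thesis by blast
qed

lemma complex_dimension_le:
  assumes "L \<in> generating_sets (spectrum_set c)"
  shows "complex_dimension c \<le> card L"
  unfolding complex_dimension_def by (rule wellorder_Inf_le1) (use assms in simp)

lemma complex_dimension_attained:
  assumes "finite (spectrum_set c)"
  obtains L where "L \<in> generating_sets (spectrum_set c)" "card L = complex_dimension c"
proof -
  have "generating_sets (spectrum_set c) \<noteq> {}"
    by (rule generating_sets_nonempty[OF assms]) (auto simp: spectrum_set_def)
  then have "complex_dimension c \<in> card ` generating_sets (spectrum_set c)"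
    unfolding complex_dimension_def by (intro Inf_nat_def1) simp
  then show ?thesis using that by auto
qed

lemma degree_wrt_ge:
  assumes "finite (spectrum_set c)" "n \<in> spectrum_set c"
  shows "(\<Sum>q\<in>L. multi_index L n q) \<le> degree_wrt c L"
  unfolding degree_wrt_def by (rule cSUP_upper) (use assms in auto)

lemma bohr_lift_cong:
  "(\<And>j. j < length qs \<Longrightarrow> z j = z' j) \<Longrightarrow> bohr_lift c qs z = bohr_lift c qs z'"
  by (simp add: bohr_lift_def)

context bohr_data
begin

lemma card_qs: "card (set qs) = d" using distinct_card[OF dist_qs] by (simp add: d_def)

lemma deg_le_degree_wrt: "n \<in> S \<Longrightarrow> deg n \<le> degree_wrt c (set qs)"
  using degree_wrt_ge[OF fin, of n "set qs"] by (simp add: sum_qs deg_def al_def)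

text \<open>A generator with exponent 0 throughout could be dropped, which would lower the
  dimension.\<close>

lemma minimal_all_used:
  assumes min: "d = complex_dimension c" and j: "j < d"
  shows "\<exists>n\<in>S. 0 < al n j"
proof (rule ccontr)
  assume "\<not> (\<exists>n\<in>S. 0 < al n j)"
  then have 0: "al n j = 0" if "n \<in> S" for n using that by auto
  define L where "L = set qs - {qs ! j}"
  have jq: "qs ! j \<in> set qs" using j by (simp add: d_def)
  have "generates L S"
    unfolding generates_def
  proof (intro ballI exI)
    fix n assume n: "n \<in> S"
    have "n = (\<Prod>q\<in>set qs. q ^ multi_index (set qs) n q)"
      using M_eq[OF S_M[OF n]] by (simp add: prod_qs al_def)
    also have "\<dots> = (qs ! j) ^ multi_index (set qs) n (qs ! j) * (\<Prod>q\<in>L. q ^ multi_index (set qs) n q)"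
      unfolding L_def by (rule prod.remove[OF _ jq]) simp
    finally show "n = (\<Prod>q\<in>L. q ^ multi_index (set qs) n q)" using 0[OF n] by (simp add: al_def)
  qed
  moreover have "rat_independent L" by (rule rat_independent_subset[OF indep(1)]) (auto simp: L_def)
  ultimately have "L \<in> generating_sets S"
    using indep by (auto simp: generating_sets_def L_def)
  then have "complex_dimension c \<le> card L" by (rule complex_dimension_le)
  moreover have "card L < d" unfolding L_def card_qs[symmetric] by (rule card_Diff1_less[OF _ jq]) simp
  ultimately show False using min by simp
qed

text \<open>A single frequency \<open>n\<close> is generated by \<open>{n}\<close>, prime or not,
  and has dimension one.\<close>

lemma minimal_two_elements:
  assumes min: "d = complex_dimension c" and d2: "2 \<le> d"
  shows "\<exists>n\<in>S. \<exists>n'\<in>S. n \<noteq> n'"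
proof (rule ccontr)
  assume "\<not> ?thesis"
  moreover obtain n where n: "n \<in> S" using minimal_all_used[OF min, of 0] d2 by auto
  ultimately have S: "S = {n}" by blast
  have n2: "2 \<le> n" by (rule S_ge[OF n])
  have "generates {n} S" unfolding generates_def S by (auto intro!: exI[of _ "\<lambda>_. 1"])
  then have "{n} \<in> generating_sets S"
    using rat_independent_singleton[OF n2] n2 by (simp add: generating_sets_def)
  then have "complex_dimension c \<le> card {n}" by (rule complex_dimension_le)
  then show False using min d2 by simp
qed

lemma psi_prod: "psi \<theta> n = (\<Prod>j<d. cis (\<theta> j) ^ al n j)"
  by (simp add: psi_def cis_sum Complex.DeMoivre)

end

context gh_data
begin

lemma partial_deriv_Re_Phi:
  "j < d \<Longrightarrow> partial_deriv j (\<lambda>\<theta>. Re (Phi \<theta>)) = (\<lambda>\<theta>. grad \<theta> j)"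
  unfolding partial_deriv_def using DERIV_imp_deriv[OF Re_Phi_deriv] by fastforce

lemma partial_deriv_grad:
  "i < d \<Longrightarrow> partial_deriv i (\<lambda>\<theta>. grad \<theta> j) \<theta> = hess \<theta> j i"
  unfolding partial_deriv_def using DERIV_imp_deriv[OF grad_deriv, of i \<theta> j "\<theta> i"] by simp

text \<open>The angles \<open>Arg (w j)\<close> and \<open>\<theta> j\<close> differ by multiples of
  \<open>2 pi\<close>, which leave the characters and hence the Hessian unchanged.\<close>

lemma boundary_index_minor:
  assumes J: "\<And>w. w \<in> torus d \<Longrightarrow> Re (bohr_lift c qs w) = 0 \<Longrightarrow> 2 \<le> boundary_index d (bohr_lift c qs) w"
    and z: "Re (Phi \<theta>) = 0"
  shows "\<exists>i<d. \<exists>j<d. \<exists>k<d. \<exists>l<d. hess \<theta> i k * hess \<theta> j l \<noteq> hess \<theta> i l * hess \<theta> j k"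
proof -
  define w where "w = restrict (\<lambda>j. cis (\<theta> j)) {..<d}"
  define \<eta> where "\<eta> = (\<lambda>j. Arg (w j))"
  have w: "w \<in> torus d" by (auto simp: w_def torus_def)
  have "bohr_lift c qs w = Phi \<theta>"
    unfolding bohr_lift_eq[symmetric] by (rule bohr_lift_cong) (simp add: w_def d_def)
  then have J2: "2 \<le> num_pos_eigenvalues (hessian d (\<lambda>\<theta>. Re (Phi \<theta>)) \<eta>)"
    using J[OF w] z by (simp add: boundary_index_def bohr_lift_eq \<eta>_def)
  have "psi \<eta> n = psi \<theta> n" for n
    unfolding psi_prod by (rule prod.cong) (auto simp: \<eta>_def w_def cis_Arg)
  then have h: "hess \<eta> = hess \<theta>" by (simp add: hess_def fun_eq_iff)
  have H: "hessian d (\<lambda>\<theta>. Re (Phi \<theta>)) \<eta> $$ (i, j) = hess \<theta> j i" if "i < d" "j < d" for i j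
    using that by (simp add: hessian_def partial_deriv_Re_Phi partial_deriv_grad h)
  have "hessian d (\<lambda>\<theta>. Re (Phi \<theta>)) \<eta> \<in> carrier_mat d d" by (simp add: hessian_def)
  from two_pos_eigenvalues_minor[OF this J2] obtain i j k l where
    ij: "i < d" "j < d" "k < d" "l < d" and "hess \<theta> k i * hess \<theta> l j \<noteq> hess \<theta> l i * hess \<theta> k j"
    using H by metis
  then have "hess \<theta> k i * hess \<theta> l j \<noteq> hess \<theta> k j * hess \<theta> l i" by (simp add: mult.commute)
  then show ?thesis using ij by blast
qed

end

text \<open>Optimality of the generating set turns the degree of the symbol into a bound on every
  \<open>deg n\<close>; its minimal cardinality shows that every coordinate occurs and that there
  are two frequencies.\<close>

lemma compact_if_small_degree_or_index:
  assumes gh: "gordon_hedenmalm c" and d2: "2 \<le> complex_dimension c" and opt: "optimal_bohr_lift c \<Phi>"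
    and alt: "dpoly_degree c = 1 \<or> dpoly_degree c = 2 \<or>
      (\<forall>w\<in>torus (complex_dimension c). Re (\<Phi> w) > 0 \<or>
        (Re (\<Phi> w) = 0 \<and> boundary_index (complex_dimension c) \<Phi> w \<ge> 2))"
  shows "compact_operator (comp_op (dpoly c))"
proof -
  obtain qs where qs: "distinct qs" "optimal c (set qs)" "\<Phi> = bohr_lift c qs"
    using opt unfolding optimal_bohr_lift_def by blast
  have ms: "set qs \<in> generating_sets (spectrum_set c)" "card (set qs) = complex_dimension c"
    and dg: "degree_wrt c (set qs) = dpoly_degree c"
    using qs(2) by (auto simp: optimal_def minimal_generating_sets_def)
  interpret gh_data c qs
    by unfold_locales (use gh qs(1) ms(1) in \<open>auto simp: gordon_hedenmalm_def dirichlet_polynomial_def\<close>)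
  have dd: "d = complex_dimension c" using ms(2) card_qs by simp
  show ?thesis
  proof (rule compact_if_slices_avoid)
    fix t
    show "AE \<theta> in tor. \<forall>s. Phi (\<lambda>j. \<theta> j + s) \<noteq> \<i> * of_real t"
    proof (cases "dpoly_degree c \<le> 2")
      case True
      show ?thesis
      proof (rule avoid_quadratic)
        show "deg n \<le> 2" if "n \<in> S" for n using deg_le_degree_wrt[OF that] dg True by simp
        show "2 \<le> d" using d2 dd by simp
        show "\<exists>n\<in>S. 0 < al n j" if "j < d" for j by (rule minimal_all_used[OF dd that])
        show "\<exists>n\<in>S. \<exists>n'\<in>S. n \<noteq> n'" using minimal_two_elements[OF dd] d2 dd by simp
      qed
    next
      case False
      then have J: "\<And>w. w \<in> torus d \<Longrightarrow> Re (bohr_lift c qs w) = 0 \<Longrightarrow> 2 \<le> boundary_index d (bohr_lift c qs) w"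
        using alt unfolding dd qs(3) by force
      show ?thesis by (rule avoid_hessian) (rule boundary_index_minor[OF J])
    qed
  qed
qed

lemma unrestricted_range_approach:
  assumes gh: "dpoly c ` half_plane 0 \<subseteq> half_plane (1/2)" and ur: "unrestricted_range c" and e: "0 < e"
  shows "\<exists>s. 0 < Re s \<and> Re (dpoly c s) < 1/2 + e"
proof -
  have "(INF s\<in>half_plane 0. Re (dpoly c s)) < 1/2 + e" using ur e by (simp add: unrestricted_range_def)
  moreover have "half_plane 0 \<noteq> {}" by (auto simp: half_plane_def intro!: exI[of _ 1])
  moreover have "bdd_below ((\<lambda>s. Re (dpoly c s)) ` half_plane 0)"
    by (rule bdd_belowI2[of _ "1/2"]) (use gh in \<open>force simp: half_plane_def\<close>)
  ultimately show ?thesis by (subst (asm) cINF_less_iff) (auto simp: half_plane_def)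
qed

text \<open>\<open>q^(-s)\<close> maps the half-plane into the disc, where the real part of the
  slice polynomial attains its minimum, at most 0 by unrestricted range and hence on the circle. As
  there is only one angle, the Lipschitz bound of \<open>Phi\<close> is already the degeneracy
  required.\<close>

lemma not_compact_if_dimension_one:
  assumes gh0: "gordon_hedenmalm c" and ur: "unrestricted_range c" and dim: "complex_dimension c = 1"
  shows "\<not> compact_operator (comp_op (dpoly c))"
proof -
  have fin0: "finite (spectrum_set c)" and gh1: "dpoly c ` half_plane 0 \<subseteq> half_plane (1/2)"
    using gh0 by (auto simp: gordon_hedenmalm_def dirichlet_polynomial_def)
  obtain L where L: "L \<in> generating_sets (spectrum_set c)" "card L = 1"
    using complex_dimension_attained[OF fin0] dim by metis
  then obtain q where q: "L = {q}" using card_1_singletonE by blast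
  interpret gh_data c "[q]"
    by unfold_locales (use fin0 gh1 L q in auto)
  have d1: "d = 1" by (simp add: d_def)
  have q2: "2 \<le> q" using qs_ge[of 0] d1 by simp
  have nq: "n = q ^ deg n" if "n \<in> S" for n
    using M_eq[OF S_M[OF that]] d1 by (simp add: deg_def)
  have sl: "dpoly c s - 1/2 = slice (\<lambda>_. 0) (of_real (q powr (- Re s)) * cis (- Im s * ln q))" for s
  proof -
    have "real n powr (- Re s) = (q powr (- Re s)) ^ deg n" if "n \<in> S" for n
    proof -
      have "real n powr (- Re s) = (real q powr real (deg n)) powr (- Re s)"
        using q2 by (subst nq[OF that]) (simp add: powr_realpow)
      also have "\<dots> = (real q powr (- Re s)) powr real (deg n)" by (simp add: powr_powr mult.commute)
      finally show ?thesis using q2 by (simp add: powr_realpow)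
    qed
    moreover have "psi (\<lambda>j. - Im s * ln ([q] ! j)) n = cis (- Im s * ln q) ^ deg n" for n
      by (simp add: psi_prod d1 deg_def)
    moreover have "psi (\<lambda>_. 0) n = 1" for n by (simp add: psi_def)
    ultimately show ?thesis
      using dpoly_flow[of "Re s" "Im s"] unfolding slice_def complex_eq[symmetric]
      by (simp add: power_mult_distrib cong: sum.cong)
  qed
  obtain z where z: "z \<in> cball 0 1" "\<And>u. u \<in> cball 0 1 \<Longrightarrow> Re (slice (\<lambda>_. 0) z) \<le> Re (slice (\<lambda>_. 0) u)"
  proof -
    have cont: "continuous_on (cball 0 1) (\<lambda>u. Re (slice (\<lambda>_. 0) u))"
      by (intro continuous_intros slice_continuous)
    show ?thesis using continuous_attains_inf[OF compact_cball _ cont] that by auto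
  qed
  have "Re (slice (\<lambda>_. 0) z) \<le> 0"
  proof (rule field_le_epsilon)
    fix e :: real assume "0 < e"
    then obtain s where s: "0 < Re s" "Re (dpoly c s) < 1/2 + e"
      using unrestricted_range_approach[OF gh1 ur] by blast
    have "real q powr (- Re s) \<le> real q powr 0" using s(1) q2 by (intro powr_mono) auto
    then have "of_real (q powr (- Re s)) * cis (- Im s * ln q) \<in> cball 0 1" using q2 by (simp add: norm_mult)
    from z(2)[OF this] have "Re (slice (\<lambda>_. 0) z) \<le> Re (dpoly c s - 1/2)" unfolding sl .
    then show "Re (slice (\<lambda>_. 0) z) \<le> 0 + e" using s(2) by simp
  qed
  then have z1: "cmod z = 1" using Re_slice_pos[of z "\<lambda>_. 0"] z(1) by force
  define t0 where "t0 = Arg2pi z"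
  have t0: "0 \<le> t0" "t0 < 2 * pi" "z = cis t0"
    using Arg2pi[of z] z1 by (auto simp: t0_def cis_conv_exp is_Arg_def)
  have "Phi (\<lambda>_. t0) = slice (\<lambda>_. 0) z"
    using W_slice[of "\<lambda>_. 0" t0] by (simp add: W_def t0(3))
  then have "Re (Phi (\<lambda>_. t0)) = 0" using Re_Phi_nonneg[of "\<lambda>_. t0"] \<open>Re (slice (\<lambda>_. 0) z) \<le> 0\<close> by simp
  then have P0: "Phi (\<lambda>_. t0) = \<i> * of_real (Im (Phi (\<lambda>_. t0)))" by (simp add: complex_eq_iff)
  show ?thesis
  proof (rule not_compact_if_degenerate[of 0 t0])
    fix \<theta>
    show "cmod (Phi \<theta> - \<i> * of_real (Im (Phi (\<lambda>_. t0)))) \<le> (\<Sum>n\<in>S. cmod (c n) * real (al n 0)) * \<bar>\<theta> 0 - t0\<bar>"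
      unfolding P0[symmetric] sum_distrib_right
      by (rule order.trans[OF Phi_lipschitz]) (simp add: d1 mult.assoc)
  qed (use t0 d1 in auto)
qed

section \<open>Non-compact examples\<close>

lemma prod_two_powers:
  fixes f :: "'a \<Rightarrow> 'b::comm_semiring_1"
  assumes "finite A" "x \<in> A" "y \<in> A"
  shows "(\<Prod>i\<in>A. f i ^ ((if i = x then a else 0) + (if i = y then b else 0))) = f x ^ a * f y ^ b"
proof -
  have "(\<Prod>i\<in>A. f i ^ (if i = x then a else 0)) = (\<Prod>i\<in>A. if i = x then f i ^ a else 1)" for x a
    by (rule prod.cong) auto
  then show ?thesis using assms by (simp add: power_add prod.distrib)
qed

text \<open>A prime is a product of generators only if it is one of them. Prime frequencies
  therefore pin down the minimal generating set, and with it dimension and degree.\<close>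

lemma prime_mem_generating:
  assumes L: "L \<in> generating_sets S" and p: "p \<in> S" "prime p"
  shows "p \<in> L"
proof -
  have fin: "finite L" using L by (simp add: generating_sets_def)
  obtain \<alpha> where \<alpha>: "p = (\<Prod>q\<in>L. q ^ \<alpha> q)"
  proof -
    have "\<forall>n\<in>S. \<exists>\<alpha>. n = (\<Prod>q\<in>L. q ^ \<alpha> q)" using L by (simp add: generating_sets_def generates_def)
    then show ?thesis using p(1) that by blast
  qed
  have "p dvd (\<Prod>q\<in>L. q ^ \<alpha> q)" unfolding \<alpha>[symmetric] by (rule dvd_refl)
  then have "\<exists>q\<in>L. p dvd q ^ \<alpha> q" unfolding prime_dvd_prod_iff[OF fin p(2)] .
  then obtain q where q: "q \<in> L" "p dvd q ^ \<alpha> q" by blast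
  have "\<alpha> q \<noteq> 0"
  proof
    assume "\<alpha> q = 0"
    then have "p dvd 1" using q(2) by simp
    then show False using p(2) by (simp add: prime_nat_iff)
  qed
  then have "q dvd q ^ \<alpha> q" by (intro dvd_power) simp
  also have "q ^ \<alpha> q dvd (\<Prod>q\<in>L. q ^ \<alpha> q)" by (rule dvd_prodI[OF fin q(1)])
  also have "\<dots> = p" by (rule \<alpha>[symmetric])
  finally have "q dvd p" .
  moreover have "p dvd q" by (rule prime_dvd_power[OF p(2) q(2)])
  ultimately have "p = q" by (simp add: dvd_antisym)
  then show ?thesis using q(1) by simp
qed

text \<open>In the unit disc \<open>|1 - x|^2 < 2 Re (1 - x)\<close>, so a perturbation of size at
  most half of \<open>|1 - x|^2\<close> cannot change the sign.\<close>

lemma Re_perturbed_pos: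
  assumes x: "cmod x < 1" and h: "cmod h \<le> 1/2"
  shows "0 < Re ((1 - x) + (1 - x)\<^sup>2 * h)"
proof -
  have "(cmod x)\<^sup>2 < 1" using x by (simp add: power_less_one_iff)
  then have x2: "(Re x)\<^sup>2 + (Im x)\<^sup>2 < 1" by (simp only: cmod_power2)
  have "(cmod (1 - x))\<^sup>2 = (1 - Re x)\<^sup>2 + (Im x)\<^sup>2" by (simp add: cmod_power2)
  then have u: "(cmod (1 - x))\<^sup>2 < 2 * Re (1 - x)" using x2 by (simp add: power2_diff)
  have "cmod ((1 - x)\<^sup>2 * h) \<le> (cmod (1 - x))\<^sup>2 * (1/2)"
    unfolding norm_mult norm_power using h by (intro mult_left_mono) auto
  then have "- ((cmod (1 - x))\<^sup>2 / 2) \<le> Re ((1 - x)\<^sup>2 * h)"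
    using abs_Re_le_cmod[of "(1 - x)\<^sup>2 * h"] by linarith
  then show ?thesis using u unfolding plus_complex.sel by linarith
qed

definition nth_prime :: "nat \<Rightarrow> nat" where "nth_prime = enumerate {p. prime p}"

lemma nth_prime: "prime (nth_prime j)"
  using enumerate_in_set[OF primes_infinite] by (simp add: nth_prime_def)

lemma nth_prime_inject [simp]: "nth_prime i = nth_prime j \<longleftrightarrow> i = j"
  using strict_mono_enumerate[OF primes_infinite] by (simp add: nth_prime_def strict_mono_eq)

text \<open>The coefficients of \<open>a^(-s)\<close>. Combinations of these add up correctly when
  frequencies coincide, as \<open>p 0 ^ (m-2)\<close> and \<open>p 0\<close> do for
  \<open>m = 3\<close>.\<close>

definition point :: "nat \<Rightarrow> nat \<Rightarrow> complex" where "point a n = (if n = a then 1 else 0)"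

text \<open>\<open>k\<close> is the dimension and \<open>m\<close> the degree. The perturbation
  vanishes to second order at \<open>z_0 = 1\<close>, as \<open>Re_perturbed_pos\<close> requires,
  so its terms in another variable reach degree 3; hence the lower bound on
  \<open>m\<close>.\<close>

locale degenerate_example =
  fixes k m :: nat
  assumes k: "1 \<le> k" and m: "3 \<le> m"
begin

abbreviation "p j \<equiv> nth_prime j"

text \<open>The factor that brings a sum of \<open>k\<close> terms of modulus at most 1 down to the
  bound \<open>1/2\<close> of \<open>Re_perturbed_pos\<close>.\<close>

definition \<kappa> :: complex where "\<kappa> = 1 / (2 * of_nat k)"

text \<open>The coefficients of \<open>1/2 + (1 - z\<^sub>0) + \<kappa> (1 - z\<^sub>0)\<^sup>2 (z\<^sub>0\<^sup>m\<^sup>-\<^sup>2 + z\<^sub>1 + \<dots> + z\<^sub>k\<^sub>-\<^sub>1)\<close>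
  at \<open>z\<^sub>j = p\<^sub>j\<^sup>-\<^sup>s\<close>.\<close>

definition coef :: "nat \<Rightarrow> complex" where
  "coef n = 3/2 * point 1 n - point (p 0) n
     + \<kappa> * (point (p 0 ^ (m-2)) n - 2 * point (p 0 ^ (m-1)) n + point (p 0 ^ m) n)
     + \<kappa> * (\<Sum>j\<in>{1..<k}. point (p j) n - 2 * point (p 0 * p j) n + point (p 0 ^ 2 * p j) n)"

definition T :: "nat set" where
  "T = {p 0, p 0 ^ (m-2), p 0 ^ (m-1), p 0 ^ m} \<union> p ` {1..<k} \<union> (\<lambda>j. p 0 * p j) ` {1..<k} \<union> (\<lambda>j. p 0 ^ 2 * p j) ` {1..<k}"

definition lift_value :: "(nat \<Rightarrow> complex) \<Rightarrow> complex" where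
  "lift_value X = (1 - X 0) + (1 - X 0)\<^sup>2 * (\<kappa> * (X 0 ^ (m-2) + (\<Sum>j\<in>{1..<k}. X j)))"

lemma T_form:
  assumes "n \<in> T"
  shows "\<exists>a b j. j < k \<and> a + b \<le> m \<and> 1 \<le> a + b \<and> n = p 0 ^ a * p j ^ b"
proof -
  have 0: "n = p 0 ^ a \<Longrightarrow> a \<le> m \<Longrightarrow> 1 \<le> a \<Longrightarrow> ?thesis" for a
    using k by (intro exI[of _ a] exI[of _ 0] exI[of _ 0]) auto
  have 1: "n = p 0 ^ a * p j \<Longrightarrow> a \<le> 2 \<Longrightarrow> j < k \<Longrightarrow> ?thesis" for a j
    using m by (intro exI[of _ a] exI[of _ 1] exI[of _ j]) auto
  show ?thesis
    using assms m 0[of 1] 0[of "m-2"] 0[of "m-1"] 0[of m] 1[of 0] 1[of 1] 1[of 2] unfolding T_def by auto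
qed

lemma T_ge2: "n \<in> T \<Longrightarrow> 2 \<le> n"
proof -
  assume "n \<in> T"
  then obtain a b j where ab: "1 \<le> a + b" "n = p 0 ^ a * p j ^ b" using T_form by blast
  have "2 \<le> p i" for i by (rule prime_ge_2_nat[OF nth_prime])
  then have "2 ^ a * 2 ^ b \<le> n" unfolding ab(2) by (intro mult_mono power_mono) auto
  moreover have "(2::nat) ^ 1 \<le> 2 ^ (a + b)" using ab(1) by (intro power_increasing) auto
  ultimately show ?thesis by (simp add: power_add)
qed

lemma coef_outside:
  assumes "n \<notin> T"
  shows "coef n = 3/2 * point 1 n"
proof -
  have "point (p j) n = 0" "point (p 0 * p j) n = 0" "point (p 0 ^ 2 * p j) n = 0" if "j \<in> {1..<k}" for j
    using assms that by (auto simp: T_def point_def)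
  moreover have "point (p 0) n = 0" "point (p 0 ^ (m-2)) n = 0" "point (p 0 ^ (m-1)) n = 0" "point (p 0 ^ m) n = 0"
    using assms by (auto simp: T_def point_def)
  ultimately show ?thesis by (simp add: coef_def)
qed

lemma coef_1: "coef 1 = 3/2" using coef_outside[of 1] T_ge2[of 1] by (auto simp: point_def)

lemma spectrum_coef: "spectrum_set coef \<subseteq> T" using coef_outside by (fastforce simp: spectrum_set_def point_def)

lemma finite_T: "finite T" by (simp add: T_def)

lemma spectrum_sum:
  "(\<Sum>n\<in>spectrum_set coef. coef n * h n) = - h (p 0) + \<kappa> * (h (p 0 ^ (m-2)) - 2 * h (p 0 ^ (m-1)) + h (p 0 ^ m))
     + \<kappa> * (\<Sum>j\<in>{1..<k}. h (p j) - 2 * h (p 0 * p j) + h (p 0 ^ 2 * p j))"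
proof -
  have e: "(\<Sum>n\<in>T. point a n * h n) = h a" if "a \<in> T" for a
  proof -
    have "(\<Sum>n\<in>T. point a n * h n) = (\<Sum>n\<in>T. if n = a then h n else 0)"
      by (rule sum.cong) (auto simp: point_def)
    then show ?thesis using that finite_T by simp
  qed
  have J: "p j \<in> T" "p 0 * p j \<in> T" "p 0 ^ 2 * p j \<in> T" if "j \<in> {1..<k}" for j using that by (auto simp: T_def)
  have I: "p 0 \<in> T" "p 0 ^ (m-2) \<in> T" "p 0 ^ (m-1) \<in> T" "p 0 ^ m \<in> T" by (auto simp: T_def)
  let ?C = "\<lambda>n j. point (p j) n * h n - 2 * (point (p 0 * p j) n * h n) + point (p 0 ^ 2 * p j) n * h n"
  have "(\<Sum>n\<in>spectrum_set coef. coef n * h n) = (\<Sum>n\<in>T. coef n * h n)"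
    by (rule sum.mono_neutral_left[OF finite_T spectrum_coef]) (use T_ge2 in \<open>auto simp: spectrum_set_def\<close>)
  also have "\<dots> = (\<Sum>n\<in>T. - (point (p 0) n * h n)
      + \<kappa> * (point (p 0 ^ (m-2)) n * h n - 2 * (point (p 0 ^ (m-1)) n * h n) + point (p 0 ^ m) n * h n)
      + \<kappa> * (\<Sum>j\<in>{1..<k}. ?C n j))"
  proof (rule sum.cong[OF refl])
    fix n assume "n \<in> T"
    then have p1: "point 1 n = 0" using T_ge2[of n] by (auto simp: point_def)
    have C: "(\<Sum>j\<in>{1..<k}. ?C n j) = (\<Sum>j\<in>{1..<k}. point (p j) n - 2 * point (p 0 * p j) n + point (p 0 ^ 2 * p j) n) * h n"
      unfolding sum_distrib_right by (rule sum.cong) (simp_all add: algebra_simps)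
    show "coef n * h n = - (point (p 0) n * h n)
      + \<kappa> * (point (p 0 ^ (m-2)) n * h n - 2 * (point (p 0 ^ (m-1)) n * h n) + point (p 0 ^ m) n * h n)
      + \<kappa> * (\<Sum>j\<in>{1..<k}. ?C n j)"
      unfolding C coef_def p1 by (simp add: algebra_simps)
  qed
  also have "\<dots> = - (\<Sum>n\<in>T. point (p 0) n * h n)
      + \<kappa> * ((\<Sum>n\<in>T. point (p 0 ^ (m-2)) n * h n) - 2 * (\<Sum>n\<in>T. point (p 0 ^ (m-1)) n * h n) + (\<Sum>n\<in>T. point (p 0 ^ m) n * h n))
      + \<kappa> * (\<Sum>n\<in>T. \<Sum>j\<in>{1..<k}. ?C n j)"
    by (simp only: sum.distrib sum_subtractf sum_negf sum_distrib_left[symmetric])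
  also have "(\<Sum>n\<in>T. \<Sum>j\<in>{1..<k}. ?C n j) = (\<Sum>j\<in>{1..<k}. \<Sum>n\<in>T. ?C n j)" by (rule sum.swap)
  also have "\<dots> = (\<Sum>j\<in>{1..<k}. h (p j) - 2 * h (p 0 * p j) + h (p 0 ^ 2 * p j))"
    by (rule sum.cong[OF refl]) (simp only: sum.distrib sum_subtractf sum_distrib_left[symmetric] e J)
  finally show ?thesis unfolding e[OF I(1)] e[OF I(2)] e[OF I(3)] e[OF I(4)] .
qed

text \<open>A single computation for both evaluations: \<open>h N = N^(-s)\<close> on the half-plane
  and the characters on the torus.\<close>

lemma spectrum_sum_value:
  assumes h: "\<And>a b j. j < k \<Longrightarrow> h (p 0 ^ a * p j ^ b) = X 0 ^ a * X j ^ b"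
  shows "1 + (\<Sum>n\<in>spectrum_set coef. coef n * h n) = lift_value X"
proof -
  define r where "r = m - 2"
  have r: "m = Suc (Suc r)" unfolding r_def using m by linarith
  have h0: "h (p 0 ^ a) = X 0 ^ a" for a using h[of 0 a 0] k by simp
  have h1: "h (p 0) = X 0" using h0[of 1] by simp
  have "(\<Sum>j\<in>{1..<k}. h (p j) - 2 * h (p 0 * p j) + h (p 0 ^ 2 * p j)) = (\<Sum>j\<in>{1..<k}. (1 - X 0)\<^sup>2 * X j)"
  proof (rule sum.cong[OF refl])
    fix j assume "j \<in> {1..<k}"
    then have "h (p j) = X j" "h (p 0 * p j) = X 0 * X j" "h (p 0 ^ 2 * p j) = X 0 ^ 2 * X j"
      using h[of j 0 1] h[of j 1 1] h[of j 2 1] by simp_all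
    then show "h (p j) - 2 * h (p 0 * p j) + h (p 0 ^ 2 * p j) = (1 - X 0)\<^sup>2 * X j"
      by (simp add: power2_eq_square algebra_simps)
  qed
  then have s: "(\<Sum>j\<in>{1..<k}. h (p j) - 2 * h (p 0 * p j) + h (p 0 ^ 2 * p j)) = (1 - X 0)\<^sup>2 * (\<Sum>j\<in>{1..<k}. X j)"
    by (simp only: sum_distrib_left)
  have ring: "1 + (- x + q * (x ^ r - 2 * x ^ Suc r + x ^ Suc (Suc r)) + q * ((1 - x)\<^sup>2 * y))
      = (1 - x) + (1 - x)\<^sup>2 * (q * (x ^ r + y))" for x q y :: complex
  proof -
    have "1 + (- x + q * (v - 2 * (x * v) + x * (x * v)) + q * ((1 - x) * (1 - x) * y))
      = (1 - x) + (1 - x) * (1 - x) * (q * (v + y))" for v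
    proof -
      have a: "v - 2 * (x * v) + x * (x * v) = (1 - x) * (1 - x) * v" by (simp add: algebra_simps)
      have b: "1 + (- x + s + t) = (1 - x) + (s + t)" for s t :: complex by simp
      show ?thesis unfolding a b distrib_left by (simp only: mult.left_commute[of q])
    qed
    from this[of "x ^ r"] show ?thesis by (simp only: power_Suc power2_eq_square)
  qed
  have m': "m - 2 = r" "m - 1 = Suc r" using r by simp_all
  show ?thesis
    unfolding spectrum_sum s h0 h1 lift_value_def m' unfolding r by (rule ring)
qed

lemma cmod_perturbation:
  assumes "\<And>j. j < k \<Longrightarrow> cmod (X j) \<le> 1"
  shows "cmod (\<kappa> * (X 0 ^ (m-2) + (\<Sum>j\<in>{1..<k}. X j))) \<le> 1/2"
proof -
  have "cmod (X 0 ^ (m-2)) \<le> 1" unfolding norm_power using assms[of 0] k by (intro power_le_one) auto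
  moreover have "cmod (\<Sum>j\<in>{1..<k}. X j) \<le> (\<Sum>j\<in>{1..<k}. 1)"
    by (rule order.trans[OF norm_sum sum_mono]) (use assms in auto)
  moreover have "(\<Sum>j\<in>{1..<k}. 1::real) = real k - 1" using k by (simp add: of_nat_diff)
  ultimately have "cmod (X 0 ^ (m-2) + (\<Sum>j\<in>{1..<k}. X j)) \<le> real k"
    using norm_triangle_ineq[of "X 0 ^ (m-2)" "\<Sum>j\<in>{1..<k}. X j"] by linarith
  then have "1 / (2 * real k) * cmod (X 0 ^ (m-2) + (\<Sum>j\<in>{1..<k}. X j)) \<le> 1 / (2 * real k) * real k"
    by (intro mult_left_mono) auto
  moreover have "cmod \<kappa> = 1 / (2 * real k)" by (simp add: \<kappa>_def norm_divide norm_mult)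
  ultimately show ?thesis using k by (simp add: norm_mult)
qed

lemma dpoly_coef: "dpoly coef s = 1/2 + lift_value (\<lambda>j. of_nat (p j) powr (- s))"
proof -
  have pw: "of_nat (a ^ r) powr (- s) = (of_nat a powr (- s)) ^ r" if "0 < a" for a r
  proof -
    have "0 < a ^ r" using that by simp
    then have "of_nat (a ^ r) powr (- s) = exp (- s * of_real (real r * ln (real a)))"
      unfolding of_nat_powr_exp[OF \<open>0 < a ^ r\<close>] using that by (simp add: ln_realpow)
    also have "\<dots> = exp (of_nat r * (- s * of_real (ln (real a))))" by (simp add: mult_ac)
    finally show ?thesis by (simp only: exp_of_nat_mult of_nat_powr_exp[OF that])
  qed
  have "of_nat (p 0 ^ a * p j ^ b) powr (- s) = (of_nat (p 0) powr (- s)) ^ a * (of_nat (p j) powr (- s)) ^ b" for a b j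
    unfolding pw[OF prime_gt_0_nat[OF nth_prime], symmetric] of_nat_mult by (rule powr_times_real) auto
  note eq = spectrum_sum_value[of "\<lambda>n. of_nat n powr (- s)", OF this]
  show ?thesis unfolding dpoly_def coef_1 eq[symmetric] by simp
qed

lemma gordon_hedenmalm_coef: "gordon_hedenmalm coef"
proof -
  have "dirichlet_polynomial coef"
    unfolding dirichlet_polynomial_def
    using finite_subset[OF spectrum_coef finite_T] coef_outside[of 0] T_ge2[of 0] by (auto simp: point_def)
  moreover have "dpoly coef ` half_plane 0 \<subseteq> half_plane (1/2)"
  proof
    fix w assume "w \<in> dpoly coef ` half_plane 0"
    then obtain s where s: "0 < Re s" "w = dpoly coef s" by (auto simp: half_plane_def)
    have X: "cmod (of_nat (p j) powr (- s)) < 1" for j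
    proof -
      have "1 < p j" by (rule prime_gt_1_nat[OF nth_prime])
      then have "real (p j) powr (- Re s) < real (p j) powr 0" using s(1) by (intro powr_less_mono) auto
      then show ?thesis using \<open>1 < p j\<close> by (simp add: cmod_of_nat_powr)
    qed
    have "0 < Re (lift_value (\<lambda>j. of_nat (p j) powr (- s)))"
      unfolding lift_value_def by (rule Re_perturbed_pos[OF X cmod_perturbation]) (use X less_imp_le in blast)
    then show "w \<in> half_plane (1/2)" by (simp add: half_plane_def s(2) dpoly_coef)
  qed
  ultimately show ?thesis by (simp add: gordon_hedenmalm_def)
qed

text \<open>The value \<open>1/2\<close> is approached along the positive reals as \<open>s\<close>
  tends to 0, where \<open>z_0\<close> tends to 1.\<close>

lemma unrestricted_range_coef: "unrestricted_range coef"
proof -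
  have lb: "1/2 \<le> Re (dpoly coef s)" if "s \<in> half_plane 0" for s
    using gordon_hedenmalm_coef that by (force simp: gordon_hedenmalm_def half_plane_def)
  have "(INF s\<in>half_plane 0. Re (dpoly coef s)) \<le> 1/2"
  proof (rule LIMSEQ_le_const)
    have dc: "dpoly coef s = coef 1 + (\<Sum>n\<in>spectrum_set coef. coef n * exp (- s * of_real (ln (real n))))" for s
      unfolding dpoly_def by (intro arg_cong2[where f = "(+)"] refl sum.cong) (auto simp: of_nat_powr_exp spectrum_set_def)
    have "dpoly coef = (\<lambda>s. coef 1 + (\<Sum>n\<in>spectrum_set coef. coef n * exp (- s * of_real (ln (real n)))))"
      by (rule ext) (rule dc)
    moreover have "isCont (\<lambda>s. coef 1 + (\<Sum>n\<in>spectrum_set coef. coef n * exp (- s * of_real (ln (real n))))) 0"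
      by (intro continuous_intros)
    ultimately have "isCont (dpoly coef) 0" by (simp only:)
    moreover have "(\<lambda>n. complex_of_real (inverse (real (Suc n)))) \<longlonglongrightarrow> 0"
      using tendsto_of_real[OF LIMSEQ_inverse_real_of_nat, where 'a = complex] by (simp only: of_real_0)
    ultimately have "(\<lambda>n. dpoly coef (of_real (inverse (real (Suc n))))) \<longlonglongrightarrow> dpoly coef 0"
      by (rule isCont_tendsto_compose)
    moreover have "dpoly coef 0 = 1/2"
      unfolding dpoly_coef lift_value_def using prime_gt_0_nat[OF nth_prime[of 0]] by simp
    ultimately show "(\<lambda>n. Re (dpoly coef (of_real (inverse (real (Suc n)))))) \<longlonglongrightarrow> 1/2"
      using tendsto_Re by fastforce
    show "\<exists>N. \<forall>n\<ge>N. (INF s\<in>half_plane 0. Re (dpoly coef s)) \<le> Re (dpoly coef (of_real (inverse (real (Suc n)))))"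
      by (intro exI allI impI cINF_lower bdd_belowI2[of _ "1/2"] lb) (auto simp: half_plane_def)
  qed
  moreover have "1/2 \<le> (INF s\<in>half_plane 0. Re (dpoly coef s))"
    by (rule cINF_greatest[OF _ lb]) (auto simp: half_plane_def intro!: exI[of _ 1])
  ultimately show ?thesis by (simp add: unrestricted_range_def)
qed

section \<open>Spectrum, dimension and degree of the examples\<close>

lemma p_not_dvd: "1 \<le> j \<Longrightarrow> \<not> p j dvd p 0 ^ a"
  using prime_dvd_power[OF nth_prime] primes_dvd_imp_eq[OF nth_prime nth_prime] nth_prime_inject by force

lemma mixed_neq: "1 \<le> j \<Longrightarrow> p 0 ^ a * p j \<noteq> p 0 ^ b"
  using p_not_dvd[of j b] by (metis dvd_triv_right)

lemma divisible_neq: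
  assumes "1 \<le> i"
  shows "p 0 * x \<noteq> p i"
proof
  assume "p 0 * x = p i"
  then have "p 0 dvd p i" by (metis dvd_triv_left)
  then have "p 0 = p i" by (rule primes_dvd_imp_eq[OF nth_prime nth_prime])
  then show False using assms by simp
qed

lemma p0_power_inject: "p 0 ^ a = p 0 ^ b \<longleftrightarrow> a = b"
  using prime_gt_1_nat[OF nth_prime, of 0] by simp

lemma coef_p0m: "coef (p 0 ^ m) = \<kappa>"
proof -
  have "point (p 0) (p 0 ^ m) = 0" "point (p 0 ^ (m-2)) (p 0 ^ m) = 0" "point (p 0 ^ (m-1)) (p 0 ^ m) = 0"
    "point 1 (p 0 ^ m) = 0" "point (p 0 ^ m) (p 0 ^ m) = 1"
    using p0_power_inject[of m 1] p0_power_inject[of m "m-2"] p0_power_inject[of m "m-1"] p0_power_inject[of m 0] m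
    by (auto simp: point_def)
  moreover have "point (p j) (p 0 ^ m) = 0" "point (p 0 * p j) (p 0 ^ m) = 0" "point (p 0 ^ 2 * p j) (p 0 ^ m) = 0"
    if "j \<in> {1..<k}" for j
    using that mixed_neq[of j 0 m] mixed_neq[of j 1 m] mixed_neq[of j 2 m] by (auto simp: point_def)
  ultimately show ?thesis by (simp add: coef_def)
qed

lemma coef_p0: "coef (p 0) = -1 + \<kappa> * point (p 0 ^ (m-2)) (p 0)"
proof -
  have "point (p 0 ^ (m-1)) (p 0) = 0" "point (p 0 ^ m) (p 0) = 0" "point 1 (p 0) = 0" "point (p 0) (p 0) = 1"
    using p0_power_inject[of 1 "m-1"] p0_power_inject[of 1 m] p0_power_inject[of 1 0] m
    by (auto simp: point_def)
  moreover have "point (p j) (p 0) = 0" "point (p 0 * p j) (p 0) = 0" "point (p 0 ^ 2 * p j) (p 0) = 0"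
    if "j \<in> {1..<k}" for j
    using that mixed_neq[of j 0 1] mixed_neq[of j 1 1] mixed_neq[of j 2 1] by (auto simp: point_def)
  ultimately show ?thesis by (simp add: coef_def)
qed

lemma coef_pi: "i \<in> {1..<k} \<Longrightarrow> coef (p i) = \<kappa>"
proof -
  assume i: "i \<in> {1..<k}"
  have ne: "p i \<noteq> p 0 ^ a" for a using i mixed_neq[of i 0 a] by auto
  have z: "point 1 (p i) = 0" "point (p 0) (p i) = 0" "point (p 0 ^ a) (p i) = 0" for a
    using ne[of 0] ne[of 1] ne[of a] by (auto simp: point_def)
  have "point (p 0 * p j) (p i) = 0" "point (p 0 ^ 2 * p j) (p i) = 0" for j
    using i divisible_neq[of i "p j"] divisible_neq[of i "p 0 * p j"] by (auto simp: point_def power2_eq_square mult.assoc)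
  then have "(\<Sum>j\<in>{1..<k}. point (p j) (p i) - 2 * point (p 0 * p j) (p i) + point (p 0 ^ 2 * p j) (p i)) = (\<Sum>j\<in>{1..<k}. if i = j then 1 else 0)"
    by (intro sum.cong) (auto simp: point_def)
  also have "\<dots> = 1" using i by simp
  finally show ?thesis unfolding coef_def z by simp
qed

lemma kappa_nonzero: "\<kappa> \<noteq> 0" using k by (simp add: \<kappa>_def)

lemma primes_in_spectrum: "i < k \<Longrightarrow> p i \<in> spectrum_set coef"
proof -
  assume i: "i < k"
  have "coef (p i) \<noteq> 0"
  proof (cases "i = 0")
    case True
    \<comment> \<open>For \<open>m = 3\<close> the term with \<open>p 0 ^ (m-2)\<close> falls on
      \<open>p 0\<close>, but \<open>\<kappa>\<close> is too small to cancel the coefficient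
      \<open>-1\<close>.\<close>
    have "Re \<kappa> \<le> 1/2" using k by (simp add: \<kappa>_def)
    then have "Re (coef (p 0)) < 0" unfolding coef_p0 by (simp add: point_def)
    then show ?thesis using True by auto
  next
    case False
    then show ?thesis using i coef_pi[of i] kappa_nonzero by simp
  qed
  then show ?thesis using prime_ge_2_nat[OF nth_prime] by (simp add: spectrum_set_def)
qed

lemma p0m_in_spectrum: "p 0 ^ m \<in> spectrum_set coef"
  using coef_p0m kappa_nonzero T_ge2[of "p 0 ^ m"] by (auto simp: spectrum_set_def T_def)

definition P :: "nat set" where "P = p ` {..<k}"

lemma P: "finite P" "P \<subseteq> {2..}" "rat_independent P" "card P = k"
proof -
  show "finite P" by (simp add: P_def)
  show "P \<subseteq> {2..}" using prime_ge_2_nat[OF nth_prime] by (auto simp: P_def)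
  show "rat_independent P" by (rule rat_independent_primes) (auto simp: P_def nth_prime)
  show "card P = k" unfolding P_def by (subst card_image) (auto simp: inj_on_def)
qed

lemma P_factorization:
  assumes "j < k"
  shows "p 0 ^ a * p j ^ b = (\<Prod>q\<in>P. q ^ ((if q = p 0 then a else 0) + (if q = p j then b else 0)))"
  by (rule prod_two_powers[symmetric, of P "p 0" "p j" "\<lambda>q. q"]) (use assms k P(1) in \<open>auto simp: P_def\<close>)

lemma multi_index_P:
  assumes "j < k"
  shows "(\<Sum>q\<in>P. multi_index P (p 0 ^ a * p j ^ b) q) = a + b"
proof -
  have "p 0 \<in> P" "p j \<in> P" using assms k by (auto simp: P_def)
  then show ?thesis
    unfolding P_factorization[OF assms] multi_index_prod[OF P(3,1,2)] using P(1) by (simp add: sum.distrib)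
qed

lemma P_generating: "P \<in> generating_sets (spectrum_set coef)"
proof -
  have "generates P (spectrum_set coef)"
    unfolding generates_def
  proof
    fix n assume "n \<in> spectrum_set coef"
    then obtain a b j where j: "j < k" and n: "n = p 0 ^ a * p j ^ b" using T_form spectrum_coef by blast
    show "\<exists>\<alpha>. n = (\<Prod>q\<in>P. q ^ \<alpha> q)"
      by (rule exI[of _ "\<lambda>q. (if q = p 0 then a else 0) + (if q = p j then b else 0)"])
        (simp only: n P_factorization[OF j])
  qed
  then show ?thesis using P by (simp add: generating_sets_def)
qed

lemma P_least: "L \<in> generating_sets (spectrum_set coef) \<Longrightarrow> P \<subseteq> L"
  using prime_mem_generating[OF _ primes_in_spectrum nth_prime] by (auto simp: P_def)

lemma complex_dimension_coef: "complex_dimension coef = k"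
proof (rule antisym)
  show "complex_dimension coef \<le> k" using complex_dimension_le[OF P_generating] P(4) by simp
  obtain L where L: "L \<in> generating_sets (spectrum_set coef)" "card L = complex_dimension coef"
    using complex_dimension_attained[OF finite_subset[OF spectrum_coef finite_T]] .
  have "card P \<le> card L" by (rule card_mono[OF _ P_least[OF L(1)]]) (use L(1) in \<open>simp add: generating_sets_def\<close>)
  then show "k \<le> complex_dimension coef" using L(2) P(4) by simp
qed

text \<open>Every generating set contains the \<open>k\<close> primes of the spectrum, so
  \<open>P\<close> is the only minimal one, and the degree is attained at
  \<open>p 0 ^ m\<close>.\<close>

lemma dpoly_degree_coef: "dpoly_degree coef = m"
proof -
  have "minimal_generating_sets coef = {P}"
  proof -
    have "L = P" if L: "L \<in> generating_sets (spectrum_set coef)" "card L = k" for L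
    proof -
      have "finite L" using L(1) by (simp add: generating_sets_def)
      then show ?thesis
        by (rule card_subset_eq[OF _ P_least[OF L(1)], symmetric]) (simp only: L(2) P(4))
    qed
    then show ?thesis
      unfolding minimal_generating_sets_def complex_dimension_coef using P_generating P(4) by blast
  qed
  moreover have "degree_wrt coef P = m"
  proof (rule antisym)
    show "degree_wrt coef P \<le> m"
      unfolding degree_wrt_def
    proof (rule cSUP_least)
      show "spectrum_set coef \<noteq> {}" using p0m_in_spectrum by blast
      fix n assume "n \<in> spectrum_set coef"
      then obtain a b j where j: "j < k" "a + b \<le> m" and n: "n = p 0 ^ a * p j ^ b" using T_form spectrum_coef by blast
      show "(\<Sum>q\<in>P. multi_index P n q) \<le> m" unfolding n multi_index_P[OF j(1)] by (rule j(2))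
    qed
    show "m \<le> degree_wrt coef P"
    proof -
      have "0 < k" using k by simp
      from multi_index_P[OF this, of m 0] have "(\<Sum>q\<in>P. multi_index P (p 0 ^ m) q) = m" by (simp only: power_0 mult_1_right add_0_right)
      then show ?thesis using degree_wrt_ge[OF finite_subset[OF spectrum_coef finite_T] p0m_in_spectrum, of P] by (simp only:)
    qed
  qed
  ultimately show ?thesis by (simp add: dpoly_degree_def)
qed

text \<open>The lift vanishes on the whole face \<open>z_0 = 1\<close> of the torus. Since
  \<open>|1 - z_0| \<le> 2\<close> and the perturbing factor is at most \<open>1/2\<close>, it is
  bounded by \<open>2 |1 - z_0|\<close>, a degeneracy in the single coordinate 0.\<close>

lemma not_compact_coef: "\<not> compact_operator (comp_op (dpoly coef))"
proof -
  have set_qs: "set (map p [0..<k]) = P" by (auto simp: P_def)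
  interpret E: gh_data coef "map p [0..<k]"
    by unfold_locales
      (use gordon_hedenmalm_coef P_generating set_qs in \<open>auto simp: gordon_hedenmalm_def dirichlet_polynomial_def distinct_map inj_on_def\<close>)
  have d: "E.d = k" by (simp add: E.d_def)
  have ps: "E.psi \<theta> (p 0 ^ a * p j ^ b) = cis (\<theta> 0) ^ a * cis (\<theta> j) ^ b" if j: "j < k" for \<theta> a b j
  proof -
    let ?\<beta> = "\<lambda>i. (if i = 0 then a else 0) + (if i = j then b else 0)"
    have "p 0 ^ a * p j ^ b = (\<Prod>i<k. p i ^ ?\<beta> i)"
      by (rule prod_two_powers[symmetric]) (use j k in auto)
    also have "\<dots> = (\<Prod>i<E.d. (map p [0..<k] ! i) ^ ?\<beta> i)" unfolding d by (rule prod.cong) auto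
    finally have "E.al (p 0 ^ a * p j ^ b) i = ?\<beta> i" if "i < E.d" for i using E.al_prod[OF that, of ?\<beta>] by simp
    then have "E.psi \<theta> (p 0 ^ a * p j ^ b) = (\<Prod>i<E.d. cis (\<theta> i) ^ ?\<beta> i)"
      unfolding E.psi_prod by (intro prod.cong) auto
    also have "\<dots> = cis (\<theta> 0) ^ a * cis (\<theta> j) ^ b" by (rule prod_two_powers) (use j d in auto)
    finally show ?thesis .
  qed
  have Phi: "E.Phi \<theta> = lift_value (\<lambda>j. cis (\<theta> j))" for \<theta>
    using spectrum_sum_value[of "E.psi \<theta>" "\<lambda>j. cis (\<theta> j)", OF ps] unfolding E.Phi_def E.w0_def coef_1 by simp
  show ?thesis
  proof (rule E.not_compact_if_degenerate[of 0 0 0 2])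
    fix \<theta> :: "nat \<Rightarrow> real"
    let ?u = "1 - cis (\<theta> 0)" and ?h = "\<kappa> * (cis (\<theta> 0) ^ (m-2) + (\<Sum>j\<in>{1..<k}. cis (\<theta> j)))"
    have h: "cmod ?h \<le> 1/2" by (rule cmod_perturbation[of "\<lambda>j. cis (\<theta> j)"]) simp
    have u1: "cmod ?u \<le> \<bar>\<theta> 0\<bar>" using cis_lipschitz[of 0 "\<theta> 0"] by simp
    have u2: "cmod ?u \<le> 2" using norm_triangle_ineq4[of 1 "cis (\<theta> 0)"] by simp
    have "cmod (?u\<^sup>2 * ?h) \<le> (cmod ?u * 2) * (1/2)"
      unfolding norm_mult[of "?u\<^sup>2" ?h] norm_power power2_eq_square[of "cmod ?u"]
      by (intro mult_mono h mult_left_mono u2) auto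
    then have "cmod (?u + ?u\<^sup>2 * ?h) \<le> cmod ?u + cmod ?u" using norm_triangle_ineq[of ?u "?u\<^sup>2 * ?h"] by linarith
    then show "cmod (E.Phi \<theta> - \<i> * complex_of_real 0) \<le> 2 * \<bar>\<theta> 0 - 0\<bar>" using u1 by (simp add: Phi lift_value_def)
  qed (use k d in auto)
qed

end

theorem theorem3:
  shows
   "(\<forall>(c :: nat \<Rightarrow> complex) \<Phi>.
        gordon_hedenmalm c \<longrightarrow> unrestricted_range c \<longrightarrow>
        complex_dimension c \<ge> 2 \<longrightarrow> optimal_bohr_lift c \<Phi> \<longrightarrow>
        (dpoly_degree c = 1 \<or> dpoly_degree c = 2 \<or>
         (dpoly_degree c \<ge> 3 \<and>
          (\<forall>w\<in>torus (complex_dimension c).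
             Re (\<Phi> w) > 0 \<or>
             (Re (\<Phi> w) = 0 \<and> boundary_index (complex_dimension c) \<Phi> w \<ge> 2)))) \<longrightarrow>
        compact_operator (comp_op (dpoly c))) \<and>
    (\<forall>c :: nat \<Rightarrow> complex.
        gordon_hedenmalm c \<longrightarrow> unrestricted_range c \<longrightarrow> complex_dimension c = 1 \<longrightarrow>
        \<not> compact_operator (comp_op (dpoly c))) \<and>
    (\<forall>d m :: nat. d \<ge> 1 \<longrightarrow> m \<ge> 3 \<longrightarrow>
        (\<exists>c :: nat \<Rightarrow> complex.
           gordon_hedenmalm c \<and> unrestricted_range c \<and>
           complex_dimension c = d \<and> dpoly_degree c = m \<and>
           \<not> compact_operator (comp_op (dpoly c))))"
proof (intro conjI allI impI)
  fix c \<Phi>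
  assume "gordon_hedenmalm c" "2 \<le> complex_dimension c" "optimal_bohr_lift c \<Phi>"
    and alt: "dpoly_degree c = 1 \<or> dpoly_degree c = 2 \<or>
         (dpoly_degree c \<ge> 3 \<and>
          (\<forall>w\<in>torus (complex_dimension c).
             Re (\<Phi> w) > 0 \<or>
             (Re (\<Phi> w) = 0 \<and> boundary_index (complex_dimension c) \<Phi> w \<ge> 2)))"
  then show "compact_operator (comp_op (dpoly c))"
    by (intro compact_if_small_degree_or_index[of c \<Phi>]) (assumption | blast)+
next
  fix c
  assume "gordon_hedenmalm c" "unrestricted_range c" "complex_dimension c = 1"
  then show "\<not> compact_operator (comp_op (dpoly c))" by (rule not_compact_if_dimension_one)
next
  fix d m :: nat
  assume "1 \<le> d" "3 \<le> m"
  then interpret degenerate_example d m by unfold_locales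
  show "\<exists>c. gordon_hedenmalm c \<and> unrestricted_range c \<and> complex_dimension c = d \<and>
      dpoly_degree c = m \<and> \<not> compact_operator (comp_op (dpoly c))"
    using gordon_hedenmalm_coef unrestricted_range_coef complex_dimension_coef dpoly_degree_coef not_compact_coef by blast
qed

end
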